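(* Let $k$ be a field over which linear algebra may be performed efficiently. There is a probabilistic polynomial-time algorithm which, given a central simple $k$-algebra $A$ (by structure constants) such that $|k| > \dim_k A$, correctly outputs: (1) an element $u \in A$ such that $F = k[u]$ is a separable maximal commutative subalgebra of $A$; (2) the minimal polynomial $P \in k[X]$ of $u$ over $k$; (3) a cocycle $c \in Z_{Am}^2(k,F)$; (4) a linear map $e\colon F^{\otimes 2} \to A$ that is an isomorphism of $k$-algebras from $A(F,c)$ to $A$.
   Context: A field $k$ admits efficient linear algebra if there is an encoding of its elements for which the field operations and the usual linear algebra tasks can be performed efficiently (in polynomial time). Structure constants of $A$ for a basis $(b_1,\dots,b_m)$ are the coefficients $\lambda_{ijl}\in k$ with $b_ib_j=\sum_l\lambda_{ijl}b_l$. Elements of $F^{\otimes n+1}$, where $F\simeq k[X]/(P)$ and $\deg P = d$, are represented by polynomials in $k[X_0,\dots,X_n]$ of degree at most $d-1$ in each variable, via $F^{\otimes n+1}\simeq k[X_0,\dots,X_n]/(P(X_0),\dots,P(X_n))$. A commutative algebra is separable if it is étale over $k$. Tensor products are over $k$. For $n\ge 0$, $C^n_{Am}(k,F)=(F^{\otimes n+1})^\times$. For $0\le i\le n+1$, $\varepsilon_i^n\colon F^{\otimes n+1}\to F^{\otimes n+2}$ is the $k$-algebra homomorphism with $\varepsilon_i^n(f_0\otimes\cdots\otimes f_n)=f_0\otimes\cdots\otimes f_{i-1}\otimes 1\otimes f_i\otimes\cdots\otimes f_n$. Set $\Delta^n_{Am}(a)=\prod_{i=0}^{n+1}\varepsilon_i^n(a)^{(-1)^i}$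 and $Z^n_{Am}(k,F)=\mathrm{Ker}(\Delta^n_{Am})$. For $c\in Z^2_{Am}(k,F)$, $A(F,c)$ is the $k$-algebra whose underlying vector space is $F^{\otimes 2}$, with multiplication $a\,a'=\mathrm{Tr}_{F^{\otimes 3}/F^{\otimes 2}}(\varepsilon_2^1(a)\,c\,\varepsilon_0^1(a'))$, where $F^{\otimes 3}$ is an $F^{\otimes 2}$-algebra via $\varepsilon_1^1$; explicitly $\mathrm{Tr}_{F^{\otimes 3}/F^{\otimes 2}}(a_0\otimes a_1\otimes a_2)=\mathrm{Tr}_{F/k}(a_1)\,(a_0\otimes a_2)$. *)

theory Defs
  imports
    "HOL-Probability.Probability_Mass_Function"
    "HOL-Algebra.QuotRing"
    "HOL-Algebra.Subrings"
    "HOL-Algebra.Algebraic_Closure_Type"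
    "Jordan_Normal_Form.Determinant"
    "Jordan_Normal_Form.Matrix_Kernel"
    "Jordan_Normal_Form.DL_Rank"
begin

hide_const (open) up_ring.coeff up_ring.monom Polynomials.degree Polynomials.lead_coeff

section \<open>Polynomial time\<close>

text \<open>
  The machine model is a variable-free form of Jones' language WHILE: programs transform binary
  trees. The cost of a run charges every step with the size of the tree it works on, so the size of
  all the data occurring in a run is bounded by its cost (up to an additive constant), and the
  model and Turing machines simulate each other with polynomial overhead.
\<close>

datatype sexp = Null | Dot sexp sexp

primrec shd :: "sexp \<Rightarrow> sexp" where
  "shd Null = Null"
| "shd (Dot x y) = x"

primrec stl :: "sexp \<Rightarrow> sexp" where
  "stl Null = Null"
| "stl (Dot x y) = y"

datatype prog =
    PId
  | PNull
  | PHd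
  | PTl
  | PFork prog prog
  | PSeq prog prog
  | PIf prog prog prog
  | PWhile prog prog

text \<open>
  \<open>runs p x y t\<close>: on input \<open>x\<close>, the program \<open>p\<close> halts with output \<open>y\<close> after \<open>t\<close> steps.
  \<open>Null\<close> is the truth value false. Note that \<open>size x\<close> is the number of \<open>Dot\<close> nodes of \<open>x\<close>.
\<close>

inductive runs :: "prog \<Rightarrow> sexp \<Rightarrow> sexp \<Rightarrow> nat \<Rightarrow> bool" where
  run_id: "runs PId x x (1 + size x)"
| run_null: "runs PNull x Null (1 + size x)"
| run_hd: "runs PHd x (shd x) (1 + size x)"
| run_tl: "runs PTl x (stl x) (1 + size x)"
| run_fork: "runs p x y s \<Longrightarrow> runs q x z t \<Longrightarrow> runs (PFork p q) x (Dot y z) (1 + size x + s + t)"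
| run_seq: "runs p x y s \<Longrightarrow> runs q y z t \<Longrightarrow> runs (PSeq p q) x z (1 + size x + s + t)"
| run_if_true: "runs b x v s \<Longrightarrow> v \<noteq> Null \<Longrightarrow> runs p x y t \<Longrightarrow> runs (PIf b p q) x y (1 + size x + s + t)"
| run_if_false: "runs b x Null s \<Longrightarrow> runs q x y t \<Longrightarrow> runs (PIf b p q) x y (1 + size x + s + t)"
| run_while_end: "runs b x Null s \<Longrightarrow> runs (PWhile b p) x x (1 + size x + s)"
| run_while_step: "runs b x v s \<Longrightarrow> v \<noteq> Null \<Longrightarrow> runs p x y t \<Longrightarrow> runs (PWhile b p) y z r \<Longrightarrow>
    runs (PWhile b p) x z (1 + size x + s + t + r)"

text \<open>
  A computational problem is given by its set \<open>D\<close> of legal inputs and a relation \<open>R\<close> between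
  inputs and correct outputs; \<open>ei\<close> and \<open>eo\<close> encode inputs and outputs.
\<close>

definition polytime_solvable ::
  "('a \<Rightarrow> sexp) \<Rightarrow> ('b \<Rightarrow> sexp) \<Rightarrow> 'a set \<Rightarrow> ('a \<Rightarrow> 'b \<Rightarrow> bool) \<Rightarrow> bool" where
  "polytime_solvable ei eo D R \<longleftrightarrow>
    (\<exists>p (q :: nat poly). \<forall>a\<in>D. \<exists>b t.
       runs p (ei a) (eo b) t \<and> t \<le> poly q (size (ei a)) \<and> R a b)"

primrec enc_list :: "('a \<Rightarrow> sexp) \<Rightarrow> 'a list \<Rightarrow> sexp" where
  "enc_list f [] = Null"
| "enc_list f (x # xs) = Dot (f x) (enc_list f xs)"

primrec enc_option :: "('a \<Rightarrow> sexp) \<Rightarrow> 'a option \<Rightarrow> sexp" where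
  "enc_option f None = Null"
| "enc_option f (Some x) = Dot (f x) Null"

definition enc_bool :: "bool \<Rightarrow> sexp" where
  "enc_bool b = (if b then Dot Null Null else Null)"

text \<open>Unary: natural numbers only occur as dimensions.\<close>

definition enc_nat :: "nat \<Rightarrow> sexp" where
  "enc_nat n = enc_list (\<lambda>_. Null) [0..<n]"

text \<open>
  Probabilistic polynomial time without wrong answers (Las Vegas): the program receives, next to
  its input, polynomially many independent fair coin tosses. For every outcome of the coins it
  halts within the polynomial time bound, and its output is either a correct answer or the
  failure symbol (the encoding of \<open>None\<close>); failure has probability at most \<open>1/2\<close>.
\<close>

definition las_vegas_polytime_solvable ::
  "('a \<Rightarrow> sexp) \<Rightarrow> ('b \<Rightarrow> sexp) \<Rightarrow> 'a set \<Rightarrow> ('a \<Rightarrow> 'b \<Rightarrow> bool) \<Rightarrow> bool" where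
  "las_vegas_polytime_solvable ei eo D R \<longleftrightarrow>
    (\<exists>p (q :: nat poly) (r :: nat poly). \<forall>a\<in>D.
       let coins = {w :: bool list. length w = poly r (size (ei a))};
           inp = (\<lambda>w. Dot (ei a) (enc_list enc_bool w))
       in (\<forall>w\<in>coins. \<exists>b t. runs p (inp w) (enc_option eo b) t \<and> t \<le> poly q (size (ei a)) \<and>
             (case b of None \<Rightarrow> True | Some y \<Rightarrow> R a y)) \<and>
          measure_pmf.prob (pmf_of_set coins) {w. \<exists>t. runs p (inp w) (enc_option eo None) t} \<le> 1/2)"


section \<open>Fields with efficient linear algebra\<close>

definition enc_vec :: "('k \<Rightarrow> sexp) \<Rightarrow> 'k vec \<Rightarrow> sexp" where
  "enc_vec enc v = enc_list enc (list_of_vec v)"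

definition enc_mat :: "('k \<Rightarrow> sexp) \<Rightarrow> 'k mat \<Rightarrow> sexp" where
  "enc_mat enc A =
    Dot (enc_nat (dim_row A)) (Dot (enc_nat (dim_col A)) (enc_list (enc_vec enc) (rows A)))"

definition enc_pair :: "('a \<Rightarrow> sexp) \<Rightarrow> ('b \<Rightarrow> sexp) \<Rightarrow> 'a \<times> 'b \<Rightarrow> sexp" where
  "enc_pair f g = (\<lambda>(x, y). Dot (f x) (g y))"

definition is_kernel_basis :: "'k::field mat \<Rightarrow> 'k vec list \<Rightarrow> bool" where
  "is_kernel_basis A vs \<longleftrightarrow>
    distinct vs \<and> set vs \<subseteq> carrier_vec (dim_col A) \<and>
    \<not> module.lin_dep class_ring (module_vec TYPE('k) (dim_col A)) (set vs) \<and>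
    module.span class_ring (module_vec TYPE('k) (dim_col A)) (set vs) = mat_kernel A"

text \<open>
  Field operations, followed by matrix sum and product, determinant, rank, inverse, solution of
  linear systems, and kernels. As \<open>enc\<close> is injective, equality of field elements is equality of
  their codes.
\<close>

definition efficient_linear_algebra :: "('k::field \<Rightarrow> sexp) \<Rightarrow> bool" where
  "efficient_linear_algebra enc \<longleftrightarrow>
    inj enc \<and>
    polytime_solvable (enc_pair enc enc) enc UNIV (\<lambda>(x, y) z. z = x + y) \<and>
    polytime_solvable enc enc UNIV (\<lambda>x z. z = - x) \<and>
    polytime_solvable (enc_pair enc enc) enc UNIV (\<lambda>(x, y) z. z = x * y) \<and>
    polytime_solvable enc enc (- {0}) (\<lambda>x z. z = inverse x) \<and>
    polytime_solvable (enc_pair (enc_mat enc) (enc_mat enc)) (enc_mat enc)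
      {(A, B). dim_row A = dim_row B \<and> dim_col A = dim_col B} (\<lambda>(A, B) C. C = A + B) \<and>
    polytime_solvable (enc_pair (enc_mat enc) (enc_mat enc)) (enc_mat enc)
      {(A, B). dim_col A = dim_row B} (\<lambda>(A, B) C. C = A * B) \<and>
    polytime_solvable (enc_mat enc) enc {A. square_mat A} (\<lambda>A x. x = det A) \<and>
    polytime_solvable (enc_mat enc) enc_nat UNIV (\<lambda>A n. n = vec_space.rank (dim_row A) A) \<and>
    polytime_solvable (enc_mat enc) (enc_option (enc_mat enc)) {A. square_mat A}
      (\<lambda>A ret. case ret of None \<Rightarrow> \<not> invertible_mat A
                   | Some B \<Rightarrow> inverts_mat A B \<and> inverts_mat B A) \<and>
    polytime_solvable (enc_pair (enc_mat enc) (enc_vec enc)) (enc_option (enc_vec enc))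
      {(A, b). dim_vec b = dim_row A}
      (\<lambda>(A, b) ret. case ret of None \<Rightarrow> \<not> (\<exists>x\<in>carrier_vec (dim_col A). A *\<^sub>v x = b)
                        | Some x \<Rightarrow> x \<in> carrier_vec (dim_col A) \<and> A *\<^sub>v x = b) \<and>
    polytime_solvable (enc_mat enc) (enc_list (enc_vec enc)) UNIV is_kernel_basis"


section \<open>Algebras given by structure constants\<close>

definition unit_elt :: "'a set \<Rightarrow> ('a \<Rightarrow> 'a \<Rightarrow> 'a) \<Rightarrow> 'a" where
  "unit_elt C f = (THE e. e \<in> C \<and> (\<forall>x\<in>C. f e x = x \<and> f x e = x))"

type_synonym 'k sconsts = "nat \<Rightarrow> nat \<Rightarrow> nat \<Rightarrow> 'k"

text \<open>
  The algebra with basis \<open>b 0, \<dots>, b (m - 1)\<close> and \<open>b i * b j = (\<Sum>l<m. s i j l * b l)\<close>, realised on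
  coordinate vectors. Its scalar multiplication is the one of vectors. Nothing is assumed about
  \<open>s\<close>, so associativity and the existence of a unit have to be required separately.
\<close>

definition sc_alg :: "nat \<Rightarrow> 'k::field sconsts \<Rightarrow> 'k vec ring" where
  "sc_alg m s =
    (let mul = (\<lambda>x y. vec m (\<lambda>l. \<Sum>i<m. \<Sum>j<m. x $ i * y $ j * s i j l))
     in \<lparr>carrier = carrier_vec m, monoid.mult = mul, one = unit_elt (carrier_vec m) mul,
         zero = 0\<^sub>v m, add = (+)\<rparr>)"

definition enc_sconsts :: "('k \<Rightarrow> sexp) \<Rightarrow> nat \<times> 'k sconsts \<Rightarrow> sexp" where
  "enc_sconsts enc = (\<lambda>(m, s).
     enc_list (\<lambda>i. enc_list (\<lambda>j. enc_list (\<lambda>l. enc (s i j l)) [0..<m]) [0..<m]) [0..<m])"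

definition central_simple :: "nat \<Rightarrow> 'k::field sconsts \<Rightarrow> bool" where
  "central_simple m s \<longleftrightarrow>
    (let A = sc_alg m s in
      ring A \<and> \<one>\<^bsub>A\<^esub> \<noteq> \<zero>\<^bsub>A\<^esub> \<and>
      (\<forall>I. ideal I A \<longrightarrow> I = {\<zero>\<^bsub>A\<^esub>} \<or> I = carrier A) \<and>
      {z \<in> carrier A. \<forall>x\<in>carrier A. z \<otimes>\<^bsub>A\<^esub> x = x \<otimes>\<^bsub>A\<^esub> z} = {c \<cdot>\<^sub>v \<one>\<^bsub>A\<^esub> | c. True})"

definition alg_eval :: "nat \<Rightarrow> 'k::field sconsts \<Rightarrow> 'k poly \<Rightarrow> 'k vec \<Rightarrow> 'k vec" where
  "alg_eval m s p u =
    (let A = sc_alg m s in \<Oplus>\<^bsub>A\<^esub>i\<in>{..degree p}. coeff p i \<cdot>\<^sub>v (u [^]\<^bsub>A\<^esub> i))"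

definition gen_subalg :: "nat \<Rightarrow> 'k::field sconsts \<Rightarrow> 'k vec \<Rightarrow> 'k vec set" where
  "gen_subalg m s u = {alg_eval m s p u | p. True}"

definition is_min_poly :: "nat \<Rightarrow> 'k::field sconsts \<Rightarrow> 'k vec \<Rightarrow> 'k poly \<Rightarrow> bool" where
  "is_min_poly m s u P \<longleftrightarrow>
    lead_coeff P = 1 \<and> alg_eval m s P u = \<zero>\<^bsub>sc_alg m s\<^esub> \<and>
    (\<forall>Q. Q \<noteq> 0 \<and> alg_eval m s Q u = \<zero>\<^bsub>sc_alg m s\<^esub> \<longrightarrow> degree P \<le> degree Q)"

definition comm_subalg :: "nat \<Rightarrow> 'k::field sconsts \<Rightarrow> 'k vec set \<Rightarrow> bool" where
  "comm_subalg m s B \<longleftrightarrow>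
    (let A = sc_alg m s in
      subring B A \<and> (\<forall>c. \<forall>x\<in>B. c \<cdot>\<^sub>v x \<in> B) \<and> (\<forall>x\<in>B. \<forall>y\<in>B. x \<otimes>\<^bsub>A\<^esub> y = y \<otimes>\<^bsub>A\<^esub> x))"

definition max_comm_subalg :: "nat \<Rightarrow> 'k::field sconsts \<Rightarrow> 'k vec set \<Rightarrow> bool" where
  "max_comm_subalg m s B \<longleftrightarrow>
    comm_subalg m s B \<and> (\<forall>B'. comm_subalg m s B' \<and> B \<subseteq> B' \<longrightarrow> B' = B)"

text \<open>
  Etale algebras: \<open>B\<close> is etale over \<open>k\<close> iff its base change to an algebraic closure \<open>K\<close> of \<open>k\<close> is
  isomorphic, as a \<open>K\<close>-algebra, to some \<open>K ^ r\<close>. The base change of the whole algebra has the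
  same structure constants, read in \<open>K\<close>; by flatness over \<open>k\<close>, the base change of the subspace \<open>B\<close> is the
  \<open>K\<close>-span of \<open>B\<close> in it.
\<close>

definition base_change_sc :: "'k::field sconsts \<Rightarrow> 'k alg_closure sconsts" where
  "base_change_sc s = (\<lambda>i j l. to_ac (s i j l))"

definition base_change_sub :: "nat \<Rightarrow> 'k::field vec set \<Rightarrow> 'k alg_closure vec set" where
  "base_change_sub m B =
    module.span class_ring (module_vec TYPE('k alg_closure) m) (map_vec to_ac ` B)"

definition split_alg :: "nat \<Rightarrow> 'k::field vec ring" where
  "split_alg r =
    \<lparr>carrier = carrier_vec r, monoid.mult = (\<lambda>x y. vec r (\<lambda>i. x $ i * y $ i)),
     one = vec r (\<lambda>_. 1), zero = 0\<^sub>v r, add = (+)\<rparr>"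

definition etale_subalg :: "nat \<Rightarrow> 'k::field sconsts \<Rightarrow> 'k vec set \<Rightarrow> bool" where
  "etale_subalg m s B \<longleftrightarrow>
    comm_subalg m s B \<and>
    (\<exists>r. \<exists>h \<in> ring_iso ((sc_alg m (base_change_sc s))\<lparr>carrier := base_change_sub m B\<rparr>)
                       (split_alg r :: 'k alg_closure vec ring).
       \<forall>c. \<forall>x\<in>base_change_sub m B. h (c \<cdot>\<^sub>v x) = c \<cdot>\<^sub>v h x)"


section \<open>Amitsur cohomology of \<open>F = k[X]/(P)\<close>\<close>

text \<open>
  The \<open>N\<close>-fold tensor power of \<open>F\<close> is \<open>k[X\<^sub>0, \<dots>, X\<^bsub>N-1\<^esub>]/(P(X\<^sub>0), \<dots>, P(X\<^bsub>N-1\<^esub>))\<close>. Its elements are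
  represented by the reduced polynomials, i.e. by the functions sending an exponent vector (a list
  of length \<open>N\<close> with entries below \<open>degree P\<close>) to a coefficient. The list \<open>[i\<^sub>0, \<dots>, i\<^bsub>N-1\<^esub>]\<close> stands
  for \<open>X\<^sub>0 ^ i\<^sub>0 * \<dots> * X\<^bsub>N-1\<^esub> ^ i\<^bsub>N-1\<^esub>\<close>, that is for the pure tensor of the powers \<open>X ^ i\<close> in \<open>F\<close>.
\<close>

type_synonym 'k tensor = "nat list \<Rightarrow> 'k"

definition expos :: "'k::field poly \<Rightarrow> nat \<Rightarrow> nat list list" where
  "expos P N = List.n_lists N [0..<degree P]"

definition tensors :: "'k::field poly \<Rightarrow> nat \<Rightarrow> 'k tensor set" where
  "tensors P N = {a. \<forall>\<alpha>. \<alpha> \<notin> set (expos P N) \<longrightarrow> a \<alpha> = 0}"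

text \<open>Multiply as polynomials and reduce modulo \<open>P\<close> in each variable.\<close>

definition tensor_mult :: "'k::field poly \<Rightarrow> nat \<Rightarrow> 'k tensor \<Rightarrow> 'k tensor \<Rightarrow> 'k tensor" where
  "tensor_mult P N a b = (\<lambda>\<gamma>. if \<gamma> \<in> set (expos P N) then
     (\<Sum>\<alpha>\<in>set (expos P N). \<Sum>\<beta>\<in>set (expos P N).
        a \<alpha> * b \<beta> * (\<Prod>j<N. coeff (monom 1 (\<alpha> ! j + \<beta> ! j) mod P) (\<gamma> ! j))) else 0)"

definition tensor_power :: "'k::field poly \<Rightarrow> nat \<Rightarrow> 'k tensor ring" where
  "tensor_power P N =
    \<lparr>carrier = tensors P N, monoid.mult = tensor_mult P N,
     one = (\<lambda>\<alpha>. if \<alpha> = replicate N 0 then 1 else 0),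
     zero = (\<lambda>_. 0), add = (\<lambda>a b \<alpha>. a \<alpha> + b \<alpha>)\<rparr>"

text \<open>\<open>\<epsilon>\<^sub>i\<close> inserts the factor \<open>1 = X ^ 0\<close> at position \<open>i\<close>; the same formula works for each \<open>n\<close>.\<close>

definition face :: "nat \<Rightarrow> 'k::zero tensor \<Rightarrow> 'k tensor" where
  "face i a = (\<lambda>\<gamma>. if i < length \<gamma> \<and> \<gamma> ! i = 0 then a (take i \<gamma> @ drop (Suc i) \<gamma>) else 0)"

definition amitsur_cochains :: "'k::field poly \<Rightarrow> nat \<Rightarrow> 'k tensor set" where
  "amitsur_cochains P n = Units (tensor_power P (n + 1))"

definition amitsur_diff :: "'k::field poly \<Rightarrow> nat \<Rightarrow> 'k tensor \<Rightarrow> 'k tensor" where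
  "amitsur_diff P n a =
    (\<Otimes>\<^bsub>tensor_power P (n + 2)\<^esub>i\<in>{..n + 1}. face i a [^]\<^bsub>tensor_power P (n + 2)\<^esub> ((- 1) ^ i :: int))"

definition amitsur_cocycles :: "'k::field poly \<Rightarrow> nat \<Rightarrow> 'k tensor set" where
  "amitsur_cocycles P n =
    {a \<in> amitsur_cochains P n. amitsur_diff P n a = \<one>\<^bsub>tensor_power P (n + 2)\<^esub>}"

text \<open>The trace over \<open>k\<close> of multiplication by (the class of) \<open>f\<close> on \<open>F\<close>, in the basis \<open>X ^ l\<close>.\<close>

definition trace_field :: "'k::field poly \<Rightarrow> 'k poly \<Rightarrow> 'k" where
  "trace_field P f = (\<Sum>l<degree P. coeff ((f * monom 1 l) mod P) l)"

definition trace_3_2 :: "'k::field poly \<Rightarrow> 'k tensor \<Rightarrow> 'k tensor" where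
  "trace_3_2 P a = (\<lambda>\<alpha>. if \<alpha> \<in> set (expos P 2) then
     (\<Sum>j<degree P. trace_field P (monom 1 j) * a [\<alpha> ! 0, j, \<alpha> ! 1]) else 0)"

text \<open>The algebra \<open>A(F, c)\<close>.\<close>

definition cocycle_alg :: "'k::field poly \<Rightarrow> 'k tensor \<Rightarrow> 'k tensor ring" where
  "cocycle_alg P c =
    (let T = tensor_power P 3;
         mul = (\<lambda>a a'. trace_3_2 P (face 2 a \<otimes>\<^bsub>T\<^esub> c \<otimes>\<^bsub>T\<^esub> face 0 a'))
     in \<lparr>carrier = tensors P 2, monoid.mult = mul, one = unit_elt (tensors P 2) mul,
         zero = (\<lambda>_. 0), add = (\<lambda>a b \<alpha>. a \<alpha> + b \<alpha>)\<rparr>)"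

text \<open>
  The linear map from the tensor square of \<open>F\<close> to \<open>k ^ m\<close> that sends the monomial with exponents
  \<open>\<alpha>\<close> to \<open>E \<alpha>\<close>. An algorithm outputs the map by listing these images.
\<close>

definition lin_map :: "nat \<Rightarrow> 'k::field poly \<Rightarrow> (nat list \<Rightarrow> 'k vec) \<Rightarrow> 'k tensor \<Rightarrow> 'k vec" where
  "lin_map m P E a = vec m (\<lambda>l. \<Sum>\<alpha>\<in>set (expos P 2). a \<alpha> * E \<alpha> $ l)"

definition enc_output ::
  "('k::field \<Rightarrow> sexp) \<Rightarrow> 'k vec \<times> 'k poly \<times> 'k tensor \<times> (nat list \<Rightarrow> 'k vec) \<Rightarrow> sexp" where
  "enc_output enc = (\<lambda>(u, P, c, E).
     Dot (enc_vec enc u) (Dot (enc_list enc (coeffs P))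
       (Dot (enc_list (\<lambda>\<alpha>. enc (c \<alpha>)) (expos P 3))
            (enc_list (\<lambda>\<alpha>. enc_vec enc (E \<alpha>)) (expos P 2)))))"

end

theory Submission imports Defs "HOL-Library.Function_Algebras" "Jordan_Normal_Form.Char_Poly" begin

text \<open>
 A random element \<open>u\<close> has, over the algebraic closure, \<open>n\<close> distinct eigenvalues, so \<open>k[u]\<close> is \<open>F\<close>, and \<open>A\<close>
 is free of rank one over \<open>F \<otimes> F\<close>; a generator \<open>v\<close> yields \<open>e(a \<otimes> b) = a v b\<close>, and the cocycle solves a
 linear system. Sampling uses a grid built from the structure constants. If it does not grow beyond
 \<open>5m\<^sup>2\<close>, it is a finite field containing them, and regular elements are counted
 exactly (Lang's theorem splits the algebra); else the Schwartz-Zippel bound applies.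
\<close>

text \<open>What shapes the algorithm is the size of codes: a field operation is polynomial in its
  input, so a chain of polynomially many operations need not have codes of polynomial size.
  Recursions are therefore not executed. Sums become matrix products, and the unit, the powers of
  \<open>u\<close> and reductions modulo the minimal polynomial are unique solutions of single
  linear systems. Only the grid is built by iteration, and there a linear system that evaluates
  words bounds the codes. The algorithm has no other supply of scalars, and those generated by the
  input may form a field small compared with \<open>m\<close>, where a degree bound is void; this is
  why regular elements also have to be counted. Descent from the closure is possible because the
  conditions are phrased as solvability of linear systems over \<open>k\<close>: \<open>acp\<close>
  is a \<open>k\<close>-linear retraction of the closure onto \<open>k\<close> and maps solutions to
  solutions. The constants fit together as follows: at most 7/16 of the grid points are bad,
  reducing random bits modulo the grid size costs a factor of at most 8/7, and the product is
  1/2.\<close>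

declare [[coercion_enabled = false]]

abbreviation "mn == Polynomial.monom"
abbreviation "eN == enc_nat"
abbreviation "eL == enc_list"
lemmas ifi = infinite_finite_induct
abbreviation (input) PiF (infixr \<open>->E\<close> 60) where "A ->E T == A \<rightarrow>\<^sub>E T"

section \<open>Linear algebra on functions that vanish from \<open>m\<close> on\<close>

definition fscale :: "'a::field => ('i => 'a) => 'i => 'a" (infixr \<open>*c\<close> 75) where
 "c *c x = (%i. c * x i)"

lemma fscale_apply: "(c *c x) i = c * x i"
 by (simp add: fscale_def)

interpretation fv: vector_space "fscale :: 'a::field => ('i => 'a) => 'i => 'a"
 by standard (auto simp: fun_eq_iff fscale_apply algebra_simps)

lemma sum_fun_apply: "(SUM j:J. f j) i = (SUM j:J. f j i)"
 by (induct J rule: ifi) auto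

declare plus_fun_apply [simp del] zero_fun_apply [simp del] minus_apply [simp del] uminus_apply [simp del]

lemmas fapp = plus_fun_apply zero_fun_apply minus_apply uminus_apply fscale_apply sum_fun_apply

text \<open>The space \<open>k^m\<close> inside a type that does not depend on \<open>m\<close>; the
  type is an additive group, so sums need no carrier sets.\<close>

definition spt :: "nat => (nat => 'a::zero) set" where
 "spt m = {x. ALL i>=m. x i = 0}"

definition bv :: "nat => nat => 'a::zero_neq_one" where
 "bv i = (%l. if l = i then 1 else 0)"

lemma sptI: "(!!i. i >= m ==> x i = 0) ==> x : spt m"
 and sptD: "x : spt m ==> i >= m ==> x i = 0"
 by (auto simp: spt_def fapp)

lemma spt_closed [simp]:
 fixes x y :: "nat => 'a::field"
 shows "0 : spt m"
  "x : spt m ==> y : spt m ==> x+y : spt m"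
  "x : spt m ==> y : spt m ==> x-y : spt m"
  "x : spt m ==>-x : spt m"
  "x : spt m ==> c *c x : spt m"
 by (auto simp: spt_def fapp)

lemma spt_sum:
 fixes f :: "'j => nat => 'a::field"
 shows "(!!j. j : J ==> f j : spt m) ==> (SUM j:J. f j) : spt m"
 by (induct J rule: ifi) auto

lemma bv_supp [simp]: "i < m ==> (bv i :: nat => 'a::field) : spt m"
 by (auto simp: spt_def bv_def)

lemma bv_apply: "bv i l = (if l = i then 1 else 0)"
 by (simp add: bv_def)

lemma expand_bv:
 assumes "x : spt m"
 shows "(x :: nat => 'a::field) = (SUM i<m. x i *c bv i)"
proof
 fix l
 show "x l = (SUM i<m. x i *c bv i) l" using assms by (cases "l < m") (auto simp: fapp bv_def spt_def if_distrib sum.delta cong: if_cong)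
qed

text \<open>Stated for families rather than sets, so that a repeated vector counts as a dependence;
  that case is settled by the coefficients 1 and -1.\<close>

lemma spt_dependent:
 fixes f :: "'j => nat => 'a::field"
 assumes fin: "finite J" and card: "card J > m" and sub: "!!j. j : J ==> f j : spt m"
 shows "EX c. (EX j:J. c j ~= 0) & (SUM j:J. c j *c f j) = 0"
proof (cases "inj_on f J")
 case False
 then obtain a b where ab: "a : J" "b : J" "a ~= b" "f a = f b" by (auto simp: inj_on_def)
 let ?c = "%j. if j = a then 1 else if j = b then-1 else (0::'a)"
 have "(SUM j:J. ?c j *c f j) = (SUM j:{a,b}. ?c j *c f j)" using fin ab by (intro sum.mono_neutral_right) (auto simp: fun_eq_iff fapp)
 also have "... = 0" using ab by (auto simp: fun_eq_iff fapp)
 finally show ?thesis using ab by (intro exI[of _ ?c]) auto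
next
 case True
 have sp: "f ` J <= fv.span (bv ` {..<m})"
 proof
  fix y assume "y : f ` J"
  hence "y = (SUM i<m. y i *c bv i)" using expand_bv using sub by auto
  also have "... : fv.span (bv ` {..<m})" by (intro fv.span_sum fv.span_scale fv.span_base) auto
  finally show "y : fv.span (bv ` {..<m})" .
 qed
 have "fv.dependent (f ` J)"
 proof (rule ccontr)
  assume "~fv.dependent (f ` J)"
  from fv.independent_span_bound[OF _ this sp] have "card (f ` J) <= card (bv ` {..<m} :: (nat => 'a) set)" by auto
  also have "... <= m" using card_image_le[of "{..<m}" bv] by simp
  finally show False using card card_image[OF True] by simp
 qed
 then obtain u where u: "EX v:f ` J. u v ~= 0" "(SUM v:f ` J. u v *c v) = 0" using fv.dependent_finite[of "f ` J"] fin by auto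
 thus ?thesis using True by (intro exI[of _ "%j. u (f j)"]) (auto simp: sum.reindex)
qed

text \<open>Adding \<open>y\<close> to the family makes \<open>m + 1\<close> vectors in dimension
  \<open>m\<close>. The coefficient of \<open>y\<close> in the resulting relation cannot vanish,
  since the family alone is independent. The option type serves as the enlarged index set.\<close>

lemma spt_spanning:
 fixes f :: "'j => nat => 'a::field"
 assumes fin: "finite J" and card: "card J = m" and sub: "!!j. j : J ==> f j : spt m"
  and ind: "!!c. (SUM j:J. c j *c f j) = 0 ==> ALL j:J. c j = 0"
  and y: "y : spt m"
 shows "EX c. y = (SUM j:J. c j *c f j)"
proof -
 let ?J = "insert None (Some ` J)"
 let ?f = "%j. case j of None => y | Some i => f i"
 have "card ?J = Suc m" using fin card by (simp add: card_image)
 moreover have "?f j : spt m" if "j : ?J" for j using that sub y by auto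
 ultimately have "EX c. (EX j:?J. c j ~= 0) & (SUM j:?J. c j *c ?f j) = 0" using fin by (intro spt_dependent[of _ m]) simp_all
 then obtain c where c: "EX j:?J. c j ~= 0" "(SUM j:?J. c j *c ?f j) = 0" by blast
 have eq: "c None *c y+(SUM j:J. c (Some j) *c f j) = 0" using c(2) fin by (simp add: sum.reindex)
 have "c None ~= 0"
 using eq ind c by force
 have "y l = (SUM j:J. (- c (Some j) / c None) *c f j) l" for l
 proof -
  have "c None * y l = - (SUM j:J. c (Some j) * f j l)" using fun_cong[OF eq, of l] by (simp add: fapp add_eq_0_iff2)
  thus ?thesis using `c None ~= 0` by (simp add: fapp sum_negf sum_divide_distrib[symmetric] field_simps)
 qed
 thus ?thesis by (intro exI[of _ "%j. - c (Some j) / c None"]) (auto simp: fun_eq_iff fapp)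
qed

section \<open>Finite-dimensional algebras, corners and orthogonal idempotents\<close>

locale fd_alg =
 fixes m :: nat and s :: "'a::field sconsts" and e1 :: "nat => 'a"
 assumes sc_assoc: "i < m ==> j < m ==> h < m ==> l < m ==>
   (SUM p<m. s i j p * s p h l) = (SUM p<m. s j h p * s i p l)"
  and sc_unit_l: "j < m ==> l < m ==> (SUM i<m. e1 i * s i j l) = (if j = l then 1 else 0)"
  and sc_unit_r: "j < m ==> l < m ==> (SUM i<m. e1 i * s j i l) = (if j = l then 1 else 0)"
  and e1_supp: "e1 : spt m"
begin

definition mul :: "(nat => 'a) => (nat => 'a) => nat => 'a" (infixl \<open>.*\<close> 70) where
 "x .* y = (%l. if l < m then SUM i<m. SUM j<m. x i * y j * s i j l else 0)"

abbreviation "A \<equiv> (spt m :: (nat => 'a) set)"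

lemma mul_supp [simp]: "x .* y : A"
 by (auto simp: spt_def mul_def)

lemma mul_add_l: "(x+y) .* z = x .* z+y .* z"
 and mul_add_r: "z .* (x+y) = z .* x+z .* y"
 and mul_scale_l [simp]: "(c *c x) .* z = c *c (x .* z)"
 and mul_scale_r [simp]: "z .* (c *c x) = c *c (z .* x)"
 by (auto simp: mul_def fapp fun_eq_iff algebra_simps sum.distrib sum_distrib_left)

lemma mul_0_l [simp]: "0 .* z = 0" and mul_0_r [simp]: "z .* 0 = 0"
 by (auto simp: mul_def fapp fun_eq_iff)

lemma mul_minus_l [simp]: "(- x) .* z = - (x .* z)" and mul_minus_r [simp]: "z .* (- x) = - (z .* x)"
 by (auto simp: mul_def fapp fun_eq_iff sum_negf)

lemma mul_diff_l: "(x-y) .* z = x .* z-y .* z" and mul_diff_r: "z .* (x-y) = z .* x-z .* y"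
 using mul_add_l[of x "- y" z] mul_add_r[of z x "- y"] by auto

lemma msum_l: "(SUM j:J. f j) .* z = (SUM j:J. f j .* z)"
 by (induct J rule: ifi) (auto simp: mul_add_l)

lemma msum_r: "z .* (SUM j:J. f j) = (SUM j:J. z .* f j)"
 by (induct J rule: ifi) (auto simp: mul_add_r)

lemma massoc: "(x .* y) .* z = x .* (y .* z)"
proof
 fix l
 show "((x .* y) .* z) l = (x .* (y .* z)) l"
 proof (cases "l < m")
  case True
  have "((x .* y) .* z) l = (SUM p<m. SUM h<m. SUM i<m. SUM j<m. x i * y j * z h*(s i j p * s p h l))" using True by (simp add: mul_def sum_distrib_left sum_distrib_right mult_ac)
  also have "... = (SUM h<m. SUM p<m. SUM i<m. SUM j<m. x i * y j * z h*(s i j p * s p h l))" by (rule sum.swap)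
  also have "... = (SUM h<m. SUM i<m. SUM p<m. SUM j<m. x i * y j * z h*(s i j p * s p h l))" by (rule sum.cong[OF refl], rule sum.swap)
  also have "... = (SUM h<m. SUM i<m. SUM j<m. SUM p<m. x i * y j * z h*(s i j p * s p h l))" by (rule sum.cong[OF refl], rule sum.cong[OF refl], rule sum.swap)
  also have "... = (SUM h<m. SUM i<m. SUM j<m. x i * y j * z h*(SUM p<m. s i j p * s p h l))" by (simp add: sum_distrib_left)
  also have "... = (SUM h<m. SUM i<m. SUM j<m. x i * y j * z h*(SUM p<m. s j h p * s i p l))" using True by (intro sum.cong refl) (simp add: sc_assoc)
  also have "... = (SUM i<m. SUM h<m. SUM j<m. SUM p<m. x i * y j * z h*(s j h p * s i p l))" by (simp add: sum_distrib_left, rule sum.swap)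
  also have "... = (SUM i<m. SUM j<m. SUM h<m. SUM p<m. x i * y j * z h*(s j h p * s i p l))" by (rule sum.cong[OF refl], rule sum.swap)
  also have "... = (SUM i<m. SUM j<m. SUM p<m. SUM h<m. x i * y j * z h*(s j h p * s i p l))" by (rule sum.cong[OF refl], rule sum.cong[OF refl], rule sum.swap)
  also have "... = (SUM i<m. SUM p<m. SUM j<m. SUM h<m. x i * y j * z h*(s j h p * s i p l))" by (rule sum.cong[OF refl], rule sum.swap)
  also have "... = (x .* (y .* z)) l" using True by (simp add: mul_def sum_distrib_left sum_distrib_right mult_ac)
  finally show ?thesis .
 qed (auto simp: mul_def)
qed

lemma mul_bv: "i < m ==> j < m ==> l < m ==> (bv i .* bv j) l = s i j l"
 by (simp add: mul_def bv_def if_distrib[of "%x. x * _"] if_distrib[of "%x. _ * x"] sum.delta cong: if_cong)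

lemma e1_left [simp]: "x : A ==> e1 .* x = x"
proof
 fix l assume x: "x : A"
 have "(e1 .* x) l = (SUM i<m. SUM j<m. x j*(e1 i * s i j l))" if "l < m" using that by (simp add: mul_def mult_ac)
 also have "... = (SUM j<m. x j*(SUM i<m. e1 i * s i j l))" by (subst sum.swap, simp add: sum_distrib_left)
 finally show "(e1 .* x) l = x l" using x by (cases "l < m") (auto simp: sc_unit_l mul_def spt_def if_distrib sum.delta cong: if_cong)
qed

lemma e1_right [simp]: "x : A ==> x .* e1 = x"
proof
 fix l assume x: "x : A"
 have "(x .* e1) l = (SUM j<m. x j*(SUM i<m. e1 i * s j i l))" if "l < m" using that by (simp add: mul_def sum_distrib_left mult_ac)
 thus "(x .* e1) l = x l" using x by (cases "l < m") (auto simp: sc_unit_r mul_def spt_def if_distrib sum.delta cong: if_cong)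
qed

lemmas e1_in_A [simp] = e1_supp

text \<open>Evaluation in a corner ring with unit \<open>e\<close>: the constant term is multiplied
  by \<open>e\<close>, not by \<open>e1\<close>. The Horner form makes the rule for
  \<open>pCons\<close> immediate.\<close>

definition peval :: "(nat => 'a) => 'a poly => (nat => 'a) => nat => 'a" where
 "peval e p z = fold_coeffs (%a x. a *c e+z .* x) p 0"

text \<open>The Peirce component \<open>eAf\<close> when \<open>e\<close> and \<open>f\<close> are
  idempotent, given by fixed-point equations instead of as an image.\<close>

definition corner :: "(nat => 'a) => (nat => 'a) => (nat => 'a) set" where
 "corner e f = {z. e .* z = z & z .* f = z}"

lemma peval_0 [simp]: "peval e 0 z = 0"
 by (simp add: peval_def)

lemma peval_pCons [simp]: "peval e (pCons a p) z = a *c e+z .* peval e p z"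
 by (cases "p = 0 & a = 0") (auto simp: peval_def)

lemma peval_add: "peval e (p+q) z = peval e p z+peval e q z"
 by (induct p q rule: poly_induct2) (auto simp: mul_add_r fv.scale_left_distrib add_ac)

lemma peval_smult: "peval e (Polynomial.smult c p) z = c *c peval e p z"
 by (induct p) (auto simp: fv.scale_right_distrib mul_add_r)

lemma peval_minus: "peval e (- p) z = - peval e p z"
 using peval_smult[of e "- 1" p z] by (auto simp: fun_eq_iff fapp)

lemma peval_diff: "peval e (p-q) z = peval e p z-peval e q z"
 using peval_add[of e p "- q" z] by (simp add: peval_minus)

lemma peval_corner:
 assumes "e .* e = e" "z : corner e e"
 shows "peval e p z : corner e e" "z .* peval e p z = peval e p z .* z"
 using assms by (induct p) (auto simp: corner_def mul_add_r mul_add_l massoc[symmetric], simp_all add: massoc)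

lemma peval_mult:
 assumes "e .* e = e" "z : corner e e"
 shows "peval e (p * q) z = peval e p z .* peval e q z"
proof (induct p)
 case (pCons a p)
 show ?case using peval_corner[OF assms, of q] using pCons by (simp add: corner_def peval_add peval_smult mul_add_l massoc)
qed auto

fun mpow :: "(nat => 'a) => (nat => 'a) => nat => nat => 'a" where
 "mpow e z 0 = e"
| "mpow e z (Suc i) = z .* mpow e z i"

lemma peval_monom: "peval e (mn c i) z = c *c mpow e z i"
 by (induct i) (auto simp: monom_0 monom_Suc)

lemma peval_sum: "peval e (SUM i:I. p i) z = (SUM i:I. peval e (p i) z)"
 by (induct I rule: ifi) (auto simp: peval_add)

lemma peval_altdef: "peval e p z = (SUM i<=degree p. coeff p i *c mpow e z i)"
 by (subst poly_as_sum_of_monoms[of p, symmetric], subst peval_sum) (simp add: peval_monom)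

lemma exists_annihilating_poly:
 assumes "e : A"
 shows "EX p. p ~= 0 & peval e p z = 0"
proof -
 have "mpow e z i : A" for i using assms by (cases i) auto
 then obtain c where c: "EX j:{..m}. c j ~= 0" "(SUM j:{..m}. c j *c mpow e z j) = 0" using spt_dependent[of "{..m}" m "mpow e z"] by auto
 define p where "p = (SUM j<=m. mn (c j) j)"
 have "coeff p j = c j" if "j <= m" for j using that by (simp add: p_def coeff_sum coeff_monom)
 hence "p ~= 0" using c(1) by (metis atMost_iff coeff_0)
 moreover have "peval e p z = 0" using c(2) by (simp add: p_def peval_sum peval_monom)
 ultimately show ?thesis by blast
qed

text \<open>A complete system of orthogonal idempotents; the values from \<open>n\<close> on are
  arbitrary.\<close>

definition idem :: "nat => (nat => nat => 'a) => bool" where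
 "idem n e \<longleftrightarrow> (ALL x<n. e x ~= 0) & (ALL x<n. ALL y<n. e x .* e y = (if x = y then e x else 0)) &
   (SUM x<n. e x) = e1"

lemma idemD:
 assumes "idem n e"
 shows "x < n ==> e x ~= 0" "x < n ==> y < n ==> e x .* e y = (if x = y then e x else 0)"
  "(SUM x<n. e x) = e1" "x < n ==> e x : A" "x < n ==> e x .* e x = e x"
 using assms mul_supp[of "e x" "e x"] unfolding idem_def by (auto simp del: mul_supp)

text \<open>Nonzero orthogonal idempotents are independent, since multiplying a relation by
  \<open>e y\<close> isolates the coefficient of \<open>e y\<close>.\<close>

lemma idem_le:
 assumes "idem n e"
 shows "n <= m"
proof (rule ccontr)
 assume "~n <= m"
 then obtain c where c: "EX j:{..<n}. c j ~= 0" "(SUM j:{..<n}. c j *c e j) = 0" using spt_dependent[of "{..<n}" m e] idemD(4)[OF assms] by auto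
 then obtain y where y: "y < n" "c y ~= 0" by auto
 have "0 = (SUM j<n. c j *c e j) .* e y" using c by simp
 also have "... = (SUM j<n. if j = y then c j *c e y else 0)" unfolding msum_l using idemD(2)[OF assms] y by (intro sum.cong) (auto simp: fun_eq_iff fapp)
 also have "... = c y *c e y" using y by simp
 finally show False using y idemD(1)[OF assms y(1)] by (auto simp: fun_eq_iff fapp)
qed

end

text \<open>The polynomial \<open>h = 1 - r / r(c)\<close> vanishes at \<open>c\<close>, so
  \<open>h^k\<close> is a multiple of \<open>(X - c)^k\<close>, while \<open>1 - h^k\<close> is a
  multiple of \<open>1 - h\<close> and hence of \<open>r\<close>.\<close>

lemma bezout_linear_power:
 fixes r :: "'a::field poly"
 assumes "poly r c ~= 0"
 shows "EX a b. a*[:-c, 1:]^k+b * r = 1"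
proof -
 define h where "h = 1-Polynomial.smult (1 / poly r c) r"
 have "poly h c = 0" using assms by (simp add: h_def)
 then obtain w where w: "h = [:-c, 1:] * w" by (auto simp: poly_eq_0_iff_dvd elim: dvdE)
 have "1-h^k = (1-h)*(SUM i<k. h^i)" by (rule one_diff_power_eq)
 also have "1-h = Polynomial.smult (1 / poly r c) r" by (simp add: h_def)
 finally have "w^k*[:-c, 1:]^k+(Polynomial.smult (1 / poly r c) (SUM i<k. h^i)) * r = 1" unfolding w power_mult_distrib by (simp add: algebra_simps)
 thus ?thesis by blast
qed

section \<open>Units and nilpotents of a corner ring\<close>

context fd_alg begin

lemma corner_subset: "z : corner e f ==> z : A"
 using mul_supp[of e z] by (auto simp: corner_def)

lemma corner_diff: "z : corner e f ==> w : corner e f ==> z-w : corner e f"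
 and corner_add: "z : corner e f ==> w : corner e f ==> z+w : corner e f"
 and corner_scale: "z : corner e f ==> c *c z : corner e f"
 by (auto simp: corner_def mul_diff_l mul_diff_r mul_add_l mul_add_r)

lemma corner_mult: "z : corner e f ==> w : corner f g ==> z .* w : corner e g"
 by (auto simp: corner_def massoc) (simp add: massoc[symmetric])

lemma corner_compress: "e .* e = e ==> f .* f = f ==> e .* z .* f : corner e f"
 by (auto simp: corner_def massoc) (simp_all add: massoc[symmetric])

lemma peval_1 [simp]: "peval e 1 z = e"
 by (simp add: one_pCons fv.scale_one)

lemma peval_power:
 assumes "e .* e = e" "z : corner e e"
 shows "peval e (p^k) z = mpow e (peval e p z) k"
 using assms by (induct k) (simp_all add: peval_mult)

lemma peval_linear:
 assumes "z : corner e e"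
 shows "peval e [:-c, 1:] z = z - c *c e"
 using assms by (simp add: corner_def)

text \<open>Factor the minimal polynomial of \<open>z\<close> as \<open>(X - c)^k * r\<close> with
  \<open>r(c)\<close> nonzero. Bezout turns the coprime factors into orthogonal idempotents with sum
  \<open>E\<close>, and as \<open>E\<close> does not split, one of them is zero; minimality rules
  out the one that would give \<open>r(z) = 0\<close>.\<close>

lemma corner_eigenvalue:
 assumes E: "E .* E = E" "E : A" "E ~= 0" and z: "z : corner E E"
  and nosplit: "!!f g. f+g = E ==> f .* f = f ==> g .* g = g ==> f .* g = 0 ==> g .* f = 0 ==> f = 0 \<or> g = 0"
  and root: "!!p :: 'a poly. degree p > 0 ==> EX c. poly p c = 0"
 shows "EX c k. mpow E (z - c *c E) k = 0"
proof -
 obtain p where p: "p ~= 0" "peval E p z = 0"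
  and min: "!!q. q ~= 0 ==> peval E q z = 0 ==> degree p <= degree q"
 proof -
  obtain p0 where "p0 ~= 0 & peval E p0 z = 0" using exists_annihilating_poly[OF E(2)] by blast
  from ex_has_least_nat[of "%p. p ~= 0 & peval E p z = 0", OF this, of degree] show ?thesis using that by blast
 qed
 have "degree p > 0"
 proof (rule ccontr)
  assume "~degree p > 0"
  then obtain a where "p = [:a:]" by (auto elim: degree_eq_zeroE)
  with p E(3) show False by (auto simp: fun_eq_iff fapp)
 qed
 then obtain c where c: "poly p c = 0" using root by blast
 obtain r where r: "p = [:-c, 1:]^Polynomial.order c p * r" "~ [:-c, 1:] dvd r" using order_decomp[OF p(1)] by blast
 define k where "k = Polynomial.order c p"
 have "k > 0" using c p(1) by (simp add: k_def Polynomial.order_root)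
 have "poly r c ~= 0" using r(2) by (simp add: poly_eq_0_iff_dvd)
 then obtain a b where ab: "a*[:-c, 1:]^k+b * r = 1" using bezout_linear_power by blast
 let ?f = "peval E (b * r) z" and ?g = "peval E (a*[:-c, 1:]^k) z"
 note pm = peval_mult[OF E(1) z]
 have pz: "peval E (q * p) z = 0" for q using p(2) by (simp add: pm)
 have "?f+?g = E" using ab by (metis add.commute peval_1 peval_add)
 moreover have fg: "?f .* ?g = 0" using pz[of "a * b"] unfolding pm[symmetric] by (subst (asm) r(1)) (simp add: k_def mult_ac)
 moreover have gf: "?g .* ?f = 0" using pz[of "a * b"] unfolding pm[symmetric] by (subst (asm) r(1)) (simp add: k_def mult_ac)
 moreover have "?f .* ?f = ?f"
 proof -
  have "?f .* (?f+?g) = ?f" using peval_corner(1)[OF E(1) z] by (simp add: corner_def `?f + ?g = E`)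
  thus ?thesis unfolding mul_add_r fg by simp
 qed
 moreover have "?g .* ?g = ?g"
 proof -
  have "?g .* (?f+?g) = ?g" using peval_corner(1)[OF E(1) z] by (simp add: corner_def `?f + ?g = E`)
  thus ?thesis unfolding mul_add_r gf by simp
 qed
 ultimately consider "?f = 0" | "?g = 0" using nosplit by blast
 thus ?thesis
 proof cases
  case 1
  have "peval E r z = peval E (r*(a*[:-c, 1:]^k+b * r)) z" using ab by simp
  also have "r*(a*[:-c, 1:]^k+b * r) = a * p + r*(b * r)" by (subst r(1)) (simp add: k_def algebra_simps)
  also have "peval E ... z = 0" using 1 pz by (simp add: peval_add pm[of r])
  finally have "peval E r z = 0" .
  moreover have "r ~= 0" using r(2) by auto
  ultimately have "degree p <= degree r" by (rule min[rotated])
  moreover have "degree p = k+degree r" by (subst r(1)) (simp add: degree_mult_eq `r ~= 0` degree_linear_power k_def)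
  ultimately show ?thesis using `k > 0` by simp
 next
  case 2
  have "peval E ([:-c, 1:]^k) z = peval E ([:-c, 1:]^k*(a*[:-c, 1:]^k+b * r)) z" using ab by simp
  also have "[:-c, 1:]^k*(a*[:-c, 1:]^k+b * r) = [:-c, 1:]^k*(a*[:-c, 1:]^k)+b * p" by (subst r(1)) (simp add: k_def algebra_simps)
  also have "peval E ... z = 0" using 2 pz by (simp add: peval_add pm[of "[:-c, 1:]^k" "a*[:-c, 1:]^k"])
  finally show ?thesis unfolding peval_power[OF E(1) z] peval_linear[OF z] by blast
 qed
qed

definition nilp :: "(nat => 'a) => (nat => 'a) => bool" where
 "nilp E z \<longleftrightarrow> (EX k. mpow E z k = 0)"

text \<open>The inverse is a polynomial in \<open>y\<close>: a power of \<open>X - c\<close>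
  annihilates \<open>y\<close>, and this power is coprime to \<open>X\<close>.\<close>

lemma corner_inverse:
 assumes E: "E .* E = E" and y: "y : corner E E" and c: "c ~= 0" and nil: "nilp E (y - c *c E)"
 shows "EX d:corner E E. d .* y = E & y .* d = E"
proof -
 from nil obtain k where k: "mpow E (y - c *c E) k = 0" by (auto simp: nilp_def)
 have "poly [:0, 1:] c ~= 0" using c by simp
 then obtain a b where ab: "a*[:-c, 1:]^k+b*[:0, 1:] = 1" using bezout_linear_power by blast
 have X: "peval E [:0, 1:] y = y" using y by (auto simp: corner_def)
 have "peval E (a*[:-c, 1:]^k) y = 0" by (simp add: peval_mult[OF E y] peval_power[OF E y] peval_linear[OF y] k del: peval_pCons)
 hence *: "peval E (b*[:0, 1:]) y = E" using ab by (metis add.left_neutral peval_1 peval_add)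
 hence "peval E b y .* y = E" by (simp only: peval_mult[OF E y] X)
 moreover have "y .* peval E b y = E" using * by (subst (asm) mult.commute) (simp only: peval_mult[OF E y] X)
 ultimately show ?thesis using peval_corner(1)[OF E y] by blast
qed

text \<open>With \<open>k\<close> the nilpotency index, \<open>z^(k-1)\<close> is nonzero and killed
  by \<open>z\<close> from either side, which a one-sided inverse of \<open>z\<close> does not
  permit.\<close>

lemma nilp_not_unit:
 assumes E: "E .* E = E" "E ~= 0" and z: "z : corner E E" "nilp E z"
 shows "c .* z ~= E" "z .* c ~= E"
proof -
 define k where "k = (LEAST k. mpow E z k = 0)"
 have k: "mpow E z k = 0" using z(2) unfolding nilp_def k_def by (rule LeastI_ex)
 have least: "mpow E z j ~= 0" if "j < k" for j using not_less_Least[OF that[unfolded k_def]] .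
 then obtain j where j: "k = Suc j" using k E(2) by (cases k) auto
 have zj: "z .* mpow E z j = 0" using k j by simp
 have jz: "mpow E z j .* z = 0" using peval_corner(2)[OF E(1) z(1), of "mn 1 j"] zj by (simp add: peval_monom)
 have pc: "mpow E z j : corner E E" using peval_corner(1)[OF E(1) z(1), of "mn 1 j"] by (simp add: peval_monom)
 show "c .* z ~= E"
 using pc zj least j by (auto simp: corner_def massoc)
 show "z .* c ~= E"
 proof
  assume "z .* c = E"
  hence "mpow E z j = mpow E z j .* (z .* c)" using pc by (simp add: corner_def)
  with jz least[of j] j show False by (simp add: massoc[symmetric])
 qed
qed

text \<open>The piece \<open>f\<close> takes the place of \<open>e x\<close> and \<open>g\<close> is
  appended as number \<open>n\<close>. Both are absorbed by \<open>e x\<close>, so they inherit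
  orthogonality to the other members.\<close>

lemma idem_split:
 assumes fam: "idem n e" and x: "x < n" and fg: "f+g = e x" "f .* f = f" "g .* g = g" "f .* g = 0" "g .* f = 0"
  and nz: "f ~= 0" "g ~= 0"
 shows "idem (Suc n) (e(x := f, n := g))"
proof -
 note D = idemD[OF fam]
 have "(f+g) .* f = f" "f .* (f+g) = f" "(f+g) .* g = g" "g .* (f+g) = g" unfolding mul_add_l mul_add_r using fg(2-) by simp_all
 note fe = this[unfolded fg(1)]
 have 0: "e y .* f = 0" "f .* e y = 0" "e y .* g = 0" "g .* e y = 0" if "y < n" "y ~= x" for y using D(2)[OF that(1) x] D(2)[OF x that(1)] that(2) fe by (metis mul_0_l massoc, metis mul_0_r massoc, metis mul_0_l massoc, metis mul_0_r massoc)
 have "(SUM y<n. (e(x := f, n := g)) y) = f+(SUM y:{..<n} - {x}. e y)" using x by (subst sum.remove[of _ x]) (auto intro!: sum.cong)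
 moreover have "(SUM y<n. e y) = e x+(SUM y:{..<n} - {x}. e y)" using x by (subst sum.remove[of _ x]) auto
 ultimately have "(SUM y<Suc n. (e(x := f, n := g)) y) = e1" using fg(1) D(3) by (simp add: add_ac)
 thus ?thesis using D(1,2) 0 nz fg x by (auto simp: idem_def less_Suc_eq)
qed

end

text \<open>Central simplicity in linear form: combinations of the maps from \<open>x\<close> to
  \<open>bv i * x * bv j\<close> include every matrix unit of the endomorphisms of \<open>A\<close>.
  This says only that certain linear systems over the base field are solvable, so it passes to
  extension fields, which is not evident from the definition by ideals and centre.\<close>

locale cs_alg = fd_alg +
 assumes e1_nz: "e1 ~= 0"
  and sc_simple: "l < m ==> t < m ==> EX c. ALL h<m. ALL r<m.
   (SUM i<m. SUM j<m. c i j*(SUM p<m. s i h p * s p j r)) = (if h = l & r = t then 1 else 0)"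
begin

lemma mul_bv3: "i < m ==> h < m ==> j < m ==> r < m ==> (bv i .* bv h .* bv j) r = (SUM p<m. s i h p * s p j r)"
 by (subst mul_def[of "bv i .* bv h"]) (simp add: mul_bv bv_apply if_distrib[of "%x. _ * x"] if_distrib[of "%x. x * _"] sum.delta cong: if_cong)

lemma simple_bv:
 assumes "l < m" "t < m"
 shows "EX c. ALL h<m. (SUM i<m. SUM j<m. c i j *c (bv i .* bv h .* bv j)) = (if h = l then bv t else 0)"
proof -
 obtain c where c: "!!h r. h < m ==> r < m ==> 
   (SUM i<m. SUM j<m. c i j*(SUM p<m. s i h p * s p j r)) = (if h = l & r = t then 1 else 0)"
  using sc_simple[OF assms] by blast
 have "(SUM i<m. SUM j<m. c i j *c (bv i .* bv h .* bv j)) r = (if h = l then bv t else 0) r" if "h < m" for h r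
 proof (cases "r < m")
  case True
  thus ?thesis using c[OF that True] that by (simp add: fapp mul_bv3 bv_apply)
 next
  case False
  thus ?thesis using assms by (auto simp: fapp mul_def bv_apply)
 qed
 thus ?thesis by blast
qed

text \<open>The ideal generated by a nonzero \<open>z\<close> is all of \<open>A\<close>, as an
  induction rule. If coordinate \<open>l\<close> of \<open>z\<close> is nonzero, the combination
  that maps \<open>bv l\<close> to \<open>bv t\<close> and kills the other basis vectors maps
  \<open>z\<close> to a nonzero multiple of \<open>bv t\<close>.\<close>

lemma simple_induct:
 assumes z: "z : A" "z ~= 0" and y: "y : A" and P: "P 0" "!!u v. P u ==> P v ==> P (u+v)" "!!c u. P u ==> P (c *c u)"
  "!!a b. a : A ==> b : A ==> P (a .* z .* b)"
 shows "P y"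
proof -
 have P_sum: "P (sum f J)" if "!!j. j : J ==> P (f j)" for f :: "nat => nat => 'a" and J using that by (induct J rule: ifi) (auto simp: P)
 obtain l where l: "l < m" "z l ~= 0"
 proof -
  obtain l where "z l ~= 0" using z(2) by (auto simp: fun_eq_iff fapp)
  moreover from this have "l < m" using sptD[OF z(1), of l] by (cases "l < m") auto
  ultimately show ?thesis using that by blast
 qed
 \<comment> \<open>The coordinates get the separate name \<open>z'\<close>, so that unfolding
   \<open>z\<close> does not rewrite inside them.\<close>
 obtain z' where z': "z = (SUM h<m. z' h *c bv h)" and l: "l < m" "z' l ~= 0" by (rule that[OF expand_bv[OF z(1)] l])
 have "P (bv t)" if t: "t < m" for t
 proof -
  obtain c where c: "!!h. h < m ==> (SUM i<m. SUM j<m. c i j *c (bv i .* bv h .* bv j)) = (if h = l then bv t else 0)" using simple_bv[OF l(1) t] by blast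
  have "bv i .* z .* bv j = (SUM h<m. z' h *c (bv i .* bv h .* bv j))" for i j unfolding z' by (simp add: msum_l msum_r)
  hence "(SUM i<m. SUM j<m. c i j *c (bv i .* z .* bv j)) =
    (SUM i<m. SUM j<m. SUM h<m. z' h *c c i j *c (bv i .* bv h .* bv j))"
   by (simp add: fv.scale_sum_right mult.commute)
  also have "... = (SUM i<m. SUM h<m. SUM j<m. z' h *c c i j *c (bv i .* bv h .* bv j))" by (rule sum.cong[OF refl], rule sum.swap)
  also have "... = (SUM h<m. SUM i<m. SUM j<m. z' h *c c i j *c (bv i .* bv h .* bv j))" by (rule sum.swap)
  also have "... = (SUM h<m. z' h *c (SUM i<m. SUM j<m. c i j *c (bv i .* bv h .* bv j)))" by (simp only: fv.scale_sum_right)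
  also have "... = (SUM h<m. z' h *c (if h = l then bv t else 0))" using c by (intro sum.cong refl) simp
  also have "... = z' l *c bv t" using l by (simp add: if_distrib sum.delta cong: if_cong)
  finally have eq: "bv t = (1 / z' l) *c (SUM i<m. SUM j<m. c i j *c (bv i .* z .* bv j))" using l by simp
  show ?thesis unfolding eq by (rule P(3), rule P_sum, rule P_sum, rule P(3), rule P(4)) simp_all
 qed
 hence "P (SUM i<m. y i *c bv i)" by (intro P_sum P(3)) simp
 thus ?thesis by (simp only: expand_bv[OF y, symmetric])
qed

text \<open>A simple ring is prime: if \<open>a x b = 0\<close> for all \<open>x\<close>, the
  elements \<open>w\<close> with \<open>w b = 0\<close> include \<open>A a A\<close>, hence
  \<open>e1\<close>, and \<open>b = 0\<close>.\<close>

lemma prod_nonzero: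
 assumes "a : A" "a ~= 0" "b : A" "b ~= 0"
 shows "EX x:A. a .* x .* b ~= 0"
proof (rule ccontr)
 assume *: "~(EX x:A. a .* x .* b ~= 0)"
 have "e1 .* b = 0"
 proof (rule simple_induct[where P = "%w. w .* b = 0" and z = a])
  fix u v assume "u : A" "v : A"
  thus "u .* a .* v .* b = 0" using * by (metis mul_0_r massoc)
 next
  fix u v assume "u .* b = 0" "v .* b = 0"
  thus "(u+v) .* b = 0" by (simp add: mul_add_l)
 qed (use assms in \<open>simp_all\<close>)
 with assms show False by simp
qed

end

section \<open>Central simple algebras over a closed field: one-dimensional Peirce blocks\<close>

locale acs_alg = cs_alg m s e1 for m and s :: "'a::alg_closed_field sconsts" and e1
begin

text \<open>A corner in which every element is a scalar plus a nilpotent is local, and its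
  nilpotents form an ideal. A nonzero nilpotent \<open>z\<close> generates everything by simplicity,
  so \<open>E\<close>, compressed to the corner, would be nilpotent.\<close>

lemma nilp_corner_0:
 assumes E: "E .* E = E" "E ~= 0"
  and eig: "!!z. z : corner E E ==> EX c. nilp E (z - c *c E)"
  and z: "z : corner E E" "nilp E z"
 shows "z = 0"
proof (rule ccontr)
 assume nz: "z ~= 0"
 have EA: "E : A" using mul_supp[of E E] E(1) by simp
 note unit = corner_inverse[OF E(1)] and nounit = nilp_not_unit[OF E]
 \<comment> \<open>A product with a nilpotent factor is a scalar plus a nilpotent; with a nonzero
   scalar it would be a unit and provide a one-sided inverse of a nilpotent.\<close>
 have mult: "nilp E (a .* w .* b)" if w: "w : corner E E" "nilp E w" and a: "a : corner E E" and b: "b : corner E E" for a w b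
 proof -
  have 1: "nilp E (c .* v)" if v: "v : corner E E" "nilp E v" and c: "c : corner E E" for c v
  proof -
   have cv: "c .* v : corner E E" by (rule corner_mult[OF c v(1)])
   from eig[OF this] obtain d where d: "nilp E (c .* v-d *c E)" by blast
   show ?thesis
   proof (cases "d = 0")
    case False
    from unit[OF cv this d] obtain f where "f .* (c .* v) = E" by blast
    hence "(f .* c) .* v = E" by (simp add: massoc)
    with nounit(1)[OF v] show ?thesis by blast
   qed (use d in simp)
  qed
  have aw: "a .* w : corner E E" "nilp E (a .* w)" using corner_mult[OF a w(1)] 1[OF w a] by auto
  have awb: "a .* w .* b : corner E E" by (rule corner_mult[OF aw(1) b])
  from eig[OF this] obtain d where d: "nilp E (a .* w .* b-d *c E)" by blast
  show ?thesis
  proof (cases "d = 0")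
   case False
   from unit[OF awb this d] obtain f where "(a .* w .* b) .* f = E" by blast
   hence "(a .* w) .* (b .* f) = E" by (simp add: massoc)
   with nounit(2)[OF aw] show ?thesis by blast
  qed (use d in simp)
 qed
 have EE: "E : corner E E" using E(1) by (simp add: corner_def)
 have neg: "nilp E (- w)" if "w : corner E E" "nilp E w" for w
 proof -
  have "- E : corner E E" using EE by (auto simp: corner_def)
  from mult[OF that this EE] show ?thesis using that(1) by (simp add: corner_def)
 qed
 have add: "nilp E (v+w)" if v: "v : corner E E" "nilp E v" and w: "w : corner E E" "nilp E w" for v w
 proof -
  have vw: "v+w : corner E E" by (rule corner_add[OF v(1) w(1)])
  from eig[OF this] obtain d where d: "nilp E (v+w-d *c E)" by blast
  show ?thesis
  proof (cases "d = 0")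
   case False
   from unit[OF vw this d] obtain f where f: "f : corner E E" "f .* (v+w) = E" by blast
   have fw: "f .* w : corner E E" "nilp E (f .* w)" using corner_mult[OF f(1) w(1)] mult[OF w f(1) EE] by (auto simp: corner_def)
   have Ew: "E-f .* w : corner E E" by (rule corner_diff[OF EE fw(1)])
   \<comment> \<open>\<open>E - f w\<close> is a unit, being \<open>E\<close> minus a nilpotent. It
     equals \<open>f v\<close>, so the nilpotent \<open>v\<close> would have a left inverse.\<close>
   have "nilp E ((E-f .* w)-1 *c E)" using neg[OF fw] by simp
   from unit[OF Ew _ this] obtain g where g: "g .* (E-f .* w) = E" by auto
   have "E-f .* w = f .* v" using f(2) by (simp add: mul_add_r algebra_simps)
   with g have "(g .* f) .* v = E" by (simp add: massoc)
   with nounit(1)[OF v] show ?thesis by blast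
  qed (use d in simp)
 qed
 have "E .* E .* E : corner E E & nilp E (E .* E .* E)"
 proof (rule simple_induct[where z = z and y = E and P = "%w. E .* w .* E : corner E E & nilp E (E .* w .* E)"])
  show "E .* 0 .* E : corner E E & nilp E (E .* 0 .* E)" by (auto simp: corner_def nilp_def intro: exI[of _ 1])
 next
  fix u v assume "E .* u .* E : corner E E & nilp E (E .* u .* E)" "E .* v .* E : corner E E & nilp E (E .* v .* E)"
  thus "E .* (u+v) .* E : corner E E & nilp E (E .* (u+v) .* E)" using add by (auto simp: mul_add_l mul_add_r intro: corner_add)
 next
  fix c u assume *: "E .* u .* E : corner E E & nilp E (E .* u .* E)"
  have "c *c E : corner E E" by (rule corner_scale[OF EE])
  from mult[OF conjunct1[OF *] conjunct2[OF *] this EE]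
  have "nilp E (c *c (E .* (E .* u .* E) .* E))" by simp
  moreover have "E .* (E .* u .* E) .* E = E .* u .* E" using * by (auto simp: corner_def)
  ultimately show "E .* (c *c u) .* E : corner E E & nilp E (E .* (c *c u) .* E)" using * by (auto intro: corner_scale)
 next
  fix a b assume "a : A" "b : A"
  have a: "E .* a .* E : corner E E" and b: "E .* b .* E : corner E E" by (intro corner_compress E(1))+
  have "E .* z = z" "z .* E = z" using z(1) by (auto simp: corner_def)
  hence eq: "E .* (a .* z .* b) .* E = (E .* a .* E) .* z .* (E .* b .* E)" by (metis massoc)
  show "E .* (a .* z .* b) .* E : corner E E & nilp E (E .* (a .* z .* b) .* E)" unfolding eq using mult[OF z a b] corner_mult[OF corner_mult[OF a z(1)] b] by blast
 qed (use nz EA corner_subset[OF z(1)] in simp_all)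
 hence "nilp E E" using E(1) by simp
 from nounit(1)[OF EE this, of E] E(1) show False by simp
qed

text \<open>Maximality makes \<open>e x\<close> primitive, because splitting it would lengthen the
  family. So \<open>z\<close> differs from a scalar by a nilpotent, and nilpotents of the corner
  vanish.\<close>

lemma maximal_family_block:
 assumes fam: "idem n e" and max: "!!n' e'. idem n' e' ==> n' <= n"
  and x: "x < n" and z: "z : corner (e x) (e x)"
 shows "EX c. z = c *c e x"
proof -
 note D = idemD[OF fam]
 have eig: "EX c. nilp (e x) (w - c *c e x)" if w: "w : corner (e x) (e x)" for w unfolding nilp_def
 proof (rule corner_eigenvalue[OF D(5)[OF x] D(4)[OF x] D(1)[OF x] w])
  fix f g assume "f+g = e x" "f .* f = f" "g .* g = g" "f .* g = 0" "g .* f = 0"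
  thus "f = 0 \<or> g = 0" using idem_split[OF fam x, of f g] max by fastforce
 qed (rule alg_closed_imp_poly_has_root)
 from eig[OF z] obtain c where c: "nilp (e x) (z - c *c e x)" by blast
 have "e x : corner (e x) (e x)" using D(5)[OF x] by (simp add: corner_def)
 hence "z - c *c e x : corner (e x) (e x)" by (intro corner_diff z corner_scale)
 from nilp_corner_0[OF D(5)[OF x] D(1)[OF x] eig this c] have "z - c *c e x = 0" .
 thus ?thesis by auto
qed

lemma corner_nonzero:
 assumes fam: "idem n e" and x: "x < n" and y: "y < n"
 shows "EX a:corner (e x) (e y). a ~= 0"
proof -
 note D = idemD[OF fam]
 obtain w where "e x .* w .* e y ~= 0" using prod_nonzero[OF D(4)[OF x] D(1)[OF x] D(4)[OF y] D(1)[OF y]] by blast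
 thus ?thesis using corner_compress[OF D(5)[OF x] D(5)[OF y]] by blast
qed

lemma corner_orth:
 assumes fam: "idem n e" and "x < n" "y < n" "x' < n" "y' < n" "a : corner (e x) (e y)"
 shows "e x' .* a .* e y' = (if x' = x & y' = y then a else 0)"
proof -
 note D = idemD(2)[OF fam]
 have "e x' .* a .* e y' = (e x' .* e x) .* a .* (e y .* e y')" using assms(6) by (auto simp: corner_def massoc) (simp_all add: massoc[symmetric])
 thus ?thesis using assms by (auto simp: D corner_def)
qed

text \<open>One nonzero element from each of the \<open>n * n\<close> blocks gives independent
  vectors: compressing a relation by \<open>e x\<close> and \<open>e y\<close> isolates the
  coefficient of block \<open>(x, y)\<close>.\<close>

lemma family_square_le:
 assumes fam: "idem n e"
 shows "n * n <= m"
proof (rule ccontr)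
 assume "~n * n <= m"
 have "ALL x y. EX b. x < n & y < n --> b : corner (e x) (e y) & b ~= 0" using corner_nonzero[OF fam] by blast
 then obtain a where a: "!!x y. x < n ==> y < n ==> a x y : corner (e x) (e y) & a x y ~= 0" by metis
 let ?J = "{..<n} \<times> {..<n}"
 have "EX c. (EX j:?J. c j ~= 0) & (SUM j:?J. c j *c a (fst j) (snd j)) = 0" using `~n * n <= m` corner_subset[OF conjunct1[OF a]] by (intro spt_dependent[of _ m]) auto
 then obtain c x y where c: "x < n" "y < n" "c (x, y) ~= 0" "(SUM j:?J. c j *c a (fst j) (snd j)) = 0" by auto
 have "0 = e x .* (SUM j:?J. c j *c a (fst j) (snd j)) .* e y" using c by simp
 also have "... = (SUM j:?J. c j *c (e x .* a (fst j) (snd j) .* e y))" by (simp add: msum_l msum_r)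
 also have "... = (SUM j:?J. if j = (x, y) then c (x, y) *c a x y else 0)" using c(1,2) a by (intro sum.cong refl) (auto simp: corner_orth[OF fam])
 also have "... = c (x, y) *c a x y" using c by simp
 finally show False using c a by simp
qed

text \<open>A family with \<open>n * n = m\<close> is maximal, since a longer one would exceed the
  dimension.\<close>

lemma family_block:
 assumes fam: "idem n e" "n * n = m" and x: "x < n" "z : corner (e x) (e x)"
 shows "EX c. z = c *c e x"
proof (rule maximal_family_block[OF fam(1) _ x])
 fix n' e' assume "idem n' e'"
 hence "n' * n' <= n * n" using family_square_le fam(2) by simp
 thus "n' <= n" using mult_strict_mono[of n n' n n'] by (cases "n' <= n") auto
qed

text \<open>Primeness gives a nonzero product \<open>a b\<close> in \<open>e x A e x\<close>, a
  corner of scalars, so after scaling \<open>b\<close> is a partial inverse of \<open>a\<close> on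
  both sides. Any \<open>z\<close> in the block of \<open>a\<close> is then \<open>a b z\<close>
  with \<open>b z\<close> a scalar.\<close>

lemma block_scalar:
 assumes fam: "idem n e" and block: "!!x z. x < n ==> z : corner (e x) (e x) ==> EX c. z = c *c e x"
  and x: "x < n" and y: "y < n" and a: "a : corner (e x) (e y)" "a ~= 0"
 shows "EX b:corner (e y) (e x). a .* b = e x & b .* a = e y"
  and "z : corner (e x) (e y) ==> EX c. z = c *c a"
proof -
 note D = idemD[OF fam]
 obtain w where w: "a .* w .* e x ~= 0" using prod_nonzero[OF corner_subset[OF a(1)] a(2) D(4)[OF x] D(1)[OF x]] by blast
 define b where "b = e y .* w .* e x"
 have b: "b : corner (e y) (e x)" unfolding b_def by (rule corner_compress[OF D(5)[OF y] D(5)[OF x]])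
 have "a .* b = (a .* e y) .* w .* e x" by (simp add: b_def massoc)
 hence "a .* b ~= 0" using w a(1) by (simp add: corner_def)
 obtain c where c: "a .* b = c *c e x" using block[OF x corner_mult[OF a(1) b]] by blast
 obtain d where d: "b .* a = d *c e y" using block[OF y corner_mult[OF b a(1)]] by blast
 have c0: "c ~= 0" using c `a .* b ~= 0` by auto
 have "a .* b .* a = c *c a" using a(1) by (simp add: c corner_def)
 moreover have "a .* b .* a = d *c a" using a(1) by (simp add: massoc d corner_def)
 ultimately have "c *c a = d *c a" by metis
 hence cd: "d = c" using a(2) by (simp only: fv.scale_cancel_right) auto
 show "EX b:corner (e y) (e x). a .* b = e x & b .* a = e y" using c d cd c0 by (intro bexI[of _ "(1 / c) *c b"] corner_scale b) simp
 assume z: "z : corner (e x) (e y)"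
 obtain k where k: "b .* z = k *c e y" using block[OF y corner_mult[OF b z]] by blast
 have "c *c z = (a .* b) .* z" using z by (simp add: c corner_def)
 also have "... = k *c a" using a(1) by (simp add: massoc k corner_def)
 finally have "(1 / c) *c c *c z = (1 / c) *c k *c a" by simp
 thus "EX c. z = c *c a" using c0 by auto
qed

lemma sum_blocks:
 assumes fam: "idem n e" and z: "z : A"
 shows "z = (SUM x<n. SUM y<n. e x .* z .* e y)"
proof -
 have "(SUM x<n. SUM y<n. e x .* z .* e y) = (SUM x<n. e x) .* z .* (SUM y<n. e y)" unfolding msum_l msum_r by (rule sum.swap)
 thus ?thesis using z by (simp add: idemD(3)[OF fam])
qed

text \<open>Lengths are bounded, so a longest family exists. Its blocks are lines, hence
  \<open>m <= n * n\<close>; the other inequality holds for every family. This plays the part of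
  Wedderburn's theorem over a closed field.\<close>

lemma exists_square_fam: "EX n e. idem n e & n * n = m"
proof -
 have 1: "EX e. idem 1 e" using e1_nz by (auto simp: idem_def)
 have "EX n. (EX e. idem n e) & (ALL n'. (EX e. idem n' e) --> n' <= n)" by (rule ex_has_greatest_nat[where f = "%n. n" and b = "Suc m" and P = "%n. EX e. idem n e", OF 1]) (auto dest: idem_le simp: less_Suc_eq_le)
 then obtain n e where fam: "idem n e" and max: "!!n' e'. idem n' e' ==> n' <= n" by blast
 note D = idemD[OF fam]
 have block: "EX c. z = c *c e x" if "x < n" "z : corner (e x) (e x)" for x z using maximal_family_block[OF fam _ that] max by blast
 have "ALL x y. EX b. x < n & y < n --> b : corner (e x) (e y) & b ~= 0" using corner_nonzero[OF fam] by blast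
 then obtain a where a: "!!x y. x < n ==> y < n ==> a x y : corner (e x) (e y) & a x y ~= 0" by metis
 have "EX c. e x .* z .* e y = c *c a x y" if "x < n" "y < n" for x y z using block_scalar(2)[OF fam block that conjunct1[OF a[OF that]] conjunct2[OF a[OF that]]
    corner_compress[OF D(5)[OF that(1)] D(5)[OF that(2)], of z]] by blast
 hence "ALL z x y. EX c. x < n & y < n --> e x .* z .* e y = c *c a x y" by blast
 then obtain c where c: "!!z x y. x < n ==> y < n ==> e x .* z .* e y = c z x y *c a x y" by metis
 have "m <= n * n"
 proof (rule ccontr)
  assume "~m <= n * n"
  \<comment> \<open>\<open>f i\<close> lists the block coordinates of \<open>bv i\<close>, block
    \<open>(x, y)\<close> in position \<open>x * n + y\<close>. If \<open>m > n * n\<close>, a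
    relation between these lists gives a nonzero \<open>z\<close> all of whose blocks
    vanish.\<close>
  define f where "f i = (%t. if t < n * n then c (bv i) (t div n) (t mod n) else 0)" for i
  have "EX d. (EX j:{..<m}. d j ~= 0) & (SUM j<m. d j *c f j) = 0" using `~m <= n * n` by (intro spt_dependent[of _ "n * n"]) (auto simp: f_def spt_def)
  then obtain d where d: "EX j<m. d j ~= 0" "(SUM j<m. d j *c f j) = 0" by auto
  define z where "z = (SUM j<m. d j *c bv j)"
  have zA: "z : A" unfolding z_def by (intro spt_sum) simp
  have "e x .* z .* e y = 0" if xy: "x < n" "y < n" for x y
  proof -
   have "x * n+y < n * n"
   proof -
    have "x * n+y < Suc x * n" using xy by simp
    also have "... <= n * n" using xy by (intro mult_le_mono) auto
    finally show ?thesis .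
   qed
   hence "(SUM j<m. d j * c (bv j) x y) = 0" using fun_cong[OF d(2), of "x * n+y"] xy by (simp add: fapp f_def)
   moreover have "e x .* z .* e y = (SUM j<m. (d j * c (bv j) x y) *c a x y)" unfolding z_def using xy by (simp add: msum_l msum_r c)
   ultimately show ?thesis by (simp add: fv.scale_sum_left[symmetric])
  qed
  hence "z = 0" using sum_blocks[OF fam zA] by simp
  obtain j where j: "j < m" "d j ~= 0" using d by blast
  have "z j = d j" using j by (simp add: z_def fapp bv_apply if_distrib sum.delta cong: if_cong)
  with `z = 0` j show False by (simp add: fapp)
 qed
 thus ?thesis using fam family_square_le[OF fam] by (intro exI[of _ n] exI[of _ e]) auto
qed

end

subsection \<open>Lagrange polynomials\<close>

definition lagr :: "nat => (nat => 'a::field) => nat => 'a poly" where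
 "lagr n mu x = Polynomial.smult (1 / (PROD y:{..<n} - {x}. mu x-mu y)) (PROD y:{..<n} - {x}. [:- mu y, 1:])"

lemma poly_lagr:
 assumes "inj_on mu {..<n}" "x < n" "y < n"
 shows "poly (lagr n mu x) (mu y) = (if x = y then 1 else 0)"
using assms by (auto simp: inj_on_def lagr_def poly_prod)

lemma degree_lagr: "x < n ==> degree (lagr n mu x) < n"
proof -
 assume x: "x < n"
 have "degree (PROD y:{..<n} - {x}. [:- mu y, 1:]) <= (SUM y:{..<n} - {x}. degree [:- mu y, 1:])" by (rule degree_prod_sum_le[unfolded o_def]) simp
 also have "... = n-1" using x by simp
 finally have "degree (PROD y:{..<n} - {x}. [:- mu y, 1:]) < n" using x by linarith
 thus ?thesis by (simp add: lagr_def)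
qed

lemma prod_linear_dvd:
 fixes n :: nat and f :: "'a::field poly"
 assumes "inj_on mu {..<n}" "!!x. x < n ==> poly f (mu x) = 0"
 shows "(PROD x<n. [:- mu x, 1:]) dvd f"
 using assms
proof (induct n)
 case (Suc n)
 hence "(PROD x<n. [:- mu x, 1:]) dvd f" by (auto simp: inj_on_def)
 then obtain g where g: "f = (PROD x<n. [:- mu x, 1:]) * g" by (elim dvdE)
 have "poly (PROD x<n. [:- mu x, 1:]) (mu n) ~= 0" using Suc(2) by (auto simp: poly_prod) (metis inj_onD lessThan_iff lessI less_SucI less_irrefl)
 moreover have "poly f (mu n) = 0" using Suc(3) by simp
 ultimately have "poly g (mu n) = 0" by (simp add: g)
 hence "[:- mu n, 1:] dvd g" by (simp add: poly_eq_0_iff_dvd)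
 thus ?case unfolding g prod.lessThan_Suc by (intro mult_dvd_mono) simp_all
qed simp

lemma degree_prod_linear: "degree (PROD x<n. [:- mu x, 1:] :: 'a::field poly) = n"
 by (subst degree_prod_eq_sum_degree) auto

lemma poly_zero_by_roots:
 fixes n :: nat and f :: "'a::field poly"
 assumes "inj_on mu {..<n}" "!!x. x < n ==> poly f (mu x) = 0" "degree f < n"
 shows "f = 0"
proof (rule ccontr)
 assume "f ~= 0"
 hence "degree (PROD x<n. [:- mu x, 1:]) <= degree f" by (intro dvd_imp_degree_le prod_linear_dvd assms)
 with assms(3) show False by (simp only: degree_prod_linear)
qed

lemma degree_interpolation:
 assumes "!!x. x < n ==> degree (p x) < n" "n > 0"
 shows "degree (SUM x<n. Polynomial.smult (c x) (p x)) < n"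
 using assms by (intro degree_sum_less) (auto intro: le_less_trans[OF degree_smult_le])

lemma lagr_expand:
 fixes f :: "'a::field poly"
 assumes "inj_on mu {..<n}" "degree f < n"
 shows "f = (SUM x<n. Polynomial.smult (poly f (mu x)) (lagr n mu x))"
proof -
 have "f-(SUM x<n. Polynomial.smult (poly f (mu x)) (lagr n mu x)) = 0"
 proof (rule poly_zero_by_roots[OF assms(1)])
  have "degree (SUM x<n. Polynomial.smult (poly f (mu x)) (lagr n mu x)) < n" using assms by (intro degree_interpolation degree_lagr) auto
  thus "degree (f-(SUM x<n. Polynomial.smult (poly f (mu x)) (lagr n mu x))) < n" using assms(2) by (intro degree_diff_less)
 qed (auto simp: poly_sum poly_lagr[OF assms(1)] if_distrib sum.delta cong: if_cong)
 thus ?thesis by simp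
qed

text \<open>The coefficient matrix of the Lagrange polynomials inverts the Vandermonde matrix. This
  is one side, from interpolating \<open>X^a\<close>; \<open>lagr_coeff'\<close> is the
  other.\<close>

lemma lagr_coeff:
 assumes "inj_on mu {..<n}" "a < n" "i < n"
 shows "(SUM x<n. mu x^a * coeff (lagr n mu x) i) = (if i = a then 1 else 0)"
proof -
 have "mn 1 a = (SUM x<n. Polynomial.smult (poly (mn 1 a) (mu x)) (lagr n mu x))" using assms by (intro lagr_expand) (auto simp: degree_monom_eq)
 from arg_cong[OF this, of "%p. coeff p i"] have "(if i = a then 1 else 0) = (SUM x<n. mu x^a * coeff (lagr n mu x) i)" by (auto simp: coeff_sum poly_monom)
 thus ?thesis by (rule sym)
qed

lemma lagr_coeff':
 assumes "inj_on mu {..<n}" "x < n" "y < n"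
 shows "(SUM i<n. coeff (lagr n mu x) i*mu y^i) = (if x = y then 1 else 0)"
proof -
 have "poly (lagr n mu x) (mu y) = (SUM i<=degree (lagr n mu x). coeff (lagr n mu x) i*mu y^i)" by (simp add: poly_altdef)
 also have "... = (SUM i<n. coeff (lagr n mu x) i*mu y^i)" using degree_lagr[OF assms(2), of mu] by (intro sum.mono_neutral_left) (auto simp: coeff_eq_0)
 finally show ?thesis by (simp add: poly_lagr[OF assms])
qed

subsection \<open>Regular separable elements\<close>

text \<open>The minimal polynomial of \<open>u\<close> has the largest possible degree
  \<open>n\<close> and distinct roots \<open>mu\<close>, so the algebra generated by
  \<open>u\<close> is a product of \<open>n\<close> copies of the field.\<close>

locale reg_elt = acs_alg +
 fixes n :: nat and mu :: "nat => 'a" and u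
 assumes nn: "n * n = m" and uA: "u : A" and inj: "inj_on mu {..<n}"
  and ann: "peval e1 (PROD x<n. [:- mu x, 1:]) u = 0"
  and ind: "q ~= 0 ==> degree q < n ==> peval e1 q u ~= 0"
begin

lemma u_corner: "u : corner e1 e1" using uA by (simp add: corner_def)
lemma e1_idem: "e1 .* e1 = e1" by simp

definition ee :: "nat => nat => 'a" where "ee x = peval e1 (lagr n mu x) u"

lemma n_pos: "n > 0"
proof (rule ccontr)
 assume "~n > 0"
 hence "e1 = 0" using nn using e1_supp by (auto simp: spt_def fun_eq_iff fapp)
 with e1_nz show False by simp
qed

text \<open>\<open>f\<close> and its interpolation polynomial agree at all \<open>mu x\<close>, so
  they differ by a multiple of the annihilating polynomial.\<close>

lemma peval_expand: "peval e1 f u = (SUM x<n. poly f (mu x) *c ee x)"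
proof -
 let ?g = "SUM x<n. Polynomial.smult (poly f (mu x)) (lagr n mu x)"
 have "(PROD x<n. [:- mu x, 1:]) dvd f-?g" by (rule prod_linear_dvd[OF inj])
   (auto simp: poly_sum poly_lagr[OF inj] if_distrib sum.delta cong: if_cong)
 then obtain h where "f-?g = (PROD x<n. [:- mu x, 1:]) * h" by (elim dvdE)
 hence "peval e1 (f-?g) u = 0" by (simp add: peval_mult[OF e1_idem u_corner] ann)
 thus ?thesis by (simp add: peval_diff peval_sum peval_smult ee_def)
qed

lemma mpow_expand: "mpow e1 u a = (SUM x<n. mu x^a *c ee x)"
 using peval_expand[of "mn 1 a"] by (simp add: peval_monom poly_monom)

lemma idem_ee: "idem n ee"
 unfolding idem_def
proof (intro conjI allI impI)
 fix x y assume xy: "x < n" "y < n"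
 have "ee x .* ee y = peval e1 (lagr n mu x * lagr n mu y) u" by (simp add: ee_def peval_mult[OF e1_idem u_corner])
 also have "... = (SUM z<n. (if x = z & y = z then 1 else 0) *c ee z)" unfolding peval_expand using xy by (intro sum.cong refl) (auto simp: poly_lagr[OF inj])
 also have "... = (SUM z<n. if x = z then (if y = z then ee z else 0) else 0)" by (intro sum.cong refl) auto
 finally show "ee x .* ee y = (if x = y then ee x else 0)" using xy by auto
next
 fix x assume x: "x < n"
 have "lagr n mu x ~= 0" using poly_lagr[OF inj x x] by auto
 thus "ee x ~= 0" unfolding ee_def by (rule ind) (rule degree_lagr[OF x])
next
 show "(SUM x<n. ee x) = e1" using peval_expand[of 1] by simp
qed

lemmas eeD = idemD[OF idem_ee]
lemmas ee_block = family_block[OF idem_ee nn]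
lemmas ee_scalar = block_scalar[OF idem_ee ee_block]

lemma ee_power: "x < n ==> ee x .* mpow e1 u a = mu x^a *c ee x" "x < n ==> mpow e1 u a .* ee x = mu x^a *c ee x"
 unfolding mpow_expand by (simp_all add: msum_r msum_l eeD if_distrib sum.delta cong: if_cong)

text \<open>The tensor square of \<open>F\<close> acts on block \<open>(x, y)\<close> through
  evaluation at the pair \<open>(mu x, mu y)\<close>. All later computations with blocks rest on
  this.\<close>

lemma block_power:
 assumes "x < n" "y < n"
 shows "ee x .* (mpow e1 u a .* z .* mpow e1 u b) .* ee y = (mu x^a*mu y^b) *c (ee x .* z .* ee y)"
proof -
 have "ee x .* (mpow e1 u a .* z .* mpow e1 u b) .* ee y = (ee x .* mpow e1 u a) .* z .* (mpow e1 u b .* ee y)" by (simp only: massoc)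
 thus ?thesis using assms by (simp add: ee_power mult.commute)
qed

lemma blocks_ext:
 assumes "z : A" "w : A" "!!x y. x < n ==> y < n ==> ee x .* z .* ee y = ee x .* w .* ee y"
 shows "z = w"
 using sum_blocks[OF idem_ee assms(1)] sum_blocks[OF idem_ee assms(2)] assms(3) by simp

text \<open>An element commuting with \<open>u\<close> has no off-diagonal blocks, because the
  eigenvalues on the two sides differ there; its diagonal blocks are scalars, which interpolation
  assembles into a polynomial in \<open>u\<close>.\<close>

lemma centralizer:
 assumes z: "z : A" "u .* z = z .* u"
 shows "EX q. degree q < n & z = peval e1 q u"
proof -
 have off: "ee x .* z .* ee y = 0" if xy: "x < n" "y < n" "x ~= y" for x y
 proof -
  have u1: "mpow e1 u 1 = u" using uA by simp
  have "mu x *c (ee x .* z .* ee y) = (ee x .* u) .* z .* ee y" using ee_power(1)[OF xy(1), of 1] u1 by simp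
  also have "... = ee x .* z .* (u .* ee y)" using z(2) by (metis massoc)
  also have "... = mu y *c (ee x .* z .* ee y)" using ee_power(2)[OF xy(2), of 1] u1 by simp
  finally have "mu x = mu y \<or> ee x .* z .* ee y = 0" by (simp only: fv.scale_cancel_right)
  thus ?thesis using inj xy by (auto simp: inj_on_def)
 qed
 have "EX c. ee x .* z .* ee x = c *c ee x" if "x < n" for x by (rule ee_block[OF that corner_compress[OF eeD(5)[OF that] eeD(5)[OF that]]])
 then obtain c where c: "!!x. x < n ==> ee x .* z .* ee x = c x *c ee x" by metis
 let ?q = "SUM x<n. Polynomial.smult (c x) (lagr n mu x)"
 have "z = (SUM x<n. SUM y<n. ee x .* z .* ee y)" by (rule sum_blocks[OF idem_ee z(1)])
 also have "... = (SUM x<n. SUM y<n. if x = y then c x *c ee x else 0)" by (intro sum.cong refl) (auto simp: off c)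
 also have "... = peval e1 ?q u" by (simp, simp add: peval_sum peval_smult ee_def)
 finally show ?thesis using n_pos by (intro exI[of _ ?q]) (auto intro!: degree_interpolation degree_lagr)
qed

end

subsection \<open>Elements with enough eigenvalues are regular\<close>

context acs_alg begin

lemma peval_eigenvector:
 assumes "w : A" "u .* w = c *c w"
 shows "peval e1 p u .* w = poly p c *c w"
 using assms by (induct p) (simp_all add: mul_add_l massoc fv.scale_left_distrib mult.commute)

text \<open>\<open>n\<close> eigenvectors with distinct eigenvalues form a basis of the left ideal
  \<open>A e 0\<close>, so the product of the linear factors, evaluated at \<open>u\<close>, kills
  this ideal. By primeness only 0 kills a nonzero left ideal.\<close>

lemma reg_eltI_eigen:
 assumes nn: "n * n = m" and u: "u : A" and fam: "idem n e"
  and inj: "inj_on mu {..<n}"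
  and w: "!!x. x < n ==> w x : A" "!!x. x < n ==> w x ~= 0" "!!x. x < n ==> w x .* e 0 = w x"
   "!!x. x < n ==> u .* w x = mu x *c w x"
 shows "reg_elt m s e1 n mu u"
proof
 show "n * n = m" "u : A" "inj_on mu {..<n}" by fact+
 have uc: "u : corner e1 e1" using u by (simp add: corner_def)
 note ev = peval_eigenvector[OF w(1) w(4)]
 have n0: "n > 0" using fam e1_nz by (cases n) (auto simp: idem_def)
 note D = idemD[OF fam]
 show "peval e1 q u ~= 0" if q: "q ~= 0" "degree q < n" for q
 proof
  assume 0: "peval e1 q u = 0"
  have "poly q (mu x) = 0" if "x < n" for x
  proof -
   show ?thesis using ev[OF that that, of q] 0 using w(2)[OF that] by simp
  qed
  with poly_zero_by_roots[OF inj _ q(2)] q(1) show False by blast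
 qed
 let ?P = "PROD x<n. [:- mu x, 1:]"
 have Pw: "peval e1 ?P u .* w x = 0" if "x < n" for x using that ev[OF that that, of ?P] by (simp add: poly_prod) blast
 text \<open>The vectors \<open>w x\<close> span the left ideal generated by \<open>e 0\<close>.\<close>
 have "ALL x. EX a. x < n --> a : corner (e x) (e 0) & a ~= 0" using corner_nonzero[OF fam] n0 by blast
 then obtain a where a: "!!x. x < n ==> a x : corner (e x) (e 0) & a x ~= 0" by metis
 have block: "EX c. z = c *c e x" if "x < n" "z : corner (e x) (e x)" for x z by (rule family_block[OF fam nn that])
 have "ALL z x. EX c. x < n --> e x .* z .* e 0 = c *c a x" using block_scalar(2)[OF fam block _ n0 conjunct1[OF a] conjunct2[OF a] corner_compress[OF D(5) D(5)[OF n0]]] by blast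
 then obtain c where c: "!!z x. x < n ==> e x .* z .* e 0 = c z x *c a x" by metis
 define co where "co z = (%x. if x < n then c z x else 0)" for z
 have expand: "z = (SUM x<n. co z x *c a x)" if "z : A" "z .* e 0 = z" for z
 proof -
  have "z = (SUM x<n. e x) .* z .* e 0" using that by (simp add: D(3))
  also have "... = (SUM x<n. co z x *c a x)" by (simp add: msum_l c co_def)
  finally show ?thesis .
 qed
 have coA: "co z : spt n" for z by (simp add: co_def spt_def)
 have ind: "ALL x:{..<n}. d x = 0" if "(SUM x<n. d x *c co (w x)) = 0" for d
 proof -
  have "(SUM x<n. d x *c w x) = (SUM x<n. SUM y<n. (d x * co (w x) y) *c a y)"
  proof (intro sum.cong refl)
   fix x assume "x : {..<n}"
   hence "d x *c w x = d x *c (SUM y<n. co (w x) y *c a y)" using arg_cong using expand[OF w(1) w(3)] by auto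
   thus "d x *c w x = (SUM y<n. (d x * co (w x) y) *c a y)" by (simp add: fv.scale_sum_right)
  qed
  also have "... = (SUM y<n. (SUM x<n. d x *c co (w x)) y *c a y)" by (subst sum.swap, simp add: fv.scale_sum_left fapp)
  finally have 0: "(SUM x<n. d x *c w x) = 0" unfolding that by (simp add: fapp)
  show ?thesis
  proof
   fix y assume "y : {..<n}"
   hence y: "y < n" by simp
   have "0 = peval e1 (lagr n mu y) u .* (SUM x<n. d x *c w x)" by (simp add: 0)
   also have "... = (SUM x<n. if y = x then d x *c w x else 0)" unfolding msum_r using y by (intro sum.cong refl) (auto simp: ev poly_lagr[OF inj])
   also have "... = d y *c w y" using y by simp
   finally show "d y = 0" using w(2)[OF y] by simp
  qed
 qed
 \<comment> \<open>The coordinates \<open>co\<close> embed the ideal into an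
   \<open>n\<close>-dimensional space, so \<open>n\<close> independent vectors span it.\<close>
 have span: "EX d. co z = (SUM x:{..<n}. d x *c co (w x))" for z by (rule spt_spanning[of _ n]) (use coA ind in auto)
 have "peval e1 ?P u .* z = 0" if "z : A" "z .* e 0 = z" for z
 proof -
  obtain d where d: "co z = (SUM x:{..<n}. d x *c co (w x))" using span by blast
  have "z = (SUM y<n. (SUM x<n. d x *c co (w x)) y *c a y)" using expand[OF that] unfolding d .
  also have "... = (SUM x<n. SUM y<n. (d x * co (w x) y) *c a y)" by (simp add: fv.scale_sum_left fapp, rule sum.swap)
  also have "... = (SUM x<n. d x *c (SUM y<n. co (w x) y *c a y))" by (simp add: fv.scale_sum_right)
  also have "... = (SUM x<n. d x *c w x)" using expand[OF w(1) w(3)] by (intro sum.cong refl) simp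
  finally show ?thesis by (simp add: msum_r Pw)
 qed
 hence *: "peval e1 ?P u .* (x .* e 0) = 0" for x using D(5)[OF n0] by (simp add: massoc)
 show "peval e1 ?P u = 0"
 proof (rule ccontr)
  assume nz: "peval e1 ?P u ~= 0"
  have "peval e1 ?P u : A" using peval_corner(1)[OF _ uc, of ?P] corner_subset by simp
  from prod_nonzero[OF this nz D(4)[OF n0] D(1)[OF n0]] * show False by (auto simp: massoc)
 qed
qed

end

section \<open>Tensor powers as functions on tuples of roots\<close>

lemma set_expos: "set (expos P N) = {al. length al = N & set al <= {..<degree P}}"
 by (auto simp: expos_def set_n_lists)

text \<open>The exponent lists depend on \<open>P\<close> only through its degree; as plain words
  they index tuples of roots as well.\<close>

definition words :: "nat => nat => nat list set" where
 "words n N = {al. length al = N & set al <= {..<n}}"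

lemma finite_words [simp]: "finite (words n N)"
 unfolding words_def using finite_lists_length_eq[of "{..<n}" N] by (simp add: conj_commute)

lemma words_nth: "al : words n N ==> j < N ==> al ! j < n"
 unfolding words_def using nth_mem by blast

lemma words_0: "words n 0 = {[]}"
 by (auto simp: words_def)

lemma sum_words_Suc:
 "(SUM al:words n (Suc N). f al) = (SUM i<n. SUM al:words n N. f (i # al))"
proof -
 have eq: "words n (Suc N) = (%(i, al). i # al) ` ({..<n} \<times> words n N)" by (auto simp: words_def length_Suc_conv image_iff)
 show ?thesis unfolding eq by (subst sum.reindex) (auto simp: inj_on_def sum.cartesian_product split_beta)
qed

lemma sum_words_2: "(SUM al:words n 2. f al) = (SUM i<n. SUM j<n. f [i, j])"
 and sum_words_3: "(SUM al:words n 3. f al) = (SUM i<n. SUM j<n. SUM l<n. f [i, j, l])"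
 by (simp_all add: numeral_2_eq_2 numeral_3_eq_3 sum_words_Suc words_0)

text \<open>The letters are chosen independently, so the sum factors. This reduces identities on
  tensor powers to a single variable.\<close>

lemma sum_words_prod:
 fixes f :: "nat => nat => 'a::comm_semiring_1"
 shows "(SUM al:words n N. PROD j<N. f j (al ! j)) = (PROD j<N. SUM i<n. f j i)"
proof (induct N arbitrary: f)
 case 0
 thus ?case by (simp add: words_0)
next
 case (Suc N)
 have "(SUM al:words n (Suc N). PROD j<Suc N. f j (al ! j)) = (SUM i<n. f 0 i*(SUM al:words n N. PROD j<N. f (Suc j) (al ! j)))" by (simp add: sum_words_Suc prod.lessThan_Suc_shift sum_distrib_left del: prod.lessThan_Suc)
 also have "... = (SUM i<n. f 0 i)*(PROD j<N. SUM i<n. f (Suc j) i)" by (simp add: Suc[of "%j. f (Suc j)"] sum_distrib_right)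
 finally show ?case by (simp add: prod.lessThan_Suc_shift del: prod.lessThan_Suc)
qed

locale split_poly =
 fixes P :: "'a::field poly" and n :: nat and mu :: "nat => 'a"
 assumes P_split: "P = (PROD x<n. [:- mu x, 1:])" and inj: "inj_on mu {..<n}"
begin

lemma degree_P [simp]: "degree P = n"
 unfolding P_split by (rule degree_prod_linear)

lemma P_nz: "P ~= 0"
 unfolding P_split by auto

lemma expos_eq: "set (expos P N) = words n N"
 by (simp add: set_expos words_def)

lemma poly_P: "x < n ==> poly P (mu x) = 0"
 unfolding P_split by (auto simp: poly_prod)

definition D :: "nat => nat => 'a" where "D x i = coeff (lagr n mu x) i"

lemma sum_D: "a < n ==> i < n ==> (SUM x<n. mu x^a * D x i) = (if i = a then 1 else 0)"
 unfolding D_def by (rule lagr_coeff[OF inj])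

lemma sum_D': "x < n ==> y < n ==> (SUM i<n. D x i*mu y^i) = (if x = y then 1 else 0)"
 unfolding D_def by (rule lagr_coeff'[OF inj])

definition red :: "nat => nat => 'a" where "red r l = coeff (mn 1 r mod P) l"

lemma red_eval: assumes "x < n" shows "(SUM l<n. red r l*mu x^l) = mu x^r"
proof -
 let ?q = "mn 1 r mod P"
 have "poly (mn 1 r) (mu x) = poly (mn 1 r div P * P+?q) (mu x)" by (simp only: div_mult_mod_eq)
 hence "mu x^r = poly ?q (mu x)" by (simp only: poly_add poly_mult poly_monom poly_P[OF assms]) simp
 also have "... = (SUM l<=degree ?q. coeff ?q l*mu x^l)" by (simp add: poly_altdef)
 also have "... = (SUM l<n. coeff ?q l*mu x^l)"
 proof (cases "n = 0")
  case False
  hence "degree ?q < n" using degree_mod_less'[of P "mn 1 r"] P_nz by (cases "?q = 0") auto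
  thus ?thesis by (intro sum.mono_neutral_left) (auto simp: coeff_eq_0)
 qed (use assms in simp)
 finally show ?thesis by (simp add: red_def)
qed

text \<open>Inverts the Vandermonde system \<open>red_eval\<close>.\<close>

lemma red_D: assumes "l < n" shows "red r l = (SUM y<n. mu y^r * D y l)"
proof -
 have "(SUM y<n. mu y^r * D y l) = (SUM y<n. (SUM i<n. red r i*mu y^i) * D y l)" by (intro sum.cong refl) (simp add: red_eval)
 also have "... = (SUM y<n. SUM i<n. red r i*(mu y^i * D y l))" by (simp only: sum_distrib_right mult.assoc)
 also have "... = (SUM i<n. SUM y<n. red r i*(mu y^i * D y l))" by (rule sum.swap)
 also have "... = (SUM i<n. red r i*(if l = i then 1 else 0))" using assms by (intro sum.cong refl) (simp only: sum_distrib_left[symmetric] sum_D lessThan_iff)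
 finally show ?thesis using assms by (simp add: if_distrib sum.delta cong: if_cong)
qed

text \<open>As \<open>P\<close> splits into distinct linear factors, the tensor power is the algebra
  of functions on \<open>N\<close>-tuples of roots. \<open>ev\<close> takes the values;
  \<open>interp\<close> is its inverse, built from the inverse Vandermonde matrix \<open>D\<close>
  in each variable.\<close>

definition ev :: "nat => (nat list => 'a) => nat list => 'a" where
 "ev N a xs = (SUM al:words n N. a al*(PROD j<N. mu (xs ! j)^(al ! j)))"

definition interp :: "nat => (nat list => 'a) => nat list => 'a" where
 "interp N F al = (if al : words n N then SUM xs:words n N. F xs*(PROD j<N. D (xs ! j) (al ! j)) else 0)"

lemma prod_delta_words:
 assumes "al : words n N" "be : words n N"
 shows "(PROD j<N. if al ! j = be ! j then 1 else 0) = (if al = be then 1 else (0::'a))"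
using assms by (auto simp: words_def list_eq_iff_nth_eq intro!: prod_zero)

lemma interp_tensors: "interp N F : tensors P N"
 by (simp add: tensors_def interp_def expos_eq)

lemma interp_ev:
 assumes "a : tensors P N"
 shows "interp N (ev N a) = a"
proof
 fix al
 show "interp N (ev N a) al = a al"
 proof (cases "al : words n N")
  case True
  have "interp N (ev N a) al = (SUM xs:words n N. SUM be:words n N. a be*(PROD j<N. mu (xs ! j)^(be ! j) * D (xs ! j) (al ! j)))" using True by (simp add: interp_def ev_def sum_distrib_right prod.distrib mult.assoc)
  also have "... = (SUM be:words n N. a be*(SUM xs:words n N. PROD j<N. mu (xs ! j)^(be ! j) * D (xs ! j) (al ! j)))" by (subst sum.swap) (simp add: sum_distrib_left)
  also have "... = (SUM be:words n N. a be*(if al = be then 1 else 0))"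
  proof (intro sum.cong refl arg_cong2[where f = "(*)"])
   fix be assume b: "be : words n N"
   have "(SUM xs:words n N. PROD j<N. mu (xs ! j)^(be ! j) * D (xs ! j) (al ! j))
     = (PROD j<N. SUM x<n. mu x^(be ! j) * D x (al ! j))"
    by (rule sum_words_prod[of "%j x. mu x^(be ! j) * D x (al ! j)"])
   also have "... = (PROD j<N. if al ! j = be ! j then 1 else 0)" using words_nth[OF True] words_nth[OF b] by (intro prod.cong refl) (simp add: sum_D)
   finally show "(SUM xs:words n N. PROD j<N. mu (xs ! j)^(be ! j) * D (xs ! j) (al ! j)) = (if al = be then 1 else 0)" using prod_delta_words[OF True b] by simp
  qed
  finally show ?thesis using True by (simp add: if_distrib sum.delta cong: if_cong)
 next
  case False
  thus ?thesis using assms by (auto simp: interp_def tensors_def expos_eq)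
 qed
qed

lemma ev_interp:
 assumes xs: "xs : words n N"
 shows "ev N (interp N F) xs = F xs"
proof -
 have "ev N (interp N F) xs = (SUM al:words n N. SUM ys:words n N. F ys*(PROD j<N. D (ys ! j) (al ! j)*mu (xs ! j)^(al ! j)))" by (simp add: interp_def ev_def sum_distrib_right prod.distrib mult.assoc)
 also have "... = (SUM ys:words n N. F ys*(SUM al:words n N. PROD j<N. D (ys ! j) (al ! j)*mu (xs ! j)^(al ! j)))" by (subst sum.swap) (simp add: sum_distrib_left)
 also have "... = (SUM ys:words n N. F ys*(if xs = ys then 1 else 0))"
 proof (intro sum.cong refl arg_cong2[where f = "(*)"])
  fix ys assume b: "ys : words n N"
  have "(SUM al:words n N. PROD j<N. D (ys ! j) (al ! j)*mu (xs ! j)^(al ! j))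
    = (PROD j<N. SUM i<n. D (ys ! j) i*mu (xs ! j)^i)"
   by (rule sum_words_prod[of "%j i. D (ys ! j) i*mu (xs ! j)^i"])
  also have "... = (PROD j<N. if xs ! j = ys ! j then 1 else 0)" using words_nth[OF xs] words_nth[OF b] by (intro prod.cong refl) (auto simp: sum_D')
  finally show "(SUM al:words n N. PROD j<N. D (ys ! j) (al ! j)*mu (xs ! j)^(al ! j)) = (if xs = ys then 1 else 0)" using prod_delta_words[OF xs b] by simp
 qed
 finally show ?thesis using xs by (simp add: if_distrib sum.delta cong: if_cong)
qed

lemma ev_inject:
 assumes "a : tensors P N" "b : tensors P N" "!!xs. xs : words n N ==> ev N a xs = ev N b xs"
 shows "a = b"
proof -
 have "interp N (ev N a) = interp N (ev N b)" using assms(3) by (auto simp: interp_def fun_eq_iff intro!: sum.cong)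
 thus ?thesis using assms by (simp add: interp_ev)
qed

lemma tmult_tensors: "tensor_mult P N a b : tensors P N"
 by (simp add: tensor_mult_def tensors_def)

text \<open>Reducing modulo \<open>P\<close> in a variable does not change the values at roots, so
  multiplication becomes pointwise. The ring laws of the tensor power are drawn from this.\<close>

lemma ev_mult:
 assumes xs: "xs : words n N"
 shows "ev N (tensor_mult P N a b) xs = ev N a xs * ev N b xs"
proof -
 have red: "(SUM ga:words n N. (PROD j<N. red (al ! j+be ! j) (ga ! j))*(PROD j<N. mu (xs ! j)^(ga ! j)))
   = (PROD j<N. mu (xs ! j)^(al ! j))*(PROD j<N. mu (xs ! j)^(be ! j))" for al be
 proof -
  have "(SUM ga:words n N. (PROD j<N. red (al ! j+be ! j) (ga ! j))*(PROD j<N. mu (xs ! j)^(ga ! j)))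
    = (SUM ga:words n N. (PROD j<N. red (al ! j+be ! j) (ga ! j)*mu (xs ! j)^(ga ! j)))"
   by (simp add: prod.distrib)
  also have "... = (PROD j<N. SUM l<n. red (al ! j+be ! j) l*mu (xs ! j)^l)" by (rule sum_words_prod[of "%j l. red (al ! j+be ! j) l*mu (xs ! j)^l"])
  also have "... = (PROD j<N. mu (xs ! j)^(al ! j)*mu (xs ! j)^(be ! j))" using words_nth[OF xs] by (intro prod.cong refl) (simp add: red_eval power_add)
  finally show ?thesis by (simp add: prod.distrib)
 qed
 have "ev N (tensor_mult P N a b) xs = (SUM ga:words n N. SUM al:words n N. SUM be:words n N. a al * b be *
   ((PROD j<N. red (al ! j+be ! j) (ga ! j))*(PROD j<N. mu (xs ! j)^(ga ! j))))"
  by (simp add: ev_def tensor_mult_def expos_eq red_def sum_distrib_right sum_distrib_left mult_ac)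
 also have "... = (SUM al:words n N. SUM ga:words n N. SUM be:words n N. a al * b be *
   ((PROD j<N. red (al ! j+be ! j) (ga ! j))*(PROD j<N. mu (xs ! j)^(ga ! j))))" by (rule sum.swap)
 also have "... = (SUM al:words n N. SUM be:words n N. SUM ga:words n N. a al * b be *
   ((PROD j<N. red (al ! j+be ! j) (ga ! j))*(PROD j<N. mu (xs ! j)^(ga ! j))))"
  by (rule sum.cong[OF refl], rule sum.swap)
 also have "... = ev N a xs * ev N b xs" by (simp add: sum_distrib_left[symmetric] red) (simp add: ev_def sum_product mult_ac)
 finally show ?thesis .
qed

lemma ev_one:
 assumes "n > 0 \<or> N = 0"
 shows "ev N (%al. if al = replicate N 0 then 1 else 0) xs = 1"
proof -
 have "replicate N 0 : words n N" using assms by (auto simp: words_def)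
 hence "ev N (%al. if al = replicate N 0 then 1 else 0) xs = (PROD j<N. mu (xs ! j)^(replicate N 0 ! j))" by (simp add: ev_def if_distrib[of "%x. x * _"] sum.delta cong: if_cong)
 thus ?thesis by simp
qed

lemma ev_3: "ev 3 a [x, y, z] = (SUM i<n. SUM j<n. SUM l<n. a [i, j, l]*(mu x^i*mu y^j*mu z^l))"
 unfolding ev_def sum_words_3 by (simp add: numeral_3_eq_3 mult_ac)

lemma ev_2: "ev 2 a [x, y] = (SUM i<n. SUM j<n. a [i, j]*(mu x^i*mu y^j))"
 unfolding ev_def sum_words_2 by (simp add: numeral_2_eq_2 mult_ac)

lemma face_tensors:
 assumes "a : tensors P N" "i <= N" "n > 0"
 shows "face i a : tensors P (Suc N)"
 unfolding tensors_def
proof (safe)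
 fix ga assume g: "ga ~: set (expos P (Suc N))"
 show "face i a ga = 0"
 proof (rule ccontr)
  assume "face i a ga ~= 0"
  hence *: "i < length ga" "ga ! i = 0" "a (take i ga @ drop (Suc i) ga) ~= 0" by (auto simp: face_def split: if_splits)
  hence "take i ga @ drop (Suc i) ga : words n N" using assms(1) by (auto simp: tensors_def expos_eq)
  moreover have "set ga = set (take i ga @ drop (Suc i) ga) \<union> {ga ! i}" using id_take_nth_drop[OF *(1)] by (metis Un_insert_right insert_is_Un list.set(2) set_append sup_bot_right sup_commute)
  ultimately have "ga : words n (Suc N)" using * assms by (auto simp: words_def)
  with g show False by (simp add: expos_eq)
 qed
qed

text \<open>On functions a face map is pullback along the map that drops entry \<open>i\<close> of a
  tuple. Only words with a zero at position \<open>i\<close> contribute, and they arise by inserting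
  that zero into a word of length \<open>N\<close>.\<close>

lemma ev_face:
 assumes i: "i <= N" and n: "n > 0" and xs: "length xs = Suc N"
 shows "ev (Suc N) (face i a) xs = ev N a (take i xs @ drop (Suc i) xs)"
proof -
 let ?ins = "%al. take i al @ 0 # drop i al"
 let ?del = "%ga. take i ga @ drop (Suc i) ga"
 have ins: "?ins al : words n (Suc N)" "face i a (?ins al) = a al" if "al : words n N" for al using that i n by (auto simp: words_def face_def nth_append dest: in_set_takeD in_set_dropD)
 have "ev (Suc N) (face i a) xs = (SUM ga:?ins ` words n N. face i a ga*(PROD j<Suc N. mu (xs ! j)^(ga ! j)))" unfolding ev_def
 proof (rule sum.mono_neutral_right)
  show "ALL ga:words n (Suc N)-?ins ` words n N. face i a ga*(PROD j<Suc N. mu (xs ! j)^(ga ! j)) = 0"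
  proof
   fix ga assume g: "ga : words n (Suc N)-?ins ` words n N"
   have "~(i < length ga & ga ! i = 0)"
   proof
    assume *: "i < length ga & ga ! i = 0"
    hence "ga = ?ins (?del ga)" using id_take_nth_drop[of i ga] by simp
    moreover have "?del ga : words n N" using g * by (auto simp: words_def dest: in_set_takeD in_set_dropD)
    ultimately show False using g by blast
   qed
   thus "face i a ga*(PROD j<Suc N. mu (xs ! j)^(ga ! j)) = 0" by (auto simp: face_def)
  qed
 qed (use ins in auto)
 also have "... = (SUM al:words n N. face i a (?ins al)*(PROD j<Suc N. mu (xs ! j)^(?ins al ! j)))"
 proof (rule sum.reindex[unfolded o_def])
  show "inj_on ?ins (words n N)"
  proof (rule inj_onI)
   fix al be assume ab: "al : words n N" "be : words n N" "?ins al = ?ins be"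
   hence "take i al = take i be & drop i al = drop i be" using i by (auto simp: words_def)
   thus "al = be" by (metis append_take_drop_id)
  qed
 qed
 also have "... = (SUM al:words n N. a al*(PROD j<N. mu (?del xs ! j)^(al ! j)))"
 proof (intro sum.cong refl)
  fix al assume a: "al : words n N"
  have "(PROD j<Suc N. mu (xs ! j)^(?ins al ! j)) = (PROD j:{..<i} \<union> {i} \<union> {Suc i..<Suc N}. mu (xs ! j)^(?ins al ! j))" using i by (intro prod.cong) auto
  also have "... = (PROD j<i. mu (xs ! j)^(?ins al ! j))*(PROD j:{Suc i..<Suc N}. mu (xs ! j)^(?ins al ! j))" using a i by (subst prod.union_disjoint) (auto simp: words_def nth_append)
  also have "(PROD j:{Suc i..<Suc N}. mu (xs ! j)^(?ins al ! j)) = (PROD j:{i..<N}. mu (xs ! Suc j)^(?ins al ! Suc j))" by (rule prod.shift_bounds_Suc_ivl)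
  also have "(PROD j<i. mu (xs ! j)^(?ins al ! j)) = (PROD j<i. mu (?del xs ! j)^(al ! j))" using a i xs by (intro prod.cong refl) (auto simp: words_def nth_append)
  also have "(PROD j:{i..<N}. mu (xs ! Suc j)^(?ins al ! Suc j)) = (PROD j:{i..<N}. mu (?del xs ! j)^(al ! j))" using a i xs by (intro prod.cong refl) (auto simp: words_def nth_append Suc_diff_le)
  also have "(PROD j<i. mu (?del xs ! j)^(al ! j))*(PROD j:{i..<N}. mu (?del xs ! j)^(al ! j)) = (PROD j<N. mu (?del xs ! j)^(al ! j))" using i by (simp add: lessThan_atLeast0 prod.atLeastLessThan_concat)
  finally show "face i a (?ins al)*(PROD j<Suc N. mu (xs ! j)^(?ins al ! j)) = a al*(PROD j<N. mu (?del xs ! j)^(al ! j))" using ins(2)[OF a] by simp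
 qed
 finally show ?thesis by (simp add: ev_def)
qed

text \<open>Multiplication by \<open>X\<close> is diagonal in the basis of Lagrange polynomials,
  with the roots on the diagonal.\<close>

lemma trace_field_power: assumes "n > 0" shows "trace_field P (mn 1 j) = (SUM y<n. mu y^j)"
proof -
 have "trace_field P (mn 1 j) = (SUM l<n. red (j+l) l)" by (simp add: trace_field_def mult_monom red_def)
 also have "... = (SUM l<n. SUM y<n. mu y^j*(D y l*mu y^l))" by (intro sum.cong refl) (simp add: red_D power_add mult_ac)
 also have "... = (SUM y<n. mu y^j*(SUM l<n. D y l*mu y^l))" by (subst sum.swap) (simp add: sum_distrib_left)
 finally show ?thesis by (simp add: sum_D')
qed

text \<open>The trace of the middle factor becomes summation over the middle point.\<close>

lemma ev_trace:
 assumes n: "n > 0"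
 shows "ev 2 (trace_3_2 P b) [x, z] = (SUM y<n. ev 3 b [x, y, z])"
proof -
 have "trace_3_2 P b [i, l] = (SUM j<n. SUM y<n. mu y^j * b [i, j, l])" if "i < n" "l < n" for i l using that by (simp add: trace_3_2_def expos_eq words_def trace_field_power[OF n] sum_distrib_right)
 hence "ev 2 (trace_3_2 P b) [x, z] = (SUM i<n. SUM l<n. SUM j<n. SUM y<n. b [i, j, l]*(mu x^i*mu y^j*mu z^l))" by (simp add: ev_2 sum_distrib_right sum_distrib_left mult_ac)
 also have "... = (SUM i<n. SUM l<n. SUM y<n. SUM j<n. b [i, j, l]*(mu x^i*mu y^j*mu z^l))" by (rule sum.cong[OF refl], rule sum.cong[OF refl], rule sum.swap)
 also have "... = (SUM i<n. SUM y<n. SUM l<n. SUM j<n. b [i, j, l]*(mu x^i*mu y^j*mu z^l))" by (rule sum.cong[OF refl], rule sum.swap)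
 also have "... = (SUM y<n. SUM i<n. SUM l<n. SUM j<n. b [i, j, l]*(mu x^i*mu y^j*mu z^l))" by (rule sum.swap)
 also have "... = (SUM y<n. SUM i<n. SUM j<n. SUM l<n. b [i, j, l]*(mu x^i*mu y^j*mu z^l))" by (rule sum.cong[OF refl], rule sum.cong[OF refl], rule sum.swap)
 finally show ?thesis by (simp add: ev_3)
qed

end

subsection \<open>Density\<close>

lemma div_mod_encode:
 fixes h r m :: nat
 assumes "r < m"
 shows "(h * m + r) div m = h" "(h * m + r) mod m = r" "h < k ==> h * m + r < k * m"
proof -
 show "(h * m + r) div m = h" "(h * m + r) mod m = r" using assms by auto
 assume "h < k"
 hence "h * m + r < Suc h * m" using assms by simp
 also have "... <= k * m" using `h < k` by (intro mult_le_mono1) simp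
 finally show "h * m + r < k * m" .
qed

context fd_alg begin

text \<open>The shortest-relation argument behind the density theorem. Among relations supported
  where \<open>a\<close> is, the entries at \<open>k\<close> form a two-sided ideal, so one relation
  has entry \<open>e1\<close> there. Its commutators with any \<open>y\<close> are shorter and
  vanish by induction, so its entries are scalars, and \<open>x = e1\<close> yields a relation among
  basis vectors.\<close>

lemma bimodule_relation_zero:
 assumes e1_nz: "e1 ~= 0"
  and idl: "!!J. J <= A ==> 0 : J ==> (!!x y. x : J ==> y : J ==> x+y : J) ==>
   (!!x y. x : J ==> y : A ==> x .* y : J & y .* x : J) ==> J = {0} \<or> J = A"
  and cen: "!!z. z : A ==> (!!x. x : A ==> z .* x = x .* z) ==> EX c. z = c *c e1"
  and "!!i. i < m ==> a i : A" "!!x. x : A ==> (SUM i<m. bv i .* x .* a i) = 0"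
 shows "ALL i<m. a i = 0"
 using assms(4-)
proof (induct "card {i. i < m & a i ~= 0}" arbitrary: a rule: less_induct)
 case less
 show ?case
 proof (rule ccontr)
  assume "~(ALL i<m. a i = 0)"
  then obtain k where k: "k < m" "a k ~= 0" by blast
  define rel where "rel b \<longleftrightarrow> (ALL i<m. b i : A) & (ALL x:A. (SUM i<m. bv i .* x .* b i) = 0) &
   (ALL i<m. a i = 0 --> b i = 0)" for b
  let ?J = "{b k | b. rel b}"
  have "?J = {0} \<or> ?J = A"
  proof (rule idl)
   show "?J <= A" using k by (auto simp: rel_def)
   show "0 : ?J" by (auto simp: rel_def)
   fix x y assume "x : ?J"
   then obtain b where b: "rel b" "x = b k" by blast
   { assume "y : ?J"
    then obtain c where c: "rel c" "y = c k" by blast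
    have "rel (%i. b i + c i)" using b(1) c(1) unfolding rel_def by (simp add: mul_add_r sum.distrib)
    thus "x+y : ?J" unfolding b(2) c(2) by (intro CollectI exI[of _ "%i. b i + c i"]) simp }
   { assume y: "y : A"
    have "(SUM i<m. bv i .* z .* (b i .* y)) = (SUM i<m. bv i .* z .* b i) .* y" for z by (simp add: msum_l massoc)
    hence "rel (%i. b i .* y)" using b(1) by (simp add: rel_def)
    hence "x .* y : ?J" unfolding b(2) by (intro CollectI exI[of _ "%i. b i .* y"]) simp
    moreover have "(SUM i<m. bv i .* z .* (y .* b i)) = (SUM i<m. bv i .* (z .* y) .* b i)" for z by (simp add: massoc)
    hence "rel (%i. y .* b i)" using b(1) y by (simp add: rel_def)
    hence "y .* x : ?J" unfolding b(2) by (intro CollectI exI[of _ "%i. y .* b i"]) simp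
    ultimately show "x .* y : ?J & y .* x : ?J" by blast }
  qed
  moreover have "a k : ?J" using less(2,3) by (auto simp: rel_def)
  ultimately have "e1 : ?J" using k(2) by auto
  then obtain b where b: "rel b" "b k = e1" by auto
  have comm: "y .* b i-b i .* y = 0" if y: "y : A" and i: "i < m" for y i
  proof -
   let ?c = "%i. y .* b i-b i .* y"
   have "ALL i<m. ?c i = 0"
   proof (rule less(1))
    have "?c k = 0" using y by (simp add: b(2))
    \<comment> \<open>The commutator vanishes at \<open>k\<close>, where the entry is
      \<open>e1\<close>, so the support really shrinks.\<close>
    hence "{i. i < m & ?c i ~= 0} <= {i. i < m & a i ~= 0} - {k}" using b(1) by (auto simp: rel_def)
    thus "card {i. i < m & ?c i ~= 0} < card {i. i < m & a i ~= 0}" using k by (intro psubset_card_mono) auto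
    show "?c i : A" for i by simp
    fix x assume x: "x : A"
    have "(SUM i<m. bv i .* x .* ?c i) = (SUM i<m. bv i .* (x .* y) .* b i)-(SUM i<m. bv i .* x .* b i) .* y" by (simp add: mul_diff_r sum_subtractf msum_l massoc)
    also have "... = 0" using b(1) x by (simp add: rel_def)
    finally show "(SUM i<m. bv i .* x .* ?c i) = 0" .
   qed
   thus ?thesis using i by blast
  qed
  have "EX c. b i = c *c e1" if "i < m" for i using b(1) that comm by (intro cen) (auto simp: rel_def)
  then obtain c where c: "!!i. i < m ==> b i = c i *c e1" by metis
  have "(SUM i<m. bv i .* e1 .* b i) = 0" using b(1) e1_in_A unfolding rel_def by blast
  moreover have "(SUM i<m. bv i .* e1 .* b i) = (SUM i<m. c i *c bv i)" by (intro sum.cong refl) (simp add: c)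
  ultimately have "(SUM i<m. c i *c bv i) k = 0" by (simp add: fapp)
  hence "c k = 0" using k(1) by (simp add: fapp bv_apply if_distrib sum.delta cong: if_cong)
  thus False using c[OF k(1)] b(2) e1_nz by (simp add: fun_eq_iff fapp)
 qed
qed

text \<open>The \<open>m * m\<close> maps from \<open>x\<close> to \<open>bv i * x * bv j\<close>
  are independent by the preceding lemma, and the endomorphisms of \<open>A\<close> have dimension
  \<open>m * m\<close>; so these maps span and reach every matrix unit.\<close>

lemma cs_algI:
 assumes e1_nz: "e1 ~= 0"
  and idl: "!!J. J <= A ==> 0 : J ==> (!!x y. x : J ==> y : J ==> x+y : J) ==>
   (!!x y. x : J ==> y : A ==> x .* y : J & y .* x : J) ==> J = {0} \<or> J = A"
  and cen: "!!z. z : A ==> (!!x. x : A ==> z .* x = x .* z) ==> EX c. z = c *c e1"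
 shows "cs_alg m s e1"
proof
 fix l t assume lt: "l < m" "t < m"
 let ?J = "{..<m} \<times> {..<m}"
 \<comment> \<open>The matrix of such a map, flattened: position \<open>h * m + r\<close> holds
   coordinate \<open>r\<close> of the image of \<open>bv h\<close>.\<close>
 define f where "f = (%(i, j) q. if q < m * m then (bv i .* bv (q div m) .* bv j) (q mod m) else 0)"
 have fq: "f (i, j) (h * m + r) = (bv i .* bv h .* bv j) r" if "h < m" "r < m" for i j h r using div_mod_encode[OF that(2), of h] div_mod_encode(3)[OF that(2) that(1)] by (simp add: f_def)
 have sJ: "(SUM j:?J. c j *c f j) q = (SUM i<m. SUM j<m. c (i, j) * f (i, j) q)" for c q by (simp add: fapp sum.cartesian_product split_beta)
 have ind: "ALL j:?J. c j = 0" if c: "(SUM j:?J. c j *c f j) = 0" for c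
 proof -
  define a where "a i = (SUM j<m. c (i, j) *c bv j)" for i
  have aA: "a i : A" for i unfolding a_def by (intro spt_sum) simp
  have bvh: "(SUM i<m. bv i .* bv h .* a i) = 0" if h: "h < m" for h
  proof
   fix r
   show "(SUM i<m. bv i .* bv h .* a i) r = 0 r"
   proof (cases "r < m")
    case True
    have "(SUM i<m. bv i .* bv h .* a i) r = (SUM j:?J. c j *c f j) (h * m + r)" unfolding sJ using h True by (simp add: a_def msum_r fapp, simp add: fq)
    thus ?thesis by (simp add: c fapp)
   next
    case False
    thus ?thesis by (simp add: fapp mul_def)
   qed
  qed
  have "(SUM i<m. bv i .* x .* a i) = 0" if x: "x : A" for x
  proof -
   obtain x' where x': "x = (SUM h<m. x' h *c bv h)" using expand_bv[OF x] by (rule that)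
   have "(SUM i<m. bv i .* x .* a i) = (SUM h<m. SUM i<m. x' h *c (bv i .* bv h .* a i))" unfolding x' by (simp add: msum_l msum_r, rule sum.swap)
   also have "... = (SUM h<m. x' h *c (SUM i<m. bv i .* bv h .* a i))" by (simp add: fv.scale_sum_right)
   finally show ?thesis by (simp add: bvh)
  qed
  from bimodule_relation_zero[OF e1_nz idl cen aA this] have a0: "ALL i<m. a i = 0" by blast
  show ?thesis
  proof
   fix p assume "p : ?J"
   then obtain i j where p: "p = (i, j)" and ij: "i < m" "j < m" by auto
   have "a i j = 0" using a0 ij by (simp add: fapp)
   thus "c p = 0" unfolding p using ij by (simp add: a_def fapp bv_apply if_distrib sum.delta cong: if_cong)
  qed
 qed
 have "EX c. (%q. if q = l * m+t then 1 else 0) = (SUM j:?J. c j *c f j)"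
 proof (rule spt_spanning[where m = "m * m"])
  show "(%q. if q = l * m+t then 1 else 0) : spt (m * m)" using div_mod_encode(3)[OF lt(2) lt(1)] by (auto simp: spt_def)
  show "f j : spt (m * m)" for j by (cases j) (auto simp: f_def spt_def)
 qed (use ind in auto)
 then obtain c where c: "(%q. if q = l * m+t then 1 else 0) = (SUM j:?J. c j *c f j)" by blast
 show "EX c. ALL h<m. ALL r<m. (SUM i<m. SUM j<m. c i j*(SUM p<m. s i h p * s p j r)) = (if h = l & r = t then 1 else 0)"
 proof (intro exI[of _ "%i j. c (i, j)"] allI impI)
  fix h r assume hr: "h < m" "r < m"
  have b3: "(bv i .* bv h .* bv j) r = (SUM p<m. s i h p * s p j r)" if "i < m" "j < m" for i j using that hr by (subst mul_def[of "bv i .* bv h"])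
    (simp add: mul_bv bv_apply if_distrib[of "%x. _ * x"] if_distrib[of "%x. x * _"] sum.delta cong: if_cong)
  have "(SUM i<m. SUM j<m. c (i, j)*(SUM p<m. s i h p * s p j r)) = (SUM j:?J. c j *c f j) (h * m + r)" using hr by (simp add: fq b3 sJ)
  also have "... = (if h * m + r = l * m+t then 1 else 0)" by (simp add: c[symmetric])
  also have "(h * m + r = l * m+t) = (h = l & r = t)" using div_mod_encode[OF hr(2), of h] div_mod_encode[OF lt(2), of l] by metis
  finally show "(SUM i<m. SUM j<m. c (i, j)*(SUM p<m. s i h p * s p j r)) = (if h = l & r = t then 1 else 0)" .
 qed
qed (fact e1_nz)

end

subsection \<open>Descent from the algebraic closure\<close>

interpretation ac: field_hom "to_ac :: 'k::field => 'k alg_closure"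
 by standard auto

interpretation acs: vector_space "%c x. to_ac (c :: 'k::field) * x"
 by standard (auto simp: algebra_simps)

text \<open>The identity on the line spanned by 1 extends to a \<open>k\<close>-linear map on the
  closure. Applied coordinatewise, such a map sends solutions over the closure of a linear system
  over \<open>k\<close> to solutions over \<open>k\<close>.\<close>

lemma exists_ac_proj:
 "EX \<pi> :: 'k::field alg_closure => 'k. \<pi> 1 = 1 & (ALL x y. \<pi> (x+y) = \<pi> x+\<pi> y) & (ALL c x. \<pi> (to_ac c * x) = c*\<pi> x)"
proof -
 interpret vector_space_pair "%c x. to_ac (c :: 'k) * x" "(*) :: 'k => 'k => 'k"
  by (intro vector_space_pair.intro acs.vector_space_axioms) (standard, auto simp: algebra_simps)
 have "acs.independent {1}" by (rule acs.independent_insertI) (simp_all add: acs.independent_empty)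
 from linear_independent_extend[OF this, of "%_. 1"] obtain \<pi> where
  \<pi>: "Vector_Spaces.linear (%c x. to_ac (c :: 'k) * x) (*) \<pi>" "\<pi> 1 = 1" by auto
 show ?thesis using \<pi> linear_add[OF \<pi>(1)] linear_scale[OF \<pi>(1)] by (intro exI[of _ \<pi>]) auto
qed

definition acp :: "'k::field alg_closure => 'k" where
 "acp = (SOME \<pi>. \<pi> 1 = 1 & (ALL x y. \<pi> (x+y) = \<pi> x+\<pi> y) & (ALL c x. \<pi> (to_ac c * x) = c*\<pi> x))"

lemma acp: "acp 1 = 1" "acp (x+y) = acp x+acp y" "acp (to_ac c * x) = c * acp x"
 using someI_ex[OF exists_ac_proj] unfolding acp_def by blast+

lemma acp_more: "acp (to_ac c) = c" "acp 0 = 0" "acp (x * to_ac c) = acp x * c"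
 using acp(3)[of c 1] acp(3)[of 0 0] acp(3)[of c x] by (simp_all add: acp(1) mult.commute)

lemma acp_sum: "acp (SUM i:I. f i) = (SUM i:I. acp (f i))"
 by (induct I rule: ifi) (simp_all add: acp(2) acp_more)

definition acv :: "('i => 'k::field) => 'i => 'k alg_closure" where "acv x = (%i. to_ac (x i))"

lemma acv_apply: "acv x i = to_ac (x i)" by (simp add: acv_def)

lemma acv_simps: "acv 0 = 0" "acv (x+y) = acv x+acv y" "acv (x-y) = acv x-acv y" "acv (c *c x) = to_ac c *c acv x"
 "acv (bv i) = bv i"
 by (auto simp: acv_def fun_eq_iff fapp bv_apply)

lemma acv_sum: "acv (SUM i:I. f i) = (SUM i:I. acv (f i))"
 by (induct I rule: ifi) (simp_all add: acv_simps)

lemma acv_inject: "acv x = acv y \<longleftrightarrow> x = y"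
 by (auto simp: acv_def fun_eq_iff)

lemma acv_supp: "x : spt m ==> acv x : spt m"
 by (auto simp: spt_def acv_def)

lemma (in fd_alg) fd_alg_base_change: "fd_alg m (base_change_sc s) (acv e1)"
proof
 show "acv e1 : spt m" by (rule acv_supp) simp
 show "(SUM p<m. base_change_sc s i j p * base_change_sc s p h l) = (SUM p<m. base_change_sc s j h p * base_change_sc s i p l)"
  if "i < m" "j < m" "h < m" "l < m" for i j h l
  using arg_cong[OF sc_assoc[OF that], of to_ac] by (simp add: base_change_sc_def to_ac_sum)
 show "(SUM i<m. acv e1 i * base_change_sc s i j l) = (if j = l then 1 else 0)" if "j < m" "l < m" for j l using arg_cong[OF sc_unit_l[OF that], of to_ac] by (simp add: base_change_sc_def to_ac_sum acv_apply)
 show "(SUM i<m. acv e1 i * base_change_sc s j i l) = (if j = l then 1 else 0)" if "j < m" "l < m" for j l using arg_cong[OF sc_unit_r[OF that], of to_ac] by (simp add: base_change_sc_def to_ac_sum acv_apply)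
qed

text \<open>The coefficients that witness the matrix units over \<open>k\<close> serve over the
  closure too.\<close>

lemma (in cs_alg) acs_alg_base_change: "acs_alg m (base_change_sc s) (acv e1)"
proof -
 interpret K: fd_alg m "base_change_sc s" "acv e1" by (rule fd_alg_base_change)
 show ?thesis
 proof
  show "acv e1 ~= 0" using e1_nz acv_inject[of e1 0] by (simp add: acv_simps)
  fix l t assume "l < m" "t < m"
  from sc_simple[OF this] obtain c where c0: "ALL h<m. ALL r<m.
    (SUM i<m. SUM j<m. c i j*(SUM p<m. s i h p * s p j r)) = (if h = l & r = t then 1 else 0)" by (rule exE)
  note c = c0[rule_format]
  show "EX c. ALL h<m. ALL r<m. (SUM i<m. SUM j<m. c i j*(SUM p<m. base_change_sc s i h p * base_change_sc s p j r)) =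
    (if h = l & r = t then 1 else 0)"
  proof (intro exI[of _ "%i j. to_ac (c i j)"] allI impI)
   fix h r assume "h < m" "r < m"
   have "(SUM i<m. SUM j<m. to_ac (c i j)*(SUM p<m. base_change_sc s i h p * base_change_sc s p j r))
     = to_ac (SUM i<m. SUM j<m. c i j*(SUM p<m. s i h p * s p j r))"
    by (simp only: base_change_sc_def to_ac_sum to_ac_mult)
   also have "... = to_ac (if h = l & r = t then 1 else 0)" by (rule arg_cong[OF c[OF `h < m` `r < m`]])
   finally show "(SUM i<m. SUM j<m. to_ac (c i j)*(SUM p<m. base_change_sc s i h p * base_change_sc s p j r)) =
     (if h = l & r = t then 1 else 0)" by (cases "h = l & r = t") auto
  qed
 qed
qed

subsection \<open>Coordinate vectors as functions\<close>

definition fvec :: "nat => 'a::zero vec => nat => 'a" where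
 "fvec m v = (%i. if i < m then v $ i else 0)"

lemma fvec_supp [simp]: "fvec m v : spt m"
 by (simp add: fvec_def spt_def)

lemma fvec_vec: "x : spt m ==> fvec m (vec m x) = x"
 by (auto simp: fvec_def spt_def)

lemma vec_fvec: "v : carrier_vec m ==> vec m (fvec m v) = v"
 by (auto simp: fvec_def)

lemma fvec_inject: "v : carrier_vec m ==> w : carrier_vec m ==> fvec m v = fvec m w \<longleftrightarrow> v = w"
 by (metis vec_fvec)

lemma fvec_add: "v : carrier_vec m ==> w : carrier_vec m ==> fvec m (v+w) = fvec m v+fvec m w"
 and fvec_smult: "v : carrier_vec m ==> fvec m (c \<cdot>\<^sub>v v) = c *c fvec m v"
 and fvec_0: "fvec m (0\<^sub>v m) = 0"
 for v w :: "'a::field vec"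
 by (auto simp: fvec_def fun_eq_iff fapp)

lemma vec_add: "vec m (x+y) = vec m x+vec m y"
 and vec_scale: "vec m (c *c x) = c \<cdot>\<^sub>v vec m x"
 for x y :: "nat => 'a::field"
 by (auto simp: fapp)

lemma sc_alg_simps [simp]:
 "carrier (sc_alg m s) = carrier_vec m" "add (sc_alg m s) = (+)" "zero (sc_alg m s) = 0\<^sub>v m"
 by (simp_all add: sc_alg_def Let_def)

definition sc_mul :: "nat => 'k::field sconsts => 'k vec => 'k vec => 'k vec" where
 "sc_mul m s x y = vec m (%l. SUM i<m. SUM j<m. x $ i * y $ j * s i j l)"

lemma sc_alg_mult: "monoid.mult (sc_alg m s) = sc_mul m s"
 and sc_alg_one: "one (sc_alg m s) = unit_elt (carrier_vec m) (sc_mul m s)"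
proof -
 have "sc_mul m s = (%x y. vec m (%l. SUM i<m. SUM j<m. x $ i * y $ j * s i j l))" by (auto simp: sc_mul_def fun_eq_iff)
 thus "monoid.mult (sc_alg m s) = sc_mul m s" "one (sc_alg m s) = unit_elt (carrier_vec m) (sc_mul m s)" by (simp_all add: sc_alg_def Let_def)
qed

lemma sum_if_const: "(SUM j:J. if b then f j else 0) = (if b then SUM j:J. f j else 0)"
 by simp

lemma unit_eltI:
 assumes "e : C" "!!x. x : C ==> f e x = x & f x e = x"
 shows "unit_elt C f = e"
 unfolding unit_elt_def
using assms by force

context fd_alg begin

lemma sc_mul_vec: "sc_mul m s (vec m x) (vec m y) = vec m (x .* y)"
 by (auto simp: sc_mul_def mul_def intro!: eq_vecI sum.cong)

lemma fvec_sc_mul: "v : carrier_vec m ==> w : carrier_vec m ==> fvec m (sc_mul m s v w) = fvec m v .* fvec m w"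
 using sc_mul_vec[of "fvec m v" "fvec m w"] by (simp add: vec_fvec fvec_vec)

lemma sc_one: "one (sc_alg m s) = vec m e1"
 unfolding sc_alg_one
proof (rule unit_eltI)
 fix v :: "'a vec" assume v: "v : carrier_vec m"
 have "sc_mul m s (vec m e1) (vec m (fvec m v)) = vec m (fvec m v)" "sc_mul m s (vec m (fvec m v)) (vec m e1) = vec m (fvec m v)" unfolding sc_mul_vec by simp_all
 thus "sc_mul m s (vec m e1) v = v & sc_mul m s v (vec m e1) = v" using v by (simp add: vec_fvec)
qed simp

lemma sc_alg_ring: "ring (sc_alg m s)"
proof (rule ringI)
 show "abelian_group (sc_alg m s)"
 proof (rule abelian_groupI)
  fix x assume "x : carrier (sc_alg m s)"
  thus "EX y:carrier (sc_alg m s). y \<oplus>\<^bsub>sc_alg m s\<^esub> x = \<zero>\<^bsub>sc_alg m s\<^esub>" by (intro bexI[of _ "- x"]) (auto simp: uminus_l_inv_vec)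
 qed (auto simp: add.assoc comm_add_vec)
next
 have v: "EX x':A. x = vec m x'" if "x : carrier_vec m" for x using vec_fvec[OF that] fvec_supp[of m x] by metis
 show "Group.monoid (sc_alg m s)"
 proof (rule monoidI)
  fix x y z assume "x : carrier (sc_alg m s)" "y : carrier (sc_alg m s)" "z : carrier (sc_alg m s)"
  thus "x \<otimes>\<^bsub>sc_alg m s\<^esub> y \<otimes>\<^bsub>sc_alg m s\<^esub> z = x \<otimes>\<^bsub>sc_alg m s\<^esub> (y \<otimes>\<^bsub>sc_alg m s\<^esub> z)" using v[of x] v[of y] v[of z] by (auto simp: sc_alg_mult sc_mul_vec massoc)
 next
  fix x assume "x : carrier (sc_alg m s)"
  thus "\<one>\<^bsub>sc_alg m s\<^esub> \<otimes>\<^bsub>sc_alg m s\<^esub> x = x" "x \<otimes>\<^bsub>sc_alg m s\<^esub> \<one>\<^bsub>sc_alg m s\<^esub> = x" using v[of x] by (auto simp: sc_alg_mult sc_mul_vec sc_one)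
 qed (auto simp: sc_alg_mult sc_one sc_mul_def)
 fix x y z assume "x : carrier (sc_alg m s)" "y : carrier (sc_alg m s)" "z : carrier (sc_alg m s)"
 hence "EX x'. x = vec m x'" "EX x'. y = vec m x'" "EX x'. z = vec m x'" using v by auto
 thus "(x \<oplus>\<^bsub>sc_alg m s\<^esub> y) \<otimes>\<^bsub>sc_alg m s\<^esub> z = x \<otimes>\<^bsub>sc_alg m s\<^esub> z \<oplus>\<^bsub>sc_alg m s\<^esub> y \<otimes>\<^bsub>sc_alg m s\<^esub> z"
  "z \<otimes>\<^bsub>sc_alg m s\<^esub> (x \<oplus>\<^bsub>sc_alg m s\<^esub> y) = z \<otimes>\<^bsub>sc_alg m s\<^esub> x \<oplus>\<^bsub>sc_alg m s\<^esub> z \<otimes>\<^bsub>sc_alg m s\<^esub> y"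
  by (auto simp: sc_alg_mult sc_mul_vec vec_add[symmetric] mul_add_l mul_add_r)
qed

lemma sc_pow: "vec m x [^]\<^bsub>sc_alg m s\<^esub> (i::nat) = vec m (mpow e1 x i)" if "x : A"
proof -
 interpret ring "sc_alg m s" by (rule sc_alg_ring)
 have "x : corner e1 e1" using that by (simp add: corner_def)
 from peval_corner(2)[OF _ this, of "mn 1 i" for i]
 have "mpow e1 x i .* x = x .* mpow e1 x i" for i by (simp add: peval_monom)
 thus ?thesis by (induct i) (simp_all add: sc_one sc_alg_mult sc_mul_vec)
qed

lemma alg_eval_eq: "alg_eval m s p (vec m x) = vec m (peval e1 p x)" if "x : A"
proof -
 interpret ring "sc_alg m s" by (rule sc_alg_ring)
 have "finsum (sc_alg m s) (%i. f i \<cdot>\<^sub>v vec m (g i)) I = vec m (SUM i:I. f i *c g i)" if "finite I"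
  for f :: "nat => 'a" and g :: "nat => nat => 'a" and I
  using that
 proof (induct I)
  case empty
  thus ?case by (auto simp: fapp)
 next
  case (insert i I)
  thus ?case by (simp add: vec_add vec_scale)
 qed
 thus ?thesis unfolding alg_eval_def Let_def by (simp add: sc_pow[OF that] peval_altdef)
qed

lemma gen_subalg_eq: "x : A ==> gen_subalg m s (vec m x) = {vec m (peval e1 p x) | p. True}"
 unfolding gen_subalg_def by (simp add: alg_eval_eq)

end

text \<open>Evaluating the ring laws on unit vectors turns them into equations between structure
  constants, and the sets \<open>J\<close> of \<open>cs_algI\<close> become ring-theoretic ideals of
  coordinate vectors.\<close>

lemma central_simple_cs_alg:
 assumes "central_simple m s"
 shows "cs_alg m s (fvec m (one (sc_alg m s)))"
proof -
 let ?R = "sc_alg m s" and ?e = "fvec m (one (sc_alg m s))"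
 interpret ring ?R using assms by (simp add: central_simple_def Let_def)
 have one: "one ?R : carrier_vec m" using one_closed by simp
 have uv: "unit_vec m i : carrier_vec m" for i by simp
 have bvu: "sc_mul m s (unit_vec m i) (unit_vec m j) = vec m (s i j)" if "i < m" "j < m" for i j using that by (auto simp: sc_mul_def unit_vec_def if_distrib[of "%x. x * _"] if_distrib[of "%x. _ * x"] sum.delta sum_if_const cong: if_cong intro!: eq_vecI)
 have F: "fd_alg m s ?e"
 proof
  show "?e : spt m" by simp
  fix i j h l assume *: "i < m" "j < m" "h < m" "l < m"
  have "sc_mul m s (sc_mul m s (unit_vec m i) (unit_vec m j)) (unit_vec m h) $ l =
    sc_mul m s (unit_vec m i) (sc_mul m s (unit_vec m j) (unit_vec m h)) $ l"
   using m_assoc[of "unit_vec m i" "unit_vec m j" "unit_vec m h"] by (simp add: sc_alg_mult)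
  thus "(SUM p<m. s i j p * s p h l) = (SUM p<m. s j h p * s i p l)" using * unfolding bvu[OF *(1,2)] bvu[OF *(2,3)] by (simp add: sc_mul_def unit_vec_def if_distrib[of "%x. x * _"] if_distrib[of "%x. _ * x"] sum.delta sum_if_const cong: if_cong)
 next
  fix j l assume *: "j < m" "l < m"
  have "sc_mul m s (one ?R) (unit_vec m j) $ l = unit_vec m j $ l" using l_one[of "unit_vec m j"] by (simp add: sc_alg_mult)
  thus "(SUM i<m. ?e i * s i j l) = (if j = l then 1 else 0)" using * by (auto simp: fvec_def sc_mul_def unit_vec_def if_distrib[of "%x. x * _"] if_distrib[of "%x. _ * x"] sum.delta sum_if_const cong: if_cong)
  have "sc_mul m s (unit_vec m j) (one ?R) $ l = unit_vec m j $ l" using r_one[of "unit_vec m j"] by (simp add: sc_alg_mult)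
  thus "(SUM i<m. ?e i * s j i l) = (if j = l then 1 else 0)" using * by (auto simp: fvec_def sc_mul_def unit_vec_def if_distrib[of "%x. x * _"] if_distrib[of "%x. _ * x"] sum.delta sum_if_const sum.swap[of _ "{..<m}" "{..<m}"] cong: if_cong)
 qed
 interpret F: fd_alg m s ?e by (rule F)
 show ?thesis
 proof (rule F.cs_algI)
  show "?e ~= 0"
  proof
   assume "?e = 0"
   hence "one ?R = zero ?R" using fvec_inject[OF one, of "0\<^sub>v m"] by (simp add: fvec_0)
   thus False using assms by (simp add: central_simple_def Let_def)
  qed
 next
  fix J assume J: "J <= F.A" "0 : J" "!!x y. x : J ==> y : J ==> x+y : J"
   "!!x y. x : J ==> y : F.A ==> F.mul x y : J & F.mul y x : J"
  let ?I = "{v : carrier_vec m. fvec m v : J}"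
  have "ideal ?I ?R"
  proof (rule idealI)
   show "ring ?R" by (rule ring_axioms)
   show "subgroup ?I (add_monoid ?R)"
   proof (rule add.subgroupI)
    show "?I ~= {}" using J(2) by (auto simp: fvec_0 intro!: exI[of _ "0\<^sub>v m"])
    fix a assume a: "a : ?I"
    \<comment> \<open>\<open>J\<close> is not assumed closed under negation; multiplication by
      \<open>- ?e\<close> supplies it.\<close>
    have "- fvec m a : J" using J(4)[of "fvec m a" "- ?e"] a by simp
    moreover have "\<ominus>\<^bsub>?R\<^esub> a = - a" using a by (intro minus_equality) (auto simp: uminus_l_inv_vec)
    moreover have "fvec m (- a) = - fvec m a" using a by (auto simp: fvec_def fun_eq_iff fapp)
    ultimately show "\<ominus>\<^bsub>?R\<^esub> a : ?I" using a by simp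
   qed (use J(3) in \<open>auto simp: fvec_add\<close>)
  qed (use J(4) in \<open>auto simp: sc_alg_mult F.fvec_sc_mul, auto simp: sc_mul_def\<close>)
  hence "?I = {zero ?R} \<or> ?I = carrier ?R" using assms by (auto simp: central_simple_def Let_def)
  thus "J = {0} \<or> J = F.A"
  proof
   assume I: "?I = {zero ?R}"
   have "x = 0" if "x : J" for x
   proof -
    have "vec m x = 0\<^sub>v m" using that J(1) using I by (force simp: fvec_vec)
    thus ?thesis using fvec_vec[of x m] that J(1) by (auto simp: fvec_0)
   qed
   thus ?thesis using J(2) by auto
  next
   assume I: "?I = carrier ?R"
   have "x : J" if "x : F.A" for x using I that fvec_vec[of x m] by (auto simp: set_eq_iff) (metis vec_carrier)
   thus ?thesis using J(1) by auto
  qed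
 next
  fix z assume z: "z : F.A" "!!x. x : F.A ==> F.mul z x = F.mul x z"
  have "vec m z \<otimes>\<^bsub>?R\<^esub> x = x \<otimes>\<^bsub>?R\<^esub> vec m z" if "x : carrier_vec m" for x using z(2)[of "fvec m x"] F.sc_mul_vec[of z "fvec m x"] F.sc_mul_vec[of "fvec m x" z] that by (simp add: sc_alg_mult vec_fvec)
  hence "vec m z : {z : carrier ?R. ALL x:carrier ?R. z \<otimes>\<^bsub>?R\<^esub> x = x \<otimes>\<^bsub>?R\<^esub> z}" by simp
  moreover have "{z : carrier ?R. ALL x:carrier ?R. z \<otimes>\<^bsub>?R\<^esub> x = x \<otimes>\<^bsub>?R\<^esub> z} = {c \<cdot>\<^sub>v one ?R | c. True}" using assms by (simp only: central_simple_def Let_def)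
  ultimately have "vec m z : {c \<cdot>\<^sub>v one ?R | c. True}" by (simp only:)
  then obtain c where "vec m z = c \<cdot>\<^sub>v one ?R" by blast
  thus "EX c. z = c *c ?e" using one using z(1) by (metis fvec_smult fvec_vec)
 qed
qed

lemma span_vec:
 fixes S :: "'a::field vec set"
 assumes S: "S <= carrier_vec m"
 defines "sp \<equiv> module.span class_ring (module_vec TYPE('a) m) S"
 shows "S <= sp" "x : sp ==> y : sp ==> x+y : sp" "x : sp ==> c \<cdot>\<^sub>v x : sp" "0\<^sub>v m : sp"
  and "S <= N ==> N <= carrier_vec m ==> 0\<^sub>v m : N ==> (!!x y. x : N ==> y : N ==> x+y : N) ==>
   (!!c x. x : N ==> c \<cdot>\<^sub>v x : N) ==> sp <= N"
proof -
 interpret vec_space "TYPE('a)" m .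
 interpret sm: submodule class_ring "span S" V by (rule span_is_submodule) (use S in auto)
 show "S <= sp" unfolding sp_def by (rule in_own_span) (use S in auto)
 show "x : sp ==> y : sp ==> x+y : sp" "x : sp ==> c \<cdot>\<^sub>v x : sp" "0\<^sub>v m : sp" unfolding sp_def using sm.m_closed[of x y] sm.smult_closed[of c x] sm.zero_closed by auto
 assume N: "S <= N" "N <= carrier_vec m" "0\<^sub>v m : N" "!!x y. x : N ==> y : N ==> x+y : N"
  "!!c x. x : N ==> c \<cdot>\<^sub>v x : N"
 show "sp <= N" unfolding sp_def
 proof (rule span_is_subset[OF N(1)])
  show "submodule class_ring N V" by unfold_locales (use N in auto)
 qed
qed

lemma solve_last_coeff:
 fixes c :: "'a::field"
 assumes "(SUM i<k. a i * b i) + c * x = 0" "c ~= 0"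
 shows "x = (SUM i<k. (- a i / c) * b i)"
proof -
 show ?thesis using assms(1) using assms(2) by (simp add: add_eq_0_iff sum_negf sum_divide_distrib[symmetric] field_simps)
qed

section \<open>Elements that pass the tests, and the subalgebra they generate\<close>

context cs_alg begin

interpretation K: acs_alg m "base_change_sc s" "acv e1" by (rule acs_alg_base_change)

lemma acv_mul: "K.mul (acv x) (acv y) = acv (x .* y)"
 unfolding K.mul_def unfolding mul_def acv_def base_change_sc_def by (auto simp: to_ac_sum fun_eq_iff)

lemma acv_mpow: "K.mpow (acv e1) (acv x) i = acv (mpow e1 x i)"
 by (induct i) (simp_all add: acv_mul)

lemma acv_peval: "K.peval (acv e1) (map_poly to_ac p) (acv x) = acv (peval e1 p x)"
 by (induct p) (simp_all add: map_poly_pCons acv_simps acv_mul)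

end

text \<open>Three tests over \<open>k\<close>, each a linear system: \<open>u^n\<close> depends on
  lower powers, \<open>u^(n-1)\<close> does not, and the derivative of the resulting polynomial is
  invertible at \<open>u\<close>, with witness \<open>dinv\<close>. The last one expresses
  separability without computing a gcd.\<close>

locale gen_elt = cs_alg +
 fixes n :: nat and u :: "nat => 'a" and p :: "nat => 'a" and dinv :: "nat => 'a"
 assumes nn: "n * n = m" and uA: "u : A" and dinvA: "dinv : A"
  and rel: "mpow e1 u n = (SUM i<n. p i *c mpow e1 u i)"
  and top: "~(EX c. mpow e1 u (n-1) = (SUM i<n-1. c i *c mpow e1 u i))"
  and sep: "peval e1 (pderiv (mn 1 n-(SUM i<n. mn (p i) i))) u .* dinv = e1"
begin

sublocale K: acs_alg m "base_change_sc s" "acv e1" by (rule acs_alg_base_change)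

definition P :: "'a poly" where "P = mn 1 n-(SUM i<n. mn (p i) i)"

lemma n_pos: "n > 0"
proof (rule ccontr)
 assume "~n > 0"
 hence "e1 = 0" using nn using e1_supp by (auto simp: spt_def fun_eq_iff fapp)
 with e1_nz show False by simp
qed

text \<open>A relation makes some \<open>u^k\<close> with \<open>k < n\<close> a combination of
  lower powers, and multiplying by \<open>u\<close> carries this upwards until it contradicts the
  test on \<open>u^(n-1)\<close>. So this single test covers all powers below
  \<open>n\<close>.\<close>

lemma ind:
 assumes c: "(SUM i<n. c i *c mpow e1 u i) = 0"
 shows "ALL i<n. c i = 0"
proof (rule ccontr)
 assume "~(ALL i<n. c i = 0)"
 hence ex: "EX i. i < n & c i ~= 0" by blast
 define k where "k = Max {i. i < n & c i ~= 0}"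
 have fin: "finite {i. i < n & c i ~= 0}" by simp
 have k: "k < n" "c k ~= 0" using Max_in[OF fin] ex unfolding k_def by auto
 have above: "c i = 0" if "k < i" "i < n" for i using Max_ge[OF fin, of i] that unfolding k_def[symmetric] by (cases "c i = 0") auto
 have "(SUM i<n. c i *c mpow e1 u i) = (SUM i<Suc k. c i *c mpow e1 u i)" using k above by (intro sum.mono_neutral_right) auto
 hence "(SUM i<k. c i *c mpow e1 u i) + c k *c mpow e1 u k = 0" using c by simp
 hence 0: "(SUM i<k. c i * mpow e1 u i l) + c k * mpow e1 u k l = 0" for l by (simp add: fun_eq_iff fapp)
 have "mpow e1 u k l = (SUM i<k. (- c i / c k) *c mpow e1 u i) l" for l unfolding fapp by (rule solve_last_coeff[OF 0 k(2)])
 hence "mpow e1 u k = (SUM i<k. (- c i / c k) *c mpow e1 u i)" by blast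
 hence base: "EX d. mpow e1 u k = (SUM i<k. d i *c mpow e1 u i)" by (rule exI[of _ "%i. - c i / c k"])
 have "EX d. mpow e1 u j = (SUM i<j. d i *c mpow e1 u i)" if "k <= j" for j using that
 proof (induct j rule: dec_induct)
  case (step j)
  then obtain d where d: "mpow e1 u j = (SUM i<j. d i *c mpow e1 u i)" by blast
  have "mpow e1 u (Suc j) = (SUM i<j. d i *c mpow e1 u (Suc i))" by (simp only: mpow.simps d, simp only: msum_r mul_scale_r mpow.simps)
  also have "... = (SUM i<Suc j. (case i of 0 => 0 | Suc i => d i) *c mpow e1 u i)" unfolding sum.lessThan_Suc_shift nat.case fv.scale_zero_left add_0 ..
  finally show ?case by (rule exI[of _ "%i. case i of 0 => 0 | Suc i => d i"])
 qed (rule base)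
 from this[of "n-1"] k top show False by simp
qed

lemma degree_P: "degree P = n" and lead_P: "lead_coeff P = 1"
proof -
 have "degree (SUM i<n. mn (p i) i) < n" using n_pos by (intro degree_sum_less) (auto intro: le_less_trans[OF degree_monom_le])
 hence d: "degree (- (SUM i<n. mn (p i) i)) < degree (mn (1::'a) n)" by (simp add: degree_monom_eq)
 have P: "P = - (SUM i<n. mn (p i) i)+mn 1 n" by (simp add: P_def)
 show "degree P = n" using degree_add_eq_right[OF d] unfolding P by (simp add: degree_monom_eq)
 show "lead_coeff P = 1" using lead_coeff_add_le[OF d] unfolding P by (simp add: degree_monom_eq)
qed

lemma peval_P: "peval e1 P u = 0"
 unfolding P_def by (simp add: peval_diff peval_monom peval_sum rel)

text \<open>Dividing by a nonzero coefficient \<open>c k\<close> first ensures that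
  \<open>acp\<close> maps that coefficient to 1, so the projected relation over \<open>k\<close>
  stays nontrivial.\<close>

lemma K_ind:
 assumes c: "(SUM i<n. c i *c K.mpow (acv e1) (acv u) i) = 0"
 shows "ALL i<n. c i = 0"
proof (rule ccontr)
 assume "~(ALL i<n. c i = 0)"
 then obtain k where k: "k < n" "c k ~= 0" by blast
 have "(SUM i<n. acp (c i / c k) *c mpow e1 u i) l = 0 l" for l
 proof -
  have "(SUM i<n. (c i / c k) * to_ac (mpow e1 u i l)) = 0" using fun_cong[OF c, of l] by (simp add: fapp acv_mpow acv_apply sum_divide_distrib[symmetric])
  hence "acp (SUM i<n. (c i / c k) * to_ac (mpow e1 u i l)) = 0" by (simp only: acp_more)
  hence "(SUM i<n. acp (c i / c k) * mpow e1 u i l) = 0" by (simp only: acp_sum acp_more(3))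
  thus ?thesis by (simp add: fapp)
 qed
 hence "(SUM i<n. acp (c i / c k) *c mpow e1 u i) = 0" by blast
 from ind[OF this] k have "acp (c k / c k) = 0" by blast
 with k show False by (simp add: acp)
qed

lemma K_peval_nz:
 assumes "q ~= 0" "degree q < n"
 shows "K.peval (acv e1) q (acv u) ~= 0"
proof
 assume "K.peval (acv e1) q (acv u) = 0"
 moreover have "K.peval (acv e1) q (acv u) = (SUM i<n. coeff q i *c K.mpow (acv e1) (acv u) i)" unfolding K.peval_altdef using assms(2) by (intro sum.mono_neutral_left) (auto simp: coeff_eq_0)
 ultimately have "ALL i<n. coeff q i = 0" using K_ind by simp
 hence "q = 0" using assms(2) by (metis leading_coeff_0_iff)
 with assms(1) show False by simp
qed

lemma acv_u_corner: "acv u : K.corner (acv e1) (acv e1)"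
 using acv_supp[OF uA] by (simp add: K.corner_def)

text \<open>A double root gives \<open>P = L * L * w\<close> over the closure. For
  \<open>q = L * w\<close> the product of \<open>q\<close> and \<open>P'\<close> is a multiple of
  \<open>P\<close>, so \<open>q(u) P'(u) = 0\<close>; as \<open>P'(u)\<close> is invertible,
  \<open>q(u) = 0\<close>, although \<open>q\<close> has degree \<open>n - 1\<close>.\<close>

lemma exists_roots:
 "EX mu. split_poly (map_poly to_ac P) n mu & reg_elt m (base_change_sc s) (acv e1) n mu (acv u)"
proof -
 let ?P = "map_poly to_ac P"
 have lead: "lead_coeff ?P = 1" and deg: "degree ?P = n"  using lead_P degree_P degree_map_poly[of to_ac P] by (simp_all add: coeff_map_poly)
 hence "?P ~= 0" by auto
 from alg_closed_imp_factorization[OF this] lead deg obtain R where R: "size R = n" "?P = (PROD x:#R. [:-x, 1:])" by auto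
 obtain xs where xs: "mset xs = R" using ex_mset by blast
 define mu where "mu i = xs ! i" for i
 have len: "length xs = n" using R xs by auto
 have "(PROD x:#R. [:-x, 1:]) = prod_list (map (%x. [:-x, 1:]) xs)" unfolding xs[symmetric] mset_map[symmetric] prod_mset_prod_list ..
 also have "... = (PROD i<n. [:- mu i, 1:])" unfolding mu_def using len by (simp add: prod.list_conv_set_nth lessThan_atLeast0)
 finally have split: "?P = (PROD i<n. [:- mu i, 1:])" using R by simp
 have ann: "K.peval (acv e1) ?P (acv u) = 0" by (simp add: acv_peval peval_P acv_simps)
 have inj: "inj_on mu {..<n}"
 proof (rule inj_onI, rule ccontr)
  fix i j assume ij: "i : {..<n}" "j : {..<n}" "mu i = mu j" "i ~= j"
  let ?w = "PROD k:{..<n} - {i} - {j}. [:- mu k, 1:]"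
  let ?L = "[:- mu i, 1:]"
  have fac: "?P = ?L*(?L*?w)" unfolding split using ij by (subst prod.remove[of _ i], simp, simp, subst prod.remove[of _ j]) auto
  define q where "q = ?L*?w"
  have fac: "?P = ?L * q" using fac by (simp only: q_def)
  have "?w ~= 0" by auto
  hence "q ~= 0" unfolding q_def by (simp only: mult_eq_0_iff) simp
  moreover have "degree ?P = 1+degree q" unfolding fac using `q ~= 0` by (subst degree_mult_eq) simp_all
  ultimately have qnz: "K.peval (acv e1) q (acv u) ~= 0" using deg by (intro K_peval_nz) simp_all
  define d where "d = map_poly to_ac (pderiv P)"
  have "pderiv ?L = 1" by (simp add: pderiv_pCons)
  hence "pderiv ?P = ?L * pderiv q+q" unfolding fac by (subst pderiv_mult) simp
  moreover have "pderiv ?P = d" unfolding d_def by (simp add: poly_eq_iff coeff_pderiv coeff_map_poly)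
  ultimately have "d = ?L * pderiv q+q" by simp
  \<comment> \<open>From \<open>d = L q' + q\<close>, \<open>q = L w\<close> and
    \<open>P = L q\<close> one gets \<open>q d = q' P + w P\<close>.\<close>
  hence "q * d = (pderiv q+?w)*?P" unfolding fac by (simp only: q_def algebra_simps)
  hence "K.peval (acv e1) (q * d) (acv u) = 0" by (simp add: K.peval_mult[OF _ acv_u_corner] ann)
  hence 0: "K.mul (K.peval (acv e1) q (acv u)) (acv (peval e1 (pderiv P) u)) = 0" by (simp add: K.peval_mult[OF _ acv_u_corner] d_def acv_peval)
  have "K.mul (K.peval (acv e1) q (acv u)) (acv e1) = K.mul (K.mul (K.peval (acv e1) q (acv u)) (acv (peval e1 (pderiv P) u))) (acv dinv)" using sep by (simp add: P_def K.massoc acv_mul)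
  hence "K.mul (K.peval (acv e1) q (acv u)) (acv e1) = 0" unfolding 0 by simp
  moreover have "K.peval (acv e1) q (acv u) : K.corner (acv e1) (acv e1)" by (rule K.peval_corner[OF _ acv_u_corner]) simp
  ultimately show False using qnz by (simp add: K.corner_def)
 qed
 have "split_poly ?P n mu" using split inj by unfold_locales
 moreover have "reg_elt m (base_change_sc s) (acv e1) n mu (acv u)" using nn acv_supp[OF uA] inj ann K_peval_nz by unfold_locales (simp_all add: split)
 ultimately show ?thesis by blast
qed

lemma u_corner: "u : corner e1 e1" using uA by (simp add: corner_def)

lemma peval_u_A: "peval e1 q u : A"
 by (rule corner_subset[OF peval_corner(1)[OF _ u_corner]]) simp

lemma min_poly: "is_min_poly m s (vec m u) P"
 unfolding is_min_poly_def
proof (intro conjI allI impI)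
 show "alg_eval m s P (vec m u) = \<zero>\<^bsub>sc_alg m s\<^esub>" using alg_eval_eq[OF uA, of P] by (auto simp: peval_P fapp)
 fix Q assume Q: "Q ~= 0 & alg_eval m s Q (vec m u) = \<zero>\<^bsub>sc_alg m s\<^esub>"
 hence 0: "peval e1 Q u = 0" using alg_eval_eq[OF uA] using fvec_vec[OF peval_u_A[of Q]] by (simp add: fvec_0)
 show "degree P <= degree Q"
 proof (rule ccontr)
  assume "~degree P <= degree Q"
  hence d: "degree Q < n" using degree_P by simp
  have "(SUM i<n. coeff Q i *c mpow e1 u i) = peval e1 Q u" unfolding peval_altdef using d by (intro sum.mono_neutral_right) (auto simp: coeff_eq_0)
  with ind[of "coeff Q"] 0 have "ALL i<n. coeff Q i = 0" by simp
  with d Q show False by (metis leading_coeff_0_iff)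
 qed
qed (rule lead_P)

abbreviation "F \<equiv> gen_subalg m s (vec m u)"

lemma F_eq: "F = {vec m (peval e1 q u) | q. True}"
 by (rule gen_subalg_eq[OF uA])

lemma F_comm_subalg: "comm_subalg m s F"
 unfolding comm_subalg_def Let_def
proof (intro conjI ballI allI)
 interpret ring "sc_alg m s" by (rule sc_alg_ring)
 note pm = peval_mult[OF _ u_corner]
 show "subring F (sc_alg m s)"
 proof (rule subringI)
  show "F <= carrier (sc_alg m s)" by (auto simp: F_eq)
  show "\<one>\<^bsub>sc_alg m s\<^esub> : F" unfolding F_eq sc_one by (intro CollectI exI[of _ 1]) simp
  fix h assume "h : F"
  then obtain q where q: "h = vec m (peval e1 q u)" by (auto simp: F_eq)
  have "\<ominus>\<^bsub>sc_alg m s\<^esub> h = vec m (peval e1 (- q) u)" by (rule minus_equality) (auto simp: q peval_minus fapp)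
  thus "\<ominus>\<^bsub>sc_alg m s\<^esub> h : F" unfolding F_eq by blast
  fix h' assume "h' : F"
  then obtain q' where q': "h' = vec m (peval e1 q' u)" by (auto simp: F_eq)
  have "h \<otimes>\<^bsub>sc_alg m s\<^esub> h' = vec m (peval e1 (q * q') u)" by (simp add: q q' sc_alg_mult sc_mul_vec pm)
  thus "h \<otimes>\<^bsub>sc_alg m s\<^esub> h' : F" unfolding F_eq by blast
  have "h \<oplus>\<^bsub>sc_alg m s\<^esub> h' = vec m (peval e1 (q+q') u)" by (simp add: q q' peval_add vec_add)
  thus "h \<oplus>\<^bsub>sc_alg m s\<^esub> h' : F" unfolding F_eq by blast
 qed
 fix h assume "h : F"
 then obtain q where q: "h = vec m (peval e1 q u)" by (auto simp: F_eq)
 have "c \<cdot>\<^sub>v h = vec m (peval e1 (Polynomial.smult c q) u)" for c by (simp add: q peval_smult vec_scale)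
 thus "c \<cdot>\<^sub>v h : F" for c unfolding F_eq by blast
 fix h' assume "h' : F"
 then obtain q' where q': "h' = vec m (peval e1 q' u)" by (auto simp: F_eq)
 show "h \<otimes>\<^bsub>sc_alg m s\<^esub> h' = h' \<otimes>\<^bsub>sc_alg m s\<^esub> h" using pm[of q q'] pm[of q' q] by (simp add: q q' sc_alg_mult sc_mul_vec mult.commute)
qed

text \<open>An element of a larger commutative subalgebra commutes with \<open>u\<close>, so over
  the closure it is a polynomial in \<open>u\<close>; \<open>acp\<close> brings the coefficients
  down to \<open>k\<close>.\<close>

lemma F_max: "max_comm_subalg m s F"
 unfolding max_comm_subalg_def
proof (intro conjI allI impI F_comm_subalg)
 fix B assume B: "comm_subalg m s B & F <= B"
 obtain mu where "reg_elt m (base_change_sc s) (acv e1) n mu (acv u)" using exists_roots by blast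
 then interpret R: reg_elt m "base_change_sc s" "acv e1" n mu "acv u" .
 have "b : F" if b: "b : B" for b
 proof -
  have "subring B (sc_alg m s)" and comm: "ALL x:B. ALL y:B. sc_mul m s x y = sc_mul m s y x" using B unfolding comm_subalg_def Let_def sc_alg_mult by blast+
  hence bc: "b : carrier_vec m" using subringE(1)[of B "sc_alg m s"] using b by auto
  define z where "z = fvec m b"
  have z: "z : A" "b = vec m z" using bc by (simp_all add: z_def vec_fvec)
  have "vec m u = vec m (peval e1 [:0, 1:] u)" using uA by simp
  hence "vec m u : F" unfolding F_eq by blast
  hence "sc_mul m s (vec m u) b = sc_mul m s b (vec m u)" using B using comm b by blast
  hence "vec m (u .* z) = vec m (z .* u)" unfolding z(2) sc_mul_vec .
  hence "u .* z = z .* u" using arg_cong by (metis fvec_vec[OF mul_supp])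
  hence "K.mul (acv u) (acv z) = K.mul (acv z) (acv u)" by (simp add: acv_mul)
  from R.centralizer[OF acv_supp[OF z(1)] this] obtain q where
   q: "degree q < n" "acv z = K.peval (acv e1) q (acv u)" by blast
  have "K.peval (acv e1) q (acv u) = (SUM i<=degree q. coeff q i *c acv (mpow e1 u i))" by (simp add: K.peval_altdef acv_mpow)
  with q(2) have "to_ac (z l) = (SUM i<=degree q. coeff q i * to_ac (mpow e1 u i l))" for l by (simp add: fun_eq_iff fapp acv_apply)
  hence "acp (to_ac (z l)) = acp (SUM i<=degree q. coeff q i * to_ac (mpow e1 u i l))" for l by simp
  hence "z = peval e1 (SUM i<=degree q. mn (acp (coeff q i)) i) u" by (simp add: acp_more acp_sum fun_eq_iff fapp peval_sum peval_monom)
  thus ?thesis unfolding z(2) F_eq by blast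
 qed
 with B show "B = F" by blast
qed

lemma base_change_F: "base_change_sub m F = {vec m (K.peval (acv e1) q (acv u)) | q. True}" (is "_ = ?N")
proof -
 have map_F: "map_vec to_ac ` F <= ?N"
 proof safe
  fix h assume "h : F"
  then obtain q where q: "h = vec m (peval e1 q u)" by (auto simp: F_eq)
  have "map_vec to_ac h = vec m (K.peval (acv e1) (map_poly to_ac q) (acv u))" unfolding acv_peval by (auto simp: q acv_apply)
  thus "EX q. map_vec to_ac h = vec m (K.peval (acv e1) q (acv u)) & True" by blast
 qed
 hence sub: "map_vec to_ac ` F <= carrier_vec m" by auto
 note sp = span_vec[OF sub, folded base_change_sub_def]
 have add: "x+y : ?N" if xy: "x : ?N" "y : ?N" for x y
 proof -
  obtain q q' where "x = vec m (K.peval (acv e1) q (acv u))" "y = vec m (K.peval (acv e1) q' (acv u))" using xy by blast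
  hence "x+y = vec m (K.peval (acv e1) (q+q') (acv u))" by (simp only: K.peval_add vec_add)
  thus ?thesis by blast
 qed
 have smult: "c \<cdot>\<^sub>v x : ?N" if x: "x : ?N" for c x
 proof -
  obtain q where "x = vec m (K.peval (acv e1) q (acv u))" using x by blast
  hence "c \<cdot>\<^sub>v x = vec m (K.peval (acv e1) (Polynomial.smult c q) (acv u))" by (simp only: K.peval_smult vec_scale)
  thus ?thesis by blast
 qed
 have "0\<^sub>v m = vec m (K.peval (acv e1) 0 (acv u))" by (auto simp: fapp)
 hence zero: "0\<^sub>v m : ?N" by blast
 have "base_change_sub m F <= ?N" by (rule sp(5)[OF map_F _ zero add smult]) auto
 moreover have "vec m (K.peval (acv e1) q (acv u)) : base_change_sub m F" for q
 proof -
  have "vec m (SUM i:I. coeff q i *c acv (mpow e1 u i)) : base_change_sub m F" if "finite I" for I using that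
  proof (induct I)
   case empty
   have "vec m (0 :: nat => 'a alg_closure) = 0\<^sub>v m" by (auto simp: fapp)
   thus ?case using sp(4) by simp
  next
   case (insert i I)
   have "vec m (acv (mpow e1 u i)) = map_vec to_ac (vec m (peval e1 (mn 1 i) u))" by (auto simp: peval_monom acv_apply)
   hence "vec m (acv (mpow e1 u i)) : map_vec to_ac ` F" unfolding F_eq by blast
   hence "vec m (acv (mpow e1 u i)) : base_change_sub m F" using sp(1) by blast
   with insert show ?case by (simp add: vec_add vec_scale sp(2,3))
  qed
  thus ?thesis by (simp add: K.peval_altdef acv_mpow)
 qed
 ultimately show ?thesis by blast
qed

text \<open>Over the closure the idempotents \<open>R.ee x\<close> form a basis of the base change
  of \<open>F\<close>, and multiplication in that basis is coordinatewise.\<close>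

lemma F_etale: "etale_subalg m s F"
proof -
 obtain mu where "reg_elt m (base_change_sc s) (acv e1) n mu (acv u)" using exists_roots by blast
 then interpret R: reg_elt m "base_change_sc s" "acv e1" n mu "acv u" .
 let ?N = "base_change_sub m F"
 define g where "g b = vec m (SUM x<n. b x *c R.ee x)" for b :: "nat => 'a alg_closure"
 have g_lagr: "g b = vec m (K.peval (acv e1) (SUM x<n. Polynomial.smult (b x) (lagr n mu x)) (acv u))" for b by (simp add: g_def K.peval_sum K.peval_smult R.ee_def)
 have g_expand: "vec m (K.peval (acv e1) q (acv u)) = g (%x. poly q (mu x))" for q by (simp add: g_def R.peval_expand)
 have N_g: "?N = range g" unfolding base_change_F
 using g_lagr by (auto simp: g_expand)
 have g_inj: "ALL x<n. b x = c x" if "g b = g c" for b c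
 proof -
  have supp: "(SUM x<n. b x *c R.ee x) : spt m" for b using R.eeD(4) by (intro spt_sum) simp
  show ?thesis
  proof (intro allI impI)
   fix y assume y: "y < n"
   have "K.mul (SUM x<n. b x *c R.ee x) (R.ee y) = b y *c R.ee y" for b
   proof -
    have "K.mul (SUM x<n. b x *c R.ee x) (R.ee y) = (SUM x<n. if x = y then b y *c R.ee y else 0)" unfolding K.msum_l using y by (intro sum.cong refl) (simp add: R.eeD)
    thus ?thesis using y by simp
   qed
   from this[of b] this[of c] have "b y *c R.ee y = c y *c R.ee y" using fvec_vec[OF supp[of b]] fvec_vec[OF supp[of c]] that unfolding g_def by metis
   thus "b y = c y" using R.eeD(1)[OF y] by (simp only: fv.scale_cancel_right) simp
  qed
 qed
 \<comment> \<open>\<open>h\<close> inverts \<open>g\<close> by choice. Any two choices agree below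
   \<open>n\<close>, so the vector of length \<open>n\<close> is well defined.\<close>
 define h where "h v = vec n (SOME b. v = g b)" for v
 have h_g: "h (g b) = vec n b" for b
 proof -
  have "g b = g (SOME c. g b = g c)" by (rule someI[of _ b]) simp
  from g_inj[OF this] show ?thesis unfolding h_def by (intro eq_vecI) simp_all
 qed
 let ?A = "sc_alg m (base_change_sc s)"
 have gmul: "sc_mul m (base_change_sc s) (g b) (g c) = g (%x. b x * c x)" for b c
 proof -
  have "K.mul (SUM x<n. b x *c R.ee x) (SUM x<n. c x *c R.ee x) = (SUM x<n. SUM y<n. if x = y then (b x * c x) *c R.ee x else 0)" unfolding K.msum_l K.msum_r by (subst sum.swap, intro sum.cong refl) (simp add: R.eeD mult.commute)
  thus ?thesis unfolding g_def K.sc_mul_vec by simp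
 qed
 have gadd: "g b+g c = g (%x. b x + c x)" for b c unfolding g_def vec_add[symmetric] sum.distrib[symmetric] fv.scale_left_distrib ..
 have gscale: "k \<cdot>\<^sub>v g b = g (%x. k * b x)" for k b by (simp add: g_def vec_scale[symmetric] fv.scale_sum_right)
 have g1: "one ?A = g (%_. 1)" unfolding K.sc_one g_def using R.eeD(3) by simp
 have "h : ring_iso (?A\<lparr>carrier := ?N\<rparr>) (split_alg n)"
 proof (rule ring_iso_memI)
  show "bij_betw h (carrier (?A\<lparr>carrier := ?N\<rparr>)) (carrier (split_alg n))" unfolding bij_betw_def
  proof
   show "inj_on h (carrier (?A\<lparr>carrier := ?N\<rparr>))"
   proof (rule inj_onI)
    fix v w assume "v : carrier (?A\<lparr>carrier := ?N\<rparr>)" "w : carrier (?A\<lparr>carrier := ?N\<rparr>)" "h v = h w"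
    then obtain b c where bc: "v = g b" "w = g c" "vec n b = vec n c" unfolding N_g by (auto simp: h_g)
    hence "ALL x<n. b x = c x" by (metis index_vec)
    thus "v = w" unfolding bc g_def by (intro arg_cong[where f = "vec m"] sum.cong refl) simp
   qed
   have "v : h ` ?N" if "v : carrier_vec n" for v
   proof -
    have "v = h (g (fvec n v))" unfolding h_g using vec_fvec[OF that] by simp
    thus ?thesis unfolding N_g by blast
   qed
   thus "h ` carrier (?A\<lparr>carrier := ?N\<rparr>) = carrier (split_alg n)" by (auto simp: split_alg_def h_def)
  qed
  fix v w assume "v : carrier (?A\<lparr>carrier := ?N\<rparr>)" "w : carrier (?A\<lparr>carrier := ?N\<rparr>)"
  hence "v : range g" "w : range g" using N_g by simp_all
  then obtain b c where bc: "v = g b" "w = g c" by blast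
  show "h (v \<otimes>\<^bsub>?A\<lparr>carrier := ?N\<rparr>\<^esub> w) = h v \<otimes>\<^bsub>split_alg n\<^esub> h w" unfolding bc by (simp add: sc_alg_mult gmul h_g) (auto simp: split_alg_def)
  show "h (v \<oplus>\<^bsub>?A\<lparr>carrier := ?N\<rparr>\<^esub> w) = h v \<oplus>\<^bsub>split_alg n\<^esub> h w" unfolding bc by (simp add: gadd h_g) (auto simp: split_alg_def)
 next
  show "h \<one>\<^bsub>?A\<lparr>carrier := ?N\<rparr>\<^esub> = \<one>\<^bsub>split_alg n\<^esub>" by (simp add: g1 h_g) (simp add: split_alg_def)
 qed (simp add: split_alg_def h_def)
 moreover have "h (c \<cdot>\<^sub>v v) = c \<cdot>\<^sub>v h v" if "v : ?N" for c v
 proof -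
  have "v : range g" using that N_g by simp
  then obtain b where b: "v = g b" by blast
  show ?thesis unfolding b gscale h_g by auto
 qed
 ultimately show ?thesis unfolding etale_subalg_def using F_comm_subalg by blast
qed

end

section \<open>The Amitsur complex evaluated at roots in the closure\<close>

locale k_split_poly =
 fixes P :: "'k::field poly" and n :: nat and mu :: "nat => 'k alg_closure"
 assumes split: "split_poly (map_poly to_ac P) n mu" and n_pos: "n > 0"
begin

sublocale S: split_poly "map_poly to_ac P" n mu by (rule split)

lemma degree_P_eq [simp]: "degree P = n"
 using S.degree_P degree_map_poly[of to_ac P] by simp

lemma expos_P: "set (expos P N) = words n N"
 by (simp add: set_expos words_def)

lemma tensors_acv: "a : tensors P N \<longleftrightarrow> acv a : tensors (map_poly to_ac P) N"
 by (simp add: tensors_def expos_P S.expos_eq acv_apply)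

lemma red_acv: "to_ac (coeff (mn 1 r mod P) l) = S.red r l"
proof -
 have "S.red r l = coeff (map_poly to_ac (mn 1 r mod P)) l" by (simp add: S.red_def ac.map_poly_mod map_poly_monom)
 thus ?thesis by (simp add: coeff_map_poly)
qed

lemma tensor_mult_acv: "acv (tensor_mult P N a b) = tensor_mult (map_poly to_ac P) N (acv a) (acv b)"
 unfolding tensor_mult_def S.expos_eq expos_P
 by (auto simp: fun_eq_iff acv_apply to_ac_sum to_ac_prod red_acv S.red_def)

lemma face_acv: "acv (face i a) = face i (acv a)"
 by (auto simp: face_def acv_def fun_eq_iff)

text \<open>A tensor over \<open>k\<close> is determined by its values at tuples of roots in the
  closure, so identities over \<open>k\<close> can be checked pointwise.\<close>

definition evk :: "nat => (nat list => 'k) => nat list => 'k alg_closure" where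
 "evk N a = S.ev N (acv a)"

lemma evk_inject:
 "a : tensors P N ==> b : tensors P N ==> (!!xs. xs : words n N ==> evk N a xs = evk N b xs) ==> a = b"
 using S.ev_inject[of "acv a" N "acv b"] by (simp add: tensors_acv evk_def acv_inject)

lemma tmult_tensors: "tensor_mult P N a b : tensors P N"
 by (simp add: tensor_mult_def tensors_def)

lemma evk_mult: "xs : words n N ==> evk N (tensor_mult P N a b) xs = evk N a xs * evk N b xs"
 by (simp add: evk_def tensor_mult_acv S.ev_mult)

definition tone :: "nat => nat list => 'k" where
 "tone N = (%al. if al = replicate N 0 then 1 else 0)"

lemma evk_one: "evk N (tone N) xs = 1"
proof -
 have "acv (tone N) = (%al. if al = replicate N 0 then 1 else 0 :: 'k alg_closure)" by (auto simp: tone_def acv_def fun_eq_iff)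
 thus ?thesis using n_pos by (simp add: evk_def S.ev_one)
qed

lemma tone_tensors: "tone N : tensors P N"
 using n_pos by (auto simp: tone_def tensors_def expos_P words_def)

lemma tensor_power_simps [simp]:
 "carrier (tensor_power P N) = tensors P N" "monoid.mult (tensor_power P N) = tensor_mult P N"
 "one (tensor_power P N) = tone N"
 by (simp_all add: tensor_power_def tone_def)

lemma comm_monoid_tensor_power: "comm_monoid (tensor_power P N)"
proof (rule comm_monoidI)
 show "x \<otimes>\<^bsub>tensor_power P N\<^esub> y \<otimes>\<^bsub>tensor_power P N\<^esub> z = x \<otimes>\<^bsub>tensor_power P N\<^esub> (y \<otimes>\<^bsub>tensor_power P N\<^esub> z)" for x y z by (rule evk_inject[of _ N]) (simp_all add: tmult_tensors evk_mult mult_ac)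
 show "x \<otimes>\<^bsub>tensor_power P N\<^esub> y = y \<otimes>\<^bsub>tensor_power P N\<^esub> x" for x y by (rule evk_inject[of _ N]) (simp_all add: tmult_tensors evk_mult mult_ac)
 fix x assume "x : carrier (tensor_power P N)"
 thus "\<one>\<^bsub>tensor_power P N\<^esub> \<otimes>\<^bsub>tensor_power P N\<^esub> x = x" by (intro evk_inject[of _ N]) (simp_all add: tmult_tensors evk_mult evk_one)
qed (simp_all add: tmult_tensors tone_tensors)

lemma tone_mult: "a : tensors P N ==> tensor_mult P N (tone N) a = a" "a : tensors P N ==> tensor_mult P N a (tone N) = a"
 using Group.monoid.l_one[OF comm_monoid.axioms(1)[OF comm_monoid_tensor_power], of a N]
  Group.monoid.r_one[OF comm_monoid.axioms(1)[OF comm_monoid_tensor_power], of a N] by simp_all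

text \<open>Over the closure the inverse is found pointwise. It solves a linear system with
  coefficients in \<open>k\<close>, so its coordinatewise image under \<open>acp\<close> is an
  inverse over \<open>k\<close>.\<close>

lemma tensor_unit:
 assumes a: "a : tensors P N" and nz: "!!xs. xs : words n N ==> evk N a xs ~= 0"
 shows "a : Units (tensor_power P N)"
proof -
 interpret comm_monoid "tensor_power P N" by (rule comm_monoid_tensor_power)
 define b' where "b' = S.interp N (%xs. 1 / evk N a xs)"
 have 1: "tensor_mult (map_poly to_ac P) N (acv a) b' = acv (tone N)"
 proof (rule S.ev_inject[of _ N])
  show "acv (tone N) : tensors (map_poly to_ac P) N" using tone_tensors tensors_acv by blast
  fix xs assume xs: "xs : words n N"
  show "S.ev N (tensor_mult (map_poly to_ac P) N (acv a) b') xs = S.ev N (acv (tone N)) xs" using nz[OF xs] evk_one[of N xs] by (simp add: S.ev_mult[OF xs] b'_def S.ev_interp[OF xs] evk_def)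
 qed (rule S.tmult_tensors)
 define b where "b = (%al. acp (b' al))"
 have b: "b : tensors P N" using S.interp_tensors[of N] by (auto simp: b_def b'_def tensors_def expos_P S.expos_eq acp_more)
 have "tensor_mult P N a b ga = tone N ga" for ga
 proof (cases "ga : words n N")
  case True
  have "(SUM al:words n N. SUM be:words n N. to_ac (a al*(PROD j<N. coeff (mn 1 (al ! j+be ! j) mod P) (ga ! j))) * b' be)
    = to_ac (tone N ga)"
   using fun_cong[OF 1, of ga] True
   by (simp add: tensor_mult_def S.expos_eq acv_apply to_ac_prod red_acv S.red_def mult_ac)
  hence "acp (SUM al:words n N. SUM be:words n N. to_ac (a al*(PROD j<N. coeff (mn 1 (al ! j+be ! j) mod P) (ga ! j))) * b' be)
    = tone N ga" by (simp only: acp_more)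
  thus ?thesis using True by (simp add: tensor_mult_def expos_P b_def acp_sum acp acp_more mult_ac del: to_ac_mult)
 next
  case False
  thus ?thesis using tone_tensors[of N] by (simp add: tensor_mult_def tensors_def expos_P)
 qed
 hence "tensor_mult P N a b = tone N" by blast
 moreover from this have "tensor_mult P N b a = tone N" using m_comm[of a b] a b by simp
 ultimately show ?thesis using a b unfolding Units_def by auto
qed

lemma evk_face: "i <= N ==> length xs = Suc N ==> evk (Suc N) (face i a) xs = evk N a (take i xs @ drop (Suc i) xs)"
 by (simp add: evk_def face_acv S.ev_face n_pos)

lemma face_tensors: "a : tensors P N ==> i <= N ==> face i a : tensors P (Suc N)"
 using S.face_tensors[of "acv a" N i] n_pos by (simp add: tensors_acv face_acv)

lemma words_drop:
 assumes "xs : words n (Suc N)" "i <= N"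
 shows "take i xs @ drop (Suc i) xs : words n N"
 using assms by (auto simp: words_def dest: in_set_takeD in_set_dropD)

lemma words_length: "xs : words n N ==> length xs = N" by (simp add: words_def)

text \<open>At a point \<open>(x, y, z, w)\<close> the alternating product of the faces is the
  quotient of the two sides of \<open>coc\<close>: faces 0 and 2 enter directly, faces 1 and 3
  inverted.\<close>

lemma amitsur_cocycleI:
 assumes c: "c : tensors P 3" and nz: "!!xs. xs : words n 3 ==> evk 3 c xs ~= 0"
  and coc: "!!x y z w. x < n ==> y < n ==> z < n ==> w < n ==>
   evk 3 c [y, z, w] * evk 3 c [x, y, w] = evk 3 c [x, z, w] * evk 3 c [x, y, z]"
 shows "c : amitsur_cocycles P 2"
proof -
 let ?T = "tensor_power P 4"
 interpret T: comm_monoid ?T by (rule comm_monoid_tensor_power)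
 have c_unit: "c : amitsur_cochains P 2" unfolding amitsur_cochains_def using tensor_unit[OF c nz] by simp
 let ?f = "%i. face i c"
 have ft: "?f i : tensors P 4" if "i <= 3" for i using face_tensors[OF c that] by (simp add: eval_nat_numeral)
 have ev: "evk 4 (?f i) xs = evk 3 c (take i xs @ drop (Suc i) xs)" if "i <= 3" "xs : words n 4" for i xs using evk_face[OF that(1), of xs c] that(2) by (simp add: eval_nat_numeral words_length)
 have fu: "?f i : Units ?T" if "i <= 3" for i
 proof (rule tensor_unit[OF ft[OF that]])
  fix xs assume xs: "xs : words n 4"
  thus "evk 4 (?f i) xs ~= 0" unfolding ev[OF that xs] using words_drop[of xs 3 i] that by (intro nz) (simp add: eval_nat_numeral)
 qed
 have inv: "inv\<^bsub>?T\<^esub> (?f i) : tensors P 4" "evk 4 (inv\<^bsub>?T\<^esub> (?f i)) xs * evk 4 (?f i) xs = 1"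
  if "i <= 3" "xs : words n 4" for i xs
 proof -
  show "inv\<^bsub>?T\<^esub> (?f i) : tensors P 4" using T.Units_inv_closed[OF fu[OF that(1)]] by simp
  show "evk 4 (inv\<^bsub>?T\<^esub> (?f i)) xs * evk 4 (?f i) xs = 1" using T.Units_l_inv[OF fu[OF that(1)]] using evk_mult[OF that(2), of "inv\<^bsub>?T\<^esub> (?f i)" "?f i"] by (simp add: evk_one)
 qed
 let ?g = "%i. if even i then ?f i else inv\<^bsub>?T\<^esub> (?f i)"
 have gt: "?g i : tensors P 4" if "i <= 3" for i using ft[OF that] T.Units_inv_closed[OF fu[OF that]] by simp
 have pow: "?f i [^]\<^bsub>?T\<^esub> ((- 1)^i :: int) = ?g i" if "i <= 3" for i using ft[OF that] T.Units_inv_closed[OF fu[OF that]] by (simp add: int_pow_def2 tone_mult)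
 have "amitsur_diff P 2 c = finprod ?T (%i. ?f i [^]\<^bsub>?T\<^esub> ((- 1)^i :: int)) {..3}" by (simp add: amitsur_diff_def)
 also have "... = finprod ?T ?g {..3}" by (rule T.finprod_cong') (use pow gt in auto)
 also have "{..3::nat} = {3, 2, 1, 0}" by auto
 also have "finprod ?T ?g {3, 2, 1, 0} = tensor_mult P 4 (?g 3) (tensor_mult P 4 (?g 2) (tensor_mult P 4 (?g 1) (?g 0)))" using gt[of 0] gt[of 1] gt[of 2] gt[of 3] by (simp add: T.finprod_insert Pi_def tmult_tensors tone_mult)
 also have "... = tone 4"
 proof (rule evk_inject[of _ 4])
  fix xs assume xs: "xs : words n 4"
  then obtain x y z w where xyzw: "xs = [x, y, z, w]" "x < n" "y < n" "z < n" "w < n" by (auto simp: words_def eval_nat_numeral length_Suc_conv)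
  have e: "evk 4 (?f 0) xs = evk 3 c [y, z, w]" "evk 4 (?f 1) xs = evk 3 c [x, z, w]"
   "evk 4 (?f 2) xs = evk 3 c [x, y, w]" "evk 4 (?f 3) xs = evk 3 c [x, y, z]"
   using ev[of 0 xs] ev[of 1 xs] ev[of 2 xs] ev[of 3 xs] xs by (simp_all add: xyzw eval_nat_numeral)
  have i: "evk 4 (inv\<^bsub>?T\<^esub> (?f 1)) xs * evk 3 c [x, z, w] = 1" "evk 4 (inv\<^bsub>?T\<^esub> (?f 3)) xs * evk 3 c [x, y, z] = 1" using inv(2)[of 1 xs] inv(2)[of 3 xs] xs e by simp_all
  have "evk 4 (tensor_mult P 4 (?g 3) (tensor_mult P 4 (?g 2) (tensor_mult P 4 (?g 1) (?g 0)))) xs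
    = evk 4 (inv\<^bsub>?T\<^esub> (?f 3)) xs * evk 4 (inv\<^bsub>?T\<^esub> (?f 1)) xs*(evk 3 c [y, z, w] * evk 3 c [x, y, w])"
   using e by (simp add: evk_mult[OF xs] mult_ac)
  also have "... = (evk 4 (inv\<^bsub>?T\<^esub> (?f 1)) xs * evk 3 c [x, z, w])*(evk 4 (inv\<^bsub>?T\<^esub> (?f 3)) xs * evk 3 c [x, y, z])" unfolding coc[OF xyzw(2-5)] by (simp add: mult_ac)
  also have "... = 1" unfolding i by simp
  finally show "evk 4 (tensor_mult P 4 (?g 3) (tensor_mult P 4 (?g 2) (tensor_mult P 4 (?g 1) (?g 0)))) xs = evk 4 (tone 4) xs" by (simp add: evk_one)
 qed (simp_all add: tmult_tensors tone_tensors)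
 finally show ?thesis using c_unit by (simp add: amitsur_cocycles_def)
qed

lemma trace_field_acv: "to_ac (trace_field P (mn 1 j)) = (SUM y<n. mu y^j)"
using S.trace_field_power by (force simp: trace_field_def to_ac_sum mult_monom red_acv S.red_def)

lemma trace_3_2_acv: "acv (trace_3_2 P b) = trace_3_2 (map_poly to_ac P) (acv b)"
 using S.trace_field_power[OF n_pos]
 by (auto simp: trace_3_2_def fun_eq_iff acv_apply expos_P S.expos_eq to_ac_sum trace_field_acv)

definition cmul :: "(nat list => 'k) => (nat list => 'k) => (nat list => 'k) => nat list => 'k" where
 "cmul c a a' = trace_3_2 P (tensor_mult P 3 (tensor_mult P 3 (face 2 a) c) (face 0 a'))"

lemma cocycle_alg_simps:
 "carrier (cocycle_alg P c) = tensors P 2" "monoid.mult (cocycle_alg P c) = cmul c"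
 "one (cocycle_alg P c) = unit_elt (tensors P 2) (cmul c)" "zero (cocycle_alg P c) = (%_. 0)"
 "add (cocycle_alg P c) = (%a b al. a al+b al)"
proof -
 have "cmul c = (%a a'. trace_3_2 P (face 2 a \<otimes>\<^bsub>tensor_power P 3\<^esub> c \<otimes>\<^bsub>tensor_power P 3\<^esub> face 0 a'))" by (simp add: cmul_def fun_eq_iff)
 thus "carrier (cocycle_alg P c) = tensors P 2" "monoid.mult (cocycle_alg P c) = cmul c"
  "one (cocycle_alg P c) = unit_elt (tensors P 2) (cmul c)" "zero (cocycle_alg P c) = (%_. 0)"
  "add (cocycle_alg P c) = (%a b al. a al+b al)"
  by (simp_all add: cocycle_alg_def Let_def)
qed

lemma cmul_tensors: "cmul c a a' : tensors P 2"
 by (simp add: cmul_def trace_3_2_def tensors_def)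

text \<open>On functions of two points the product of \<open>A(F, c)\<close> is matrix
  multiplication with the weight \<open>c\<close> on each path \<open>x, y, z\<close>.\<close>

lemma evk_cmul:
 assumes "x < n" "z < n"
 shows "evk 2 (cmul c a a') [x, z] = (SUM y<n. evk 2 a [x, y] * evk 3 c [x, y, z] * evk 2 a' [y, z])"
proof -
 have f: "evk 3 (face 2 a) [x, y, z] = evk 2 a [x, y]" "evk 3 (face 0 a') [x, y, z] = evk 2 a' [y, z]" for y using evk_face[of 2 2 "[x, y, z]" a] evk_face[of 0 2 "[x, y, z]" a'] by (simp_all add: eval_nat_numeral)
 have w: "[x, y, z] : words n 3" if "y < n" for y using assms that by (simp add: words_def)
 have "evk 2 (cmul c a a') [x, z] = (SUM y<n. evk 3 (tensor_mult P 3 (tensor_mult P 3 (face 2 a) c) (face 0 a')) [x, y, z])" unfolding evk_def cmul_def trace_3_2_acv by (rule S.ev_trace[OF n_pos])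
 also have "... = (SUM y<n. evk 2 a [x, y] * evk 3 c [x, y, z] * evk 2 a' [y, z])" by (intro sum.cong refl) (simp add: evk_mult[OF w] f)
 finally show ?thesis .
qed

end

section \<open>The algebra as a free module of rank one over the tensor square of
  \<open>F\<close>\<close>

locale gen_elt_split = gen_elt +
 fixes mu :: "nat => 'a alg_closure"
 assumes split: "split_poly (map_poly to_ac P) n mu"
  and reg: "reg_elt m (base_change_sc s) (acv e1) n mu (acv u)"
begin

sublocale R: reg_elt m "base_change_sc s" "acv e1" n mu "acv u" by (rule reg)
sublocale S: k_split_poly P n mu by (rule k_split_poly.intro[OF split n_pos])

abbreviation Kmul (infixl \<open>*.\<close> 70) where "Kmul \<equiv> K.mul"

text \<open>The action on \<open>z\<close> of the pure tensor of \<open>X^a\<close> and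
  \<open>X^b\<close>: the first factor multiplies from the left, the second from the right.\<close>

definition T :: "(nat => 'a) => nat => nat => nat => 'a" where
 "T z a b = mpow e1 u a .* z .* mpow e1 u b"

definition blk :: "(nat => 'a) => nat => nat => nat => 'a alg_closure" where
 "blk z x y = R.ee x *. acv z *. R.ee y"

lemma T_A [simp]: "T z a b : A" by (simp add: T_def)

lemma blk_T: "x < n ==> y < n ==> blk (T z a b) x y = (mu x^a*mu y^b) *c blk z x y"
 unfolding blk_def T_def acv_mul[symmetric] acv_mpow[symmetric] by (rule R.block_power)

lemma blk_linear:
 "blk (z+w) x y = blk z x y+blk w x y" "blk (c *c z) x y = to_ac c *c blk z x y"
 "blk (SUM i:I. f i) x y = (SUM i:I. blk (f i) x y)" "blk 0 x y = 0"
 by (simp_all add: blk_def acv_simps acv_sum K.mul_add_l K.mul_add_r K.msum_l K.msum_r)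

lemma blk_corner: "x < n ==> y < n ==> blk z x y : K.corner (R.ee x) (R.ee y)"
 unfolding blk_def by (rule K.corner_compress) (simp_all add: R.eeD)

lemma blk_ext:
 assumes "z : A" "w : A" "!!x y. x < n ==> y < n ==> blk z x y = blk w x y"
 shows "z = w"
 using R.blocks_ext[OF acv_supp[OF assms(1)] acv_supp[OF assms(2)]] assms(3) by (simp add: blk_def acv_inject)

text \<open>The unit, written as the sum of the idempotents, is inserted between the
  factors.\<close>

lemma blk_mult:
 assumes "z : A"
 shows "blk (z .* w) x y = (SUM k<n. blk z x k *. blk w k y)"
proof -
 have 1: "blk (z .* w) x y = R.ee x *. (acv z *. acv e1) *. acv w *. R.ee y" using assms by (simp add: blk_def acv_mul[symmetric] K.massoc acv_supp)
 have e: "acv e1 = (SUM k<n. R.ee k *. R.ee k)" using R.eeD(3,5) by simp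
 have 2: "acv z *. acv e1 = (SUM k<n. acv z *. (R.ee k *. R.ee k))" by (rule trans[OF arg_cong[OF e, of "%t. acv z *. t"]]) (rule K.msum_r)
 show ?thesis unfolding 1 2 by (simp only: K.msum_l K.msum_r K.massoc blk_def)
qed

lemma blk_scalar:
 assumes "x < n" "y < n" "a : K.corner (R.ee x) (R.ee y)" "a ~= 0" "z : K.corner (R.ee x) (R.ee y)"
 shows "EX c. z = c *c a"
 using R.ee_scalar(2)[OF _ _ assms(1-4) assms(5)] by blast

lemma blk_prod_nz:
 assumes "x < n" "y < n" "z < n" "a : K.corner (R.ee x) (R.ee y)" "a ~= 0" "b : K.corner (R.ee y) (R.ee z)" "b ~= 0"
 shows "a *. b ~= 0"
proof
 assume 0: "a *. b = 0"
 obtain d where d: "d : K.corner (R.ee y) (R.ee x)" "d *. a = R.ee y" using R.ee_scalar(1)[OF _ _ assms(1,2,4,5)] by blast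
 have "b = (d *. a) *. b" using assms(6) d by (simp add: K.corner_def)
 also have "... = 0" using 0 by (simp add: K.massoc)
 finally show False using assms(7) by simp
qed

definition ev2 :: "(nat => nat => 'a) => nat => nat => 'a alg_closure" where
 "ev2 r x y = (SUM a<n. SUM b<n. to_ac (r a b)*(mu x^a*mu y^b))"

lemma blk_act: "x < n ==> y < n ==> blk (SUM a<n. SUM b<n. r a b *c T z a b) x y = ev2 r x y *c blk z x y"
 by (simp add: blk_linear blk_T ev2_def fv.scale_sum_left)

text \<open>
 \<open>A\<close> is free of rank one over \<open>F \<otimes> F\<close>: in each of the one-dimensional blocks over the closure the sum
 of the components of the basis vectors outside the submodule generated by their predecessors is
 the first nonzero component.
\<close>

definition fb_rel :: "nat => (nat => nat => 'a) => (nat => nat => nat => 'a) => bool" where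
 "fb_rel i r w \<longleftrightarrow> (ALL j<i. (SUM a<n. SUM b<n. r a b *c T (bv j) a b) = 0) &
   bv i = (SUM a<n. SUM b<n. r a b *c T (bv i) a b)+(SUM j<i. SUM a<n. SUM b<n. w j a b *c T (bv j) a b)"

text \<open>Let \<open>k\<close> be the first index with nonzero component in block
  \<open>(x, y)\<close>. The second clause of \<open>fb_rel\<close> makes \<open>r k\<close> act as
  1 there, the first makes \<open>r i\<close> act as 0 for \<open>i > k\<close>, so exactly one
  summand survives.\<close>

lemma generator_blk_nz:
 assumes rw: "!!i. i < m ==> fb_rel i (r i) (w i)" and xy: "x < n" "y < n"
 shows "blk (SUM i<m. SUM a<n. SUM b<n. r i a b *c T (bv i) a b) x y ~= 0"
proof -
 have "EX i<m. blk (bv i) x y ~= 0"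
 proof (rule ccontr)
  assume "~(EX i<m. blk (bv i) x y ~= 0)"
  hence 0: "R.ee x *. bv i *. R.ee y = 0" if "i < m" for i using that by (simp add: blk_def acv_simps)
  obtain a where a: "a : K.corner (R.ee x) (R.ee y)" "a ~= 0" using K.corner_nonzero[OF R.idem_ee xy] by blast
  obtain a' where a': "a = (SUM i<m. a' i *c bv i)" using expand_bv[OF K.corner_subset[OF a(1)]] by (rule that)
  have "a = R.ee x *. (SUM i<m. a' i *c bv i) *. R.ee y" using a(1) unfolding a'[symmetric] by (simp add: K.corner_def)
  also have "... = 0" by (simp add: K.msum_l K.msum_r 0)
  finally show False using a(2) by simp
 qed
 hence ex: "EX i. i < m & blk (bv i) x y ~= 0" by blast
 define k where "k = (LEAST i. i < m & blk (bv i) x y ~= 0)"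
 have k: "k < m" "blk (bv k) x y ~= 0" using LeastI_ex[OF ex] unfolding k_def by auto
 have below: "blk (bv i) x y = 0" if "i < k" for i using not_less_Least[OF that[unfolded k_def]] that k(1) by auto
 have part: "ev2 (r i) x y *c blk (bv i) x y = (if i = k then blk (bv k) x y else 0)" if i: "i < m" for i
 proof -
  consider "i < k" | "i = k" | "k < i" by linarith
  thus ?thesis
  proof cases
   case 2
   have "bv k = (SUM a<n. SUM b<n. r k a b *c T (bv k) a b)+(SUM j<k. SUM a<n. SUM b<n. w k j a b *c T (bv j) a b)" using rw[OF k(1)] by (simp add: fb_rel_def)
   from arg_cong[OF this, of "%z. blk z x y"]
   have "blk (bv k) x y = ev2 (r k) x y *c blk (bv k) x y+(SUM j<k. ev2 (w k j) x y *c blk (bv j) x y)" unfolding blk_linear(1) blk_linear(3)[of _ "{..<k}"] blk_act[OF xy] .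
   thus ?thesis using 2 below by simp
  next
   case 3
   hence "ev2 (r i) x y *c blk (bv k) x y = 0" using rw[OF i] using blk_act[OF xy, of "r i" "bv k"] by (simp add: fb_rel_def blk_linear)
   thus ?thesis using k(2) 3 by simp
  qed (simp add: below)
 qed
 have "blk (SUM i<m. SUM a<n. SUM b<n. r i a b *c T (bv i) a b) x y = blk (bv k) x y" using xy using k(1) by (simp add: blk_linear(3)[of _ "{..<m}"] blk_act, simp add: part)
 thus ?thesis using k(2) by simp
qed

text \<open>Solvability over the closure suffices, by the projection \<open>acp\<close>.\<close>

lemma K_blk_T: "x < n ==> y < n ==> R.ee x *. acv (T z a b) *. R.ee y = (mu x^a*mu y^b) *c blk z x y"
 using blk_T[of x y z a b] by (simp add: blk_def)

text \<open>Interpolation at pairs of roots realises any prescribed scalars on the blocks by an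
  element of the tensor square.\<close>

lemma K_blk_act:
 assumes "x < n" "y < n"
 shows "R.ee x *. (SUM a<n. SUM b<n. S.S.interp 2 \<Phi> [a, b] *c acv (T z a b)) *. R.ee y = \<Phi> [x, y] *c blk z x y"
proof -
 have "R.ee x *. (SUM a<n. SUM b<n. S.S.interp 2 \<Phi> [a, b] *c acv (T z a b)) *. R.ee y
   = (SUM a<n. SUM b<n. (S.S.interp 2 \<Phi> [a, b]*(mu x^a*mu y^b)) *c blk z x y)"
  using assms by (simp add: K.msum_l K.msum_r K_blk_T)
 also have "... = S.S.ev 2 (S.S.interp 2 \<Phi>) [x, y] *c blk z x y" by (simp add: S.S.ev_2 fv.scale_sum_left)
 also have "S.S.ev 2 (S.S.interp 2 \<Phi>) [x, y] = \<Phi> [x, y]" by (rule S.S.ev_interp) (use assms in \<open>simp add: words_def\<close>)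
 finally show ?thesis .
qed

lemma acv_proj_sum:
 assumes "(SUM a<n. SUM b<n. f a b *c acv (T z a b)) = acv y"
 shows "(SUM a<n. SUM b<n. acp (f a b) *c T z a b) = y"
proof
 fix l
 have "acp (SUM a<n. SUM b<n. f a b * to_ac (T z a b l)) = y l" using fun_cong[OF assms, of l] by (simp add: fapp acv_apply acp_more)
 thus "(SUM a<n. SUM b<n. acp (f a b) *c T z a b) l = y l" by (simp add: acp_sum acp_more fapp)
qed

text \<open>Over the closure \<open>r\<close> is the indicator of the blocks on which all earlier
  basis vectors vanish. On every other block \<open>bv i\<close> is a multiple of an earlier vector
  that is nonzero there, which gives \<open>w\<close>. Both clauses are linear over
  \<open>k\<close>, so \<open>acp\<close> descends them.\<close>

lemma exists_first_block_rel:
 assumes i: "i < m"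
 shows "EX r w. fb_rel i r w"
proof -
 define dep where "dep xs \<longleftrightarrow> (EX j<i. blk (bv j) (xs ! 0) (xs ! 1) ~= 0)" for xs :: "nat list"
 define fst_j where "fst_j xs = (SOME j. j < i & blk (bv j) (xs ! 0) (xs ! 1) ~= 0)" for xs :: "nat list"
 have fj: "fst_j xs < i" "blk (bv (fst_j xs)) (xs ! 0) (xs ! 1) ~= 0" if "dep xs" for xs using someI_ex[of "%j. j < i & blk (bv j) (xs ! 0) (xs ! 1) ~= 0"] that unfolding dep_def fst_j_def by auto
 have "EX c. blk (bv i) x y = c *c blk (bv (fst_j [x, y])) x y" if "x < n" "y < n" "dep [x, y]" for x y using fj[OF that(3)] blk_scalar[OF that(1,2) blk_corner[OF that(1,2)] _ blk_corner[OF that(1,2)]] by simp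
 then obtain c where c: "!!x y. x < n ==> y < n ==> dep [x, y] ==> blk (bv i) x y = c x y *c blk (bv (fst_j [x, y])) x y" by metis
 let ?F = "%xs. if dep xs then 0 else 1"
 let ?G = "%j xs. if dep xs & fst_j xs = j then c (xs ! 0) (xs ! 1) else 0"
 let ?r = "%a b. S.S.interp 2 ?F [a, b]" and ?w = "%j a b. S.S.interp 2 (?G j) [a, b]"
 have 1: "(SUM a<n. SUM b<n. ?r a b *c acv (T (bv j) a b)) = acv 0" if j: "j < i" for j
 proof (rule R.blocks_ext)
  fix x y assume xy: "x < n" "y < n"
  show "R.ee x *. (SUM a<n. SUM b<n. ?r a b *c acv (T (bv j) a b)) *. R.ee y = R.ee x *. acv 0 *. R.ee y" using K_blk_act[OF xy, of ?F "bv j"] j by (auto simp: acv_simps dep_def)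
 qed (intro spt_sum spt_closed acv_supp T_A, simp add: acv_simps)
 have 2: "(SUM a<n. SUM b<n. ?r a b *c acv (T (bv i) a b))+(SUM j<i. SUM a<n. SUM b<n. ?w j a b *c acv (T (bv j) a b)) = acv (bv i)"
 proof (rule R.blocks_ext)
  fix x y assume xy: "x < n" "y < n"
  have "R.ee x *. (SUM j<i. SUM a<n. SUM b<n. ?w j a b *c acv (T (bv j) a b)) *. R.ee y
    = (SUM j<i. R.ee x *. (SUM a<n. SUM b<n. ?w j a b *c acv (T (bv j) a b)) *. R.ee y)"
   by (simp only: K.msum_l K.msum_r)
  also have "... = (SUM j<i. ?G j [x, y] *c blk (bv j) x y)" by (intro sum.cong refl K_blk_act xy)
  also have "... = (SUM j<i. if fst_j [x, y] = j then (if dep [x, y] then c x y *c blk (bv j) x y else 0) else 0)" by (intro sum.cong refl) simp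
  also have "... = (if dep [x, y] then blk (bv i) x y else 0)" using fj(1)[of "[x, y]"] c[OF xy] by simp
  finally have w: "R.ee x *. (SUM j<i. SUM a<n. SUM b<n. ?w j a b *c acv (T (bv j) a b)) *. R.ee y = (if dep [x, y] then blk (bv i) x y else 0)" .
  show "R.ee x *. ((SUM a<n. SUM b<n. ?r a b *c acv (T (bv i) a b))+(SUM j<i. SUM a<n. SUM b<n. ?w j a b *c acv (T (bv j) a b))) *. R.ee y
    = R.ee x *. acv (bv i) *. R.ee y"
   unfolding K.mul_add_l K.mul_add_r w K_blk_act[OF xy, of ?F "bv i"] by (simp add: blk_def)
 qed (intro spt_sum spt_closed acv_supp T_A, use i in \<open>simp add: acv_supp\<close>)
 have "fb_rel i (%a b. acp (?r a b)) (%j a b. acp (?w j a b))" unfolding fb_rel_def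
 proof (intro conjI allI impI)
  fix j assume "j < i"
  from acv_proj_sum[OF 1[OF this]] show "(SUM a<n. SUM b<n. acp (?r a b) *c T (bv j) a b) = 0" .
 next
  show "bv i = (SUM a<n. SUM b<n. acp (?r a b) *c T (bv i) a b)+(SUM j<i. SUM a<n. SUM b<n. acp (?w j a b) *c T (bv j) a b)"
  proof
   fix l
   have "acp ((SUM a<n. SUM b<n. ?r a b * to_ac (T (bv i) a b l))+(SUM j<i. SUM a<n. SUM b<n. ?w j a b * to_ac (T (bv j) a b l))) = bv i l" using fun_cong[OF 2, of l] by (simp add: fapp acv_apply acp_more)
   thus "bv i l = ((SUM a<n. SUM b<n. acp (?r a b) *c T (bv i) a b)+(SUM j<i. SUM a<n. SUM b<n. acp (?w j a b) *c T (bv j) a b)) l" by (simp only: acp(2) acp_sum acp_more fapp)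
  qed
 qed
 thus ?thesis by blast
qed

end

section \<open>The cocycle defined by a generator\<close>

locale cocycle_data = gen_elt_split +
 fixes v :: "nat => 'a" and c :: "nat list => 'a"
 assumes vA: "v : A" and v_nz: "x < n ==> y < n ==> blk v x y ~= 0"
  and c_tensor: "c : tensors P 3"
  and c_eq: "i < n ==> (SUM a<n. SUM b<n. SUM d<n.
   (c [a, b, d] * trace_field P (mn 1 (b+i))) *c T v a d) = v .* mpow e1 u i .* v"
begin

lemma blk_power_mid:
 assumes "x < n" "z < n"
 shows "blk (v .* mpow e1 u i .* v) x z = (SUM y<n. mu y^i *c (blk v x y *. blk v y z))"
proof -
 have "blk (v .* (mpow e1 u i .* v)) x z = (SUM y<n. blk v x y *. blk (mpow e1 u i .* v) y z)" by (rule blk_mult[OF vA])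
 also have "... = (SUM y<n. mu y^i *c (blk v x y *. blk v y z))"
 proof (intro sum.cong refl)
  fix y assume y: "y : {..<n}"
  have "blk (mpow e1 u i .* v) y z = mu y^i *c blk v y z" using vA using blk_T[of y z v i 0] y assms by (simp add: T_def massoc)
  thus "blk v x y *. blk (mpow e1 u i .* v) y z = mu y^i *c (blk v x y *. blk v y z)" by simp
 qed
 finally show ?thesis by (simp add: massoc)
qed

text \<open>By \<open>c_eq\<close> the differences \<open>d y\<close> of the two sides satisfy the
  Vandermonde equations with weights \<open>mu y^i\<close> for \<open>i < n\<close>, so each of them
  is zero. Thus the values of \<open>c\<close> are the structure constants of the blocks of
  \<open>v\<close>.\<close>

lemma c_evk:
 assumes xyz: "x < n" "y < n" "z < n"
 shows "S.evk 3 c [x, y, z] *c blk v x z = blk v x y *. blk v y z"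
proof -
 define d where "d y = S.evk 3 c [x, y, z] *c blk v x z-blk v x y *. blk v y z" for y
 have eq: "(SUM y<n. mu y^i *c d y) = 0" if i: "i < n" for i
 proof -
  have "(SUM y<n. mu y^i * S.evk 3 c [x, y, z]) = (SUM y<n. SUM a<n. SUM b<n. SUM d<n.
    to_ac (c [a, b, d])*mu y^(b+i)*(mu x^a*mu z^d))"
   by (simp add: S.evk_def S.S.ev_3 acv_apply sum_distrib_left power_add mult_ac)
  also have "... = (SUM a<n. SUM b<n. SUM y<n. SUM d<n. to_ac (c [a, b, d])*mu y^(b+i)*(mu x^a*mu z^d))" by (subst sum.swap, rule sum.cong[OF refl], rule sum.swap)
  also have "... = (SUM a<n. SUM b<n. SUM d<n. SUM y<n. to_ac (c [a, b, d])*mu y^(b+i)*(mu x^a*mu z^d))" by (rule sum.cong[OF refl], rule sum.cong[OF refl], rule sum.swap)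
  also have "... = (SUM a<n. SUM b<n. SUM d<n. to_ac (c [a, b, d] * trace_field P (mn 1 (b+i)))*(mu x^a*mu z^d))" by (simp add: S.trace_field_acv sum_distrib_left sum_distrib_right)
  finally have 1: "(SUM y<n. mu y^i * S.evk 3 c [x, y, z]) = ..." .
  have "(SUM y<n. mu y^i * S.evk 3 c [x, y, z]) *c blk v x z = blk (v .* mpow e1 u i .* v) x z" unfolding c_eq[OF i, symmetric] 1 using xyz by (simp add: blk_linear blk_T fv.scale_sum_left)
  also have "... = (SUM y<n. mu y^i *c (blk v x y *. blk v y z))" by (rule blk_power_mid[OF xyz(1,3)])
  finally show ?thesis by (simp add: d_def fv.scale_right_diff_distrib sum_subtractf fv.scale_sum_left)
 qed
 have "0 = (SUM i<n. S.S.D y i *c (SUM k<n. mu k^i *c d k))" by (simp add: eq)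
 also have "... = (SUM i<n. SUM k<n. (S.S.D y i*mu k^i) *c d k)" by (simp add: fv.scale_sum_right)
 also have "... = (SUM k<n. SUM i<n. (S.S.D y i*mu k^i) *c d k)" by (rule sum.swap)
 also have "... = (SUM k<n. (if y = k then 1 else 0) *c d k)" unfolding fv.scale_sum_left[symmetric] using xyz by (intro sum.cong refl) (simp add: S.S.sum_D')
 also have "... = (SUM k<n. if y = k then d k else 0)" by (intro sum.cong refl) simp
 also have "... = d y" using xyz by simp
 finally show ?thesis by (simp add: d_def)
qed

lemma c_evk_nz: "x < n ==> y < n ==> z < n ==> S.evk 3 c [x, y, z] ~= 0"
 using c_evk[of x y z] blk_prod_nz[of x y z "blk v x y" "blk v y z"] by (auto simp: blk_corner v_nz)

text \<open>The cocycle identity is associativity of the product of the blocks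
  \<open>(x, y)\<close>, \<open>(y, z)\<close> and \<open>(z, w)\<close> of
  \<open>v\<close>.\<close>

lemma c_cocycle: "c : amitsur_cocycles P 2"
proof (rule S.amitsur_cocycleI[OF c_tensor])
 fix xs assume "xs : words n 3"
 then obtain x y z where "xs = [x, y, z]" "x < n" "y < n" "z < n" by (auto simp: words_def eval_nat_numeral length_Suc_conv)
 thus "S.evk 3 c xs ~= 0" using c_evk_nz by simp
next
 fix x y z w assume xyzw: "x < n" "y < n" "z < n" "w < n"
 let ?g = "%x y z. S.evk 3 c [x, y, z]"
 have "(?g y z w*?g x y w) *c blk v x w = ?g y z w *c (blk v x y *. blk v y w)" using c_evk[of x y w] xyzw by (simp add: fv.scale_scale[symmetric] del: fv.scale_scale)
 also have "... = blk v x y *. (blk v y z *. blk v z w)" using c_evk[of y z w] xyzw by (metis K.mul_scale_r)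
 also have "... = ?g x y z *c (blk v x z *. blk v z w)" using c_evk[of x y z] xyzw by (metis K.mul_scale_l K.massoc)
 also have "... = (?g x z w*?g x y z) *c blk v x w" using c_evk[of x z w] xyzw by (simp add: fv.scale_scale[symmetric] mult.commute del: fv.scale_scale)
 finally have "(?g y z w*?g x y w) *c blk v x w = (?g x z w*?g x y z) *c blk v x w" .
 thus "?g y z w*?g x y w = ?g x z w*?g x y z" using v_nz[of x w] xyzw by (simp only: fv.scale_cancel_right) simp
qed

definition E :: "nat list => 'a vec" where "E al = vec m (T v (al ! 0) (al ! 1))"

definition lmap :: "(nat list => 'a) => nat => 'a" where
 "lmap a = (SUM i<n. SUM j<n. a [i, j] *c T v i j)"

lemma lmap_A: "lmap a : A" unfolding lmap_def by (intro spt_sum spt_closed T_A)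

lemma lin_map_E: "(!!al. al : set (expos P 2) ==> E' al = E al) ==> lin_map m P E' a = vec m (lmap a)"
 unfolding lin_map_def lmap_def S.expos_P sum_words_2
 by (auto simp: E_def fapp words_def intro!: sum.cong)

lemma blk_lmap: "x < n ==> y < n ==> blk (lmap a) x y = S.evk 2 a [x, y] *c blk v x y"
 unfolding lmap_def by (simp add: blk_act ev2_def S.evk_def S.S.ev_2 acv_apply)

lemma lmap_inj:
 assumes "a : tensors P 2" "b : tensors P 2" "lmap a = lmap b"
 shows "a = b"
proof (rule S.evk_inject[OF assms(1,2)])
 fix xs assume "xs : words n 2"
 then obtain x y where xy: "xs = [x, y]" "x < n" "y < n" by (auto simp: words_def eval_nat_numeral length_Suc_conv)
 have "S.evk 2 a [x, y] *c blk v x y = S.evk 2 b [x, y] *c blk v x y" using blk_lmap[OF xy(2,3)] assms(3) by metis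
 thus "S.evk 2 a xs = S.evk 2 b xs" unfolding xy(1) using v_nz[OF xy(2,3)] by (simp only: fv.scale_cancel_right) simp
qed

text \<open>Every block of \<open>z\<close> is a multiple of the corresponding block of
  \<open>v\<close>; these multiples are interpolated and projected to \<open>k\<close>.\<close>

lemma lmap_surj:
 assumes z: "z : A"
 shows "EX a:tensors P 2. lmap a = z"
proof -
 have "EX k. blk z x y = k *c blk v x y" if "x < n" "y < n" for x y by (rule blk_scalar[OF that blk_corner[OF that] v_nz[OF that] blk_corner[OF that]])
 then obtain k where k: "!!x y. x < n ==> y < n ==> blk z x y = k x y *c blk v x y" by metis
 let ?b = "S.S.interp 2 (%xs. k (xs ! 0) (xs ! 1))"
 have "(SUM i<n. SUM j<n. ?b [i, j] *c acv (T v i j)) = acv z"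
 proof (rule R.blocks_ext)
  fix x y assume xy: "x < n" "y < n"
  show "R.ee x *. (SUM i<n. SUM j<n. ?b [i, j] *c acv (T v i j)) *. R.ee y = R.ee x *. acv z *. R.ee y" unfolding K_blk_act[OF xy] using k[OF xy] by (simp add: blk_def)
 qed (intro spt_sum spt_closed acv_supp T_A, simp add: acv_supp z)
 from acv_proj_sum[OF this] have "lmap (%al. acp (?b al)) = z" by (simp add: lmap_def)
 moreover have "(%al. acp (?b al)) : tensors P 2" using S.S.interp_tensors[of 2] by (auto simp: tensors_def S.expos_P S.S.expos_eq acp_more)
 ultimately show ?thesis by blast
qed

lemma lmap_mult: "lmap (S.cmul c a a') = lmap a .* lmap a'"
proof (rule blk_ext)
 fix x z assume xz: "x < n" "z < n"
 have "blk (lmap a .* lmap a') x z = (SUM y<n. (S.evk 2 a [x, y] * S.evk 3 c [x, y, z] * S.evk 2 a' [y, z]) *c blk v x z)" unfolding blk_mult[OF lmap_A] using xz using xz by (simp add: blk_lmap mult.commute c_evk[symmetric] mult_ac)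
 also have "... = blk (lmap (S.cmul c a a')) x z" by (simp add: blk_lmap[OF xz] S.evk_cmul[OF xz] fv.scale_sum_left)
 finally show "blk (lmap (S.cmul c a a')) x z = blk (lmap a .* lmap a') x z" by simp
qed (simp_all add: lmap_A)

lemma lmap_add: "lmap (%al. a al+b al) = lmap a+lmap b"
 by (simp add: lmap_def fv.scale_left_distrib sum.distrib)

lemma lin_map_iso:
 assumes E': "!!al. al : set (expos P 2) ==> E' al = E al"
 shows "lin_map m P E' : ring_iso (cocycle_alg P c) (sc_alg m s)"
proof -
 have L: "lin_map m P E' = (%a. vec m (lmap a))" using lin_map_E[OF E'] by blast
 have inj: "a = b" if "a : tensors P 2" "b : tensors P 2" "vec m (lmap a) = vec m (lmap b)" for a b using lmap_inj[OF that(1,2)] arg_cong[OF that(3), of "fvec m"] by (simp only: fvec_vec[OF lmap_A])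
 obtain a1 where a1: "a1 : tensors P 2" "lmap a1 = e1" using lmap_surj[of e1] by auto
 \<comment> \<open>No formula for the unit of \<open>A(F, c)\<close> is used: the preimage of
   \<open>e1\<close> is a unit because the map is injective and multiplicative.\<close>
 have "unit_elt (tensors P 2) (S.cmul c) = a1"
 proof (rule unit_eltI[OF a1(1)])
  fix a assume a: "a : tensors P 2"
  show "S.cmul c a1 a = a & S.cmul c a a1 = a" using lmap_inj[OF S.cmul_tensors a] lmap_A[of a] by (simp add: lmap_mult a1(2))
 qed
 hence one: "one (cocycle_alg P c) = a1" by (simp add: S.cocycle_alg_simps)
 show ?thesis unfolding L
 proof (rule ring_iso_memI)
  show "bij_betw (%a. vec m (lmap a)) (carrier (cocycle_alg P c)) (carrier (sc_alg m s))" unfolding bij_betw_def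
  proof
   show "inj_on (%a. vec m (lmap a)) (carrier (cocycle_alg P c))" by (intro inj_onI inj) (simp_all add: S.cocycle_alg_simps)
   have "w : (%a. vec m (lmap a)) ` tensors P 2" if w: "w : carrier_vec m" for w
   proof -
    obtain a where "a : tensors P 2" "lmap a = fvec m w" using lmap_surj[of "fvec m w"] by auto
    thus ?thesis using vec_fvec[OF w] by (intro image_eqI[of _ _ a]) auto
   qed
   thus "(%a. vec m (lmap a)) ` carrier (cocycle_alg P c) = carrier (sc_alg m s)" by (auto simp: S.cocycle_alg_simps)
  qed
 qed (simp_all add: S.cocycle_alg_simps(1,2,5) sc_alg_mult sc_mul_vec lmap_mult lmap_add vec_add one a1 sc_one)
qed

end

context gen_elt_split begin

text \<open>Products of blocks of \<open>v\<close> are multiples of blocks of \<open>v\<close>, and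
  a tensor over the closure interpolates these multiples as a function of three points. Pairing with
  the trace form in the middle variable turns its property into linear equations over
  \<open>k\<close>, which \<open>acp\<close> descends.\<close>

lemma exists_cocycle:
 assumes vA: "v : A" and v_nz: "!!x y. x < n ==> y < n ==> blk v x y ~= 0"
 shows "EX c:tensors P 3. ALL i<n. (SUM a<n. SUM b<n. SUM d<n.
   (c [a, b, d] * trace_field P (mn 1 (b+i))) *c T v a d) = v .* mpow e1 u i .* v"
proof -
 have "EX k. blk v x y *. blk v y z = k *c blk v x z" if "x < n" "y < n" "z < n" for x y z using that by (intro blk_scalar[OF _ _ blk_corner v_nz] K.corner_mult[OF blk_corner blk_corner])
 then obtain k where k: "!!x y z. x < n ==> y < n ==> z < n ==> blk v x y *. blk v y z = k x y z *c blk v x z" by metis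
 let ?c = "S.S.interp 3 (%xs. k (xs ! 0) (xs ! 1) (xs ! 2))"
 let ?t = "%j. trace_field P (mn 1 j)"
 have ev: "S.S.ev 3 ?c [x, y, z] = k x y z" if "x < n" "y < n" "z < n" for x y z using that by (subst S.S.ev_interp) (simp_all add: words_def eval_nat_numeral)
 have 1: "(SUM a<n. SUM b<n. SUM d<n. (?c [a, b, d] * to_ac (?t (b+i))) *c acv (T v a d)) = acv (v .* mpow e1 u i .* v)" if i: "i < n" for i
 proof (rule R.blocks_ext)
  fix x z assume xz: "x < n" "z < n"
  have "R.ee x *. (SUM a<n. SUM b<n. SUM d<n. (?c [a, b, d] * to_ac (?t (b+i))) *c acv (T v a d)) *. R.ee z
    = (SUM a<n. SUM b<n. SUM d<n. ?c [a, b, d] * to_ac (?t (b+i))*(mu x^a*mu z^d)) *c blk v x z"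
   using xz by (simp add: K.msum_l K.msum_r K_blk_T fv.scale_sum_left)
  also have "(SUM a<n. SUM b<n. SUM d<n. ?c [a, b, d] * to_ac (?t (b+i))*(mu x^a*mu z^d))
    = (SUM a<n. SUM b<n. SUM d<n. SUM y<n. mu y^i*(?c [a, b, d]*(mu x^a*mu y^b*mu z^d)))"
   by (simp add: S.trace_field_acv sum_distrib_left sum_distrib_right power_add mult_ac)
  also have "... = (SUM a<n. SUM b<n. SUM y<n. SUM d<n. mu y^i*(?c [a, b, d]*(mu x^a*mu y^b*mu z^d)))" by (rule sum.cong[OF refl], rule sum.cong[OF refl], rule sum.swap)
  also have "... = (SUM a<n. SUM y<n. SUM b<n. SUM d<n. mu y^i*(?c [a, b, d]*(mu x^a*mu y^b*mu z^d)))" by (rule sum.cong[OF refl], rule sum.swap)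
  also have "... = (SUM y<n. SUM a<n. SUM b<n. SUM d<n. mu y^i*(?c [a, b, d]*(mu x^a*mu y^b*mu z^d)))" by (rule sum.swap)
  also have "... = (SUM y<n. mu y^i * k x y z)" using xz by (intro sum.cong refl) (simp add: ev[symmetric] S.S.ev_3 sum_distrib_left)
  finally have "R.ee x *. (SUM a<n. SUM b<n. SUM d<n. (?c [a, b, d] * to_ac (?t (b+i))) *c acv (T v a d)) *. R.ee z
    = (SUM y<n. mu y^i *c (k x y z *c blk v x z))" by (simp add: fv.scale_sum_left)
  also have "... = (SUM y<n. blk v x y *. blk (mpow e1 u i .* v) y z)"
  proof (intro sum.cong refl)
   fix y assume y: "y : {..<n}"
   have "blk (mpow e1 u i .* v) y z = mu y^i *c blk v y z" using vA using blk_T[of y z v i 0] y xz by (simp add: T_def massoc)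
   thus "mu y^i *c (k x y z *c blk v x z) = blk v x y *. blk (mpow e1 u i .* v) y z" using k[of x y z] xz y by simp
  qed
  also have "... = R.ee x *. acv (v .* mpow e1 u i .* v) *. R.ee z" using blk_mult[OF vA, of "mpow e1 u i .* v" x z] by (simp add: blk_def massoc)
  finally show "R.ee x *. (SUM a<n. SUM b<n. SUM d<n. (?c [a, b, d] * to_ac (?t (b+i))) *c acv (T v a d)) *. R.ee z
    = R.ee x *. acv (v .* mpow e1 u i .* v) *. R.ee z" .
 qed (intro spt_sum spt_closed acv_supp T_A, simp add: acv_supp)
 show ?thesis
 proof (intro bexI[of _ "%al. acp (?c al)"] allI impI ext)
  show "(%al. acp (?c al)) : tensors P 3" using S.S.interp_tensors[of 3] by (auto simp: tensors_def S.expos_P S.S.expos_eq acp_more)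
  fix i l assume i: "i < n"
  have "acp (SUM a<n. SUM b<n. SUM d<n. ?c [a, b, d] * to_ac (?t (b+i) * T v a d l)) = (v .* mpow e1 u i .* v) l" using fun_cong[OF 1[OF i], of l] by (simp add: fapp acv_apply mult.assoc acp_more)
  thus "(SUM a<n. SUM b<n. SUM d<n. (acp (?c [a, b, d])*?t (b+i)) *c T v a d) l = (v .* mpow e1 u i .* v) l" by (simp only: acp_sum acp_more fapp mult.assoc)
 qed
qed

end

subsection \<open>Functions that are polynomial of bounded degree\<close>

text \<open>Degrees are bounded in one variable at a time, which is enough for the zero count and
  avoids multivariate polynomials.\<close>

definition polyf :: "nat => ('a::field => 'a) => bool" where
 "polyf d f \<longleftrightarrow> (EX p. degree p <= d & f = poly p)"

lemma polyf_mono: "polyf d f ==> d <= d' ==> polyf d' f"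
 unfolding polyf_def by (elim exE) (rule exI, auto)

lemma polyf_const [simp]: "polyf d (%t. c)"
 unfolding polyf_def by (intro exI[of _ "[:c:]"]) auto

lemma polyf_linear: "d >= 1 ==> polyf d (%t. a+t * b)"
 unfolding polyf_def by (intro exI[of _ "[:a, b:]"]) auto

lemma polyf_add: assumes "polyf d f" "polyf d g" shows "polyf d (%t. f t+g t)"
using assms by (force simp: polyf_def intro!: degree_add_le)

lemma polyf_mult: "polyf d f ==> polyf d' g ==> polyf (d+d') (%t. f t * g t)"
proof -
 assume "polyf d f" "polyf d' g"
 then obtain p q where "degree p <= d" "f = poly p" "degree q <= d'" "g = poly q" by (auto simp: polyf_def)
 thus ?thesis unfolding polyf_def using degree_mult_le[of p q] by (intro exI[of _ "p * q"]) auto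
qed

lemma polyf_cmult: "polyf d f ==> polyf d (%t. c * f t)"
 using polyf_mult[of 0 "%_. c" d f] by simp

lemma polyf_sum: "(!!i. i : I ==> polyf d (%t. f t i)) ==> polyf d (%t. SUM i:I. f t i)"
 by (induct I rule: ifi) (simp_all add: polyf_add)

lemma polyf_prod: "(!!i. i : I ==> polyf d (%t. f t i)) ==> polyf (card I * d) (%t. PROD i:I. f t i)"
proof (induct I rule: ifi)
 case (insert i I)
 thus ?case using polyf_mult[of d "%t. f t i" "card I * d" "%t. PROD i:I. f t i"] by simp
qed simp_all

lemma polyf_roots:
 assumes "polyf d f" "f t0 ~= 0"
 shows "finite {t. f t = 0}" "card {t. f t = 0} <= d"
proof -
 obtain p where p: "degree p <= d" "f = poly p" using assms(1) by (auto simp: polyf_def)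
 hence "p ~= 0" using assms(2) by auto
 thus "finite {t. f t = 0}" "card {t. f t = 0} <= d" using poly_roots_finite[of p] card_poly_roots_bound[of p] p by auto
qed

definition polyfp :: "nat => ('a::field => 'a poly) => bool" where
 "polyfp d P \<longleftrightarrow> (ALL i. polyf d (%t. coeff (P t) i))"

lemma polyfp_mult: "polyfp d P ==> polyfp d' Q ==> polyfp (d+d') (%t. P t * Q t)"
 unfolding polyfp_def coeff_mult by (auto intro!: polyf_sum polyf_mult)

lemma polyfp_prod: "(!!i. i : I ==> polyfp d (%t. f t i)) ==> polyfp (card I * d) (%t. PROD i:I. f t i)"
proof (induct I rule: ifi)
 case (insert i I)
 thus ?case using polyfp_mult[of d "%t. f t i" "card I * d" "%t. PROD i:I. f t i"] by simp
qed (simp_all add: polyfp_def)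

lemma polyf_det:
 assumes A: "!!t. A t : carrier_mat n n" and e: "!!i j. i < n ==> j < n ==> polyf d (%t. A t $$ (i, j))"
 shows "polyf (n * d) (%t. det (A t))"
proof -
 have "polyf (n * d) (%t. SUM p:{p. p permutes {0..<n}}. signof p*(PROD i=0..<n. A t $$ (i, p i)))"
 proof (intro polyf_sum polyf_cmult)
  fix p assume "p : {p. p permutes {0..<n}}"
  hence "p i < n" if "i < n" for i using that permutes_in_image[of p "{0..<n}" i] by auto
  thus "polyf (n * d) (%t. PROD i=0..<n. A t $$ (i, p i))" using polyf_prod[of "{0..<n}" d "%t i. A t $$ (i, p i)"] e by simp
 qed
 thus ?thesis unfolding det_def'[OF A] .
qed

text \<open>The entries of the characteristic matrix have coefficients of degree at most
  \<open>d\<close> in \<open>t\<close>; the Leibniz formula multiplies \<open>n\<close> of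
  them.\<close>

lemma polyfp_char_poly:
 fixes A :: "'a::field => 'a mat"
 assumes A: "!!t. A t : carrier_mat n n" and e: "!!i j. i < n ==> j < n ==> polyf d (%t. A t $$ (i, j))"
 shows "polyf (n * d) (%t. coeff (char_poly (A t)) k)"
proof -
 have entry: "polyfp d (%t. char_poly_matrix (A t) $$ (i, j))" if "i < n" "j < n" for i j unfolding polyfp_def
 proof
  fix k
  have eq: "coeff (char_poly_matrix (A t) $$ (i, j)) k = (if k = 0 then-(A t $$ (i, j)) else if k = 1 & i = j then 1 else 0)" for t using that A[of t] by (auto simp: char_poly_matrix_def coeff_pCons split: nat.splits)
  show "polyf d (%t. coeff (char_poly_matrix (A t) $$ (i, j)) k)" unfolding eq using polyf_cmult[OF e[OF that], of "- 1"] by (cases "k = 0") auto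
 qed
 have sg: "polyf (n * d) (%t. coeff (signof p * P t) k)" if "polyfp (n * d) P" for P :: "'a => 'a poly" and p :: "nat => nat" using that polyf_cmult[of "n * d" "%t. coeff (P t) k" "- 1"] by (cases "sign p = 1") (auto simp: polyfp_def sign_def)
 have "polyf (n * d) (%t. SUM p:{p. p permutes {0..<n}}. coeff (signof p*(PROD i=0..<n. char_poly_matrix (A t) $$ (i, p i))) k)"
 proof (intro polyf_sum sg)
  fix p assume "p : {p. p permutes {0..<n}}"
  hence "p i < n" if "i < n" for i using that permutes_in_image[of p "{0..<n}" i] by auto
  thus "polyfp (n * d) (%t. PROD i=0..<n. char_poly_matrix (A t) $$ (i, p i))" using polyfp_prod[of "{0..<n}" d "%t i. char_poly_matrix (A t) $$ (i, p i)"] entry by simp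
 qed
 moreover have "char_poly_matrix (A t) : carrier_mat n n" for t using A[of t] by simp
 ultimately show ?thesis unfolding char_poly_def by (simp only: det_def'[of _ n] coeff_sum)
qed

text \<open>
 Coordinatewise form of the Schwartz-Zippel bound: pass from the witness \<open>w\<close> to a point of the grid
 one coordinate at a time.
\<close>

lemma grid_zeros_bound:
 fixes f :: "(nat => 'a::field) => 'a"
 assumes S: "finite S" and f: "!!x i. i < m ==> polyf d (%t. f (x(i := t)))" and w: "f w ~= 0"
 defines "Z \<equiv> %k. {x. (ALL i<k. x i : S) & (ALL i>=k. x i = w i)}"
 shows "k <= m ==> finite (Z k) & card (Z k) = card S^k & card S * card {x : Z k. f x = 0} <= k * d * card S^k"
proof (induct k)
 case 0
 have "Z 0 = {w}" by (auto simp: Z_def)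
 thus ?case using w by simp
next
 case (Suc k)
 have eq: "Z (Suc k) = (%(x, t). x(k := t)) ` (Z k \<times> S)"
 proof (intro equalityI subsetI)
  fix x assume x: "x : Z (Suc k)"
  hence "x = (x(k := w k))(k := x k)" "x(k := w k) : Z k" "x k : S" by (auto simp: Z_def less_Suc_eq)
  thus "x : (%(x, t). x(k := t)) ` (Z k \<times> S)" by (intro image_eqI[of _ _ "(x(k := w k), x k)"]) auto
 qed (auto simp: Z_def less_Suc_eq)
 have inj: "inj_on (%(x, t). x(k := t)) (Z k \<times> S)"
 proof (rule inj_onI, safe)
  fix x t y t' assume *: "x : Z k" "y : Z k" "x(k := t) = y(k := t')"
  have "x i = y i" for i using fun_cong[OF *(3), of i] *(1,2) by (cases "i = k") (auto simp: Z_def)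
  thus "x = y" by blast
  show "t = t'" using fun_cong[OF *(3), of k] by simp
 qed
 have fin: "finite (Z k)" and card: "card (Z k) = card S^k" and IH: "card S * card {x : Z k. f x = 0} <= k * d * card S^k" using Suc by auto
 let ?bad = "{x : Z k. f x = 0}"
 let ?Z = "%x. {t : S. f (x(k := t)) = 0}"
 \<comment> \<open>A zero at stage \<open>k + 1\<close> lies over a zero at stage \<open>k\<close>,
   with any new entry, or over a nonzero, where at most \<open>d\<close> new entries are
   zeros.\<close>
 have "{x : Z (Suc k). f x = 0} <= (%(x, t). x(k := t)) ` (?bad \<times> S \<union> Sigma (Z k-?bad) ?Z)" unfolding eq by auto
 hence "card {x : Z (Suc k). f x = 0} <= card (?bad \<times> S \<union> Sigma (Z k-?bad) ?Z)" using fin S by (intro surj_card_le) auto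
 also have "... <= card (?bad \<times> S) + card (Sigma (Z k-?bad) ?Z)" by (rule card_Un_le)
 also have "card (Sigma (Z k-?bad) ?Z) = (SUM x:Z k-?bad. card (?Z x))" using fin S by (subst card_SigmaI) auto
 also have "... <= (SUM x:Z k-?bad. d)"
 proof (rule sum_mono)
  fix x assume x: "x : Z k-?bad"
  hence "f (x(k := x k)) ~= 0" by auto
  have "polyf d (%t. f (x(k := t)))" using f Suc(2) by simp
  note R = polyf_roots[where f = "%t. f (x(k := t))", OF this `f (x(k := x k)) ~= 0`]
  show "card (?Z x) <= d" by (rule order_trans[OF card_mono[OF R(1)] R(2)]) blast
 qed
 also have "... <= card S^k * d" using card fin by (simp add: card_Diff_subset)
 finally have "card {x : Z (Suc k). f x = 0} <= card S * card ?bad + card S^k * d" by (simp add: card_cartesian_product mult.commute)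
 also have "... <= k * d * card S^k + card S^k * d" using IH by simp
 finally have "card S * card {x : Z (Suc k). f x = 0} <= card S*(k * d * card S^k + card S^k * d)" by simp
 thus ?case using fin S card unfolding eq by (simp add: card_image[OF inj] card_cartesian_product algebra_simps)
qed

subsection \<open>Most elements are regular\<close>

context acs_alg begin

text \<open>Were the field finite, the product of all \<open>X - a\<close> plus 1 would have no
  root.\<close>

lemma infinite_scalars: "infinite (UNIV :: 'a set)"
proof
 assume fin: "finite (UNIV :: 'a set)"
 let ?p = "(PROD a:UNIV. [:- a, 1:])+1 :: 'a poly"
 have "degree (PROD a:UNIV. [:- a, 1:] :: 'a poly) = card (UNIV :: 'a set)" by (subst degree_prod_eq_sum_degree) auto
 moreover have "card (UNIV :: 'a set) > 0" using fin by (simp add: card_gt_0_iff)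
 ultimately have "degree ?p > 0" by (subst degree_add_eq_left) simp_all
 then obtain x where "poly ?p x = 0" using alg_closed_imp_poly_has_root by blast
 moreover have "poly (PROD a:UNIV. [:- a, 1:]) x = 0" using fin by (auto simp: poly_prod)
 ultimately show False by simp
qed

text \<open>The representation on the left ideal \<open>A e 0\<close>, with one basis vector in each
  \<open>e x A e 0\<close>. Its dimension \<open>n\<close> matters: in the regular representation
  every eigenvalue would be repeated \<open>n\<close> times.\<close>

lemma exists_representation:
 assumes fam: "idem n e" and nn: "n * n = m"
 shows "EX v ph. (ALL x<n. v x : corner (e x) (e 0) & v x ~= 0) &
  (ALL u. ph u : carrier_mat n n) & (ALL u:A. ALL y<n. u .* v y = (SUM x<n. ph u $$ (x, y) *c v x)) &
  (ALL u w x y c. x < n --> y < n --> ph (u + c *c w) $$ (x, y) = ph u $$ (x, y) + c*ph w $$ (x, y))"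
proof -
 have n0: "n > 0" using fam e1_nz by (cases n) (auto simp: idem_def)
 note D = idemD[OF fam]
 have "ALL x. EX a. x < n --> a : corner (e x) (e 0) & a ~= 0" using corner_nonzero[OF fam] n0 by blast
 then obtain v where v: "!!x. x < n ==> v x : corner (e x) (e 0) & v x ~= 0" by metis
 have block: "EX c. z = c *c e x" if "x < n" "z : corner (e x) (e x)" for x z by (rule family_block[OF fam nn that])
 have "EX c. e x .* z .* e 0 = c *c v x" if x: "x < n" for z x using v[OF x] by (intro block_scalar(2)[OF fam block x n0 _ _ corner_compress[OF D(5)[OF x] D(5)[OF n0]]]) auto
 hence "ALL z x. EX c. x < n --> e x .* z .* e 0 = c *c v x" by blast
 then obtain c where c: "!!z x. x < n ==> e x .* z .* e 0 = c z x *c v x" by metis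
 have c_lin: "c (z+k *c w) x = c z x+k * c w x" if x: "x < n" for z w k x
 proof -
  have "c (z+k *c w) x *c v x = e x .* (z+k *c w) .* e 0" using c[OF x] by simp
  also have "... = c z x *c v x+k *c c w x *c v x" by (simp add: mul_add_l mul_add_r c[OF x])
  also have "... = (c z x+k * c w x) *c v x" by (simp add: fv.scale_left_distrib)
  finally show ?thesis using v[OF x] by (simp only: fv.scale_cancel_right) simp
 qed
 define ph where "ph u = mat n n (%(x, y). c (u .* v y) x)" for u
 show ?thesis
 proof (intro exI[of _ v] exI[of _ ph] conjI allI impI ballI)
  fix u y assume u: "u : A" and y: "y < n"
  have "u .* v y = (SUM x<n. e x) .* (u .* v y) .* e 0" using v[OF y] D(3) by (simp add: corner_def massoc)
  also have "... = (SUM x<n. ph u $$ (x, y) *c v x)" using y by (simp add: msum_l c ph_def)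
  finally show "u .* v y = (SUM x<n. ph u $$ (x, y) *c v x)" .
 qed (use v in \<open>auto simp: ph_def mul_add_l c_lin\<close>)
qed

definition regular :: "nat => (nat => 'a) => bool" where
 "regular n u \<longleftrightarrow> (EX mu. reg_elt m s e1 n mu u)"

lemma eigen_independent:
 assumes "(SUM x<n. k x *c v x) = 0" "idem n e" "!!x. x < n ==> v x : corner (e x) (e 0) & v x ~= 0" "y < n"
 shows "k y = 0"
proof -
 note D = idemD[OF assms(2)]
 have "0 = e y .* (SUM x<n. k x *c v x)" using assms(1) by simp
 also have "... = (SUM x<n. if y = x then k y *c v y else 0)" unfolding msum_r
 proof (intro sum.cong refl)
  fix x assume "x : {..<n}"
  hence x: "x < n" by simp
  have "e y .* v x = (e y .* e x) .* v x" using assms(3)[OF x] by (simp add: corner_def massoc)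
  thus "e y .* (k x *c v x) = (if y = x then k y *c v y else 0)" using D(2)[OF assms(4) x] assms(3)[OF x] by (auto simp: corner_def)
 qed
 also have "... = k y *c v y" using assms(4) by simp
 finally show ?thesis using assms(3)[OF assms(4)] by simp
qed

text \<open>At a double root of the characteristic polynomial an eigenvector is killed by the
  derivative evaluated at \<open>u\<close>, so the determinant would be 0. Hence there are
  \<open>n\<close> distinct eigenvalues. The determinant stands in for the discriminant and is
  visibly polynomial in \<open>u\<close>.\<close>

lemma regular_if_separable:
 assumes fam: "idem n e" and nn: "n * n = m" and u: "u : A"
  and v: "!!x. x < n ==> v x : corner (e x) (e 0) & v x ~= 0"
  and ph: "!!u. ph u : carrier_mat n n" "!!u y. u : A ==> y < n ==> u .* v y = (SUM x<n. ph u $$ (x, y) *c v x)"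
  and det: "det (ph (peval e1 (pderiv (char_poly (ph u))) u)) ~= 0"
 shows "regular n u"
proof -
 let ?c = "char_poly (ph u)"
 let ?w = "%w. SUM x<n. vec_index w x *c v x"
 have act: "z .* ?w w = ?w (ph z *\<^sub>v w)" if "z : A" "w : carrier_vec n" for z w
 proof -
  have "z .* ?w w = (SUM x<n. SUM y<n. (vec_index w y*ph z $$ (x, y)) *c v x)" by (simp add: msum_r ph(2)[OF that(1)] fv.scale_sum_right, rule sum.swap)
  also have "... = ?w (ph z *\<^sub>v w)" using that(2) ph(1)[of z] by (intro sum.cong refl) (auto simp: fv.scale_sum_left[symmetric] scalar_prod_def lessThan_atLeast0 mult.commute intro!: arg_cong2[where f = fscale] sum.cong)
  finally show ?thesis .
 qed
 have w_nz: "?w w ~= 0" if "w : carrier_vec n" "w ~= 0\<^sub>v n" for w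
 proof
  assume "?w w = 0"
  hence "vec_index w y = 0" if "y < n" for y using eigen_independent[OF _ fam v that] by blast
  with that show False by (auto intro!: eq_vecI)
 qed
 have wA: "?w w : A" for w using v corner_subset by (intro spt_sum spt_closed) blast
 have eigvec: "EX w:carrier_vec n. w ~= 0\<^sub>v n & u .* ?w w = c *c ?w w" if "poly ?c c = 0" for c
 proof -
  have "eigenvalue (ph u) c" using that eigenvalue_root_char_poly[OF ph(1)] by blast
  then obtain w where "eigenvector (ph u) w c" unfolding eigenvalue_def by blast
  hence w: "w : carrier_vec n" "w ~= 0\<^sub>v n" "ph u *\<^sub>v w = c \<cdot>\<^sub>v w" using ph(1)[of u] by (auto simp: eigenvector_def)
  have "u .* ?w w = c *c ?w w" unfolding act[OF u w(1)] w(3) using w(1) by (simp add: fv.scale_sum_right)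
  with w show ?thesis by blast
 qed
 have simple: "poly (pderiv ?c) c ~= 0" if c: "poly ?c c = 0" for c
 proof
  assume 0: "poly (pderiv ?c) c = 0"
  obtain w where w: "w : carrier_vec n" "w ~= 0\<^sub>v n" "u .* ?w w = c *c ?w w" using eigvec[OF c] by blast
  let ?z = "peval e1 (pderiv ?c) u"
  have "u : corner e1 e1" using u by (simp add: corner_def)
  moreover have "e1 .* e1 = e1" by simp
  ultimately have zA: "?z : A" using peval_corner(1) corner_subset by blast
  have "?w (ph ?z *\<^sub>v w) = 0" using peval_eigenvector[OF wA w(3)] 0 using act[OF zA w(1)] by simp
  hence "ph ?z *\<^sub>v w = 0\<^sub>v n" using w_nz[of "ph ?z *\<^sub>v w"] ph(1)[of ?z] w(1) by (metis mult_mat_vec_carrier)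
  thus False using det det_0_iff_vec_prod_zero_field[OF ph(1)] w by blast
 qed
 have deg: "degree ?c = n" "lead_coeff ?c = 1" using degree_monic_char_poly[OF ph(1)] by auto
 hence "?c ~= 0" by auto
 from alg_closed_imp_factorization[OF this] deg obtain R where R: "size R = n" "?c = (PROD x:#R. [:-x, 1:])" by auto
 obtain xs where xs: "mset xs = R" using ex_mset by blast
 define mu where "mu i = xs ! i" for i
 have len: "length xs = n" using R xs by auto
 have "(PROD x:#R. [:-x, 1:]) = prod_list (map (%x. [:-x, 1:]) xs)" unfolding xs[symmetric] mset_map[symmetric] prod_mset_prod_list ..
 also have "... = (PROD i<n. [:- mu i, 1:])" unfolding mu_def using len by (simp add: prod.list_conv_set_nth lessThan_atLeast0)
 finally have split: "?c = (PROD i<n. [:- mu i, 1:])" using R by simp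
 have root: "poly ?c (mu i) = 0" if "i < n" for i using that unfolding split by (auto simp: poly_prod)
 have inj: "inj_on mu {..<n}"
 proof (rule inj_onI, rule ccontr)
  fix i j assume ij: "i : {..<n}" "j : {..<n}" "mu i = mu j" "i ~= j"
  let ?r = "PROD k:{..<n} - {i} - {j}. [:- mu k, 1:]"
  have c: "?c = [:- mu i, 1:]*([:- mu i, 1:]*?r)" unfolding split using ij prod.remove[of "{..<n}" i "%k. [:- mu k, 1:]"] prod.remove[of "{..<n} - {i}" j "%k. [:- mu k, 1:]"] by simp
  have "poly (pderiv (q*(q * r))) x = 0" if "poly q x = 0" for q r :: "'a poly" and x using that by (simp add: pderiv_mult)
  hence "poly (pderiv ?c) (mu i) = 0" unfolding c by this simp
  with simple[OF root] ij show False by auto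
 qed
 have "ALL i. EX w. i < n --> w : carrier_vec n & w ~= 0\<^sub>v n & u .* ?w w = mu i *c ?w w" using eigvec root by blast
 from choice[OF this]
 obtain w where w: "!!i. i < n ==> w i : carrier_vec n & w i ~= 0\<^sub>v n & u .* ?w (w i) = mu i *c ?w (w i)" by blast
 have "reg_elt m s e1 n mu u"
 proof (rule reg_eltI_eigen[OF nn u fam inj, of "%i. ?w (w i)"])
  show "?w (w i) ~= 0" if "i < n" for i using w[OF that] w_nz by blast
  show "?w (w i) .* e 0 = ?w (w i)" for i using v by (simp add: msum_l corner_def)
 qed (use w wA in auto)
 thus ?thesis by (auto simp: regular_def)
qed

lemma polyf_mul:
 assumes "!!l. polyf d (%t. x t l)" "!!l. polyf d' (%t. y t l)"
 shows "polyf (d+d') (%t. (x t .* y t) l)"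
 using assms by (cases "l < m") (auto simp: mul_def mult.commute[of _ "s _ _ _"] intro!: polyf_sum polyf_cmult polyf_mult)

text \<open>\<open>G\<close> detects regularity and has degree at most \<open>2 * m\<close> in each
  coordinate: coefficients of the characteristic polynomial contribute \<open>n\<close>, powers of
  \<open>u\<close> less than \<open>n\<close>, and the determinant multiplies by \<open>n\<close>.
  It is nonzero at a diagonal element with distinct entries.\<close>

theorem nonregular_bound:
 assumes nn: "n * n = m" and S: "finite S"
 shows "card S * card {x. (ALL i<m. x i : S) & (ALL i>=m. x i = 0) & ~regular n x} <= 2 * m^2 * card S^m"
  and "finite {x. (ALL i<m. x i : S) & (ALL i>=m. x i = (0 :: 'a))}"
  and "card {x. (ALL i<m. x i : S) & (ALL i>=m. x i = (0 :: 'a))} = card S^m"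
proof -
 obtain n' e where fam: "idem n' e" "n' * n' = m" using exists_square_fam by blast
 hence "n' = n" using power2_eq_imp_eq zero_le using nn by (auto simp: power2_eq_square)
 hence fam: "idem n e" using fam by simp
 have n0: "n > 0" using fam e1_nz by (cases n) (auto simp: idem_def)
 note D = idemD[OF fam]
 obtain v ph where v: "!!x. x < n ==> v x : corner (e x) (e 0) & v x ~= 0"
  and ph: "!!u. ph u : carrier_mat n n" "!!u y. u : A ==> y < n ==> u .* v y = (SUM x<n. ph u $$ (x, y) *c v x)"
  "!!u w x y c. x < n ==> y < n ==> ph (u + c *c w) $$ (x, y) = ph u $$ (x, y) + c*ph w $$ (x, y)"
  using exists_representation[OF fam nn] by (elim exE conjE) blast
 have ph0: "ph 0 $$ (x, y) = 0" if "x < n" "y < n" for x y using ph(3)[OF that, of 0 "- 1" 0] by simp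
 have phsum: "ph (SUM i:I. c i *c g i) $$ (x, y) = (SUM i:I. c i*ph (g i) $$ (x, y))"
  if "x < n" "y < n" for x y I and c :: "nat => 'a" and g :: "nat => nat => 'a"
 proof (induct I rule: ifi)
  case (insert i I)
  show ?case unfolding sum.insert[OF insert(1,2)] add.commute[of "c i *c g i"] ph(3)[OF that] insert(3) by (simp only: add.commute)
 qed (simp_all only: sum.infinite sum.empty ph0[OF that] not_False_eq_True)
 \<comment> \<open>\<open>cut\<close> makes \<open>G\<close> a function of arbitrary sequences, as
   \<open>grid_zeros_bound\<close> requires.\<close>
 define cut where "cut x = (%i. if i < m then x i else 0 :: 'a)" for x
 have cutA: "cut x : A" for x by (simp add: cut_def spt_def)
 define G where "G x = det (ph (peval e1 (pderiv (char_poly (ph (cut x)))) (cut x)))" for x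
 have poly: "polyf (2 * m) (%t. G (x(i := t)))" if i: "i < m" for x i
 proof -
  define z where "z = cut (x(i := 0))"
  define U where "U t = cut (x(i := t))" for t
  have ueq: "U t = z+t *c bv i" for t using i by (auto simp: U_def z_def cut_def bv_def fun_eq_iff fapp)
  have u: "polyf 1 (%t. U t l)" for l unfolding ueq fapp by (rule polyf_linear) simp
  have phu: "polyf 1 (%t. ph (U t) $$ (a, b))" if "a < n" "b < n" for a b unfolding ueq ph(3)[OF that] by (rule polyf_linear) simp
  have ch: "polyf n (%t. coeff (char_poly (ph (U t))) k)" for k using polyfp_char_poly[of "%t. ph (U t)" n 1 k] ph(1) phu by simp
  have pw: "polyf k (%t. mpow e1 (U t) k l)" for k l
  proof (induct k arbitrary: l)
   case (Suc k)
   show ?case using polyf_mul[OF u Suc] by simp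
  qed simp
  have pe: "peval e1 (pderiv (char_poly (ph (U t)))) (U t) =
    (SUM k<n. (of_nat (Suc k) * coeff (char_poly (ph (U t))) (Suc k)) *c mpow e1 (U t) k)" for t
  proof -
   have "degree (pderiv (char_poly (ph (U t)))) < n \<or> pderiv (char_poly (ph (U t))) = 0" using degree_monic_char_poly[OF ph(1), of "U t"] n0 degree_pderiv_le[of "char_poly (ph (U t))"] by auto
   thus ?thesis unfolding peval_altdef coeff_pderiv[symmetric] using n0 by (intro sum.mono_neutral_left) (auto simp: coeff_eq_0)
  qed
  have ent: "polyf (n+n) (%t. ph (peval e1 (pderiv (char_poly (ph (U t)))) (U t)) $$ (a, b))" if ab: "a < n" "b < n" for a b
  proof -
   have "polyf k (%t. ph (mpow e1 (U t) k) $$ (a, b))" for k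
   proof -
    have mA: "mpow e1 z k : A" for z by (cases k) auto
    have "ph (mpow e1 (U t) k) $$ (a, b) = (SUM l<m. mpow e1 (U t) k l*ph (bv l) $$ (a, b))" for t using phsum[OF ab, of "mpow e1 (U t) k" bv "{..<m}"] expand_bv[OF mA, of "U t"] by simp
    thus ?thesis using polyf_sum[of "{..<m}" k "%t l. ph (bv l) $$ (a, b) * mpow e1 (U t) k l"] polyf_cmult[OF pw] by (simp add: mult.commute)
   qed
   hence *: "polyf (n+n) (%t. of_nat (Suc k)*(coeff (char_poly (ph (U t))) (Suc k)*ph (mpow e1 (U t) k) $$ (a, b)))"
    if "k < n" for k
    using that by (intro polyf_cmult polyf_mono[OF polyf_mult[OF ch]]) auto
   show ?thesis unfolding pe phsum[OF ab] mult.assoc by (intro polyf_sum *) simp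
  qed
  show ?thesis using polyf_det[OF ph(1) ent] unfolding G_def U_def[symmetric] using nn by (simp add: distrib_left mult_2)
 qed
 obtain mu :: "nat => 'a" where mu: "inj mu" using infinite_scalars infinite_countable_subset by blast
 define w where "w = (SUM x<n. mu x *c e x)"
 have wA: "w : A" unfolding w_def using D(4) by (intro spt_sum) simp
 have cw: "cut w = w" using wA by (auto simp: cut_def spt_def)
 have ev: "e x .* v y = (if x = y then v y else 0)" if "x < n" "y < n" for x y
 proof -
  have "e x .* v y = (e x .* e y) .* v y" using v[OF that(2)] by (simp add: corner_def massoc)
  thus ?thesis using D(2)[OF that] v[OF that(2)] by (auto simp: corner_def)
 qed
 have diag: "ph z $$ (x, y) = (if x = y then k y else 0)"
  if z: "z : A" "!!y. y < n ==> z .* v y = k y *c v y" and xy: "x < n" "y < n" for z k x y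
 proof -
  have "(SUM x<n. (ph z $$ (x, y)-(if x = y then k y else 0)) *c v x) = (SUM x<n. ph z $$ (x, y) *c v x)-(SUM x<n. if x = y then k y *c v y else 0)" unfolding sum_subtractf[symmetric] by (intro sum.cong refl) (simp add: fv.scale_left_diff_distrib)
  also have "... = 0" using ph(2)[OF z(1) xy(2)] z(2)[OF xy(2)] xy by simp
  finally show ?thesis using eigen_independent[OF _ fam v xy(1)] by fastforce
 qed
 have det_diag: "det M = (PROD x<n. k x)" and ch_diag: "char_poly M = (PROD x<n. [:- k x, 1:])"
  if M: "M : carrier_mat n n" "!!x y. x < n ==> y < n ==> M $$ (x, y) = (if x = y then k y else 0)" for M k
 proof -
  have ut: "upper_triangular M" using M by (auto simp: upper_triangular_def)
  have dm: "diag_mat M = map k [0..<n]" using M by (auto simp: diag_mat_def)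
  show "det M = (PROD x<n. k x)" using det_upper_triangular[OF ut M(1)] dm by (simp add: prod.list_conv_set_nth lessThan_atLeast0)
  show "char_poly M = (PROD x<n. [:- k x, 1:])" using char_poly_upper_triangular[OF M(1) ut] dm by (simp add: prod.list_conv_set_nth lessThan_atLeast0)
 qed
 have wv: "w .* v y = mu y *c v y" if y: "y < n" for y
 proof -
  have "w .* v y = (SUM x<n. if x = y then mu y *c v y else 0)" unfolding w_def msum_l using y by (intro sum.cong refl) (auto simp: ev)
  thus ?thesis using y by simp
 qed
 have chw: "char_poly (ph w) = (PROD x<n. [:- mu x, 1:])" by (rule ch_diag[OF ph(1) diag[OF wA wv]])
 let ?z = "peval e1 (pderiv (char_poly (ph w))) w"
 have e11: "e1 .* e1 = e1" by simp
 have "w : corner e1 e1" using wA by (simp add: corner_def)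
 hence zA: "?z : A" using peval_corner(1)[OF e11] corner_subset by blast
 have zv: "?z .* v y = poly (pderiv (char_poly (ph w))) (mu y) *c v y" if "y < n" for y using v[OF that] corner_subset by (intro peval_eigenvector wv that) blast
 have "G w = (PROD x<n. poly (pderiv (char_poly (ph w))) (mu x))" unfolding G_def cw by (rule det_diag[OF ph(1) diag[OF zA zv]])
 also have "... ~= 0"
 proof -
  have "poly (pderiv (char_poly (ph w))) (mu x) ~= 0" if x: "x < n" for x
  proof -
   have "char_poly (ph w) = [:- mu x, 1:]*(PROD y:{..<n} - {x}. [:- mu y, 1:])" unfolding chw using x by (subst prod.remove[of _ x]) auto
   hence "poly (pderiv (char_poly (ph w))) (mu x) = (PROD y:{..<n} - {x}. mu x-mu y)" by (simp add: pderiv_mult pderiv_pCons poly_prod del: mult_pCons_left)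
   thus ?thesis using mu by (auto simp: inj_eq)
  qed
  thus ?thesis by auto
 qed
 finally have Gw: "G w ~= 0" .
 have w0: "w i = 0" if "i >= m" for i using wA that by (simp add: spt_def)
 let ?Z = "{x. (ALL i<m. x i : S) & (ALL i>=m. x i = 0)}"
 have Zeq: "{x. (ALL i<m. x i : S) & (ALL i>=m. x i = w i)} = ?Z" using w0 by auto
 from grid_zeros_bound[OF S poly Gw, of m m, unfolded Zeq]
 have fin: "finite ?Z" and card: "card ?Z = card S^m" and bd: "card S * card {x : ?Z. G x = 0} <= m*(2 * m) * card S^m" by auto
 show "finite ?Z" "card ?Z = card S^m" by fact+
 have "regular n x" if "x : ?Z" "G x ~= 0" for x
 proof -
  have xA: "x : A" and cx: "cut x = x" using that(1) by (auto simp: spt_def cut_def)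
  show ?thesis using that(2) regular_if_separable[OF fam nn xA v ph(1,2)] unfolding G_def cx by blast
 qed
 hence "{x. (ALL i<m. x i : S) & (ALL i>=m. x i = 0) & ~regular n x} <= {x : ?Z. G x = 0}" by blast
 hence "card {x. (ALL i<m. x i : S) & (ALL i>=m. x i = 0) & ~regular n x} <= card {x : ?Z. G x = 0}" by (intro card_mono finite_subset[OF _ fin]) auto
 hence "card S * card {x. (ALL i<m. x i : S) & (ALL i>=m. x i = 0) & ~regular n x} <= card S * card {x : ?Z. G x = 0}" by simp
 from order_trans[OF this bd]
 show "card S * card {x. (ALL i<m. x i : S) & (ALL i>=m. x i = 0) & ~regular n x} <= 2 * m^2 * card S^m" by (simp add: power2_eq_square ac_simps)
qed

end

section \<open>Regularity in terms of linear systems\<close>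

context acs_alg begin

lemma regular_power_rel:
 assumes "reg_elt m s e1 n mu u"
 shows "mpow e1 u n = (SUM i<n. (- coeff (PROD x<n. [:- mu x, 1:]) i) *c mpow e1 u i)"
proof -
 interpret R: reg_elt m s e1 n mu u by (rule assms)
 let ?P = "PROD x<n. [:- mu x, 1:]"
 have d: "degree ?P = n" by (rule degree_prod_linear)
 have "lead_coeff ?P = 1" by (rule monic_prod) simp
 hence l: "coeff ?P n = 1" by (simp only: d)
 have "0 = (SUM i<n. coeff ?P i *c mpow e1 u i)+mpow e1 u n" using R.ann unfolding peval_altdef d lessThan_Suc_atMost[symmetric] sum.lessThan_Suc l by simp
 from fun_cong[OF this] have 0: "(SUM i<n. coeff ?P i * mpow e1 u i l)+mpow e1 u n l = 0" for l by (simp add: fapp)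
 show ?thesis
 using 0 by (auto simp: fapp sum_negf add_eq_0_iff)
qed

lemma regular_ind:
 assumes "reg_elt m s e1 n mu u" "(SUM i<n. c i *c mpow e1 u i) = 0" "i < n"
 shows "c i = 0"
proof (rule ccontr)
 interpret R: reg_elt m s e1 n mu u by (rule assms(1))
 assume "c i ~= 0"
 let ?q = "SUM i<n. mn (c i) i"
 have "coeff ?q i = c i" using assms(3) by (simp add: coeff_sum if_distrib cong: if_cong)
 hence "?q ~= 0" using `c i ~= 0` by auto
 moreover have "degree ?q < n" using R.n_pos by (intro degree_sum_less) (auto intro: le_less_trans[OF degree_monom_le])
 ultimately have "peval e1 ?q u ~= 0" by (rule R.ind)
 thus False using assms(2) by (simp add: peval_sum peval_monom)
qed

text \<open>In the basis of idempotents the derivative at \<open>u\<close> is diagonal with entries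
  \<open>P'(mu x)\<close>, which are nonzero because the roots are simple.\<close>

lemma regular_sep:
 assumes "reg_elt m s e1 n mu u"
 shows "EX d:A. peval e1 (pderiv (PROD x<n. [:- mu x, 1:])) u .* d = e1"
proof -
 interpret R: reg_elt m s e1 n mu u by (rule assms)
 let ?P = "PROD x<n. [:- mu x, 1:]"
 have nz: "poly (pderiv ?P) (mu x) ~= 0" if x: "x < n" for x
 proof -
  have P: "?P = [:- mu x, 1:]*(PROD y:{..<n} - {x}. [:- mu y, 1:])" using x by (subst prod.remove[of _ x]) auto
  have "poly (pderiv ?P) (mu x) = (PROD y:{..<n} - {x}. mu x-mu y)" unfolding P by (simp add: pderiv_mult pderiv_pCons poly_prod del: mult_pCons_left)
  thus ?thesis using R.inj x by (auto simp: inj_on_def)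
 qed
 let ?d = "SUM x<n. inverse (poly (pderiv ?P) (mu x)) *c R.ee x"
 have "peval e1 (pderiv ?P) u .* ?d = (SUM y<n. SUM x<n. (poly (pderiv ?P) (mu x) * inverse (poly (pderiv ?P) (mu y))) *c (R.ee x .* R.ee y))" unfolding R.peval_expand msum_l msum_r by (intro sum.cong refl) (simp add: mult.commute)
 also have "... = (SUM y<n. SUM x<n. if x = y then R.ee x else 0)" using nz by (intro sum.cong refl) (auto simp: R.eeD)
 also have "... = e1" using R.eeD(3) by simp
 finally have "peval e1 (pderiv ?P) u .* ?d = e1" .
 moreover have "?d : A" using R.eeD(4) by (intro spt_sum spt_closed) simp
 ultimately show ?thesis by blast
qed

end

text \<open>
 Regularity over the closure is visible over the base field: the linear systems the algorithm
 solves have coefficients there.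
\<close>

context cs_alg begin

interpretation K: acs_alg m "base_change_sc s" "acv e1" by (rule acs_alg_base_change)

lemma descend_power_rel:
 assumes "acv z = (SUM i:I. c i *c acv (g i))"
 shows "z = (SUM i:I. acp (c i) *c g i)"
proof
 fix l
 have "acp (to_ac (z l)) = acp (SUM i:I. c i * to_ac (g i l))" using fun_cong[OF assms, of l] by (simp add: fapp acv_apply)
 thus "z l = (SUM i:I. acp (c i) *c g i) l" by (simp add: acp_more acp_sum fapp)
qed

lemma regular_descent:
 assumes reg: "reg_elt m (base_change_sc s) (acv e1) n mu (acv u)" and u: "u : A"
 shows "EX p. mpow e1 u n = (SUM i<n. p i *c mpow e1 u i)"
  and "~(EX c. mpow e1 u (n-1) = (SUM i<n-1. c i *c mpow e1 u i))"
  and "mpow e1 u n = (SUM i<n. p i *c mpow e1 u i) ==>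
   EX d:A. peval e1 (pderiv (mn 1 n-(SUM i<n. mn (p i) i))) u .* d = e1"
proof -
 interpret R: reg_elt m "base_change_sc s" "acv e1" n mu "acv u" by (rule reg)
 let ?c = "%i. - coeff (PROD x<n. [:- mu x, 1:]) i"
 have Krel: "acv (mpow e1 u n) = (SUM i<n. ?c i *c acv (mpow e1 u i))"
  using K.regular_power_rel[OF reg] by (simp only: acv_mpow)
 from descend_power_rel[OF this]
 show "EX p. mpow e1 u n = (SUM i<n. p i *c mpow e1 u i)" by (rule exI[of _ "%i. acp (?c i)"])
 show "~(EX c. mpow e1 u (n-1) = (SUM i<n-1. c i *c mpow e1 u i))"
 proof
  assume "EX c. mpow e1 u (n-1) = (SUM i<n-1. c i *c mpow e1 u i)"
  then obtain c where c: "mpow e1 u (n-1) = (SUM i<n-1. c i *c mpow e1 u i)" by blast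
  let ?d = "%i. if i = n-1 then-1 else to_ac (c i)"
  have n: "n = Suc (n-1)" using R.n_pos by simp
  have "(SUM i<n. ?d i *c K.mpow (acv e1) (acv u) i) = (SUM i<n-1. to_ac (c i) *c acv (mpow e1 u i))+(- 1) *c acv (mpow e1 u (n-1))" by (subst n, subst sum.lessThan_Suc) (simp add: acv_mpow)
  also have "(SUM i<n-1. to_ac (c i) *c acv (mpow e1 u i)) = acv (mpow e1 u (n-1))" unfolding c by (simp add: acv_simps acv_sum)
  also have "acv (mpow e1 u (n-1))+(- 1) *c acv (mpow e1 u (n-1)) = 0" by (simp add: fun_eq_iff fapp)
  finally have "?d (n-1) = 0" using K.regular_ind[OF reg, of ?d "n-1"] R.n_pos by simp
  thus False by simp
 qed
 assume p: "mpow e1 u n = (SUM i<n. p i *c mpow e1 u i)"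
 let ?P = "mn 1 n-(SUM i<n. mn (p i) i)"
 \<comment> \<open>Independence of the powers over the closure identifies any solution
   \<open>p\<close> over \<open>k\<close> with the coefficients of the split polynomial, so the
   claim holds for whichever \<open>p\<close> a solver returns.\<close>
 have pc: "to_ac (p i) = ?c i" if "i < n" for i
 proof -
  have "(SUM i<n. (to_ac (p i)-?c i) *c K.mpow (acv e1) (acv u) i) =
    (SUM i<n. to_ac (p i) *c K.mpow (acv e1) (acv u) i)-(SUM i<n. ?c i *c K.mpow (acv e1) (acv u) i)"
   by (simp only: fv.scale_left_diff_distrib sum_subtractf)
  also have "(SUM i<n. to_ac (p i) *c K.mpow (acv e1) (acv u) i) = acv (mpow e1 u n)" unfolding p by (simp add: acv_simps acv_sum acv_mpow)
  also have "(SUM i<n. ?c i *c K.mpow (acv e1) (acv u) i) = acv (mpow e1 u n)" using K.regular_power_rel[OF reg] by (simp only: acv_mpow)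
  also have "acv (mpow e1 u n)-acv (mpow e1 u n) = 0" by (rule diff_self)
  finally have "(SUM i<n. (to_ac (p i)-?c i) *c K.mpow (acv e1) (acv u) i) = 0" .
  from K.regular_ind[OF reg this that] show ?thesis by (simp only: right_minus_eq)
 qed
 have d: "degree (PROD x<n. [:- mu x, 1:]) = n" by (rule degree_prod_linear)
 have "lead_coeff (PROD x<n. [:- mu x, 1:]) = 1" by (rule monic_prod) simp
 hence l: "coeff (PROD x<n. [:- mu x, 1:]) n = 1" by (simp only: d)
 have P: "map_poly to_ac ?P = (PROD x<n. [:- mu x, 1:])"
 proof (rule poly_eqI)
  fix i
  consider "i < n" | "i = n" | "n < i" by linarith
  thus "coeff (map_poly to_ac ?P) i = coeff (PROD x<n. [:- mu x, 1:]) i" by cases (simp_all add: coeff_map_poly coeff_sum pc l d coeff_eq_0 if_distrib cong: if_cong)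
 qed
 obtain D where D: "D : K.A" "K.mul (K.peval (acv e1) (pderiv (PROD x<n. [:- mu x, 1:])) (acv u)) D = acv e1" using K.regular_sep[OF reg] by blast
 have "map_poly to_ac (pderiv ?P) = pderiv (map_poly to_ac ?P)" by (rule poly_eqI) (simp add: coeff_map_poly coeff_pderiv ac.hom_mult ac.hom_of_nat del: of_nat_Suc)
 hence "K.mul (acv (peval e1 (pderiv ?P) u)) D = acv e1" using D(2) unfolding P[symmetric] by (simp only: acv_peval[symmetric])
 \<comment> \<open>Multiplication by an element over \<open>k\<close> is given by a matrix over
   \<open>k\<close>, so it commutes with \<open>acp\<close>.\<close>
 moreover have "z .* (%i. acp (D i)) = e1" if "K.mul (acv z) D = acv e1" for z
 proof
  fix l
  have pe: "acp (K.mul (acv z) D l) = acp (to_ac (e1 l))" unfolding that acv_apply ..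
  thus "(z .* (%i. acp (D i))) l = e1 l"
  proof (cases "l < m")
   case True
   have "acp (to_ac (z i) * D j * to_ac (s i j l)) = z i * acp (D j) * s i j l" for i j using acp(3)[of "z i" "D j"] acp_more(3) by metis
   hence pk: "acp (K.mul (acv z) D l) = (z .* (%i. acp (D i))) l" using True unfolding K.mul_def unfolding mul_def base_change_sc_def by (simp add: acp_sum acv_apply)
   thus ?thesis using pe unfolding pk by (simp only: acp_more)
  next
   case False
   thus ?thesis using e1_supp by (simp add: mul_def spt_def)
  qed
 qed
 moreover have "(%i. acp (D i)) : A" using D(1) by (simp add: spt_def acp_more)
 ultimately show "EX d:A. peval e1 (pderiv ?P) u .* d = e1" by blast
qed

end

subsection \<open>Finite subfields and Lang's theorem\<close>

text \<open>Closure under sums and products is enough to ask for: negatives and inverses follow from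
  finiteness.\<close>

locale fin_subfield =
 fixes T :: "'a::alg_closed_field set"
 assumes fin: "finite T" and T0: "0 : T" and T1: "1 : T"
  and Tadd: "x : T ==> y : T ==> x+y : T" and Tmul: "x : T ==> y : T ==> x * y : T"
begin

abbreviation q :: nat where "q \<equiv> card T"

lemma q_ge: "q >= 2"
 using card_mono[OF fin, of "{0, 1}"] T0 T1 by simp

text \<open>Translation by \<open>x\<close> is injective on a finite set, so it attains 0.\<close>

lemma Tneg: assumes "x : T" shows "- x : T"
proof -
 have "(%y. x+y) ` T = T" by (rule endo_inj_surj[OF fin]) (use assms Tadd in \<open>auto simp: inj_on_def\<close>)
 then obtain y where "y : T" "x+y = 0" using T0 by (metis imageE)
 thus ?thesis using minus_unique by blast
qed

lemma Tdiff: "x : T ==> y : T ==> x-y : T" using Tadd[OF _ Tneg, of x y] by simp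

text \<open>Multiplication by a nonzero \<open>x\<close> permutes the nonzero elements; comparing
  their products gives \<open>x^(q-1) = 1\<close>.\<close>

lemma Tpow: assumes x: "x : T" shows "x^q = x"
proof (cases "x = 0")
 case False
 let ?U = "T - {0}"
 have "(%y. x * y) ` ?U = ?U" by (rule endo_inj_surj) (use False x fin Tmul in \<open>auto simp: inj_on_def\<close>)
 hence "(PROD y:?U. y) = (PROD y:?U. x * y)" using False by (subst prod.reindex[of "%y. x * y" ?U "%y. y", symmetric, simplified o_def]) (auto simp: inj_on_def)
 also have "... = x^(q-1)*(PROD y:?U. y)" using fin T0 by (simp add: prod.distrib)
 finally have "x^(q-1) = 1" using fin by simp
 thus ?thesis using q_ge power_minus_mult[of q x] by simp
qed (use q_ge in simp)

abbreviation f where "f \<equiv> PROD t:T. [:- t, 1:]"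

lemma degree_f: "degree f = q" and coeff_f: "coeff f q = 1"
proof -
 show d: "degree f = q" by (subst degree_prod_eq_sum_degree) auto
 have "lead_coeff f = 1" by (rule monic_prod) simp
 thus "coeff f q = 1" by (simp only: d)
qed

lemma zero_if_roots:
 assumes "!!t. t : T ==> poly g t = 0" "!!k. k >= q ==> coeff g k = 0"
 shows "g = 0"
proof (rule ccontr)
 assume g: "g ~= 0"
 have "degree g < q" using g assms(2) leading_coeff_0_iff linorder_not_le by blast
 moreover have "q <= card {x. poly g x = 0}" using assms(1) g by (intro card_mono poly_roots_finite) auto
 ultimately show False using card_poly_roots_bound[OF g] by simp
qed

text \<open>\<open>f\<close> and \<open>X^q - X\<close> are both monic of degree \<open>q\<close>
  and agree at the \<open>q\<close> points of \<open>T\<close>.\<close>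

lemma poly_f: "poly f x = x^q-x"
proof -
 have "f-(mn 1 q-mn 1 1) = 0"
 proof (rule zero_if_roots)
  fix t assume "t : T"
  thus "poly (f-(mn 1 q-mn 1 1)) t = 0" using fin Tpow by (auto simp: poly_prod poly_monom)
 next
  fix k assume "k >= q"
  thus "coeff (f-(mn 1 q-mn 1 1)) k = 0" using q_ge coeff_f degree_f coeff_eq_0[of f k] by (cases "k = q") auto
 qed
 thus ?thesis by (simp add: poly_monom)
qed

definition fr :: "'a => 'a" where "fr x = x^q"

lemma fr_T: "fr x = x \<longleftrightarrow> x : T"
proof
 assume "fr x = x"
 hence "poly f x = 0" by (simp add: poly_f fr_def)
 thus "x : T" using fin by (auto simp: poly_prod)
qed (simp add: fr_def Tpow)

text \<open>The polynomial \<open>X ^ q - X\<close> is additive because its set of roots is an additive group.\<close>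

lemma fr_add: "fr (x + c) = fr x+fr c"
proof -
 let ?g = "pcompose f [:c, 1:]-f - [:poly f c:]"
 have shift: "poly f (t + c) = poly f c" if t: "t : T" for t
 proof -
  \<comment> \<open>Translation by an element of \<open>T\<close> permutes \<open>T\<close>, so
    \<open>f\<close> is invariant under it.\<close>
  have "(PROD s:T. t + c - s) = (PROD s:T. c - s)" by (rule prod.reindex_bij_witness[of _ "%s. s+t" "%s. s-t"]) (use t Tadd Tdiff in auto)
  thus ?thesis by (simp add: poly_prod)
 qed
 have "?g = 0"
 proof (rule zero_if_roots)
  fix t assume t: "t : T"
  hence "poly f t = 0" by (simp add: poly_f Tpow)
  thus "poly ?g t = 0" using shift[OF t] by (simp add: poly_pcompose add.commute)
 next
  fix k assume k: "k >= q"
  have dp: "degree (pcompose f [:c, 1:]) = q" by (simp add: degree_pcompose degree_f)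
  have "lead_coeff (pcompose f [:c, 1:]) = lead_coeff f * lead_coeff [:c, 1:]^degree f" by (rule lead_coeff_comp) simp
  hence "coeff (pcompose f [:c, 1:]) q = 1" by (simp add: dp degree_f coeff_f)
  thus "coeff ?g k = 0" using k q_ge coeff_f degree_f dp coeff_eq_0[of f k] coeff_eq_0[of "pcompose f [:c, 1:]" k] by (cases "k = q") (auto simp: coeff_pCons split: nat.splits)
 qed
 hence "poly ?g x = 0" by simp
 thus ?thesis by (simp add: poly_pcompose poly_f fr_def algebra_simps)
qed

lemma fr_simps: "fr 0 = 0" "fr 1 = 1" "fr (x * y) = fr x * fr y" "fr x = 0 \<longleftrightarrow> x = 0"
 using q_ge by (auto simp: fr_def power_mult_distrib)

lemma fr_minus: "fr (- x) = - fr x" using fr_add[of x "- x"] fr_simps(1) by (simp add: add_eq_0_iff)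

lemma fr_diff: "fr (x-y) = fr x-fr y" using fr_add[of x "- y"] fr_minus by simp

lemma fr_inj: "fr x = fr y \<longleftrightarrow> x = y" using fr_simps(4)[of "x-y"] by (simp add: fr_diff)

lemma fr_sum: "fr (SUM i:I. g i) = (SUM i:I. fr (g i))"
 by (induct I rule: ifi) (simp_all add: fr_simps fr_add)

lemma fr_surj: "EX y. fr y = x"
 unfolding fr_def using nth_root_exists[of q x] q_ge by auto

lemma artin_schreier: "EX y. fr y-y = x"
proof -
 have "coeff (f - [:x:]) q = 1" using q_ge coeff_f by (auto simp: coeff_pCons split: nat.splits)
 hence "degree (f - [:x:]) > 0" using le_degree[of "f - [:x:]" q] q_ge by auto
 then obtain y where "poly (f - [:x:]) y = 0" using alg_closed_imp_poly_has_root by blast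
 thus ?thesis by (auto simp: poly_f fr_def)
qed

text \<open>The conditions make \<open>c i\<close> a polynomial \<open>g i\<close> in
  \<open>y\<close> of degree \<open>q^(i+1)\<close>, and the last one reads
  \<open>g k (y) = y\<close>. As \<open>q >= 2\<close>, every \<open>g i\<close> is divisible by
  \<open>X^2\<close>, so \<open>g k - X = X * (X * r - 1)\<close>, and the second factor has a root,
  which is not 0.\<close>

lemma lang_root:
 assumes "a 0 ~= 0"
 shows "EX y c. y ~= 0 & c 0 = a 0 * fr y & (ALL i. c (Suc i) = fr (c i)+a (Suc i) * fr y) & c k = y"
proof -
 define g where "g = rec_nat (mn (a 0) q) (%i p. p^q+mn (a (Suc i)) q)"
 have g: "g 0 = mn (a 0) q" "g (Suc i) = g i^q+mn (a (Suc i)) q" for i by (simp_all add: g_def)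
 have deg: "degree (g i) = q^Suc i" for i
 proof (induct i)
  case 0 thus ?case using assms by (simp add: g degree_monom_eq)
 next
  case (Suc i)
  have "g i ~= 0" using Suc q_ge by auto
  hence d: "degree (g i^q) = q * q^Suc i" using Suc by (simp add: degree_power_eq)
  have "1 < q^Suc i" using q_ge by (intro one_less_power) auto
  hence "q*1 < q * q^Suc i" using q_ge by (intro mult_strict_left_mono) auto
  hence "degree (mn (a (Suc i)) q) < degree (g i^q)" unfolding d using degree_monom_le[of "a (Suc i)" q] by linarith
  thus ?case unfolding g by (simp add: degree_add_eq_left d)
 qed
 have X2: "mn 1 2 dvd (mn b q :: 'a poly)" for b
 proof
  have "2+(q-2) = q" using q_ge by simp
  thus "mn b q = mn 1 2 * mn b (q-2)" by (simp only: mult_monom mult_1_left)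
 qed
 have dvd: "mn 1 2 dvd g i" for i
 proof (induct i)
  case (Suc i)
  have "mn 1 2 dvd g i^q" using Suc q_ge by (cases q) (auto intro: dvd_mult2)
  thus ?case unfolding g by (intro dvd_add X2)
 qed (simp add: g X2)
 obtain r where r: "g k = mn 1 2 * r" using dvd[of k] by (elim dvdE)
 have "r ~= 0" using deg[of k] q_ge using r by auto
 hence "coeff (pCons 0 r-1) (Suc (degree r)) ~= 0" by simp
 from le_degree[OF this] have "degree (pCons 0 r-1) > 0" by linarith
 then obtain y where y: "poly (pCons 0 r-1) y = 0" using alg_closed_imp_poly_has_root by blast
 hence "y ~= 0" by auto
 moreover have "poly (g k) y = y" using y by (simp add: r poly_monom power2_eq_square algebra_simps)
 ultimately show ?thesis by (intro exI[of _ y] exI[of _ "%i. poly (g i) y"]) (simp add: g poly_monom fr_def)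
qed

text \<open>A maximal independent set \<open>C\<close> of fixed vectors must span. Otherwise the
  iterates of a vector outside yield, by \<open>lang_root\<close>, a vector that is fixed modulo the
  span of \<open>C\<close>, and an Artin-Schreier equation corrects it by an element of the span to
  a new fixed vector. This is Lang's theorem for the general linear group.\<close>

lemma lang:
 fixes th :: "('i => 'a) => 'i => 'a"
 assumes V: "fv.subspace V" "!!x. x : V ==> th x : V"
  and add: "!!x y. x : V ==> y : V ==> th (x+y) = th x+th y"
  and sc: "!!c x. x : V ==> th (c *c x) = fr c *c th x"
  and inj: "!!x. x : V ==> th x = 0 ==> x = 0"
  and B: "finite B" "V <= fv.span B"
 shows "\<exists>C\<subseteq>V. finite C & fv.independent C & fv.span C = V & (ALL x:C. th x = x)"
proof -
 note Vc = fv.subspace_0[OF V(1)] fv.subspace_add[OF V(1)] fv.subspace_scale[OF V(1)] fv.subspace_diff[OF V(1)] fv.subspace_sum[OF V(1)]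
 have th0: "th 0 = 0" using sc[OF Vc(1), of 0] by (simp add: fr_simps)
 have thsum: "th (SUM i:I. c i *c g i) = (SUM i:I. fr (c i) *c th (g i))" if "!!i. i : I ==> g i : V" for I c and g :: "'j => 'i => 'a" using that
 proof (induct I rule: ifi)
  case (insert i I)
  hence "(SUM i:I. c i *c g i) : V" by (intro Vc(5) Vc(3)) auto
  have gi: "g i : V" and IH: "th (SUM i:I. c i *c g i) = (SUM i:I. fr (c i) *c th (g i))" using insert by auto
  show ?case unfolding sum.insert[OF insert(1,2)] add[OF Vc(3)[OF gi] `(SUM i:I. c i *c g i) : V`] IH sc[OF gi] ..
 qed (simp_all only: sum.infinite sum.empty th0 not_False_eq_True)
 have inj2: "x = y" if "x : V" "y : V" "th x = th y" for x y
 proof -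
  have "th (x-y) = 0" using add[OF Vc(4)[OF that(1,2)] that(2)] using that(3) by simp
  thus ?thesis using inj[OF Vc(4)[OF that(1,2)]] by simp
 qed
 let ?ok = "%C. C <= V & fv.independent C & (ALL x:C. th x = x)"
 have bound: "finite C & card C <= card B" if "C <= V" "fv.independent C" for C using fv.independent_span_bound[OF B(1) that(2)] that(1) B(2) by blast
 have "?ok {}" by (simp add: fv.independent_empty)
 from ex_has_greatest_nat[of ?ok, OF this, of card "Suc (card B)"] bound
 obtain C where C: "C <= V" "fv.independent C" "!!x. x : C ==> th x = x" and mx: "!!C'. ?ok C' ==> card C' <= card C" by (auto simp: less_Suc_eq_le)
 have fC: "finite C" using bound C by blast
 have CV: "fv.span C <= V" using C(1) V(1) by (rule fv.span_minimal)
 have exp: "EX r. x = (SUM w:C. r w *c w)" if "x : fv.span C" for x using that unfolding fv.span_finite[OF fC] by auto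
 have comb: "(SUM w:C. r w *c w) : fv.span C" for r by (intro fv.span_sum fv.span_scale fv.span_base)
 have thC: "th (SUM w:C. r w *c w) = (SUM w:C. fr (r w) *c w)" for r using thsum[of C "%w. w" r] C by (auto intro!: sum.cong)
 have pre: "EX y:fv.span C. th y = x" if x: "x : fv.span C" for x
 proof -
  obtain r where r: "x = (SUM w:C. r w *c w)" using exp[OF x] by blast
  have "ALL w. EX y. fr y = r w" using fr_surj by blast
  from choice[OF this] obtain d where "!!w. fr (d w) = r w" by blast
  hence "th (SUM w:C. d w *c w) = x" by (simp add: thC r)
  thus ?thesis using comb by blast
 qed
 have AS: "EX z:fv.span C. th z = z+x" if x: "x : fv.span C" for x
 proof -
  obtain r where r: "x = (SUM w:C. r w *c w)" using exp[OF x] by blast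
  have "ALL w. EX y. fr y-y = r w" using artin_schreier by blast
  from choice[OF this] obtain d where d: "!!w. fr (d w)-d w = r w" by blast
  have "fr (d w) = d w + r w" for w using d[of w] by (simp add: algebra_simps)
  hence "th (SUM w:C. d w *c w) = (SUM w:C. d w *c w)+x" by (simp add: thC r fv.scale_left_distrib sum.distrib)
  thus ?thesis using comb by blast
 qed
 have "V <= fv.span C"
 proof
  fix v assume v: "v : V"
  show "v : fv.span C"
  proof (rule ccontr)
   assume nv: "v ~: fv.span C"
   define it where "it i = (th ^^ i) v" for i
   have it: "it 0 = v" "it (Suc i) = th (it i)" for i by (simp_all add: it_def)
   have itV: "it i : V" for i by (induct i) (simp_all add: it v V(2))
   define U where "U i = fv.span (C \<union> it ` {..<i})" for i
   have U_exp: "EX u:fv.span C. EX a. x = u+(SUM j<i. a j *c it j)" if "x : U i" for x i using that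
   proof (induct i arbitrary: x)
    case 0 thus ?case by (auto simp: U_def intro!: bexI[of _ x])
   next
    case (Suc i)
    have "C \<union> it ` {..<Suc i} = insert (it i) (C \<union> it ` {..<i})" by (auto simp: less_Suc_eq)
    then obtain b where "x-b *c it i : U i" using Suc(2) unfolding U_def by (auto simp: fv.span_breakdown_eq)
    from Suc(1)[OF this] obtain u a where u: "u : fv.span C" "x-b *c it i = u+(SUM j<i. a j *c it j)" by blast
    have "x = u+(SUM j<Suc i. (a(i := b)) j *c it j)" using u(2) by (simp add: algebra_simps)
    thus ?case using u(1) by blast
   qed
   have U_in: "u+(SUM j<i. a j *c it j) : U i" if "u : fv.span C" for u a i unfolding U_def using fv.span_mono[of C "C \<union> it ` {..<i}"] that by (intro fv.span_add fv.span_sum fv.span_scale) (auto intro: fv.span_base)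
   have "EX r. it r : U r"
   proof (rule ccontr)
    assume no: "~(EX r. it r : U r)"
    have "fv.independent (C \<union> it ` {..<i}) & card (C \<union> it ` {..<i}) = card C+i" for i
    proof (induct i)
     case (Suc i)
     have e: "C \<union> it ` {..<Suc i} = insert (it i) (C \<union> it ` {..<i})" by (auto simp: less_Suc_eq)
     have ni: "it i ~: fv.span (C \<union> it ` {..<i})" using no by (auto simp: U_def)
     have "it i ~: C \<union> it ` {..<i}" using ni fv.span_base by metis
     with ni show ?case unfolding e using Suc fC by (simp add: fv.independent_insert)
    qed (simp add: C)
    from this[of "Suc (card B)"] bound[of "C \<union> it ` {..<Suc (card B)}"] itV C(1) show False by auto
   qed
   then obtain r where r: "it r : U r" "!!i. i < r ==> it i ~: U i" using exists_least_iff[of "%r. it r : U r"] by blast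
   have "r ~= 0"
   proof
    assume "r = 0"
    thus False using r(1) nv by (simp add: U_def it)
   qed
   then obtain k where k: "r = Suc k" by (cases r) auto
   have nk: "it k ~: U k" using r(2) k by simp
   obtain u0 a where ua: "u0 : fv.span C" "it (Suc k) = u0+(SUM j<Suc k. a j *c it j)" using U_exp[OF r(1)] k by blast
   \<comment> \<open>If \<open>a 0 = 0\<close>, the relation is the image under \<open>th\<close> of
     one that holds a step earlier; by injectivity this contradicts the minimality of
     \<open>r\<close>.\<close>
   have a0: "a 0 ~= 0"
   proof
    assume a0: "a 0 = 0"
    have "ALL j. EX y. fr y = a (Suc j)" using fr_surj by blast
    from choice[OF this] obtain b where b: "!!j. fr (b j) = a (Suc j)" by blast
    obtain y0 where y0: "y0 : fv.span C" "th y0 = u0" using pre[OF ua(1)] by blast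
    have sV: "(SUM j<k. b j *c it j) : V" by (intro Vc(5) Vc(3) itV)
    have "th (y0+(SUM j<k. b j *c it j)) = it (Suc k)" using y0 CV sV thsum[of "{..<k}" it b] itV unfolding ua(2) sum.lessThan_Suc_shift using a0 by (force simp: b it add)
    hence "th (it k) = th (y0+(SUM j<k. b j *c it j))" unfolding it(2)[symmetric] by (rule sym)
    hence "it k = y0+(SUM j<k. b j *c it j)" by (rule inj2[OF itV Vc(2)[OF subsetD[OF CV y0(1)] sV]])
    thus False using nk U_in[OF y0(1)] by simp
   qed
   obtain y c where y: "y ~= 0" "c 0 = a 0 * fr y" "!!i. c (Suc i) = fr (c i)+a (Suc i) * fr y" "c k = y" using lang_root[of a k, OF a0] by blast
   \<comment> \<open>The recursion of \<open>lang_root\<close> is made for this: the coefficients of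
     \<open>th w\<close> and \<open>w\<close> agree, up to the contribution of \<open>u0\<close> in
     the span of \<open>C\<close>.\<close>
   define w where "w = (SUM i<Suc k. c i *c it i)"
   have wV: "w : V" unfolding w_def by (intro Vc(5) Vc(3) itV)
   have "th w = (SUM i<k. fr (c i) *c it (Suc i))+fr y *c it (Suc k)" unfolding w_def using thsum[of "{..<Suc k}" it c] itV y(4) by (simp add: it)
   also have "fr y *c it (Suc k) = fr y *c u0+((a 0 * fr y) *c it 0+(SUM i<k. (a (Suc i) * fr y) *c it (Suc i)))" unfolding ua(2) sum.lessThan_Suc_shift by (simp add: fv.scale_right_distrib fv.scale_sum_right mult.commute)
   also have "(SUM i<k. fr (c i) *c it (Suc i))+(fr y *c u0+((a 0 * fr y) *c it 0+(SUM i<k. (a (Suc i) * fr y) *c it (Suc i)))) =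
     (c 0 *c it 0+(SUM i<k. c (Suc i) *c it (Suc i)))+fr y *c u0"
    by (simp add: y(2,3) fv.scale_left_distrib sum.distrib)
   also have "c 0 *c it 0+(SUM i<k. c (Suc i) *c it (Suc i)) = w" unfolding w_def sum.lessThan_Suc_shift ..
   finally have thw: "th w = w+fr y *c u0" .
   \<comment> \<open>The top coefficient \<open>c k = y\<close> is nonzero, so otherwise
     \<open>it k\<close> would lie in \<open>U k\<close>.\<close>
   have nw: "w ~: fv.span C"
   proof
    assume w: "w : fv.span C"
    have "inverse y *c w+(SUM i<k. (- inverse y * c i) *c it i) : U k" by (rule U_in) (rule fv.span_scale[OF w])
    moreover have "inverse y *c w+(SUM i<k. (- inverse y * c i) *c it i) = it k" unfolding w_def using y(1,4) by (simp add: fv.scale_right_distrib fv.scale_sum_right sum_negf)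
    ultimately show False using nk by simp
   qed
   have "- (fr y *c u0) : fv.span C" by (intro fv.span_neg fv.span_scale ua)
   from AS[OF this] obtain z where z: "z : fv.span C" "th z = z + - (fr y *c u0)" by blast
   have nwz: "w+z ~: fv.span C"
   proof
    assume "w+z : fv.span C"
    from fv.span_diff[OF this z(1)] show False using nw by simp
   qed
   hence nwz': "w+z ~: C" using fv.span_base by blast
   have "?ok (insert (w+z) C)" using add[OF wV, of z] z CV thw using C nwz nwz'  z(1) CV wV by (auto simp: fv.independent_insert intro: Vc(2))
   from mx[OF this] show False using nwz' fC by simp
  qed
 qed
 thus ?thesis using C fC CV by blast
qed

end

subsection \<open>Counting regular elements over a finite field\<close>

context fin_subfield begin

definition mon :: "nat => (nat => 'a) => 'a poly" where
 "mon k g = mn 1 k+(SUM i<k. mn (g i) i)"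

lemma coeff_mon: "coeff (mon k g) i = (if i = k then 1 else if i < k then g i else 0)"
 by (cases "i < k") (auto simp: mon_def coeff_sum)

lemma monic_eq_mon: "degree p = k ==> lead_coeff p = 1 ==> p = mon k (coeff p)"
proof (rule poly_eqI)
 fix i assume p: "degree p = k" "lead_coeff p = 1"
 consider "i = k" | "i < k" | "k < i" by linarith
 thus "coeff p i = coeff (mon k (coeff p)) i" by cases (use p in \<open>simp_all add: coeff_mon coeff_eq_0\<close>)
qed

lemma prod_roots_dvd: "finite W ==> (!!x. x : W ==> poly p x = 0) ==> (PROD x:W. [:- x, 1:]) dvd (p :: 'a poly)"
proof (induct W rule: finite_induct)
 case (insert x W)
 then obtain g where g: "p = (PROD y:W. [:- y, 1:]) * g" by (auto elim: dvdE)
 have "poly (PROD y:W. [:- y, 1:]) x ~= 0" using insert(1,2) by (auto simp: poly_prod)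
 moreover have "poly p x = 0" using insert by simp
 ultimately have "[:- x, 1:] dvd g" by (simp add: g poly_eq_0_iff_dvd[symmetric])
 thus ?case unfolding g prod.insert[OF insert(1,2)] by (subst mult.commute) (intro mult_dvd_mono dvd_refl)
qed simp

lemma degree_mon: "degree (mon k g) = k"
 by (rule antisym) (auto intro!: degree_le le_degree simp: coeff_mon)

definition frp :: "'a poly => 'a poly" where "frp p = map_poly fr p"

lemma coeff_frp: "coeff (frp p) i = fr (coeff p i)" by (simp add: frp_def coeff_map_poly fr_simps)

lemma frp_mult: "frp (a * b) = frp a * frp b"
 by (rule poly_eqI) (simp add: coeff_frp coeff_mult fr_sum fr_simps)

lemma frp_linear: "frp [:a, b:] = [:fr a, fr b:]"
 by (rule poly_eqI) (simp add: coeff_frp coeff_pCons fr_simps split: nat.split)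

lemma frp_prod: "frp (PROD i:I. g i) = (PROD i:I. frp (g i))"
proof (induct I rule: ifi)
 have 1: "frp 1 = 1" by (rule poly_eqI) (simp add: coeff_frp fr_simps)
 { case infinite thus ?case using 1 by simp }
 { case empty thus ?case using 1 by simp }
qed (simp add: frp_mult)

lemma poly_frp: "poly (frp p) (fr x) = fr (poly p x)"
proof -
 have "frp p = pCons (fr a) (frp r)" if "p = pCons a r" for a r p unfolding that by (rule poly_eqI) (simp add: coeff_frp coeff_pCons fr_simps split: nat.split)
 note e = this
 show ?thesis
 proof (induct p)
  case 0
  have "frp 0 = 0" by (rule poly_eqI) (simp add: coeff_frp fr_simps)
  thus ?case by (simp add: fr_simps)
 qed (simp add: e[OF refl] fr_add fr_simps)
qed

lemma frp_T: "frp p = p \<longleftrightarrow> (ALL i. coeff p i : T)"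
 by (simp add: poly_eq_iff coeff_frp fr_T)

text \<open>Prepares a count: such a polynomial is determined by \<open>d\<close> coefficients of
  \<open>a\<close> and \<open>n - 2 * d\<close> of \<open>b\<close>, thus by \<open>n - d\<close>
  elements of \<open>T\<close> instead of \<open>n\<close>.\<close>

lemma double_root_factor:
 assumes f: "ALL i<n. g i : T" and root: "poly (mon n g) al = 0" "poly (pderiv (mon n g)) al = 0"
 shows "EX d a b. 1 <= d & 2 * d <= n & (ALL i<d. a i : T) & (ALL i<n-2 * d. b i : T) & mon n g = mon d a * mon d a * mon (n-2 * d) b"
proof -
 let ?P = "mon n g"
 have P0: "?P ~= 0" using coeff_mon[of n g n] by auto
 have PT: "frp ?P = ?P" unfolding frp_T using f T0 T1 by (simp add: coeff_mon)
 have oT: "of_nat i : T" for i by (induct i) (simp_all add: T0 T1 Tadd)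
 have DT: "frp (pderiv ?P) = pderiv ?P" unfolding frp_T coeff_pderiv using f T0 T1 oT by (intro allI Tmul) (simp_all add: coeff_mon del: of_nat_Suc)
 define W where "W = {x. poly ?P x = 0 & poly (pderiv ?P) x = 0}"
 have frW: "fr x : W" if "x : W" for x using that poly_frp[of ?P x] poly_frp[of "pderiv ?P" x] unfolding W_def PT DT by (simp add: fr_simps)
 have finW: "finite W" unfolding W_def using poly_roots_finite[OF P0] by (rule rev_finite_subset) auto
 text \<open>All double roots may be taken at once: they are permuted by the Frobenius.\<close>
 let ?G = "PROD x:W. [:- x, 1:]"
 have imW: "fr ` W = W" by (rule endo_inj_surj[OF finW]) (use frW in \<open>auto simp: inj_on_def fr_inj\<close>)
 have "frp ?G = (PROD x:fr ` W. [:- x, 1:])" by (simp add: frp_prod frp_linear fr_minus fr_simps inj_on_def fr_inj prod.reindex)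
 hence GT: "frp ?G = ?G" by (simp only: imW)
 obtain h1 where h1: "?P = ?G * h1" using prod_roots_dvd[OF finW, of ?P] by (auto simp: W_def elim: dvdE)
 \<comment> \<open>\<open>G\<close> has simple roots, so at a double root of the product the
   derivative leaves only the cofactor \<open>h1\<close>; it vanishes as well, and \<open>G\<close>
   divides twice.\<close>
 have "poly h1 x = 0" if x: "x : W" for x
 proof -
  have G: "?G = [:- x, 1:]*(PROD y:W - {x}. [:- y, 1:])" using x finW by (simp only: prod.remove)
  have "poly (pderiv ?G) x ~= 0" unfolding G using finW by (simp add: pderiv_mult pderiv_pCons poly_prod del: mult_pCons_left)
  moreover have "poly ?G x = 0" unfolding G by simp
  moreover have "poly (pderiv ?P) x = 0" using x by (simp add: W_def)
  ultimately show ?thesis unfolding h1 pderiv_mult by simp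
 qed
 then obtain h where "h1 = ?G * h" using prod_roots_dvd[OF finW, of h1] by (auto elim: dvdE)
 hence h: "?P = ?G*?G * h" using h1 by (simp only: mult.assoc)
 have G: "degree ?G = card W" by (subst degree_prod_eq_sum_degree) auto
 have lG: "lead_coeff ?G = 1" by (rule monic_prod) simp
 have G0: "?G ~= 0" using lG by auto
 have h0: "h ~= 0" using h P0 by auto
 have dh: "n = 2 * card W+degree h" using arg_cong[OF h, of degree] G0 h0 by (simp add: degree_mult_eq degree_mon G)
 have lh: "lead_coeff h = 1" using arg_cong[OF h, of lead_coeff] coeff_mon[of n g n] lG by (simp add: lead_coeff_mult degree_mon)
 have "frp (?G*?G * h) = ?G*?G * h" using PT by (simp only: h[symmetric])
 hence "?G*?G * frp h = ?G*?G * h" unfolding frp_mult GT .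
 moreover have "?G*?G ~= 0" using G0 by simp
 ultimately have hT: "frp h = h" using mult_left_cancel by blast
 have d1: "1 <= card W" using root using finW by (force simp: W_def Suc_le_eq card_gt_0_iff)
 have eG: "?G = mon (card W) (coeff ?G)" by (rule monic_eq_mon[OF G lG])
 have eh: "h = mon (n-2 * card W) (coeff h)" by (rule monic_eq_mon[OF _ lh]) (use dh in simp)
 show ?thesis by (rule exI[of _ "card W"], rule exI[of _ "coeff ?G"], rule exI[of _ "coeff h"])
   (use d1 dh h eG eh GT hT in \<open>auto simp: frp_T\<close>)
qed

text \<open>The separable monic polynomials of degree \<open>n\<close> over \<open>T\<close>, given
  by their lower coefficients; extensional functions make them countable by
  \<open>card_PiE\<close>.\<close>

definition Sep :: "nat => (nat => 'a) set" where
 "Sep n = {g : {..<n} ->E T. ALL x. poly (mon n g) x = 0 --> poly (pderiv (mon n g)) x ~= 0}"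

lemma geom: "(q-1)*(SUM i<n. q^i) <= q^n"
proof (induct n)
 case (Suc n)
 have "(q-1)*(SUM i<Suc n. q^i) <= q^n+(q-1) * q^n" using Suc by (simp add: distrib_left)
 also have "... = q^Suc n" using q_ge by (cases q) auto
 finally show ?case .
qed simp

text \<open>The factorisations of \<open>double_root_factor\<close> leave at most
  \<open>q^(n-d)\<close> polynomials for each \<open>d >= 1\<close>, a geometric sum.\<close>

lemma card_nonsep: "(q-1) * card (({..<n} ->E T)-Sep n) <= q^n"
proof -
 define D where "D d = (%(a, b). \<lambda>i\<in>{..<n}. coeff (mon d a * mon d a * mon (n-2 * d) b) i) `
   (({..<d} ->E T) \<times> ({..<n-2 * d} ->E T))" for d
 have finD: "finite (D d)" for d unfolding D_def by (intro finite_imageI finite_cartesian_product finite_PiE) (auto simp: fin)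
 have cD: "card (D d) <= q^(n-d)" if "2 * d <= n" for d
 proof -
  have "card (D d) <= card (({..<d} ->E T) \<times> ({..<n-2 * d} ->E T))" unfolding D_def by (intro card_image_le finite_cartesian_product finite_PiE) (auto simp: fin)
  also have "... = q^(n-d)" using that by (simp add: card_cartesian_product card_PiE power_add[symmetric])
  finally show ?thesis .
 qed
 have "({..<n} ->E T)-Sep n <= (UN d:{d. 1 <= d & 2 * d <= n}. D d)"
 proof
  fix g assume g: "g : ({..<n} ->E T)-Sep n"
  then obtain al where rt: "poly (mon n g) al = 0" "poly (pderiv (mon n g)) al = 0" by (auto simp: Sep_def)
  have gT: "ALL i<n. g i : T" using g by auto
  from double_root_factor[OF gT rt] obtain d a b where ab: "1 <= d" "2 * d <= n" "ALL i<d. a i : T" "ALL i<n-2 * d. b i : T"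
   "mon n g = mon d a * mon d a * mon (n-2 * d) b" by (elim exE conjE) (rule that)
  have r: "mon k (restrict a {..<k}) = mon k a" for k a by (simp add: mon_def)
  have "g = (\<lambda>i\<in>{..<n}. coeff (mon n g) i)" using g by (auto simp: coeff_mon fun_eq_iff PiE_def extensional_def restrict_def)
  also have "... = (%(a, b). \<lambda>i\<in>{..<n}. coeff (mon d a * mon d a * mon (n-2 * d) b) i) (restrict a {..<d}, restrict b {..<n-2 * d})" by (simp only: ab(5) r split)
  also have "... : D d" unfolding D_def by (intro imageI SigmaI restrict_PiE_iff[THEN iffD2] ballI) (use ab(3,4) in simp_all)
  finally show "g : (UN d:{d. 1 <= d & 2 * d <= n}. D d)" using ab by blast
 qed
 moreover have fd: "finite {d. 1 <= d & 2 * d <= n}" by (rule finite_subset[of _ "{..n}"]) auto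
 ultimately have "card (({..<n} ->E T)-Sep n) <= card (UN d:{d. 1 <= d & 2 * d <= n}. D d)" by (intro card_mono finite_UN_I finD)
 also have "... <= (SUM d:{d. 1 <= d & 2 * d <= n}. card (D d))" by (rule card_UN_le[OF fd])
 also have "... <= (SUM d:{d. 1 <= d & 2 * d <= n}. q^(n-d))" by (intro sum_mono cD) auto
 also have "... <= (SUM d:{1..n}. q^(n-d))" by (intro sum_mono2) auto
 also have "... = (SUM i<n. q^i)" by (rule sum.reindex_bij_witness[of _ "%i. n-i" "%d. n-d"]) auto
 finally show ?thesis using geom[of n] by (meson le_trans mult_le_mono2)
qed

text \<open>Independence over the subfield only. For fixed vectors of a semilinear map it will imply
  independence over the whole field.\<close>

definition tind :: "nat => (nat => 'i => 'a) => bool" where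
 "tind j y \<longleftrightarrow> (ALL c. (ALL i<j. c i : T) --> (SUM i<j. c i *c y i) = 0 --> (ALL i<j. c i = 0))"

lemma tindD: "tind j y ==> (!!i. i < j ==> c i : T) ==> (SUM i<j. c i *c y i) = 0 ==> i < j ==> c i = 0"
 unfolding tind_def by blast

lemma tind_dependent:
 assumes "~tind n y"
 shows "EX i<n. EX c:{..<i} ->E T. y i = (SUM j<i. c j *c y j)"
proof -
 obtain c where c: "ALL i<n. c i : T" "(SUM i<n. c i *c y i) = 0" "~(ALL i<n. c i = 0)" using assms by (auto simp: tind_def)
 define k where "k = Max {i. i < n & c i ~= 0}"
 have fn: "finite {i. i < n & c i ~= 0}" by simp
 have k: "k < n" "c k ~= 0" using Max_in[OF fn] c(3) unfolding k_def by auto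
 have above: "c i = 0" if "k < i" "i < n" for i using Max_ge[OF fn, of i] that unfolding k_def[symmetric] by (cases "c i = 0") auto
 have inv: "inverse x : T" if "x : T" for x
 proof (cases "x = 0")
  case False
  have "x^q = x * x^(q-1)" using q_ge by (metis not_numeral_le_zero power_eq_if)
  hence "x^(q-1) = 1" using Tpow[OF that] False by simp
  hence "inverse x = x^(q-2)" using Suc_1 Suc_diff_Suc Suc_le_lessD diff_Suc_1' power_Suc inverse_unique using q_ge by metis
  moreover have "x^j : T" for j by (induct j) (simp_all add: T1 Tmul that)
  ultimately show ?thesis by simp
 qed (simp add: T0)
 have "(SUM i<n. c i *c y i) = (SUM i<Suc k. c i *c y i)" using k above by (intro sum.mono_neutral_right) auto
 hence "(SUM i<k. c i *c y i) + c k *c y k = 0" using c(2) by simp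
 hence 0: "(SUM i<k. c i * y i l) + c k * y k l = 0" for l by (simp add: fun_eq_iff fapp)
 have "y k l = (SUM i<k. (- c i / c k) *c y i) l" for l unfolding fapp by (rule solve_last_coeff[OF 0 k(2)])
 hence "y k = (SUM i<k. (restrict (%i. - c i / c k) {..<k}) i *c y i)" by auto
 moreover have "restrict (%i. - c i / c k) {..<k} : {..<k} ->E T" using c(1) k by (auto simp: divide_inverse intro!: Tmul Tneg inv)
 ultimately show ?thesis using k(1) by blast
qed

text \<open>In a dependent tuple some entry \<open>i\<close> is a \<open>T\<close>-combination of
  the earlier ones, which leaves \<open>q^i\<close> possibilities once the other entries are fixed;
  the geometric sum over \<open>i\<close> does the rest.\<close>

lemma card_dependent:
 fixes W :: "('i => 'a) set"
 assumes W: "finite W" "card W = q^n"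
 shows "(q-1) * card {y : {..<n} ->E W. ~tind n y} <= q^(n * n)"
proof (cases "n = 0")
 case False
 define D where "D i = (%(c, y). y(i := SUM j<i. c j *c y j)) ` (({..<i} ->E T) \<times> (({..<n} - {i}) ->E W))" for i
 have finD: "finite (D i)" for i unfolding D_def by (intro finite_imageI finite_cartesian_product finite_PiE) (auto simp: fin W)
 have cD: "card (D i) <= q^i * q^(n*(n-1))" if "i < n" for i
 proof -
  have "card (D i) <= card (({..<i} ->E T) \<times> (({..<n} - {i}) ->E W))" unfolding D_def by (intro card_image_le finite_cartesian_product finite_PiE) (auto simp: fin W)
  also have "... = q^i * q^(n*(n-1))" using that W by (simp add: card_cartesian_product card_PiE power_mult[symmetric])
  finally show ?thesis .
 qed
 have "{y : {..<n} ->E W. ~tind n y} <= (UN i:{..<n}. D i)"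
 proof
  fix y assume y: "y : {y : {..<n} ->E W. ~tind n y}"
  hence "~tind n y" by simp
  from tind_dependent[OF this] obtain i c where ic: "i < n" "c : {..<i} ->E T" "y i = (SUM j<i. c j *c y j)" by (elim exE bexE conjE) (rule that)
  let ?y = "restrict y ({..<n} - {i})"
  have "y = (%(c, y). y(i := SUM j<i. c j *c y j)) (c, ?y)" using ic(1) using y ic by (auto simp: fun_eq_iff PiE_def extensional_def)
  moreover have "(c, ?y) : ({..<i} ->E T) \<times> (({..<n} - {i}) ->E W)" using y ic by auto
  ultimately have "y : D i" unfolding D_def by (rule image_eqI)
  thus "y : (UN i:{..<n}. D i)" using ic by blast
 qed
 hence "card {y : {..<n} ->E W. ~tind n y} <= card (UN i:{..<n}. D i)" by (intro card_mono finite_UN_I finD) auto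
 also have "... <= (SUM i<n. card (D i))" by (rule card_UN_le) simp
 also have "... <= (SUM i<n. q^i * q^(n*(n-1)))" by (intro sum_mono cD) auto
 also have "... = (SUM i<n. q^i) * q^(n*(n-1))" by (simp add: sum_distrib_right)
 finally have "card {y : {..<n} ->E W. ~tind n y} <= (SUM i<n. q^i) * q^(n*(n-1))" .
 from mult_le_mono2[OF this, of "q-1"]
 have "(q-1) * card {y : {..<n} ->E W. ~tind n y} <= ((q-1)*(SUM i<n. q^i)) * q^(n*(n-1))" by (simp only: mult.assoc)
 also have "... <= q^n * q^(n*(n-1))" using geom[of n] by (rule mult_le_mono1)
 also have "... = q^(n+n*(n-1))" by (simp add: power_add)
 also have "n+n*(n-1) = n * n" using False by (cases n) auto
 finally show ?thesis .
qed (simp add: tind_def)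

end

section \<open>Frobenius descent to a module over the finite form\<close>

locale fin_cs = acs_alg m s e1 + fin_subfield T
 for m and s :: "nat => nat => nat => 'a::alg_closed_field" and e1 and T :: "'a set" +
 assumes sT: "i < m ==> j < m ==> l < m ==> s i j l : T"
begin

text \<open>It respects products because the structure constants lie in \<open>T\<close> and are
  fixed by the Frobenius.\<close>

definition frv :: "(nat => 'a) => nat => 'a" where "frv x = (%i. fr (x i))"

lemma frv_A: "x : A ==> frv x : A" by (simp add: frv_def spt_def fr_simps)

lemma frv_add: "frv (x+y) = frv x+frv y" by (simp add: frv_def fun_eq_iff fapp fr_add)

lemma frv_scale: "frv (c *c x) = fr c *c frv x" by (simp add: frv_def fun_eq_iff fapp fr_simps)

lemma frv_0: "frv x = 0 \<longleftrightarrow> x = 0" by (simp add: frv_def fun_eq_iff fapp fr_simps)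

lemma frv_mul: "frv (x .* y) = frv x .* frv y"
proof
 fix l
 have "fr (s i j l) = s i j l" if "i < m" "j < m" "l < m" for i j using fr_T sT that by blast
 thus "frv (x .* y) l = (frv x .* frv y) l" by (cases "l < m") (simp_all add: frv_def mul_def fr_sum fr_simps)
qed

lemma frv_fixed: "frv x = x \<longleftrightarrow> (ALL i. x i : T)" by (simp add: frv_def fun_eq_iff fr_T)

lemma frv_surj: "x : A ==> EX y:A. frv y = x"
proof -
 assume x: "x : A"
 have "ALL i. EX y. fr y = x i" using fr_surj by blast
 from choice[OF this] obtain y where y: "!!i. fr (y i) = x i" by blast
 have "y i = 0" if "i >= m" for i using x y[of i] that fr_simps(4)[of "y i"] by (simp add: spt_def)
 thus ?thesis using y by (auto simp: spt_def frv_def)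
qed

text \<open>
 The semilinear map \<open>\<theta>\<close> on the minimal left ideal \<open>A e\<^sub>0\<close> is the Frobenius followed by an intertwiner
 from the conjugate ideal back to \<open>A e\<^sub>0\<close>; its fixed vectors form a simple module over the finite form.
\<close>

lemma exists_finite_form:
 assumes fam: "idem n e" and nn: "n * n = m"
 shows "EX W. finite W & card W = q^n & W <= A & 0 : W & (ALL x:W. ALL y:W. x+y : W) & (ALL c:T. ALL x:W. c *c x : W) &
  (ALL a:A. ALL x:W. frv a = a --> a .* x : W) & (ALL a:A. (ALL x:W. a .* x = 0) --> a = 0) &
  (ALL j y c. (ALL i<j. y i : W) --> tind j y --> (SUM i<j. c i *c y i) = 0 --> (ALL i<j. c i = 0))"
proof -
 note D = idemD[OF fam]
 have n0: "0 < n" using fam e1_nz by (cases n) (auto simp: idem_def)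
 note block = family_block[OF fam nn]
 let ?e = "e 0" and ?f = "frv (e 0)"
 have eA: "?e : A" "?e .* ?e = ?e" "?e ~= 0" using D n0 by auto
 have fA: "?f : A" "?f .* ?f = ?f" "?f ~= 0" using eA by (simp_all add: frv_A frv_mul[symmetric] frv_0)
 obtain z where z: "?f .* z .* ?e ~= 0" using prod_nonzero[OF fA(1,3) eA(1,3)] by blast
 \<comment> \<open>The intertwiner: right multiplication by \<open>g\<close> carries the conjugate
   ideal \<open>A ?f\<close> into \<open>A ?e\<close>.\<close>
 define g where "g = ?f .* z .* ?e"
 have g: "g : A" "g ~= 0" "?f .* g = g" "g .* ?e = g" using z fA eA by (simp_all add: g_def massoc) (simp_all add: massoc[symmetric])
 obtain y where y: "g .* y .* ?f ~= 0" using prod_nonzero[OF g(1,2) fA(1,3)] by blast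
 define h where "h = g .* y .* ?f"
 \<comment> \<open>The conjugate corner consists of scalars too: \<open>h\<close> is pulled back
   along the surjective Frobenius to the corner of \<open>?e\<close>.\<close>
 obtain h' where h': "h' : A" "frv h' = h" using frv_surj[of h] by (auto simp: h_def)
 have fhf: "?f .* h .* ?f = h" using g(3) fA(2) by (simp add: h_def massoc) (simp add: massoc[symmetric] g(3))
 have "frv (?e .* h' .* ?e) = h" by (simp add: frv_mul h' fhf)
 moreover obtain c where c: "?e .* h' .* ?e = c *c ?e" using block[OF n0 corner_compress[OF eA(2) eA(2)]] by blast
 ultimately have hc: "h = fr c *c ?f" by (simp add: frv_scale)
 have "fr c ~= 0" using y hc by (auto simp: h_def)
 \<comment> \<open>As \<open>g y ?f\<close> is a nonzero multiple of the idempotent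
   \<open>?f\<close>, right multiplication by \<open>g\<close> is injective on the conjugate
   ideal.\<close>
 have kill: "w = 0" if w: "w : A" "w .* ?f = w" "w .* g = 0" for w
 proof -
  have "w .* h = (w .* g) .* (y .* ?f)" by (simp add: h_def massoc)
  hence "fr c *c w = 0" using w hc by simp
  thus ?thesis using `fr c ~= 0` by simp
 qed
 define V where "V = {v : A. v .* ?e = v}"
 define th where "th v = frv v .* g" for v
 have V: "fv.subspace V" unfolding fv.subspace_def V_def using spt_closed by (auto simp: mul_add_l)
 have thV: "th x : V" for x by (simp add: th_def V_def massoc g)
 have thadd: "th (x+y) = th x+th y" for x y by (simp add: th_def frv_add mul_add_l)
 have thsc: "th (c *c x) = fr c *c th x" for c x by (simp add: th_def frv_scale)
 have thinj: "x = 0" if "x : V" "th x = 0" for x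
 proof -
  have 1: "frv x .* ?f = frv x" using that(1) by (simp add: V_def frv_mul[symmetric])
  have 2: "frv x : A" using that(1) by (intro frv_A) (simp add: V_def)
  show ?thesis using that(2) using kill[OF 2 1 ] by (simp add: th_def frv_0)
 qed
 obtain v ph where v: "!!x. x < n ==> v x : corner (e x) (e 0) & v x ~= 0"
  and ph: "!!u y. u : A ==> y < n ==> u .* v y = (SUM x<n. ph u $$ (x, y) *c v x)"
  using exists_representation[OF fam nn] by (elim exE conjE) blast
 have vind: "ALL x<n. c x = 0" if "(SUM x<n. c x *c v x) = 0" for c using eigen_independent[OF that fam v] by blast
 have Vspan: "V <= fv.span (v ` {..<n})"
 proof
  fix x assume x: "x : V"
  have xA: "x : A" "x .* ?e = x" using x by (auto simp: V_def)
  obtain c where c: "v 0 = c *c ?e" using block[OF n0] v[OF n0] by blast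
  hence c0: "c ~= 0" using v[OF n0] by auto
  have "c *c x : fv.span (v ` {..<n})" using ph[OF xA(1) n0] xA(2) c by (auto intro: fv.span_sum fv.span_scale fv.span_base)
  from fv.span_scale[OF this, of "inverse c"] show "x : fv.span (v ` {..<n})" using c0 by simp
 qed
 have "\<exists>C\<subseteq>V. finite C & fv.independent C & fv.span C = V & (ALL x:C. th x = x)" by (rule lang[where B = "v ` {..<n}"]) (use V thV thadd thsc thinj Vspan in auto)
 then obtain C where C: "C <= V" "finite C" "fv.independent C" "fv.span C = V" "!!x. x : C ==> th x = x" by blast
 have vinj: "inj_on v {..<n}"
 proof (rule inj_onI, rule ccontr)
  fix i j assume ij: "i : {..<n}" "j : {..<n}" "v i = v j" "i ~= j"
  have "(SUM x<n. (if x = i then 1 else if x = j then-1 else 0) *c v x) = (SUM x<n. (if x = i then v i else 0)+(if x = j then-v j else 0))" using ij by (intro sum.cong) auto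
  also have "... = 0" using ij by (simp add: sum.distrib)
  finally show False using vind ij(1) by fastforce
 qed
 have "fv.independent (v ` {..<n})"
 proof (rule fv.independent_if_scalars_zero)
  fix r x assume r: "(SUM x:v ` {..<n}. r x *c x) = 0" and x: "x : v ` {..<n}"
  have "ALL i<n. r (v i) = 0" using vind using r by (simp add: sum.reindex[OF vinj])
  thus "r x = 0" using x by blast
 qed simp
 moreover have "v x : V" if "x < n" for x using v[OF that] corner_subset[of "v x" "e x" "e 0"] by (simp add: V_def corner_def)
 hence "v ` {..<n} <= V" by blast
 ultimately have "card (v ` {..<n}) <= card C" using fv.independent_span_bound[OF C(2)] C(4) by blast
 moreover have "card C <= card (v ` {..<n})" using fv.independent_span_bound[OF _ C(3)] C(1) Vspan by blast
 ultimately have cC: "card C = n" using card_image[OF vinj] by simp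
 define W where "W = {x : V. th x = x}"
 have thsum: "th (SUM i:I. c i *c k i) = (SUM i:I. fr (c i) *c th (k i))" for I c and k :: "'j => nat => 'a"
 proof (induct I rule: ifi)
  have 0: "th 0 = 0" using thsc[of 0 0] by (simp add: fr_simps)
  { case infinite thus ?case by (simp only: sum.infinite 0 not_False_eq_True) }
  { case empty thus ?case by (simp only: sum.empty 0) }
  case (insert i I)
  thus ?case by (simp only: sum.insert thadd thsc not_False_eq_True)
 qed
 define L where "L c = (SUM w:C. c w *c w)" for c
 have Linj: "inj_on L (C ->E T)"
 proof (rule inj_onI)
  fix c d assume cd: "c : C ->E T" "d : C ->E T" "L c = L d"
  hence "(SUM w:C. (c w-d w) *c w) = 0" by (simp add: L_def fv.scale_left_diff_distrib sum_subtractf)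
  hence "c w-d w = 0" if "w : C" for w using fv.independentD[OF C(3) C(2) subset_refl, of "%w. c w-d w"] that by blast
  thus "c = d" using cd(1,2) by (intro PiE_ext) auto
 qed
 have "L ` (C ->E T) = W"
 proof (intro equalityI subsetI)
  fix x assume "x : L ` (C ->E T)"
  then obtain c where c: "c : C ->E T" "x = L c" by blast
  have "x : fv.span C" unfolding c(2) L_def by (intro fv.span_sum fv.span_scale fv.span_base)
  moreover have "th x = (SUM w:C. fr (c w) *c th w)" unfolding c(2) L_def by (rule thsum)
  hence "th x = x" unfolding c(2) L_def using c(1) C(5) fr_T by (auto intro!: sum.cong)
  ultimately show "x : W" using C(4) by (simp add: W_def)
 next
  fix x assume x: "x : W"
  hence "x : fv.span C" using C(4) by (simp add: W_def)
  then obtain r where r: "x = L r" unfolding fv.span_finite[OF C(2)] L_def by auto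
  have "th x = (SUM w:C. fr (r w) *c th w)" unfolding r L_def by (rule thsum)
  hence "(SUM w:C. fr (r w) *c w) = L r" using x C(5) r by (simp add: W_def)
  hence "(SUM w:C. (fr (r w) - r w) *c w) = 0" by (simp add: L_def fv.scale_left_diff_distrib sum_subtractf)
  hence "fr (r w) - r w = 0" if "w : C" for w using fv.independentD[OF C(3) C(2) subset_refl, of "%w. fr (r w) - r w"] that by blast
  hence "restrict r C : C ->E T" using fr_T by auto
  moreover have "x = L (restrict r C)" unfolding r L_def by (rule sum.cong) auto
  ultimately show "x : L ` (C ->E T)" by blast
 qed
 hence cW: "card W = q^n" using card_image[OF Linj] using C(2) cC by (simp add: card_PiE)
 hence fW: "finite W" using q_ge by (intro card_ge_0_finite) simp
 have faithful: "a = 0" if a: "a : A" "!!x. x : W ==> a .* x = 0" for a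
 proof (rule ccontr)
  assume "a ~= 0"
  then obtain x where x: "a .* x .* ?e ~= 0" using prod_nonzero[OF a(1) _ eA(1,3)] by blast
  have "x .* ?e : fv.span C" unfolding C(4) by (simp add: V_def massoc eA)
  then obtain r where r: "x .* ?e = (SUM w:C. r w *c w)" unfolding fv.span_finite[OF C(2)] by auto
  have "a .* w = 0" if "w : C" for w using that C(1,5) a(2) by (auto simp: W_def)
  hence "a .* (x .* ?e) = 0" unfolding r msum_r by simp
  thus False using x by (simp add: massoc)
 qed
 have "ALL i<j. c i = 0" if "ALL i<j. y i : W" "tind j y" "(SUM i<j. c i *c y i) = 0" for j y c using that
 proof (induct j arbitrary: c)
  case (Suc j)
  have tj: "tind j y" unfolding tind_def
  proof (intro allI impI)
   fix c i assume c: "ALL i<j. c i : T" "(SUM i<j. c i *c y i) = 0" and i: "i < j"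
   have "(SUM i<Suc j. (c(j := 0)) i *c y i) = 0" using c(2) by simp
   moreover have "ALL i<Suc j. (c(j := 0)) i : T" using c(1) T0 by (auto simp: less_Suc_eq)
   ultimately show "c i = 0" using tindD[OF Suc(3), of "c(j := 0)" i] i by auto
  qed
  have yj: "th (y i) = y i" if "i < Suc j" for i using Suc(2) that by (auto simp: W_def)
  have yW: "ALL i<j. y i : W" using Suc(2) by simp
  \<comment> \<open>Artin's argument: normalise the last coefficient to 1 and subtract the image of
    the relation under \<open>th\<close>. The difference is shorter, so by induction all
    coefficients are fixed by the Frobenius and lie in \<open>T\<close>.\<close>
  have cj0: "c j = 0"
  proof (rule ccontr)
   assume cj: "c j ~= 0"
   define d where "d i = c i / c j" for i
   have "inverse (c j) *c (SUM i<Suc j. c i *c y i) = 0" unfolding Suc(4) by simp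
   hence d0: "(SUM i<Suc j. d i *c y i) = 0" unfolding fv.scale_sum_right d_def by (simp add: divide_inverse mult.commute del: sum.lessThan_Suc)
   have "th (SUM i<Suc j. d i *c y i) = (SUM i<Suc j. fr (d i) *c th (y i))" by (rule thsum)
   also have "... = (SUM i<Suc j. fr (d i) *c y i)" by (intro sum.cong refl) (simp add: yj)
   finally have "(SUM i<Suc j. fr (d i) *c y i) = 0" unfolding d0 using thsc[of 0 0] by (simp add: fr_simps del: sum.lessThan_Suc)
   hence "(SUM i<Suc j. (fr (d i)-d i) *c y i) = 0" unfolding fv.scale_left_diff_distrib sum_subtractf d0 by (simp del: sum.lessThan_Suc)
   moreover have dj: "d j = 1" using cj by (simp add: d_def)
   ultimately have s0: "(SUM i<j. (fr (d i)-d i) *c y i) = 0" by (simp add: fr_simps)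
   have "ALL i<Suc j. d i : T" using Suc(1)[OF yW tj s0] using dj T1 fr_T by (auto simp: less_Suc_eq)
   hence "d j = 0" using tindD[OF Suc(3) _ d0, of j] by simp
   thus False using dj by simp
  qed
  have "(SUM i<j. c i *c y i) = 0" using Suc(4) unfolding sum.lessThan_Suc cj0 fv.scale_zero_left add_0_right .
  from Suc(1)[OF yW tj this] show ?case using cj0 by (auto simp: less_Suc_eq)
 qed simp
 hence K: "ALL j y c. (ALL i<j. y i : W) --> tind j y --> (SUM i<j. c i *c y i) = 0 --> (ALL i<j. c i = 0)" by (intro allI impI) blast
 have 1: "ALL a:A. ALL x:W. frv a = a --> a .* x : W" by (simp add: W_def V_def th_def frv_mul massoc)
 have 2: "0 : W" using thsc[of 0 0] fv.subspace_0[OF V] by (simp add: W_def fr_simps)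
 have 3: "ALL x:W. ALL y:W. x+y : W" using thadd fv.subspace_add[OF V] by (simp add: W_def)
 have 4: "ALL c:T. ALL x:W. c *c x : W" using thsc fr_T fv.subspace_scale[OF V] by (simp add: W_def)
 have 5: "W <= A" by (auto simp: W_def V_def)
 have 6: "ALL a:A. (ALL x:W. a .* x = 0) --> a = 0" using faithful by blast
 show ?thesis by (intro exI[of _ W] conjI fW cW 5 2 3 4 1 6 K)
qed

end

section \<open>Counting regular elements by cyclic vectors\<close>

context fin_cs begin

lemma mon_split:
 assumes g: "g : Sep n"
 shows "EX mu. inj_on mu {..<n} & mon n g = (PROD x<n. [:- mu x, 1:])"
proof -
 let ?P = "mon n g"
 have lP: "lead_coeff ?P = 1" by (simp add: degree_mon coeff_mon)
 hence P0: "?P ~= 0" by auto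
 define R where "R = {x. poly ?P x = 0}"
 have fR: "finite R" unfolding R_def by (rule poly_roots_finite[OF P0])
 let ?Q = "PROD x:R. [:- x, 1:]"
 obtain h where h: "?P = ?Q * h" using prod_roots_dvd[OF fR, of ?P] by (auto simp: R_def elim: dvdE)
 have lQ: "lead_coeff ?Q = 1" by (rule monic_prod) simp
 have lh: "lead_coeff h = 1" using lP lQ unfolding h lead_coeff_mult by simp
 have "degree h = 0"
 proof (rule ccontr)
  assume "degree h ~= 0"
  then obtain z where z: "poly h z = 0" using alg_closed_imp_poly_has_root[of h] by blast
  hence Pz: "poly ?P z = 0" unfolding h by simp
  hence "poly ?Q z = 0" using fR by (simp add: R_def poly_prod)
  hence "poly (pderiv ?P) z = 0" unfolding h pderiv_mult using z by simp
  thus False using g Pz by (simp add: Sep_def)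
 qed
 hence "h = 1" using lh by (metis degree_eq_zeroE lead_coeff_pCons(2) one_pCons)
 hence P: "?P = ?Q" using h by simp
 have "degree ?Q = card R" by (subst degree_prod_eq_sum_degree) auto
 hence cR: "card R = n" using P by (metis degree_mon)
 obtain mu where mu: "bij_betw mu {..<n} R" using ex_bij_betw_nat_finite[OF fR] cR by (auto simp: lessThan_atLeast0)
 thus ?thesis using prod.reindex_bij_betw[OF mu, of "%x. [:- x, 1:]"] using mu P by (auto simp: bij_betw_def)
qed

text \<open>\<open>a\<close> acts on \<open>y\<close> as the companion matrix of
  \<open>mon n g\<close>, so this polynomial in \<open>a\<close> kills \<open>y 0\<close>, then all
  \<open>y i\<close>, and is 0 by faithfulness. Independence of \<open>y\<close> excludes lower
  degrees, and \<open>g\<close> in \<open>Sep n\<close> gives distinct roots.\<close>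

lemma cyclic_regular:
 assumes nn: "n * n = m" and n0: "0 < n" and a: "a : A" and g: "g : Sep n" and y: "!!i. i < n ==> y i : A"
  and step: "!!i. Suc i < n ==> a .* y i = y (Suc i)" and last: "a .* y (n-1)+(SUM j<n. g j *c y j) = 0"
  and ind: "!!c. (SUM i<n. c i *c y i) = 0 ==> ALL i<n. c i = 0"
  and faithful: "!!z. z : A ==> (!!i. i < n ==> z .* y i = 0) ==> z = 0"
 shows "i < n ==> mpow e1 a i .* y 0 = y i" and "regular n a"
proof -
 have pw: "i < n ==> mpow e1 a i .* y 0 = y i" for i
 proof (induct i)
  case 0 thus ?case using y by simp
 next
  case (Suc i)
  thus ?case using step[of i] by (simp add: massoc)
 qed
 thus "i < n ==> mpow e1 a i .* y 0 = y i" .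
 have e1i: "e1 .* e1 = e1" by simp
 have ac: "a : corner e1 e1" using a by (simp add: corner_def)
 let ?z = "peval e1 (mon n g) a"
 have zA: "?z : A" using peval_corner(1)[OF e1i ac] corner_subset by blast
 have pn: "mpow e1 a n .* y 0 = a .* y (n-1)" using pw[of "n-1"] n0 by (cases n) (auto simp: massoc)
 have "?z .* y 0 = (SUM i<n. g i *c (mpow e1 a i .* y 0))+a .* y (n-1)" unfolding mon_def by (simp add: peval_add peval_sum peval_monom mul_add_l msum_l pn)
 also have "(SUM i<n. g i *c (mpow e1 a i .* y 0)) = (SUM i<n. g i *c y i)" by (intro sum.cong refl) (simp add: pw)
 finally have z0: "?z .* y 0 = 0" using last by (simp only: add.commute)
 have zero: "?z = 0"
 proof (rule faithful[OF zA])
  fix i assume i: "i < n"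
  have "?z .* mpow e1 a i = mpow e1 a i .* ?z" using peval_mult[OF e1i ac, of "mon n g" "mn 1 i"] peval_mult[OF e1i ac, of "mn 1 i" "mon n g"] by (simp add: peval_monom mult.commute)
  hence "(?z .* mpow e1 a i) .* y 0 = 0" using z0 by (simp add: massoc)
  thus "?z .* y i = 0" using pw[OF i] by (simp add: massoc)
 qed
 obtain mu where mu: "inj_on mu {..<n}" "mon n g = (PROD x<n. [:- mu x, 1:])" using mon_split[OF g] by blast
 have "reg_elt m s e1 n mu a"
 proof unfold_locales
  fix r :: "'a poly" assume r: "r ~= 0" "degree r < n"
  show "peval e1 r a ~= 0"
  proof
   assume 0: "peval e1 r a = 0"
   have "peval e1 r a = (SUM i<n. coeff r i *c mpow e1 a i)" unfolding peval_altdef using r(2) by (intro sum.mono_neutral_left) (auto simp: coeff_eq_0)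
   from arg_cong[OF this, of "%t. t .* y 0"] have "(SUM i<n. coeff r i *c (mpow e1 a i .* y 0)) = 0" unfolding 0 msum_l by simp
   hence "(SUM i<n. coeff r i *c y i) = 0" by (simp add: pw)
   from ind[OF this] have "coeff r (degree r) = 0" using r(2) by blast
   thus False using r(1) by simp
  qed
 qed (use nn a mu zero in auto)
 thus "regular n a" by (auto simp: regular_def)
qed

text \<open>A \<open>T\<close>-basis \<open>y\<close> of \<open>W\<close> and a separable
  \<open>g\<close> yield a regular element that acts as a companion matrix; it and
  \<open>y 0\<close> determine the pair. So the number of bases times the number of separable
  \<open>g\<close> is at most \<open>q^n\<close> times the number of regular elements. For
  \<open>q >= 5\<close> each factor is at least 3/4 of its total, whence 9/16.\<close>

theorem regular_count:
 assumes nn: "n * n = m" and q5: "q >= 5"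
 shows "16 * card {x. (ALL i<m. x i : T) & (ALL i>=m. x i = 0) & ~regular n x} <= 7 * q^m"
proof -
 obtain n' e where fam: "idem n' e" "n' * n' = m" using exists_square_fam by blast
 hence "n' = n" using power2_eq_imp_eq zero_le using nn by (auto simp: power2_eq_square)
 hence fam: "idem n e" using fam by simp
 have n0: "0 < n" using fam e1_nz by (cases n) (auto simp: idem_def)
 obtain W where W': "finite W" "card W = q^n" "W <= A" "0 : W" "ALL x:W. ALL y:W. x+y : W" "ALL c:T. ALL x:W. c *c x : W"
  "ALL a:A. ALL x:W. frv a = a --> a .* x : W" "ALL a:A. (ALL x:W. a .* x = 0) --> a = 0"
  "ALL j y c. (ALL i<j. y i : W) --> tind j y --> (SUM i<j. c i *c y i) = 0 --> (ALL i<j. c i = 0)"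
  using exists_finite_form[OF fam nn] by (elim exE conjE) (rule that)
 note W = W'[rule_format]
 have Wsum: "(SUM i:I. c i *c y i) : W" if "!!i. i : I ==> c i : T" "!!i. i : I ==> y i : W" for I :: "nat set" and c y using that by (induct I rule: ifi) (auto intro: W(4-6))
 define A0 where "A0 = {x. (ALL i<m. x i : T) & (ALL i>=m. x i = (0 :: 'a))}"
 have A0: "finite A0" "card A0 = q^m" unfolding A0_def using nonregular_bound(2,3)[OF nn fin] by auto
 have A0D: "x : A" "frv x = x" if "x : A0" for x
 proof -
  show "x : A" using that by (simp add: A0_def spt_def)
  have "x i : T" for i using that T0 by (cases "i < m") (auto simp: A0_def)
  thus "frv x = x" by (simp add: frv_fixed)
 qed
 define Y where "Y = {y : {..<n} ->E W. tind n y}"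
 have comb: "bij_betw (%c. SUM i<n. c i *c y i) ({..<n} ->E T) W" if y: "y : Y" for y
 proof -
  have inj: "inj_on (%c. SUM i<n. c i *c y i) ({..<n} ->E T)"
  proof (rule inj_onI)
   fix c d assume cd: "c : {..<n} ->E T" "d : {..<n} ->E T" "(SUM i<n. c i *c y i) = (SUM i<n. d i *c y i)"
   hence "(SUM i<n. (c i-d i) *c y i) = 0" by (simp add: fv.scale_left_diff_distrib sum_subtractf)
   moreover have "c i-d i : T" if "i < n" for i using cd(1,2) that by (auto intro!: Tdiff)
   moreover have "tind n y" using y by (simp add: Y_def)
   ultimately have "c i-d i = 0" if "i < n" for i using tindD[of n y "%i. c i-d i" i] that by simp
   thus "c = d" using cd(1,2) by (intro PiE_ext) auto
  qed
  have "(%c. SUM i<n. c i *c y i) ` ({..<n} ->E T) = W"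
  proof (rule card_subset_eq[OF W(1)])
   show "(%c. SUM i<n. c i *c y i) ` ({..<n} ->E T) <= W" using y by (auto simp: Y_def intro!: Wsum)
   show "card ((%c. SUM i<n. c i *c y i) ` ({..<n} ->E T)) = card W" using card_image[OF inj] W(2) by (simp add: card_PiE)
  qed
  thus ?thesis using inj by (simp add: bij_betw_def)
 qed
 have faithful: "z = 0" if y: "y : Y" and z: "z : A" "!!i. i < n ==> z .* y i = 0" for y z
 proof (rule W(8)[OF z(1)])
  fix x assume "x : W"
  then obtain c where "x = (SUM i<n. c i *c y i)" using comb[OF y] by (auto simp: bij_betw_def)
  thus "z .* x = 0" using z(2) by (simp add: msum_r)
 qed
 \<comment> \<open>Elements of the finite form are determined by their values on \<open>y\<close>,
   and there are \<open>q^m\<close> elements and \<open>q^m\<close> tuples in \<open>W\<close>; so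
   every tuple of values is attained.\<close>
 have act: "EX a:A0. ALL i<n. a .* y i = t i" if y: "y : Y" and t: "t : {..<n} ->E W" for y t
 proof -
  let ?M = "%a. restrict (%i. a .* y i) {..<n}"
  have inj: "inj_on ?M A0"
  proof (rule inj_onI)
   fix a b assume ab: "a : A0" "b : A0" "?M a = ?M b"
   have "a-b = 0"
   proof (rule faithful[OF y])
    show "a-b : A" by (rule spt_closed(3)[OF A0D(1)[OF ab(1)] A0D(1)[OF ab(2)]])
    show "(a-b) .* y i = 0" if "i < n" for i using fun_cong[OF ab(3), of i] that by (simp add: mul_diff_l)
   qed
   thus "a = b" by simp
  qed
  have "?M ` A0 = {..<n} ->E W"
  proof (rule card_subset_eq)
   show "finite ({..<n} ->E W)" using W(1) by (simp add: finite_PiE)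
   show "?M ` A0 <= {..<n} ->E W" using y A0D by (auto simp: Y_def intro!: W(7))
   show "card (?M ` A0) = card ({..<n} ->E W)" using card_image[OF inj] A0(2) W(2) nn by (simp add: card_PiE power_mult[symmetric])
  qed
  hence "t : ?M ` A0" using t by (simp only:)
  then obtain a where a: "a : A0" "t = ?M a" by (elim imageE) (rule that)
  hence "a .* y i = t i" if "i < n" for i using that by simp
  thus ?thesis using a(1) by blast
 qed
 have exF: "EX a:A0. (ALL i. Suc i < n --> a .* y i = y (Suc i)) & a .* y (n-1)+(SUM j<n. g j *c y j) = 0"
  if y: "y : Y" and g: "g : {..<n} ->E T" for y g
 proof -
  let ?t = "\<lambda>i\<in>{..<n}. if i = n-1 then SUM j<n. (- g j) *c y j else y (Suc i)"
  have "(SUM j<n. (- g j) *c y j) : W" using y g by (intro Wsum Tneg) (auto simp: Y_def)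
  moreover have "y (Suc i) : W" if "i < n" "i ~= n-1" for i
  proof -
   show ?thesis using that using y unfolding Y_def by (auto simp: PiE_iff)
  qed
  ultimately have "?t : {..<n} ->E W" by auto
  from act[OF y this] obtain a where a: "a : A0" "!!i. i < n ==> a .* y i = ?t i" by blast
  have "a .* y i = y (Suc i)" if "Suc i < n" for i using a(2)[of i] that by auto
  moreover have "a .* y (n-1)+(SUM j<n. g j *c y j) = 0" using a(2)[of "n-1"] n0 by (simp add: sum_negf)
  ultimately show ?thesis using a(1) by blast
 qed
 have "ALL p:Y \<times> ({..<n} ->E T). EX a. a : A0 & (ALL i. Suc i < n --> a .* fst p i = fst p (Suc i)) &
   a .* fst p (n-1)+(SUM j<n. snd p j *c fst p j) = 0"
 proof
  fix p assume "p : Y \<times> ({..<n} ->E T)"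
  hence fs: "fst p : Y & snd p : {..<n} ->E T" by (simp only: mem_Times_iff)
  from exF[OF conjunct1[OF fs] conjunct2[OF fs]] show "EX a. a : A0 & (ALL i. Suc i < n --> a .* fst p i = fst p (Suc i)) &
   a .* fst p (n-1)+(SUM j<n. snd p j *c fst p j) = 0" by blast
 qed
 from bchoice[OF this] obtain F where F': "ALL p:Y \<times> ({..<n} ->E T). F p : A0 & (ALL i. Suc i < n --> F p .* fst p i = fst p (Suc i)) &
   F p .* fst p (n-1)+(SUM j<n. snd p j *c fst p j) = 0" by (elim exE) (rule that)
 have F: "F (y, g) : A0" "Suc i < n ==> F (y, g) .* y i = y (Suc i)" "F (y, g) .* y (n-1)+(SUM j<n. g j *c y j) = 0"
  if "y : Y" "g : {..<n} ->E T" for y g i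
 proof -
  have "(y, g) : Y \<times> ({..<n} ->E T)" using that by (rule SigmaI)
  note B = bspec[OF F' this, unfolded fst_conv snd_conv]
  show "F (y, g) : A0" by (rule conjunct1[OF B])
  show "Suc i < n ==> F (y, g) .* y i = y (Suc i)" by (rule conjunct1[OF conjunct2[OF B], rule_format])
  show "F (y, g) .* y (n-1)+(SUM j<n. g j *c y j) = 0" by (rule conjunct2[OF conjunct2[OF B]])
 qed
 have SepT: "g : {..<n} ->E T" if "g : Sep n" for g using that by (simp add: Sep_def)
 have YW: "y i : W" if "y : Y" "i < n" for y i using that by (auto simp: Y_def)
 have cyc: "i < n ==> mpow e1 (F (y, g)) i .* y 0 = y i" "regular n (F (y, g))" if y: "y : Y" and g: "g : Sep n" for y g i
 proof -
  have c: "ALL i<n. c i = 0" if "(SUM i<n. c i *c y i) = 0" for c using W(9)[OF _ _ that] y YW unfolding Y_def by blast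
  have yA: "y i : A" if "i < n" for i using YW[OF y that] W(3) by blast
  note cr = cyclic_regular[OF nn n0 A0D(1)[OF F(1)[OF y SepT[OF g]]] g yA F(2)[OF y SepT[OF g]] F(3)[OF y SepT[OF g]] c faithful[OF y]]
  show "i < n ==> mpow e1 (F (y, g)) i .* y 0 = y i" "regular n (F (y, g))" using cr by blast+
 qed
 define Reg where "Reg = {x : A0. regular n x}"
 have "card (Y \<times> Sep n) <= card (Reg \<times> W)"
 proof (rule card_inj_on_le)
  show "inj_on (%(y, g). (F (y, g), y 0)) (Y \<times> Sep n)"
  proof (rule inj_onI, clarify)
   fix y g y' g' assume yg: "y : Y" "g : Sep n" "y' : Y" "g' : Sep n" and eq: "F (y, g) = F (y', g')" "y 0 = y' 0"
   have "y i = y' i" if "i < n" for i using cyc(1)[OF yg(1,2) that] cyc(1)[OF yg(3,4) that] eq by simp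
   hence yy: "y = y'" using yg(1,3) by (intro PiE_ext[of y "{..<n}" "%_. W" y']) (auto simp: Y_def)
   have "(SUM j<n. g j *c y j) = (SUM j<n. g' j *c y j)" using eq(1) yy using trans[OF F(3)[OF yg(1) SepT[OF yg(2)], unfolded ] F(3)[OF yg(1) SepT[OF yg(4)], symmetric]] by (simp only: add_left_cancel)
   thus "y = y' & g = g'" using bij_betw_imp_inj_on[OF comb[OF yg(1)]] SepT yg(2,4) using yy by (auto dest: inj_onD)
  qed
  show "(%(y, g). (F (y, g), y 0)) ` (Y \<times> Sep n) <= Reg \<times> W" using F(1) SepT cyc(2) YW n0 by (auto simp: Reg_def)
  show "finite (Reg \<times> W)" using A0(1) W(1) by (simp add: Reg_def)
 qed
 hence main: "card Y * card (Sep n) <= card Reg * q^n" by (simp add: card_cartesian_product W(2))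
 have finE: "finite ({..<n} ->E W)" "finite ({..<n} ->E T)" using W(1) fin by (simp_all add: finite_PiE)
 have "4 * card {y : {..<n} ->E W. ~tind n y} <= (q-1) * card {y : {..<n} ->E W. ~tind n y}" using q5 by (intro mult_le_mono1) simp
 also have "... <= q^m" using card_dependent[OF W(1,2)] nn by simp
 finally have b1: "4 * card {y : {..<n} ->E W. ~tind n y} <= q^m" .
 have "card ({..<n} ->E W) = q^m" using W(2) nn by (simp add: card_PiE power_mult[symmetric])
 moreover have "card ({..<n} ->E W) = card Y + card {y : {..<n} ->E W. ~tind n y}" unfolding Y_def using finE(1) by (subst card_Un_disjoint[symmetric]) (auto intro!: arg_cong[of _ _ card])
 ultimately have Y: "3 * q^m <= 4 * card Y" using b1 by linarith
 have "4 * card (({..<n} ->E T)-Sep n) <= (q-1) * card (({..<n} ->E T)-Sep n)" using q5 by (intro mult_le_mono1) simp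
 also have "... <= q^n" by (rule card_nonsep)
 finally have b2: "4 * card (({..<n} ->E T)-Sep n) <= q^n" .
 have "card ({..<n} ->E T) = q^n" by (simp add: card_PiE)
 moreover have "card ({..<n} ->E T) = card (Sep n) + card (({..<n} ->E T)-Sep n)" using finE(2) SepT by (subst card_Un_disjoint[symmetric]) (auto intro!: arg_cong[of _ _ card] finite_subset[OF _ finE(2)])
 ultimately have S: "3 * q^n <= 4 * card (Sep n)" using b2 by linarith
 have "9 * q^m * q^n = (3 * q^m)*(3 * q^n)" by simp
 also have "... <= (4 * card Y)*(4 * card (Sep n))" by (rule mult_le_mono[OF Y S])
 also have "... <= 16 * card Reg * q^n" using main by simp
 finally have "9 * q^m <= 16 * card Reg" using q_ge by simp
 moreover have "q^m = card Reg + card {x : A0. ~regular n x}" unfolding A0(2)[symmetric] Reg_def using A0(1) by (subst card_Un_disjoint[symmetric]) (auto intro!: arg_cong[of _ _ card])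
 moreover have e: "{x. (ALL i<m. x i : T) & (ALL i>=m. x i = 0) & ~regular n x} = {x : A0. ~regular n x}" by (auto simp: A0_def)
 ultimately show ?thesis unfolding e by linarith
qed

end

text \<open>
 A grid \<open>S ^ m\<close> consists mostly of good elements in two cases: when \<open>S\<close> is large, and when \<open>S\<close> is a
 finite subfield of definition.
\<close>

context cs_alg begin

interpretation K: acs_alg m "base_change_sc s" "acv e1" by (rule acs_alg_base_change)

definition good_elt :: "nat => (nat => 'a) => bool" where
 "good_elt n u \<longleftrightarrow> K.regular n (acv u)"

lemma bad_grid_image:
 fixes S :: "'a set"
 shows "card {x. (ALL i<m. x i : S) & (ALL i>=m. x i = 0) & ~good_elt n x} =
  card {x. (ALL i<m. x i : to_ac ` S) & (ALL i>=m. x i = 0) & ~K.regular n x}"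
proof -
 have "{x. (ALL i<m. x i : to_ac ` S) & (ALL i>=m. x i = 0) & ~K.regular n x} =
   acv ` {x. (ALL i<m. x i : S) & (ALL i>=m. x i = 0) & ~good_elt n x}"
 proof (intro equalityI subsetI)
  fix x assume x: "x : {x. (ALL i<m. x i : to_ac ` S) & (ALL i>=m. x i = 0) & ~K.regular n x}"
  have "ALL i. EX y. x i = to_ac y & (i < m --> y : S) & (i >= m --> y = 0)"
  proof
   fix i show "EX y. x i = to_ac y & (i < m --> y : S) & (i >= m --> y = 0)"
    using x by (cases "i < m") (auto intro: exI[of _ 0])
  qed
  from choice[OF this] obtain y where y: "!!i. x i = to_ac (y i) & (i < m --> y i : S) & (i >= m --> y i = 0)" by blast
  hence "x = acv y" by (auto simp: acv_def)
  thus "x : acv ` {x. (ALL i<m. x i : S) & (ALL i>=m. x i = 0) & ~good_elt n x}" using x y by (auto simp: good_elt_def)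
 qed (auto simp: good_elt_def acv_apply)
 thus ?thesis by (simp only:) (rule card_image[symmetric], simp add: inj_on_def acv_inject)
qed

text \<open>The degree bound leaves at most 2/5 of the points bad, which is below 7/16.\<close>

lemma bad_grid_large:
 assumes nn: "n * n = m" and S: "finite S" "5 * m^2 <= card S"
 shows "16 * card {x. (ALL i<m. x i : S) & (ALL i>=m. x i = 0) & ~good_elt n x} <= 7 * card S^m"
proof -
 let ?b = "card {x. (ALL i<m. x i : S) & (ALL i>=m. x i = 0) & ~good_elt n x}"
 have c: "card (to_ac ` S) = card S" by (rule card_image) (simp add: inj_on_def)
 have m0: "m > 0"
 using e1_supp e1_nz by (auto simp: spt_def fun_eq_iff fapp)
 have 1: "card S*?b <= 2 * m^2 * card S^m" using K.nonregular_bound(1)[OF nn, of "to_ac ` S"] S(1) unfolding bad_grid_image c by simp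
 have 2: "5 * m^2*?b <= card S*?b" using S(2) by (rule mult_le_mono1)
 have "5*?b <= 2 * card S^m" using order_trans[OF 2 1] using m0 by simp
 thus ?thesis by linarith
qed

text \<open>In dimension one every element is a scalar and has a linear annihilating polynomial.
  This settles fields with fewer than five elements, for which the dimension, a square below the
  size of the field, can only be 1.\<close>

lemma good_elt_1:
 assumes "m = 1" "u : A"
 shows "good_elt 1 u"
proof -
 have uA: "acv u : K.A" by (rule acv_supp[OF assms(2)])
 have e0: "acv e1 0 ~= 0"
 proof
  assume "acv e1 0 = 0"
  hence "acv e1 i = 0" for i using K.e1_supp assms(1) by (cases i) (auto simp: spt_def)
  hence "acv e1 = 0" by (auto simp: fun_eq_iff fapp)
  thus False using K.e1_nz by simp
 qed
 define c where "c = acv u 0 / acv e1 0"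
 have uc: "acv u = c *c acv e1"
 proof
  fix i show "acv u i = (c *c acv e1) i"
   using uA K.e1_supp assms(1) e0 by (cases i) (auto simp: spt_def fapp c_def)
 qed
 have "reg_elt m (base_change_sc s) (acv e1) 1 (%_. c) (acv u)"
 proof unfold_locales
  show "K.peval (acv e1) (PROD x<(1 :: nat). [:- c, 1:]) (acv u) = 0" using uA by (simp add: uc fv.scale_minus_left lessThan_Suc)
  fix r :: "'a alg_closure poly" assume r: "r ~= 0" "degree r < 1"
  then obtain a where "r = [:a:]" "a ~= 0" by (metis degree_eq_zeroE less_one pCons_0_0)
  thus "K.peval (acv e1) r (acv u) ~= 0" using K.e1_nz by simp
 qed (use assms uA in \<open>auto simp: inj_on_def\<close>)
 thus ?thesis unfolding good_elt_def K.regular_def by blast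
qed

lemma bad_grid_closed:
 assumes nn: "n * n = m" and S: "finite S" "0 : S" "1 : S" "!!x y. x : S ==> y : S ==> x+y : S" "!!x y. x : S ==> y : S ==> x * y : S"
  and s: "!!i j l. i < m ==> j < m ==> l < m ==> s i j l : S" and big: "m = 1 \<or> card S >= 5"
 shows "16 * card {x. (ALL i<m. x i : S) & (ALL i>=m. x i = 0) & ~good_elt n x} <= 7 * card S^m"
proof (cases "card S >= 5")
 case True
 have c: "card (to_ac ` S) = card S" by (rule card_image) (simp add: inj_on_def)
 interpret F: fin_cs m "base_change_sc s" "acv e1" "to_ac ` S"
 proof unfold_locales
  show "finite (to_ac ` S)" "0 : to_ac ` S" "1 : to_ac ` S" using S by (auto intro: rev_image_eqI[of 0] rev_image_eqI[of 1])
  fix x y :: "'a alg_closure" assume "x : to_ac ` S" "y : to_ac ` S"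
  then obtain x' y' where "x' : S" "y' : S" "x = to_ac x'" "y = to_ac y'" by blast
  thus "x+y : to_ac ` S" "x * y : to_ac ` S" using S(4,5) by (auto simp flip: to_ac_add to_ac_mult)
 qed (use s in \<open>auto simp: base_change_sc_def\<close>)
 show ?thesis using F.regular_count[OF nn] True unfolding bad_grid_image c by blast
next
 case False
 hence m: "m = 1" "n = 1" using big nn by auto
 have "{x. (ALL i<m. x i : S) & (ALL i>=m. x i = 0) & ~good_elt n x} = {}" using good_elt_1[OF m(1)] unfolding m(2) spt_def by blast
 thus ?thesis by (simp only: card.empty mult_0_right zero_le)
qed

lemma card_grid:
 fixes S :: "'a set"
 assumes "n * n = m" "finite S"
 shows "finite {x. (ALL i<m. x i : S) & (ALL i>=m. x i = 0)}" "card {x. (ALL i<m. x i : S) & (ALL i>=m. x i = 0)} = card S^m"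
proof -
 have "bij_betw (%f i. if i < m then f i else 0) ({..<m} ->E S) {x. (ALL i<m. x i : S) & (ALL i>=m. x i = 0)}" by (rule bij_betw_byWitness[where f' = "%x. restrict x {..<m}"]) (auto simp: PiE_def extensional_def fun_eq_iff)
 from bij_betw_finite[OF this] bij_betw_same_card[OF this]
 show "finite {x. (ALL i<m. x i : S) & (ALL i>=m. x i = 0)}" "card {x. (ALL i<m. x i : S) & (ALL i>=m. x i = 0)} = card S^m" using assms(2) by (simp_all add: finite_PiE card_PiE)
qed

lemma good_elt_tests:
 assumes nn: "n * n = m" and u: "u : A" and good: "good_elt n u"
 shows "EX p. mpow e1 u n = (SUM i<n. p i *c mpow e1 u i)"
  and "~(EX c. mpow e1 u (n-1) = (SUM i<n-1. c i *c mpow e1 u i))"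
  and "mpow e1 u n = (SUM i<n. p i *c mpow e1 u i) ==>
   EX d:A. peval e1 (pderiv (mn 1 n-(SUM i<n. mn (p i) i))) u .* d = e1"
proof -
 obtain mu where "reg_elt m (base_change_sc s) (acv e1) n mu (acv u)" using good by (auto simp: good_elt_def K.regular_def)
 from regular_descent[OF this u]
 show "EX p. mpow e1 u n = (SUM i<n. p i *c mpow e1 u i)"
  "~(EX c. mpow e1 u (n-1) = (SUM i<n-1. c i *c mpow e1 u i))"
  "mpow e1 u n = (SUM i<n. p i *c mpow e1 u i) ==>
   EX d:A. peval e1 (pderiv (mn 1 n-(SUM i<n. mn (p i) i))) u .* d = e1" by blast+
qed

lemma exists_square: "EX n. n * n = m"
 using K.exists_square_fam by blast

end

subsection \<open>The linear systems of the algorithm\<close>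

text \<open>Unknowns and equations of the linear systems carry several indices, packed as
  \<open>r * m + j\<close>; \<open>sum_flat\<close> and \<open>all_flat\<close> unpack sums and
  quantifiers.\<close>

lemma sum_flat:
 fixes g :: "nat => 'b::comm_monoid_add"
 assumes "m > 0"
 shows "(SUM q<N * m. g q) = (SUM r<N. SUM j<m. g (r * m+j))"
proof (induct N)
 case (Suc N)
 have "(SUM q<Suc N * m. g q) = (SUM q<N * m. g q)+(SUM q:{N * m..<N * m+m}. g q)" using sum.atLeastLessThan_concat[of 0 "N * m" "N * m+m" g] by (simp add: lessThan_atLeast0 add.commute)
 also have "(SUM q:{N * m..<N * m+m}. g q) = (SUM j<m. g (N * m+j))" using sum.shift_bounds_nat_ivl[of g 0 "N * m" m] by (simp add: lessThan_atLeast0 add.commute)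
 finally show ?case using Suc by simp
qed simp

lemma flat: "[|j < m; r < N|] ==> r * m+j < N * m" "j < m ==> (r * m+j) div m = r" "j < m ==> (r * m+j) mod m = (j :: nat)"
 using div_mod_encode[of j m r] by auto

lemma all_flat:
 fixes m N :: nat
 assumes "m > 0"
 shows "(ALL q<N * m. Q q) \<longleftrightarrow> (ALL r<N. ALL j<m. Q (r * m+j))"
proof
 assume Q: "ALL r<N. ALL j<m. Q (r * m+j)"
 show "ALL q<N * m. Q q"
 proof (intro allI impI)
  fix q assume "q < N * m"
  hence "q div m < N" "q mod m < m" using assms by (auto simp: less_mult_imp_div_less)
  thus "Q q" using Q by force
 qed
qed (use flat(1) in blast)

context cs_alg begin

lemma m_pos: "m > 0"
using e1_supp e1_nz by (auto simp: spt_def fun_eq_iff fapp)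

text \<open>The equations make \<open>y\<close> a left unit on the basis, so its product with
  \<open>e1\<close> is both \<open>e1\<close> and \<open>y\<close>.\<close>

lemma unit_unique:
 assumes y: "!!j l. j < m ==> l < m ==> (SUM i<m. s i j l * y i) = (if j = l then 1 else 0)" and i: "i < m"
 shows "y i = e1 i"
proof -
 let ?y = "%i. if i < m then y i else 0"
 have "(?y .* e1) l = e1 l" for l
 proof (cases "l < m")
  case True
  have "(?y .* e1) l = (SUM j<m. e1 j*(SUM i<m. s i j l * y i))" using True by (simp add: mul_def sum_distrib_left) (subst sum.swap, simp add: mult_ac)
  also have "... = (SUM j<m. if j = l then e1 j else 0)" by (intro sum.cong refl) (simp add: y True)
  finally show ?thesis using True by simp
 qed (use e1_supp in \<open>simp add: mul_def spt_def\<close>)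
 hence "?y .* e1 = e1" by blast
 moreover have "?y : A" by (simp add: spt_def)
 ultimately have "?y = e1" by simp
 from fun_cong[OF this, of i] show ?thesis using i by simp
qed

text \<open>The row of \<open>u^(r+1)\<close> is linear in the row of \<open>u^r\<close>, so one
  triangular system has the whole table of powers as its only solution.\<close>

lemma power_system_unique:
 assumes y: "!!l. l < m ==> y (0 * m+l) = e1 l"
  "!!r l. Suc r < N ==> l < m ==> y (Suc r * m+l) = (SUM j<m. (SUM i<m. u i * s i j l) * y (r * m+j))"
 shows "r < N ==> l < m ==> y (r * m+l) = mpow e1 u r l"
proof (induct r arbitrary: l)
 case (Suc r)
 have "y (Suc r * m+l) = (SUM j<m. (SUM i<m. u i * s i j l) * mpow e1 u r j)" unfolding y(2)[OF Suc(2,3)] using Suc by (intro sum.cong refl) simp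
 also have "... = mpow e1 u (Suc r) l" using Suc(3) by (simp add: mul_def sum_distrib_right) (subst sum.swap, simp add: mult_ac)
 finally show ?case .
qed (use y(1) in simp)

lemma power_system:
 assumes l: "l < m"
 shows "mpow e1 u (Suc r) l = (SUM j<m. (SUM i<m. u i * s i j l) * mpow e1 u r j)"
 using l by (simp add: mul_def sum_distrib_right) (subst sum.swap, simp add: mult_ac)

end

context gen_elt begin

lemma K1: "e1 .* e1 = e1" "u : corner e1 e1" using uA by (simp_all add: corner_def)

lemma red_rel: "mpow e1 u r = (SUM l<n. coeff (mn 1 r mod P) l *c mpow e1 u l)"
proof -
 let ?R = "mn 1 r mod P"
 have P0: "P ~= 0" using lead_P by auto
 have "degree ?R < n" using degree_mod_less[OF P0, of "mn 1 r"] n_pos degree_P by auto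
 hence "peval e1 ?R u = (SUM l<n. coeff ?R l *c mpow e1 u l)" unfolding peval_altdef by (intro sum.mono_neutral_left) (auto simp: coeff_eq_0)
 moreover have "peval e1 (P * d+?R) u = peval e1 ?R u" for d by (simp add: peval_add peval_mult[OF K1] peval_P)
 from this[of "mn 1 r div P"] have "peval e1 (mn 1 r) u = peval e1 ?R u" by simp
 ultimately show ?thesis by (simp add: peval_monom)
qed

text \<open>Reductions modulo \<open>P\<close> are read off from relations between powers of
  \<open>u\<close>, unique by independence, so no polynomial division has to be computed.\<close>

lemma red_unique:
 assumes y: "!!l. l < m ==> (SUM i<n. mpow e1 u i l * y i) = mpow e1 u r l" and i: "i < n"
 shows "y i = coeff (mn 1 r mod P) i"
proof -
 let ?c = "%i. coeff (mn 1 r mod P) i"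
 have pA: "mpow e1 u i : A" for i by (cases i) auto
 have "(SUM i<n. y i *c mpow e1 u i) l = mpow e1 u r l" for l using y[of l] pA by (cases "l < m") (simp_all add: fapp mult.commute spt_def)
 hence "(SUM i<n. y i *c mpow e1 u i)-(SUM i<n. ?c i *c mpow e1 u i) = 0" using red_rel[of r] by auto
 hence "(SUM i<n. (y i-?c i) *c mpow e1 u i) = 0" by (simp only: fv.scale_left_diff_distrib sum_subtractf)
 from ind[OF this] i show ?thesis by simp
qed

lemma trace_red: "trace_field P (mn 1 j) = (SUM l<n. coeff (mn 1 (j+l) mod P) l)"
 by (simp add: trace_field_def degree_P mult_monom)

lemma coeffs_P: "coeffs P = map (%i. if i < n then-p i else 1) [0..<Suc n]"
proof -
 have "P ~= 0" using lead_P by auto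
 moreover have "coeff P i = (if i < n then-p i else 1)" if "i <= n" for i using that by (auto simp: P_def coeff_sum)
 ultimately show ?thesis unfolding coeffs_def by (simp add: degree_P del: upt_Suc)
qed

end

context gen_elt_split begin

text \<open>Matrix of the system \<open>fb_rel\<close>. Row \<open>j * m + l\<close> is coordinate
  \<open>l\<close> of the condition for \<open>bv j\<close>; column
  \<open>h * m + (a * n + b)\<close> belongs to \<open>r\<close> if \<open>h = i\<close> and to
  \<open>w h\<close> if \<open>h < i\<close>. The columns of \<open>w\<close> enter only the rows
  with \<open>j = i\<close>.\<close>

definition fbG :: "nat => nat => nat => 'a" where
 "fbG i k q = (if q div m = i then T (bv (k div m)) (q mod m div n) (q mod m mod n) (k mod m)
   else if k div m = i then T (bv (q div m)) (q mod m div n) (q mod m mod n) (k mod m) else 0)"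

definition fbb :: "nat => nat => 'a" where "fbb i k = (if k div m = i & k mod m = i then 1 else 0)"

lemma sum_nn: "(SUM q<m. g q) = (SUM a<n. SUM b<n. g (a * n+b))" for g :: "nat => 'b::comm_monoid_add"
 using sum_flat[OF n_pos, of g n] nn by simp

lemma nn_less: "a < n ==> b < n ==> a * n+b < m" using flat(1)[of b n a n] nn by simp

lemma fb_solves:
 assumes i: "i < m"
 shows "(ALL k<Suc i * m. (SUM q<Suc i * m. fbG i k q * y q) = fbb i k) \<longleftrightarrow>
  fb_rel i (%a b. y (i * m+(a * n+b))) (%j a b. y (j * m+(a * n+b)))"
proof -
 define FS where "FS h z = (SUM a<n. SUM b<n. y (h * m+(a * n+b)) *c T z a b)" for h z
 define W where "W = (SUM h<i. FS h (bv h))"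
 have FA: "FS h z : A" for h z unfolding FS_def by (intro spt_sum spt_closed T_A)
 have WA: "W : A" unfolding W_def by (intro spt_sum FA)
 have FSl: "(SUM a<n. SUM b<n. y (h * m+(a * n+b)) * T z a b l) = FS h z l" for h z l by (simp add: FS_def fapp)
 have row: "(SUM q<Suc i * m. fbG i (j * m+l) q * y q) = FS i (bv j) l+(if j = i then W l else 0)"
  if "j < Suc i" "l < m" for j l
 proof -
  have "(SUM q<Suc i * m. fbG i (j * m+l) q * y q) = (SUM h<Suc i. SUM a<n. SUM b<n. fbG i (j * m+l) (h * m+(a * n+b)) * y (h * m+(a * n+b)))" by (simp only: sum_flat[OF m_pos] sum_nn)
  also have "... = (SUM h<Suc i. if h = i then FS i (bv j) l else if j = i then FS h (bv h) l else 0)" unfolding FSl[symmetric] using nn_less that(2) by (intro sum.cong refl) (auto simp: fbG_def flat mult.commute intro!: sum.cong)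
  also have "... = FS i (bv j) l+(if j = i then W l else 0)" by (simp add: W_def fapp)
  finally show ?thesis .
 qed
 have ext: "(ALL l<m. (z l :: 'a) = w l) \<longleftrightarrow> z = w" if "z : A" "w : A" for z w using that by (auto simp: spt_def fun_eq_iff) (metis not_less)
 have e1: "(ALL l<m. FS i (bv j) l = 0) \<longleftrightarrow> FS i (bv j) = 0" for j using ext[OF FA[of i "bv j"] spt_closed(1)] by (simp add: fapp)
 have "bv i : A" using i by (auto simp: spt_def bv_apply)
 from ext[OF this spt_closed(2)[OF FA[of i "bv i"] WA]]
 have e2: "(ALL l<m. FS i (bv i) l+W l = (if l = i then 1 else 0)) \<longleftrightarrow> bv i = FS i (bv i)+W" by (simp add: fapp bv_apply eq_commute)
 have "(ALL k<Suc i * m. (SUM q<Suc i * m. fbG i k q * y q) = fbb i k) \<longleftrightarrow>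
   (ALL j<Suc i. ALL l<m. FS i (bv j) l+(if j = i then W l else 0) = (if j = i & l = i then 1 else 0))"
  unfolding all_flat[OF m_pos] by (simp add: row fbb_def flat del: mult_Suc sum.lessThan_Suc)
 also have "... \<longleftrightarrow> (ALL j<i. ALL l<m. FS i (bv j) l = 0) & (ALL l<m. FS i (bv i) l+W l = (if l = i then 1 else 0))" by (auto simp: All_less_Suc)
 also have "... \<longleftrightarrow> fb_rel i (%a b. y (i * m+(a * n+b))) (%j a b. y (j * m+(a * n+b)))" unfolding e1 e2 unfolding fb_rel_def W_def FS_def ..
 finally show ?thesis .
qed

lemma fb_exists:
 assumes i: "i < m"
 shows "EX y. ALL k<Suc i * m. (SUM q<Suc i * m. fbG i k q * y q) = fbb i k"
proof -
 obtain r w where rw: "fb_rel i r w" using exists_first_block_rel[OF i] by blast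
 let ?y = "%q. if q div m = i then r (q mod m div n) (q mod m mod n) else w (q div m) (q mod m div n) (q mod m mod n)"
 define y where "y = ?y"
 have yi: "y (i * m+(a * n+b)) = r a b" if "a < n" "b < n" for a b using that nn_less[OF that] by (simp add: y_def flat)
 have yj: "y (j * m+(a * n+b)) = w j a b" if "j < i" "a < n" "b < n" for j a b using that nn_less[OF that(2,3)] by (simp add: y_def flat)
 have 1: "(SUM a<n. SUM b<n. y (i * m+(a * n+b)) *c T z a b) = (SUM a<n. SUM b<n. r a b *c T z a b)" for z by (intro sum.cong refl) (simp add: yi)
 have 2: "(SUM j<i. SUM a<n. SUM b<n. y (j * m+(a * n+b)) *c T (bv j) a b) = (SUM j<i. SUM a<n. SUM b<n. w j a b *c T (bv j) a b)" by (intro sum.cong refl) (simp add: yj)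
 have "fb_rel i (%a b. y (i * m+(a * n+b))) (%j a b. y (j * m+(a * n+b)))" using rw unfolding fb_rel_def 1 2 .
 from iffD2[OF fb_solves[OF i] this] show ?thesis by (rule exI[of _ y])
qed

lemma c_solves:
 fixes v :: "nat => 'a" and t :: "nat => 'a"
 assumes vA: "v : A"
 shows "(ALL k<n * m. (SUM q<n * n * n. (t (q div n mod n+k div m) * T v (q div n div n) (q mod n) (k mod m)) * y q) =
   (v .* mpow e1 u (k div m) .* v) (k mod m)) \<longleftrightarrow>
  (ALL i<n. (SUM a<n. SUM b<n. SUM d<n. (y ((a * n+b) * n+d) * t (b+i)) *c T v a d) = v .* mpow e1 u i .* v)"
proof -
 have row: "(SUM q<n * n * n. (t (q div n mod n+i) * T v (q div n div n) (q mod n) l) * y q) =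
   (SUM a<n. SUM b<n. SUM d<n. (y ((a * n+b) * n+d) * t (b+i)) *c T v a d) l" for i l
 proof -
  let ?g = "%q. (t (q div n mod n+i) * T v (q div n div n) (q mod n) l) * y q"
  have "(SUM q<n * n * n. ?g q) = (SUM a<n. SUM b<n. SUM d<n. ?g ((a * n+b) * n+d))" by (simp add: sum_flat[OF n_pos])
  also have "... = (SUM a<n. SUM b<n. SUM d<n. y ((a * n+b) * n+d) * t (b+i) * T v a d l)" by (intro sum.cong refl, simp only: lessThan_iff flat, simp only: mult_ac)
  finally show ?thesis by (simp add: fapp)
 qed
 have ext: "(ALL l<m. (z l :: 'a) = w l) \<longleftrightarrow> z = w" if "z : A" "w : A" for z w using that by (auto simp: spt_def fun_eq_iff) (metis not_less)
 have SA: "(SUM a<n. SUM b<n. SUM d<n. (y ((a * n+b) * n+d) * t (b+i)) *c T v a d) : A" for i by (intro spt_sum spt_closed T_A)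
 have RA: "v .* mpow e1 u i .* v : A" for i by simp
 show ?thesis unfolding all_flat[OF m_pos] row ext[OF SA RA, symmetric] by (simp add: flat)
qed

text \<open>Any answers of the solver will do: every solution of the first systems gives a generator
  \<open>v\<close>, and every solution of the last one a cocycle, so no particular choice has to be
  controlled.\<close>

theorem output_correct:
 assumes y: "ALL i<m. ALL k<Suc i * m. (SUM q<Suc i * m. fbG i k q * y i q) = fbb i k"
  and v: "v = (SUM i<m. SUM a<n. SUM b<n. y i (i * m+(a * n+b)) *c T (bv i) a b)"
 shows "EX z. ALL i<n. (SUM a<n. SUM b<n. SUM d<n. (z ((a * n+b) * n+d) * trace_field P (mn 1 (b+i))) *c T v a d) = v .* mpow e1 u i .* v"
  and "ALL i<n. (SUM a<n. SUM b<n. SUM d<n. (z ((a * n+b) * n+d) * trace_field P (mn 1 (b+i))) *c T v a d) = v .* mpow e1 u i .* v ==>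
   vec m u : carrier (sc_alg m s) &
    max_comm_subalg m s (gen_subalg m s (vec m u)) & etale_subalg m s (gen_subalg m s (vec m u)) &
    is_min_poly m s (vec m u) P &
    (%al. if al : set (expos P 3) then z ((al ! 0 * n+al ! 1) * n+al ! 2) else 0) : amitsur_cocycles P 2 &
    (ALL al:set (expos P 2). vec m (T v (al ! 0) (al ! 1)) : carrier_vec m) &
    lin_map m P (%al. vec m (T v (al ! 0) (al ! 1))) :
     ring_iso (cocycle_alg P (%al. if al : set (expos P 3) then z ((al ! 0 * n+al ! 1) * n+al ! 2) else 0)) (sc_alg m s)"
proof -
 have vA: "v : A" unfolding v by (intro spt_sum spt_closed T_A)
 have v_nz: "blk v x x' ~= 0" if "x < n" "x' < n" for x x' unfolding v by (rule generator_blk_nz[OF _ that]) (use y fb_solves in blast)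
 obtain c where c: "c : tensors P 3" "ALL i<n. (SUM a<n. SUM b<n. SUM d<n.
   (c [a, b, d] * trace_field P (mn 1 (b+i))) *c T v a d) = v .* mpow e1 u i .* v"
  using exists_cocycle[OF vA v_nz] by blast
 let ?z = "%q. c [q div n div n, q div n mod n, q mod n]"
 have "(SUM a<n. SUM b<n. SUM d<n. (?z ((a * n+b) * n+d) * trace_field P (mn 1 (b+i))) *c T v a d) =
  (SUM a<n. SUM b<n. SUM d<n. (c [a, b, d] * trace_field P (mn 1 (b+i))) *c T v a d)" for i
  by (intro sum.cong refl) (simp add: flat)
 thus "EX z. ALL i<n. (SUM a<n. SUM b<n. SUM d<n. (z ((a * n+b) * n+d) * trace_field P (mn 1 (b+i))) *c T v a d) = v .* mpow e1 u i .* v" using c(2) by (intro exI[of _ ?z]) simp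
 assume z: "ALL i<n. (SUM a<n. SUM b<n. SUM d<n. (z ((a * n+b) * n+d) * trace_field P (mn 1 (b+i))) *c T v a d) = v .* mpow e1 u i .* v"
 let ?c = "%al. if al : set (expos P 3) then z ((al ! 0 * n+al ! 1) * n+al ! 2) else 0"
 have ex: "[a, b, d] : set (expos P 3)" if "a < n" "b < n" "d < n" for a b d using that degree_P by (simp add: expos_def set_n_lists)
 have "(SUM a<n. SUM b<n. SUM d<n. (?c [a, b, d] * trace_field P (mn 1 (b+i))) *c T v a d) =
  (SUM a<n. SUM b<n. SUM d<n. (z ((a * n+b) * n+d) * trace_field P (mn 1 (b+i))) *c T v a d)" for i
  by (intro sum.cong refl) (simp add: ex)
 then interpret C: cocycle_data m s e1 n u p dinv mu v ?c
  using z v_nz vA by unfold_locales (auto simp: tensors_def)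
 show "vec m u : carrier (sc_alg m s) &
    max_comm_subalg m s (gen_subalg m s (vec m u)) & etale_subalg m s (gen_subalg m s (vec m u)) &
    is_min_poly m s (vec m u) P & ?c : amitsur_cocycles P 2 &
    (ALL al:set (expos P 2). vec m (T v (al ! 0) (al ! 1)) : carrier_vec m) &
    lin_map m P (%al. vec m (T v (al ! 0) (al ! 1))) : ring_iso (cocycle_alg P ?c) (sc_alg m s)"
  using F_max F_etale min_poly C.c_cocycle C.lin_map_iso[of "%al. vec m (T v (al ! 0) (al ! 1))"]
  by (simp add: C.E_def sc_alg_simps)
qed

end

subsection \<open>Polynomial time computations\<close>

lemma size_shd: "size (shd x) <= size x" and size_stl: "size (stl x) <= size x"
 by (cases x; simp)+

lemma runs_size: "runs p x y t ==> size x <= t & size y <= t"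
 by (induct rule: runs.induct) (auto simp: le_SucI size_shd size_stl)

inductive_cases run_cases: "runs PId x y t" "runs PNull x y t" "runs PHd x y t" "runs PTl x y t"
 "runs (PFork p q) x y t" "runs (PSeq p q) x y t" "runs (PIf b p q) x y t"
inductive_cases run_WhileE: "runs (PWhile b p) x y t"

text \<open>The failure event of the definition speaks of some run; determinism turns it into a
  statement about the computed result.\<close>

lemma runs_det: "runs p x y t ==> runs p x y' t' ==> y = y'"
proof (induct arbitrary: y' t' rule: runs.induct)
 case (run_if_true b x v s p y t q)
 from run_if_true.prems show ?case by (rule run_cases(7)) (use run_if_true.hyps(2,3,5) in metis)+
next
 case (run_if_false b x s q y t p)
 from run_if_false.prems show ?case by (rule run_cases(7)) (use run_if_false.hyps(2,4) in metis)+
next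
 case (run_while_end b x s p)
 from run_while_end.prems show ?case by (rule run_WhileE) (use run_while_end.hyps(2) in blast)+
next
 case (run_while_step b x v s p y t z r)
 from run_while_step.prems run_while_step.hyps show ?case by - (erule run_WhileE, blast+)
next
 case (run_fork p x y s q z t)
 from run_fork.prems run_fork.hyps show ?case by (elim run_cases(5)) blast
next
 case (run_seq p x y s q z t)
 from run_seq.prems run_seq.hyps show ?case by (elim run_cases(6)) blast
qed (auto elim: run_cases)

lemma poly_nat_mono: "a <= b ==> poly (p :: nat poly) a <= poly p b"
 by (induct p) (auto intro: add_mono mult_mono)

text \<open>Existence of a polynomial bound in the size of \<open>f a\<close>, so that bounds
  compose without naming polynomials.\<close>

definition pb :: "'a set => ('a => sexp) => ('a => nat) => bool" where
 "pb D f h \<longleftrightarrow> (EX q :: nat poly. ALL a:D. h a <= poly q (size (f a)))"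

lemma pb_mono: "pb D f h ==> (!!a. a : D ==> h' a <= h a) ==> pb D f h'"
 unfolding pb_def by (meson order_trans)

lemma pb_const: "pb D f (%_. c)" unfolding pb_def by (rule exI[of _ "[:c:]"]) simp

lemma pb_size: "pb D f (%a. size (f a))" unfolding pb_def by (rule exI[of _ "[:0, 1:]"]) simp

lemma pb_add: "pb D f g ==> pb D f h ==> pb D f (%a. g a+h a)"
 unfolding pb_def
proof (elim exE)
 fix p q assume "ALL a:D. g a <= poly p (size (f a))" "ALL a:D. h a <= poly q (size (f a))"
 thus "EX q. ALL a:D. g a+h a <= poly q (size (f a))" by (intro exI[of _ "p+q"]) (simp add: add_mono)
qed

lemma pb_mult: "pb D f g ==> pb D f h ==> pb D f (%a. g a * h a)"
 unfolding pb_def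
proof (elim exE)
 fix p q assume "ALL a:D. g a <= poly p (size (f a))" "ALL a:D. h a <= poly q (size (f a))"
 thus "EX q. ALL a:D. g a * h a <= poly q (size (f a))" by (intro exI[of _ "p * q"]) (simp add: mult_mono)
qed

lemma pb_trans: "pb D f (%a. size (g a)) ==> pb D g h ==> pb D f h"
 unfolding pb_def
proof (elim exE)
 fix p q assume *: "ALL a:D. size (g a) <= poly p (size (f a))" "ALL a:D. h a <= poly q (size (g a))"
 show "EX q. ALL a:D. h a <= poly q (size (f a))"
 proof (intro exI[of _ "q \<circ>\<^sub>p p"] ballI)
  fix a assume "a : D"
  hence "h a <= poly q (size (g a))" "size (g a) <= poly p (size (f a))" using * by auto
  thus "h a <= poly (q \<circ>\<^sub>p p) (size (f a))" unfolding poly_pcompose using poly_nat_mono[of "size (g a)" "poly p (size (f a))" q] by linarith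
 qed
qed

lemma pb_subset: "pb Y f g ==> D <= Y ==> pb D f g"
 unfolding pb_def by blast

lemma pb_cong: "pb D f g ==> (!!a. a : D ==> f a = f' a) ==> pb D f' g"
 unfolding pb_def by auto

lemma pb_pull: "pb D f g ==> h ` Y <= D ==> pb Y (%b. f (h b)) (%b. g (h b))"
 unfolding pb_def by auto

text \<open>
 \<open>pt D f g\<close>: over the family of situations \<open>D\<close>, the quantity \<open>g\<close> is computable in polynomial time
 from the quantity \<open>f\<close>.
\<close>

definition pt :: "'a set => ('a => sexp) => ('a => sexp) => bool" where
 "pt D f g \<longleftrightarrow> (EX p T. pb D f T & (ALL a:D. EX t <= T a. runs p (f a) (g a) t))"

lemma ptI: "pb D f T ==> (!!a. a : D ==> EX t <= T a. runs p (f a) (g a) t) ==> pt D f g"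
 unfolding pt_def by blast

lemma pt_size: "pt D f g ==> pb D f (%a. size (g a))"
 unfolding pt_def using runs_size by (metis (no_types, lifting) order_trans pb_mono)

lemma pt_id: "pt D f f"
 by (rule ptI[OF pb_add[OF pb_const[of _ _ 1] pb_size], of _ _ PId]) (meson order_refl run_id)

lemma pt_null: "pt D f (%_. Null)"
 by (rule ptI[OF pb_add[OF pb_const[of _ _ 1] pb_size], of _ _ PNull]) (meson order_refl run_null)

lemma pt_trans: assumes "pt D f g" "pt D g h" shows "pt D f h"
proof -
 obtain p T where p: "pb D f T" "!!a. a : D ==> EX t <= T a. runs p (f a) (g a) t" using assms(1) unfolding pt_def by blast
 obtain q U where q: "pb D g U" "!!a. a : D ==> EX t <= U a. runs q (g a) (h a) t" using assms(2) unfolding pt_def by blast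
 have "pb D f (%a. 1 + size (f a)+T a+U a)" by (intro pb_add pb_const pb_size p pb_trans[OF pt_size[OF assms(1)] q(1)])
 thus ?thesis
 proof (rule ptI[where p = "PSeq p q"])
  fix a assume "a : D"
  then obtain t u where "t <= T a" "runs p (f a) (g a) t" "u <= U a" "runs q (g a) (h a) u" using p(2) q(2) by blast
  thus "EX t <= 1 + size (f a)+T a+U a. runs (PSeq p q) (f a) (h a) t" using run_seq[of p "f a" "g a" t q "h a" u] by (intro exI[of _ "1 + size (f a)+t+u"]) auto
 qed
qed

lemma pt_hd: "pt D f g ==> pt D f (%a. shd (g a))"
 by (rule pt_trans, assumption, rule ptI[OF pb_add[OF pb_const[of _ _ 1] pb_size], of _ _ PHd])
  (meson order_refl run_hd)

lemma pt_tl: "pt D f g ==> pt D f (%a. stl (g a))"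
 by (rule pt_trans, assumption, rule ptI[OF pb_add[OF pb_const[of _ _ 1] pb_size], of _ _ PTl])
  (meson order_refl run_tl)

lemma pt_Dot: assumes "pt D f g" "pt D f h" shows "pt D f (%a. Dot (g a) (h a))"
proof -
 obtain p T where p: "pb D f T" "!!a. a : D ==> EX t <= T a. runs p (f a) (g a) t" using assms(1) unfolding pt_def by blast
 obtain q U where q: "pb D f U" "!!a. a : D ==> EX t <= U a. runs q (f a) (h a) t" using assms(2) unfolding pt_def by blast
 have "pb D f (%a. 1 + size (f a)+T a+U a)" by (intro pb_add pb_const pb_size p q)
 thus ?thesis
 proof (rule ptI[where p = "PFork p q"])
  fix a assume "a : D"
  then obtain t u where "t <= T a" "runs p (f a) (g a) t" "u <= U a" "runs q (f a) (h a) u" using p(2) q(2) by blast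
  thus "EX t <= 1 + size (f a)+T a+U a. runs (PFork p q) (f a) (Dot (g a) (h a)) t" using run_fork[of p "f a" "g a" t q "h a" u] by (intro exI[of _ "1 + size (f a)+t+u"]) auto
 qed
qed

lemma pt_cg: "pt D f g ==> (!!a. a : D ==> g a = g' a) ==> pt D f g'"
 unfolding pt_def by (metis (no_types, lifting))

lemma pt_sub: "pt Y f g ==> D <= Y ==> pt D f g"
 unfolding pt_def using pb_subset by blast

lemma pt_pull: "pt D f g ==> h ` Y <= D ==> pt Y (%b. f (h b)) (%b. g (h b))"
 unfolding pt_def using pb_pull by blast

text \<open>Each branch has to be computable only where it is taken, so it may rely on the outcome
  of the test, such as a system being solvable.\<close>

lemma pt_if_sexp:
 assumes "pt D f b" "pt {a:D. b a ~= Null} f g" "pt {a:D. b a = Null} f h"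
 shows "pt D f (%a. if b a ~= Null then g a else h a)"
proof -
 obtain o' S where o: "pb D f S" "!!a. a : D ==> EX t <= S a. runs o' (f a) (b a) t" using assms(1) unfolding pt_def by blast
 obtain p T where p: "pb {a:D. b a ~= Null} f T" "!!a. a : D ==> b a ~= Null ==> EX t <= T a. runs p (f a) (g a) t" using assms(2) unfolding pt_def by blast
 obtain q U where q: "pb {a:D. b a = Null} f U" "!!a. a : D ==> b a = Null ==> EX t <= U a. runs q (f a) (h a) t" using assms(3) unfolding pt_def by blast
 obtain P where P: "!!a. a : D ==> b a ~= Null ==> T a <= poly P (size (f a))" using p(1) unfolding pb_def by blast
 obtain Q where Q: "!!a. a : D ==> b a = Null ==> U a <= poly Q (size (f a))" using q(1) unfolding pb_def by blast
 have "pb D f (%a. 1 + size (f a)+S a+(poly P (size (f a))+poly Q (size (f a))))" by (intro pb_add pb_const pb_size o) (auto simp: pb_def)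
 thus ?thesis
 proof (rule ptI[where p = "PIf o' p q"])
  fix a assume a: "a : D"
  obtain s where s: "s <= S a" "runs o' (f a) (b a) s" using o(2)[OF a] by blast
  show "EX t <= 1 + size (f a)+S a+(poly P (size (f a))+poly Q (size (f a))).
    runs (PIf o' p q) (f a) (if b a ~= Null then g a else h a) t"
  proof (cases "b a = Null")
   case True
   then obtain u where "u <= U a" "runs q (f a) (h a) u" using q(2) a by blast
   thus ?thesis using s True Q[OF a True] run_if_false[of o' "f a" s q "h a" u p] by (intro exI[of _ "1 + size (f a) + s+u"]) auto
  next
   case False
   then obtain u where "u <= T a" "runs p (f a) (g a) u" using p(2) a by blast
   thus ?thesis using s False P[OF a False] run_if_true[of o' "f a" "b a" s p "g a" u q] by (intro exI[of _ "1 + size (f a) + s+u"]) auto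
  qed
 qed
qed

lemma enc_bool_Null [simp]: "enc_bool b = Null \<longleftrightarrow> ~b" by (simp add: enc_bool_def)

lemma pt_if:
 assumes "pt D f (%a. enc_bool (b a))" "pt {a:D. b a} f g" "pt {a:D. ~b a} f h"
 shows "pt D f (%a. if b a then g a else h a)"
 using pt_if_sexp[OF assms(1), of g h] assms(2,3) by simp

lemma pt_c: "pt D f (%_. c)"
proof (induct c)
 case (Dot c d) thus ?case by (intro pt_Dot)
qed (rule pt_null)

lemma pt_not: "pt D f (%a. enc_bool (b a)) ==> pt D f (%a. enc_bool (~b a))"
 by (rule pt_cg[OF pt_if[of _ _ b "%_. Null" "%_. Dot Null Null"]]) (auto simp: enc_bool_def intro: pt_c)

lemma pt_conj: "pt D f (%a. enc_bool (b a)) ==> pt {a:D. b a} f (%a. enc_bool (c a)) ==> pt D f (%a. enc_bool (b a & c a))"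
 by (rule pt_cg[OF pt_if[of _ _ b "%a. enc_bool (c a)" "%_. Null"]]) (auto simp: enc_bool_def intro: pt_c)

lemma pt_nonnull: "pt D f g ==> pt D f (%a. enc_bool (g a ~= Null))"
 by (rule pt_cg[OF pt_if_sexp[of _ _ g "%_. Dot Null Null" "%_. Null"]]) (auto simp: enc_bool_def intro: pt_c)

text \<open>The comparison is unrolled along the fixed tree \<open>c\<close>. Together with
  subtraction it yields the equality test in the field.\<close>

lemma pt_eq_const: "pt D f g ==> pt D f (%a. enc_bool (g a = c))"
proof (induct c arbitrary: g D)
 case Null
 thus ?case using pt_not[OF pt_nonnull, of D f g] by simp
next
 case (Dot c d)
 have "pt D f (%a. enc_bool (g a ~= Null & shd (g a) = c & stl (g a) = d))" by (intro pt_conj pt_nonnull Dot pt_hd pt_tl pt_sub[OF Dot(3)]) auto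
 moreover have "g a ~= Null & shd (g a) = c & stl (g a) = d \<longleftrightarrow> g a = Dot c d" for a by (cases "g a") auto
 ultimately show ?case by simp
qed

text \<open>The bound \<open>S\<close> on all intermediate states does not follow from a bound on
  one round, since polynomial growth compounds. Given \<open>S\<close>, the cost is the number of
  rounds times a polynomial.\<close>

lemma pt_while:
 assumes b: "pt (SIGMA a:D. {..N a}) (%(a, i). st a i) (%(a, i). b a i)"
  and b': "!!a i. a : D ==> i <= N a ==> b a i = Null \<longleftrightarrow> i = N a"
  and p: "pt (SIGMA a:D. {..<N a}) (%(a, i). st a i) (%(a, i). st a (Suc i))"
  and N: "pb D (%a. st a 0) N"
  and S: "pb (SIGMA a:D. {..N a}) (%(a, i). st a 0) (%(a, i). size (st a i))"
 shows "pt D (%a. st a 0) (%a. st a (N a))"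
proof -
 obtain p' T where p': "pb (SIGMA a:D. {..<N a}) (%(a, i). st a i) T"
   "!!a i. a : D ==> i < N a ==> EX t <= T (a, i). runs p' (st a i) (st a (Suc i)) t"
  using p unfolding pt_def by fastforce
 obtain b'' U where b'': "pb (SIGMA a:D. {..N a}) (%(a, i). st a i) U"
   "!!a i. a : D ==> i <= N a ==> EX t <= U (a, i). runs b'' (st a i) (b a i) t"
  using b unfolding pt_def by fastforce
 obtain P where P: "!!a i. a : D ==> i < N a ==> T (a, i) <= poly P (size (st a i))" using p'(1) unfolding pb_def by fastforce
 obtain Q where Q: "!!a i. a : D ==> i <= N a ==> U (a, i) <= poly Q (size (st a i))" using b''(1) unfolding pb_def by fastforce
 obtain R where R: "!!a i. a : D ==> i <= N a ==> size (st a i) <= poly R (size (st a 0))" using S unfolding pb_def by fastforce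
 define B where "B n = 1+poly R n+poly P (poly R n)+poly Q (poly R n)" for n
 have "pb D (%a. st a 0) (%a. (N a+1) * B (size (st a 0)))" by (intro pb_mult pb_add N pb_const) (unfold pb_def B_def, rule exI[of _ "1 + R+P \<circ>\<^sub>p R+Q \<circ>\<^sub>p R"], simp add: poly_pcompose)
 thus ?thesis
 proof (rule ptI[where p = "PWhile b'' p'"])
  fix a assume a: "a : D"
  have "k <= N a ==> EX t <= (k+1) * B (size (st a 0)). runs (PWhile b'' p') (st a (N a-k)) (st a (N a)) t" for k
  proof (induct k)
   case 0
   obtain u where u: "u <= U (a, N a)" "runs b'' (st a (N a)) Null u" using b''(2)[OF a, of "N a"] b'[OF a, of "N a"] by auto
   have "1 + size (st a (N a))+u <= B (size (st a 0))" using u(1) Q[OF a, of "N a"] R[OF a, of "N a"] poly_nat_mono[OF R[OF a, of "N a"], of Q] unfolding B_def by linarith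
   thus ?case using run_while_end[OF u(2), of p'] by auto
  next
   case (Suc k)
   let ?i = "N a-Suc k"
   have i: "?i < N a" "Suc ?i = N a-k" using Suc(2) by auto
   obtain r where r: "r <= (k+1) * B (size (st a 0))" "runs (PWhile b'' p') (st a (N a-k)) (st a (N a)) r" using Suc by auto
   obtain u where u: "u <= U (a, ?i)" "runs b'' (st a ?i) (b a ?i) u" using b''(2)[OF a, of ?i] i by auto
   obtain t where t: "t <= T (a, ?i)" "runs p' (st a ?i) (st a (N a-k)) t" using p'(2)[OF a i(1)] i by auto
   have nn: "b a ?i ~= Null" using b'[OF a, of ?i] i by auto
   have "1 + size (st a ?i)+u+t <= B (size (st a 0))" using u(1) t(1) Q[OF a, of ?i] P[OF a i(1)] R[OF a, of ?i] poly_nat_mono[OF R[OF a, of ?i], of Q]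
     poly_nat_mono[OF R[OF a, of ?i], of P] unfolding B_def by auto
   thus ?case using run_while_step[OF u(2) nn t(2) r(2)] r(1) by (intro exI[of _ "1 + size (st a ?i)+u+t + r"]) auto
  qed
  from this[of "N a"] show "EX t <= (N a+1) * B (size (st a 0)). runs (PWhile b'' p') (st a 0) (st a (N a)) t" by simp
 qed
qed

subsection \<open>Unary numbers and lists\<close>

lemma enc_list_map: "eL f (map g xs) = eL (%x. f (g x)) xs" by (induct xs) auto

lemma enc_list_cong: "(!!x. x : set xs ==> f x = g x) ==> eL f xs = eL g xs" by (induct xs) auto

lemma enc_list_nth: "eL f xs = eL (%i. f (xs ! i)) [0..<length xs]"
 using enc_list_map[of f "(!) xs" "[0..<length xs]"] by (simp add: map_nth)

lemma enc_list_const: "eL (%_. c) xs = eL (%_. c) [0..<length xs]" by (rule enc_list_nth)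

lemma enc_nat_0 [simp]: "eN 0 = Null" by (simp add: enc_nat_def)

lemma enc_nat_Suc [simp]: "eN (Suc n) = Dot Null (eN n)"
proof -
 have "eN (Suc n) = Dot Null (eL (%_. Null) [Suc 0..<Suc n])" unfolding enc_nat_def by (simp add: upt_conv_Cons zero_less_Suc enc_list.simps)
 thus ?thesis unfolding enc_nat_def using enc_list_const[of Null "[Suc 0..<Suc n]"] by (simp del: upt_Suc)
qed

lemma enc_nat_Null [simp]: "eN n = Null \<longleftrightarrow> n = 0" by (cases n) auto

lemma stl_enc_nat [simp]: "stl (eN n) = eN (n-1)" by (cases n) auto

lemma size_enc_nat [simp]: "size (eN n) = n" by (induct n) auto

lemma size_enc_list: "size (eL f xs) = (SUM x<-xs. size (f x)+1)" by (induct xs) auto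

text \<open>A situation with a running index that travels in unary next to the data. Nested uses of
  \<open>Idx\<close> describe the bodies of nested sums and lists.\<close>

abbreviation ext :: "('a => sexp) => 'a \<times> nat => sexp" where
 "ext f \<equiv> %p. Dot (f (fst p)) (eN (snd p))"

abbreviation Idx :: "'a set => ('a => nat) => ('a \<times> nat) set" where
 "Idx D n \<equiv> SIGMA a:D. {..<n a}"

lemma pt_ext: "pt D f g ==> fst ` Y <= D ==> pt Y (%p. Dot (f (fst p)) (h p)) (%p. g (fst p))"
 by (rule pt_trans[of _ _ "%p. f (fst p)"], rule pt_cg[OF pt_hd[OF pt_id]], simp, rule pt_pull)

lemma pt_Idx: "pt D f g ==> pt (Idx D n) (ext f) (%p. g (fst p))"
 by (rule pt_ext) auto

lemma pt_snd: "pt Y (%p. Dot (f p) (g p)) g"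
 by (rule pt_cg[OF pt_tl[OF pt_id]]) simp

lemma pb_nat: "pt D f (%a. eN (n a)) ==> pb D f n"
 using pt_size by fastforce

lemma pb_fst: "pb D f h ==> fst ` Y <= D ==> pb Y (%p. f (fst p)) (%p. h (fst p))"
 by (rule pb_pull)

text \<open>A countdown loop: the body sees the number of rounds that remain after the current one,
  the index needed to build a list from its end.\<close>

lemma pt_iter:
 assumes n: "pt D f (%a. eN (n a))" and s0: "pt D f (%a. s a 0)"
  and step: "pt (Idx D n) (%p. Dot (f (fst p)) (Dot (eN (n (fst p)-Suc (snd p))) (s (fst p) (snd p))))
   (%p. s (fst p) (Suc (snd p)))"
  and S: "pb (SIGMA a:D. {..n a}) (%p. f (fst p)) (%p. size (s (fst p) (snd p)))"
 shows "pt D f (%a. s a (n a))"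
proof -
 define st where "st a i = Dot (f a) (Dot (eN (n a-i)) (s a i))" for a i
 have 0: "pt D f (%a. st a 0)" unfolding st_def by (intro pt_Dot pt_id s0) (use n in simp)
 have "pt D (%a. st a 0) (%a. st a (n a))"
 proof (rule pt_while[where b = "%a i. eN (n a-i)"])
  show "pt (SIGMA a:D. {..n a}) (%(a, i). st a i) (%(a, i). eN (n a-i))" by (rule pt_cg[OF pt_hd[OF pt_tl[OF pt_id]]]) (auto simp: st_def)
  show "eN (n a-i) = Null \<longleftrightarrow> i = n a" if "i <= n a" for a i using that by auto
  let ?g = "%p. Dot (f (fst p)) (Dot (eN (n (fst p)-Suc (snd p))) (s (fst p) (snd p)))"
  have e: "pt (Idx D n) (%(a, i). st a i) ?g" by (rule pt_cg[OF pt_Dot[OF pt_hd[OF pt_id] pt_Dot[OF pt_tl[OF pt_hd[OF pt_tl[OF pt_id]]] pt_tl[OF pt_tl[OF pt_id]]]]])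
    (auto simp: st_def)
  show "pt (Idx D n) (%(a, i). st a i) (%(a, i). st a (Suc i))" by (rule pt_cg[OF pt_Dot[OF pt_hd[OF e] pt_Dot[OF pt_hd[OF pt_tl[OF e]] pt_trans[OF e step]]]]) (auto simp: st_def)
  have sz: "pb D (%a. st a 0) (%a. size (f a))" by (rule pb_mono[OF pb_size]) (simp add: st_def)
  show "pb D (%a. st a 0) n" by (rule pb_trans[OF sz pb_nat[OF n]])
  have f: "pb (SIGMA a:D. {..n a}) (%p. st (fst p) 0) (%p. size (f (fst p)))" by (rule pb_fst[OF sz]) auto
  have "pb (SIGMA a:D. {..n a}) (%p. f (fst p)) (%p. size (f (fst p))+(n (fst p) + size (s (fst p) (snd p))+1)+1)" by (intro pb_add S pb_size pb_const pb_fst[OF pb_nat[OF n]]) auto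
  hence "pb (SIGMA a:D. {..n a}) (%p. f (fst p)) (%p. size (st (fst p) (snd p)))" by (rule pb_mono) (auto simp: st_def)
  thus "pb (SIGMA a:D. {..n a}) (%(a, i). st a 0) (%(a, i). size (st a i))" using pb_trans[OF f] by (auto simp: split_def)
 qed
 from pt_tl[OF pt_tl[OF pt_trans[OF 0 this]]] show ?thesis by (simp add: st_def)
qed

text \<open>The variant with an ascending index, which is carried as part of the state.\<close>

lemma pt_fold:
 assumes n: "pt D f (%a. eN (n a))" and s0: "pt D f (%a. s a 0)"
  and step: "pt (Idx D n) (%p. Dot (f (fst p)) (Dot (eN (snd p)) (s (fst p) (snd p)))) (%p. s (fst p) (Suc (snd p)))"
  and S: "pb (SIGMA a:D. {..n a}) (%p. f (fst p)) (%p. size (s (fst p) (snd p)))"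
 shows "pt D f (%a. s a (n a))"
proof -
 define r where "r a i = Dot (eN i) (s a i)" for a i
 have "pt D f (%a. r a (n a))"
 proof (rule pt_iter[OF n])
  show "pt D f (%a. r a 0)" unfolding r_def by (intro pt_Dot pt_c s0)
  let ?e = "%p. Dot (f (fst p)) (Dot (eN (n (fst p)-Suc (snd p))) (r (fst p) (snd p)))"
  have g: "pt (Idx D n) ?e (%p. Dot (f (fst p)) (r (fst p) (snd p)))" by (rule pt_cg[OF pt_Dot[OF pt_hd[OF pt_id] pt_tl[OF pt_tl[OF pt_id]]]]) simp
  show "pt (Idx D n) ?e (%p. r (fst p) (Suc (snd p)))" unfolding r_def by (rule pt_cg[OF pt_Dot[OF pt_Dot[OF pt_null pt_hd[OF pt_tl[OF g[unfolded r_def]]]] pt_trans[OF g[unfolded r_def] step]]]) simp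
  have "pb (SIGMA a:D. {..n a}) (%p. f (fst p)) (%p. n (fst p) + size (s (fst p) (snd p))+1)" by (intro pb_add S pb_size pb_const pb_fst[OF pb_nat[OF n]]) auto
  thus "pb (SIGMA a:D. {..n a}) (%p. f (fst p)) (%p. size (r (fst p) (snd p)))" by (rule pb_mono) (auto simp: r_def)
 qed
 from pt_tl[OF this] show ?thesis by (simp add: r_def)
qed

lemma pb_Idx:
 assumes "pt D f (%a. eN (n a))" "pb (Idx D n) (ext f) h"
 shows "pb (Idx D n) (%p. f (fst p)) h"
proof (rule pb_trans[OF _ assms(2)])
 have "pb (Idx D n) (%p. f (fst p)) (%p. size (f (fst p))+n (fst p)+1)" by (intro pb_add pb_size pb_const pb_fst[OF pb_nat[OF assms(1)]]) auto
 thus "pb (Idx D n) (%p. f (fst p)) (%p. size (ext f p))" by (rule pb_mono) auto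
qed

lemma sum_list_le: "(!!x. x : set xs ==> g x <= (B :: nat)) ==> (SUM x<-xs. g x) <= length xs * B"
 by (induct xs) (auto intro: add_mono)

text \<open>Starting from the last entry, each round prepends with one \<open>Dot\<close>. The state
  stays small because the entries are computed independently of each other.\<close>

lemma pt_map:
 assumes n: "pt D f (%a. eN (n a))" and g: "pt (Idx D n) (ext f) (%p. g (fst p) (snd p))"
 shows "pt D f (%a. eL (g a) [0..<n a])"
proof -
 define s where "s a i = eL (g a) [n a - i..<n a]" for a i
 have sSuc: "s a (Suc i) = Dot (g a (n a-Suc i)) (s a i)" if "i < n a" for a i using that by (simp add: s_def upt_conv_Cons Suc_diff_Suc)
 have "pt D f (%a. s a (n a))"
 proof (rule pt_iter[OF n])
  show "pt D f (%a. s a 0)" by (simp add: s_def pt_null)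
  let ?e = "%p. Dot (f (fst p)) (Dot (eN (n (fst p)-Suc (snd p))) (s (fst p) (snd p)))"
  let ?h = "%p. (fst p, n (fst p)-Suc (snd p))"
  have "pt (Idx D n) (%p. ext f (?h p)) (%p. g (fst (?h p)) (snd (?h p)))" by (rule pt_pull[OF g]) auto
  moreover have e: "pt (Idx D n) ?e (%p. ext f (?h p))" by (rule pt_cg[OF pt_Dot[OF pt_hd[OF pt_id] pt_hd[OF pt_tl[OF pt_id]]]]) simp
  ultimately have "pt (Idx D n) ?e (%p. g (fst p) (n (fst p)-Suc (snd p)))" by (auto dest: pt_trans)
  from pt_Dot[OF this pt_tl[OF pt_tl[OF pt_id]]]
  show "pt (Idx D n) ?e (%p. s (fst p) (Suc (snd p)))" by (rule pt_cg) (auto simp: sSuc)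
  obtain q where q: "!!a i. a : D ==> i < n a ==> size (g a i) <= poly q (size (f a))" using pb_Idx[OF n pt_size[OF g]] unfolding pb_def by auto
  have "pb (SIGMA a:D. {..n a}) (%p. f (fst p)) (%p. n (fst p)*(poly q (size (f (fst p)))+1))" by (intro pb_mult pb_add pb_const pb_fst[OF pb_nat[OF n]]) (auto simp: pb_def)
  thus "pb (SIGMA a:D. {..n a}) (%p. f (fst p)) (%p. size (s (fst p) (snd p)))"
  proof (rule pb_mono)
   fix p assume "p : (SIGMA a:D. {..n a})"
   then obtain a i where p: "p = (a, i)" "a : D" "i <= n a" by auto
   have "size (s a i) <= length [n a - i..<n a]*(poly q (size (f a))+1)" unfolding s_def size_enc_list by (rule sum_list_le) (use q[OF p(2)] in auto)
   also have "... <= n a*(poly q (size (f a))+1)" using p by (intro mult_right_mono) auto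
   finally show "size (s (fst p) (snd p)) <= n (fst p)*(poly q (size (f (fst p)))+1)" using p by simp
  qed
 qed
 thus ?thesis by (simp add: s_def)
qed

lemma size_enc_list_drop: "size (eL f (drop i xs)) <= size (eL f xs)"
proof (induct xs arbitrary: i)
 case (Cons x xs)
 thus ?case by (cases i) (auto intro: le_SucI trans_le_add2)
qed simp

lemma pt_drop:
 assumes l: "pt D f (%a. eL (g a) (xs a))" and i: "pt D f (%a. eN (i a))"
  and le: "!!a. a : D ==> i a <= length (xs a)"
 shows "pt D f (%a. eL (g a) (drop (i a) (xs a)))"
proof (rule pt_iter[OF i, where s = "%a k. eL (g a) (drop k (xs a))"])
 show "pt D f (%a. eL (g a) (drop 0 (xs a)))" using l by simp
 show "pt (Idx D i) (%p. Dot (f (fst p)) (Dot (eN (i (fst p)-Suc (snd p))) (eL (g (fst p)) (drop (snd p) (xs (fst p))))))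
   (%p. eL (g (fst p)) (drop (Suc (snd p)) (xs (fst p))))"
 proof (rule pt_cg[OF pt_tl[OF pt_tl[OF pt_tl[OF pt_id]]]], clarsimp)
  fix a k assume "a : D" "k < i a"
  thus "stl (eL (g a) (drop k (xs a))) = eL (g a) (drop (Suc k) (xs a))" using le by (force simp: Cons_nth_drop_Suc[symmetric])
 qed
 have "pb (SIGMA a:D. {..i a}) (%p. f (fst p)) (%p. size (eL (g (fst p)) (xs (fst p))))" by (rule pb_fst[OF pt_size[OF l]]) auto
 thus "pb (SIGMA a:D. {..i a}) (%p. f (fst p)) (%p. size (eL (g (fst p)) (drop (snd p) (xs (fst p)))))" by (rule pb_mono) (rule size_enc_list_drop)
qed

lemma pt_nth:
 assumes "pt D f (%a. eL (g a) (xs a))" "pt D f (%a. eN (i a))" "!!a. a : D ==> i a < length (xs a)"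
 shows "pt D f (%a. g a (xs a ! i a))"
 by (rule pt_cg[OF pt_hd[OF pt_drop[OF assms(1,2)]]])
  (auto simp: Cons_nth_drop_Suc[symmetric] less_imp_le assms(3))

lemma pt_entry:
 assumes "pt D f (%a. eL (g a) [0..<n a])" "pt D f (%a. eN (i a))" "!!a. a : D ==> i a < n a"
 shows "pt D f (%a. g a (i a))"
 by (rule pt_cg[OF pt_nth[OF assms(1,2)]]) (use assms(3) in auto)

lemma pt_Suc: "pt D f (%a. eN (i a)) ==> pt D f (%a. eN (Suc (i a)))"
 unfolding enc_nat_Suc by (intro pt_Dot pt_c)

lemma pt_plus:
 assumes "pt D f (%a. eN (i a))" "pt D f (%a. eN (j a))"
 shows "pt D f (%a. eN (i a+j a))"
proof (rule pt_iter[OF assms(2), where s = "%a k. eN (i a+k)"])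
 show "pt D f (%a. eN (i a+0))" using assms(1) by simp
 show "pt (Idx D j) (%p. Dot (f (fst p)) (Dot (eN (j (fst p)-Suc (snd p))) (eN (i (fst p) + snd p))))
   (%p. eN (i (fst p)+Suc (snd p)))"
  by (rule pt_cg[OF pt_Dot[OF pt_null pt_tl[OF pt_tl[OF pt_id]]]]) simp
 have "pb (SIGMA a:D. {..j a}) (%p. f (fst p)) (%p. i (fst p)+j (fst p))" by (intro pb_add pb_fst[OF pb_nat[OF assms(1)]] pb_fst[OF pb_nat[OF assms(2)]]) auto
 thus "pb (SIGMA a:D. {..j a}) (%p. f (fst p)) (%p. size (eN (i (fst p) + snd p)))" by (rule pb_mono) auto
qed

lemma pt_times:
 assumes "pt D f (%a. eN (i a))" "pt D f (%a. eN (j a))"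
 shows "pt D f (%a. eN (i a * j a))"
proof (rule pt_iter[OF assms(2), where s = "%a k. eN (i a * k)"])
 show "pt D f (%a. eN (i a*0))" by (simp add: pt_null)
 show "pt (Idx D j) (%p. Dot (f (fst p)) (Dot (eN (j (fst p)-Suc (snd p))) (eN (i (fst p) * snd p))))
   (%p. eN (i (fst p) * Suc (snd p)))"
  unfolding mult_Suc_right
  by (intro pt_plus pt_ext[OF assms(1)] pt_trans[OF pt_snd pt_snd]) auto
 have "pb (SIGMA a:D. {..j a}) (%p. f (fst p)) (%p. i (fst p) * j (fst p))" by (intro pb_mult pb_fst[OF pb_nat[OF assms(1)]] pb_fst[OF pb_nat[OF assms(2)]]) auto
 thus "pb (SIGMA a:D. {..j a}) (%p. f (fst p)) (%p. size (eN (i (fst p) * snd p)))" by (rule pb_mono) (auto intro: mult_left_mono)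
qed

lemma pt_minus:
 assumes "pt D f (%a. eN (i a))" "pt D f (%a. eN (j a))"
 shows "pt D f (%a. eN (i a-j a))"
proof (rule pt_iter[OF assms(2), where s = "%a k. eN (i a-k)"])
 show "pt D f (%a. eN (i a-0))" using assms(1) by simp
 show "pt (Idx D j) (%p. Dot (f (fst p)) (Dot (eN (j (fst p)-Suc (snd p))) (eN (i (fst p) - snd p))))
   (%p. eN (i (fst p)-Suc (snd p)))"
  by (rule pt_cg[OF pt_tl[OF pt_tl[OF pt_tl[OF pt_id]]]]) simp
 have "pb (SIGMA a:D. {..j a}) (%p. f (fst p)) (%p. i (fst p))" by (intro pb_fst[OF pb_nat[OF assms(1)]]) auto
 thus "pb (SIGMA a:D. {..j a}) (%p. f (fst p)) (%p. size (eN (i (fst p) - snd p)))" by (rule pb_mono) auto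
qed

lemma pt_less:
 assumes "pt D f (%a. eN (i a))" "pt D f (%a. eN (j a))"
 shows "pt D f (%a. enc_bool (i a < j a))"
 by (rule pt_cg[OF pt_nonnull[OF pt_minus[OF assms(2,1)]]]) (simp add: enc_bool_def)

lemma pt_le:
 assumes "pt D f (%a. eN (i a))" "pt D f (%a. eN (j a))"
 shows "pt D f (%a. enc_bool (i a <= j a))"
 using pt_not[OF pt_less[OF assms(2,1)]] by (simp add: not_less)

lemma pt_eq:
 assumes "pt D f (%a. eN (i a))" "pt D f (%a. eN (j a))"
 shows "pt D f (%a. enc_bool (i a = j a))"
 unfolding order_eq_iff[of "i _"] by (intro pt_conj pt_le pt_sub[OF assms(1)] pt_sub[OF assms(2)] assms) auto

lemma pt_len:
 assumes "pt D f (%a. eL (g a) (xs a))"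
 shows "pt D f (%a. eN (length (xs a)))"
proof -
 define st where "st a i = Dot (eL (g a) (drop i (xs a))) (eN i)" for a i
 have len: "length xs <= size (eL g xs)" for g and xs :: "'b list" by (induct xs) auto
 have "pt D (%a. st a 0) (%a. st a (length (xs a)))"
 proof (rule pt_while[where b = "%a i. eL (g a) (drop i (xs a))"])
  show "pt (SIGMA a:D. {..length (xs a)}) (%(a, i). st a i) (%(a, i). eL (g a) (drop i (xs a)))" by (rule pt_cg[OF pt_hd[OF pt_id]]) (auto simp: st_def)
  have nl: "eL g ys = Null \<longleftrightarrow> ys = []" for g and ys :: "'b list" by (cases ys) auto
  show "eL (g a) (drop i (xs a)) = Null \<longleftrightarrow> i = length (xs a)" if "i <= length (xs a)" for a i using that unfolding nl by auto
  show "pt (Idx D (%a. length (xs a))) (%(a, i). st a i) (%(a, i). st a (Suc i))" by (rule pt_cg[OF pt_Dot[OF pt_tl[OF pt_hd[OF pt_id]] pt_Dot[OF pt_null pt_tl[OF pt_id]]]])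
    (auto simp: st_def Cons_nth_drop_Suc[symmetric])
  show "pb D (%a. st a 0) (%a. length (xs a))" by (rule pb_mono[OF pb_size]) (use len in \<open>auto simp: st_def intro: le_SucI\<close>)
  show "pb (SIGMA a:D. {..length (xs a)}) (%(a, i). st a 0) (%(a, i). size (st a i))"
  proof (rule pb_mono[OF pb_add[OF pb_size pb_size]], clarsimp)
   fix a i assume "i <= length (xs a)"
   thus "size (st a i) <= size (st a 0) + size (st a 0)" using size_enc_list_drop[of "g a" i "xs a"] len[of "xs a" "g a"] by (simp add: st_def)
  qed
 qed
 moreover have "pt D f (%a. st a 0)" unfolding st_def by (intro pt_Dot) (use assms in \<open>auto intro: pt_null\<close>)
 ultimately have "pt D f (%a. st a (length (xs a)))" by (rule pt_trans[rotated])
 from pt_tl[OF this] show ?thesis by (simp add: st_def)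
qed

lemma pt_append:
 assumes "pt D f (%a. eL (g a) (xs a))" "pt D f (%a. eL (g a) (ys a))"
 shows "pt D f (%a. eL (g a) (xs a @ ys a))"
proof -
 let ?n = "%a. length (xs a)+length (ys a)"
 have n: "pt D f (%a. eN (?n a))" by (intro pt_plus pt_len[OF assms(1)] pt_len[OF assms(2)])
 have "pt D f (%a. eL (%i. if i < length (xs a) then g a (xs a ! i) else g a (ys a ! (i-length (xs a)))) [0..<?n a])"
 proof (rule pt_map[OF n], rule pt_if)
  show "pt (Idx D ?n) (ext f) (%p. enc_bool (snd p < length (xs (fst p))))" by (intro pt_less pt_snd pt_Idx pt_len[OF assms(1)])
  show "pt {a : Idx D ?n. snd a < length (xs (fst a))} (ext f) (%p. g (fst p) (xs (fst p) ! snd p))" by (rule pt_nth) (auto intro: pt_snd pt_ext[OF assms(1)])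
  show "pt {a : Idx D ?n. ~snd a < length (xs (fst a))} (ext f) (%p. g (fst p) (ys (fst p) ! (snd p-length (xs (fst p)))))" by (rule pt_nth) (auto intro!: pt_snd pt_ext[OF assms(2)] pt_minus pt_ext[OF pt_len[OF assms(1)]])
 qed
 thus ?thesis by (rule pt_cg) (subst (2) enc_list_nth, auto intro!: enc_list_cong simp: nth_append)
qed

text \<open>The quotient is the largest \<open>k\<close> with \<open>k * d <= i\<close>, found by
  scanning all \<open>k\<close> up to \<open>i\<close>; numbers are unary, so this is
  affordable.\<close>

lemma pt_Least_div:
 assumes "pt D f (%a. eN (i a))" "pt D f (%a. eN (d a))" "!!a. a : D ==> d a > 0"
 shows "pt D f (%a. eN (i a div d a))"
proof -
 define s where "s a k = min k (i a div d a)" for a k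
 have "pt D f (%a. eN (s a (i a)))"
 proof (rule pt_fold[OF assms(1)])
  show "pt D f (%a. eN (s a 0))" by (simp add: s_def pt_null)
  let ?e = "%p. Dot (f (fst p)) (Dot (eN (snd p)) (eN (s (fst p) (snd p))))"
  have s: "pt (Idx D i) ?e (%p. eN (s (fst p) (snd p)))" by (rule pt_trans[OF pt_snd pt_snd])
  have k: "pt (Idx D i) ?e (%p. eN (snd p))" by (rule pt_cg[OF pt_hd[OF pt_tl[OF pt_id]]]) simp
  have F: "pt (Idx D i) ?e (%p. eN (i (fst p)))" "pt (Idx D i) ?e (%p. eN (d (fst p)))" by (rule pt_ext, rule assms, force)+
  have "pt (Idx D i) ?e (%p. if Suc (snd p) * d (fst p) <= i (fst p) then eN (Suc (snd p)) else eN (s (fst p) (snd p)))" by (intro pt_if pt_le pt_times pt_Suc F k pt_sub[OF s] pt_sub[OF k]) auto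
  thus "pt (Idx D i) ?e (%p. eN (s (fst p) (Suc (snd p))))"
  proof (rule pt_cg, clarsimp)
   fix a k assume a: "a : D" "k < i a"
   have "(d a+k * d a <= i a) = (Suc k <= i a div d a)" using assms(3)[OF a(1)] by (simp add: less_eq_div_iff_mult_less_eq)
   thus "(d a+k * d a <= i a --> Dot Null (eN k) = eN (s a (Suc k))) &
      (~d a+k * d a <= i a --> eN (s a k) = eN (s a (Suc k)))"
    unfolding enc_nat_Suc[symmetric] by (auto simp: s_def intro!: arg_cong[of _ _ eN])
  qed
  have "pb (SIGMA a:D. {..i a}) (%p. f (fst p)) (%p. i (fst p))" by (rule pb_fst[OF pb_nat[OF assms(1)]]) auto
  thus "pb (SIGMA a:D. {..i a}) (%p. f (fst p)) (%p. size (eN (s (fst p) (snd p))))" by (rule pb_mono) (auto simp: s_def intro: order_trans[OF min.cobounded1])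
 qed
 moreover have "s a (i a) = i a div d a" for a unfolding s_def using div_le_dividend[of "i a" "d a"] by simp
 ultimately show ?thesis by simp
qed

lemma pt_mod:
 assumes "pt D f (%a. eN (i a))" "pt D f (%a. eN (d a))" "!!a. a : D ==> d a > 0"
 shows "pt D f (%a. eN (i a mod d a))"
 unfolding modulo_nat_def by (intro pt_minus pt_times pt_Least_div assms)

lemma pt_concat:
 assumes n: "pt D f (%a. eN (n a))" and x: "pt (Idx D n) (ext f) (%p. eL (g (fst p)) (xs (fst p) (snd p)))"
 shows "pt D f (%a. eL (g a) (concat (map (xs a) [0..<n a])))"
proof -
 define s where "s a k = concat (map (xs a) [0..<k])" for a k
 have "pt D f (%a. eL (g a) (s a (n a)))"
 proof (rule pt_fold[OF n])
  show "pt D f (%a. eL (g a) (s a 0))" by (simp add: s_def pt_null)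
  let ?e = "%p. Dot (f (fst p)) (Dot (eN (snd p)) (eL (g (fst p)) (s (fst p) (snd p))))"
  have "pt (Idx D n) ?e (%p. eL (g (fst p)) (s (fst p) (snd p) @ xs (fst p) (snd p)))"
  proof (rule pt_append)
   show "pt (Idx D n) ?e (%p. eL (g (fst p)) (s (fst p) (snd p)))" by (rule pt_trans[OF pt_snd pt_snd])
   have "pt (Idx D n) ?e (ext f)" by (rule pt_cg[OF pt_Dot[OF pt_hd[OF pt_id] pt_hd[OF pt_tl[OF pt_id]]]]) simp
   thus "pt (Idx D n) ?e (%p. eL (g (fst p)) (xs (fst p) (snd p)))" by (rule pt_trans) (rule x)
  qed
  thus "pt (Idx D n) ?e (%p. eL (g (fst p)) (s (fst p) (Suc (snd p))))" by (simp add: s_def)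
  obtain q where q: "!!a i. a : D ==> i < n a ==> size (eL (g a) (xs a i)) <= poly q (size (f a))" using pb_Idx[OF n pt_size[OF x]] unfolding pb_def by auto
  have "pb (SIGMA a:D. {..n a}) (%p. f (fst p)) (%p. n (fst p) * poly q (size (f (fst p))))" by (intro pb_mult pb_fst[OF pb_nat[OF n]]) (auto simp: pb_def)
  thus "pb (SIGMA a:D. {..n a}) (%p. f (fst p)) (%p. size (eL (g (fst p)) (s (fst p) (snd p))))"
  proof (rule pb_mono, clarsimp)
   fix a i assume a: "a : D" and i: "i <= n a"
   have "k <= n a ==> size (eL (g a) (s a k)) <= k * poly q (size (f a))" for k
   proof (induct k)
    case (Suc k)
    show ?case using Suc q[OF a, of k] by (simp add: s_def size_enc_list)
   qed (simp add: s_def)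
   from this[OF i] show "size (eL (g a) (s a i)) <= n a * poly q (size (f a))" using i by (meson mult_le_mono1 order_trans)
  qed
 qed
 thus ?thesis by (simp add: s_def)
qed

text \<open>A problem may have several correct answers; the one given by the program is fixed as a
  function \<open>F\<close> to which later statements can refer.\<close>

lemma polytime_solvableD:
 assumes "polytime_solvable ei eo D R"
 shows "EX F. (ALL a:D. R a (F a)) & pt D ei (%a. eo (F a))"
proof -
 from assms obtain p q where "ALL a:D. EX b t. runs p (ei a) (eo b) t & t <= poly q (size (ei a)) & R a b" unfolding polytime_solvable_def by blast
 then obtain F where F: "ALL a:D. EX t. runs p (ei a) (eo (F a)) t & t <= poly q (size (ei a)) & R a (F a)" by metis
 have "pb D ei (%a. poly q (size (ei a)))" by (auto simp: pb_def)
 hence "pt D ei (%a. eo (F a))" by (rule ptI) (use F in blast)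
 thus ?thesis using F by blast
qed

lemma pt_oracle: "pt E ei g ==> pt D f (%a. ei (h a)) ==> h ` D <= E ==> pt D f (%a. g (h a))"
 by (rule pt_trans[OF _ pt_pull])

section \<open>Calls to the linear algebra of the field\<close>

locale ela =
 fixes enc :: "'k::field => sexp"
 assumes ela: "efficient_linear_algebra enc"
begin

lemma inj_enc: "inj enc" using ela unfolding efficient_linear_algebra_def by blast

lemma pt_add:
 assumes "pt D f (%a. enc (x a))" "pt D f (%a. enc (y a))"
 shows "pt D f (%a. enc (x a+y a))"
proof -
 have "polytime_solvable (enc_pair enc enc) enc UNIV (%(x, y) z. z = x+y)" using ela unfolding efficient_linear_algebra_def by (elim conjE)
 from polytime_solvableD[OF this] obtain F where F: "!!x y. F (x, y) = x+y" "pt UNIV (enc_pair enc enc) (%p. enc (F p))" by auto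
 have "pt D f (%a. enc_pair enc enc (x a, y a))" unfolding enc_pair_def split by (rule pt_Dot[OF assms])
 from pt_oracle[OF F(2) this] show ?thesis by (simp add: F(1))
qed

lemma pt_mul:
 assumes "pt D f (%a. enc (x a))" "pt D f (%a. enc (y a))"
 shows "pt D f (%a. enc (x a * y a))"
proof -
 have "polytime_solvable (enc_pair enc enc) enc UNIV (%(x, y) z. z = x * y)" using ela unfolding efficient_linear_algebra_def by (elim conjE)
 from polytime_solvableD[OF this] obtain F where F: "!!x y. F (x, y) = x * y" "pt UNIV (enc_pair enc enc) (%p. enc (F p))" by auto
 have "pt D f (%a. enc_pair enc enc (x a, y a))" unfolding enc_pair_def split by (rule pt_Dot[OF assms])
 from pt_oracle[OF F(2) this] show ?thesis by (simp add: F(1))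
qed

lemma pt_uminus:
 assumes "pt D f (%a. enc (x a))"
 shows "pt D f (%a. enc (- x a))"
proof -
 have "polytime_solvable enc enc UNIV (%x z. z = - x)" using ela unfolding efficient_linear_algebra_def by (elim conjE)
 from polytime_solvableD[OF this] obtain F where F: "!!x. F x = - x" "pt UNIV enc (%p. enc (F p))" by auto
 from pt_oracle[OF F(2) assms] show ?thesis by (simp add: F(1))
qed

lemma pt_diff: "pt D f (%a. enc (x a)) ==> pt D f (%a. enc (y a)) ==> pt D f (%a. enc (x a-y a))"
 unfolding diff_conv_add_uminus by (intro pt_add pt_uminus)

lemma pt_eq_field: "pt D f (%a. enc (x a)) ==> pt D f (%a. enc (y a)) ==> pt D f (%a. enc_bool (x a = y a))"
 using pt_eq_const[OF pt_diff, of D f x y "enc 0"] by (simp add: inj_eq[OF inj_enc])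

lemma pt_if_field:
 assumes "pt D f (%a. enc_bool (b a))" "pt {a:D. b a} f (%a. enc (x a))" "pt {a:D. ~b a} f (%a. enc (y a))"
 shows "pt D f (%a. enc (if b a then x a else y a))"
 by (rule pt_cg[OF pt_if[OF assms]]) simp

lemma enc_vec_vec: "enc_vec enc (vec n g) = eL (%i. enc (g i)) [0..<n]"
using list_of_vec_index by (simp add: list_of_vec_index enc_vec_def enc_list_map)

lemma enc_mat_mat:
 "enc_mat enc (mat nr nc (%(i, j). G i j)) =
  Dot (eN nr) (Dot (eN nc) (eL (%i. eL (%j. enc (G i j)) [0..<nc]) [0..<nr]))"
proof -
 have "row (mat nr nc (%(i, j). G i j)) i = vec nc (G i)" if "i < nr" for i using that by (intro eq_vecI) auto
 thus ?thesis unfolding enc_mat_def rows_def by (auto simp: enc_list_map enc_vec_vec intro!: enc_list_cong)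
qed

lemma pt_mat:
 assumes "pt D f (%a. eN (nr a))" "pt D f (%a. eN (nc a))"
  "pt (Idx (Idx D nr) (%p. nc (fst p))) (ext (ext f)) (%p. enc (G (fst (fst p)) (snd (fst p)) (snd p)))"
 shows "pt D f (%a. enc_mat enc (mat (nr a) (nc a) (%(i, j). G a i j)))"
 unfolding enc_mat_mat
proof (intro pt_Dot assms(1,2) pt_map)
 show "pt (Idx D nr) (ext f) (%p. eN (nc (fst p)))" by (rule pt_Idx[OF assms(2)])
 show "pt (Idx (Idx D nr) (%p. nc (fst p))) (ext (ext f)) (%p. enc (G (fst (fst p)) (snd (fst p)) (snd p)))" by (rule assms(3))
qed

text \<open>Repeated addition might let codes grow out of bounds. The row of terms times a column of
  ones gives the sum in a single matrix product.\<close>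

lemma pt_sum:
 assumes n: "pt D f (%a. eN (n a))" and g: "pt (Idx D n) (ext f) (%p. enc (g (fst p) (snd p)))"
 shows "pt D f (%a. enc (SUM i<n a. g a i))"
proof -
 have "polytime_solvable (enc_pair (enc_mat enc) (enc_mat enc)) (enc_mat enc) {(A, B). dim_col A = dim_row B} (%(A, B) C. C = A * B)" using ela unfolding efficient_linear_algebra_def by (elim conjE)
 from polytime_solvableD[OF this] obtain F
  where F: "!!A B. dim_col A = dim_row B ==> F (A, B) = A * B"
   "pt {(A, B). dim_col A = dim_row B} (enc_pair (enc_mat enc) (enc_mat enc)) (%p. enc_mat enc (F p))" by blast
 let ?A = "%a. mat 1 (n a) (%(_ :: nat, j). g a j)" and ?B = "%a. mat (n a) 1 (%(_ :: nat, _ :: nat). 1 :: 'k)"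
 have A: "pt D f (%a. enc_mat enc (?A a))"
 proof (rule pt_mat[where nr = "%_. 1" and G = "%a i j. g a j"])
  let ?h = "%p. (fst (fst p), snd p)"
  have 1: "pt (Idx (Idx D (%_. 1)) (%p. n (fst p))) (%p. ext f (?h p)) (%p. enc (g (fst (?h p)) (snd (?h p))))" by (rule pt_pull[OF g]) auto
  have "pt (Idx (Idx D (%_. 1)) (%p. n (fst p))) (ext (ext f)) (%p. ext f (?h p))" by (rule pt_cg[OF pt_Dot[OF pt_hd[OF pt_hd[OF pt_id]] pt_tl[OF pt_id]]]) simp
  from pt_trans[OF this 1]
  show "pt (Idx (Idx D (%_. 1)) (%p. n (fst p))) (ext (ext f)) (%p. enc (g (fst (fst p)) (snd p)))" by simp
 qed (rule pt_c n)+
 have B: "pt D f (%a. enc_mat enc (?B a))" by (rule pt_mat[where nc = "%_. 1" and G = "%_ _ _. 1"]) (rule pt_c n)+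
 have "pt D f (%a. enc_pair (enc_mat enc) (enc_mat enc) (?A a, ?B a))" unfolding enc_pair_def split by (rule pt_Dot[OF A B])
 have "pt D f (%a. enc_mat enc (F (?A a, ?B a)))" by (rule pt_oracle[OF F(2) `pt D f (%a. enc_pair _ _ _)`]) auto
 hence "pt D f (%a. enc_mat enc (?A a*?B a))" by (simp add: F(1))
 moreover have "?A a*?B a = mat 1 1 (%(_ :: nat, _ :: nat). SUM i<n a. g a i)" for a by (rule eq_matI) (auto simp: scalar_prod_def lessThan_atLeast0)
 ultimately have "pt D f (%a. enc_mat enc (mat 1 1 (%(_ :: nat, _ :: nat). SUM i<n a. g a i)))" by simp
 from pt_hd[OF pt_hd[OF pt_tl[OF pt_tl[OF this[unfolded enc_mat_mat]]]]] show ?thesis by simp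
qed

definition solves :: "nat => nat => (nat => nat => 'k) => (nat => 'k) => (nat => 'k) => bool" where
 "solves nr nc G b x \<longleftrightarrow> (ALL i<nr. (SUM j<nc. G i j * x j) = b i)"

definition lsol_rel :: "'k mat \<times> 'k vec => 'k vec option => bool" where
 "lsol_rel = (%(A, b) ret. case ret of None => ~(EX x:carrier_vec (dim_col A). A *\<^sub>v x = b)
            | Some x => x : carrier_vec (dim_col A) & A *\<^sub>v x = b)"

text \<open>The solver is chosen once and for all, so that its answers can be named in the
  definition of the algorithm.\<close>

definition raw_sol :: "'k mat \<times> 'k vec => 'k vec option" where
 "raw_sol = (SOME F. (ALL a:{(A, b). dim_vec b = dim_row A}. lsol_rel a (F a)) &
   pt {(A, b). dim_vec b = dim_row A} (enc_pair (enc_mat enc) (enc_vec enc)) (%a. enc_option (enc_vec enc) (F a)))"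

lemma raw_sol:
 "dim_vec b = dim_row A ==> lsol_rel (A, b) (raw_sol (A, b))"
 "pt {(A, b). dim_vec b = dim_row A} (enc_pair (enc_mat enc) (enc_vec enc)) (%a. enc_option (enc_vec enc) (raw_sol a))"
proof -
 have "polytime_solvable (enc_pair (enc_mat enc) (enc_vec enc)) (enc_option (enc_vec enc)) {(A, b). dim_vec b = dim_row A} lsol_rel" using ela unfolding efficient_linear_algebra_def lsol_rel_def by (elim conjE)
 from someI_ex[OF polytime_solvableD[OF this], folded raw_sol_def]
 show "dim_vec b = dim_row A ==> lsol_rel (A, b) (raw_sol (A, b))"
 "pt {(A, b). dim_vec b = dim_row A} (enc_pair (enc_mat enc) (enc_vec enc)) (%a. enc_option (enc_vec enc) (raw_sol a))" by auto
qed

definition lsol :: "nat => nat => (nat => nat => 'k) => (nat => 'k) => (nat => 'k) option" where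
 "lsol nr nc G b = map_option (%v j. if j < nc then v $ j else 0) (raw_sol (mat nr nc (%(i, j). G i j), vec nr b))"

lemma mat_solves:
 "x : carrier_vec nc ==> mat nr nc (%(i, j). G i j) *\<^sub>v x = vec nr b \<longleftrightarrow> solves nr nc G b (%j. if j < nc then x $ j else 0)"
 by (auto simp: solves_def vec_eq_iff scalar_prod_def lessThan_atLeast0)

lemma lsol_None: "lsol nr nc G b = None ==> ~solves nr nc G b x"
proof
 assume 0: "lsol nr nc G b = None" and x: "solves nr nc G b x"
 have "solves nr nc G b (%j. if j < nc then vec nc x $ j else 0)" using x by (simp add: solves_def)
 hence "mat nr nc (%(i, j). G i j) *\<^sub>v vec nc x = vec nr b" by (subst mat_solves) auto
 moreover have "raw_sol (mat nr nc (%(i, j). G i j), vec nr b) = None" using 0 by (simp add: lsol_def)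
 ultimately show False using raw_sol(1)[of "vec nr b" "mat nr nc (%(i, j). G i j)"] vec_carrier[of nc x] by (auto simp: lsol_rel_def)
qed

lemma lsol_Some:
 assumes "lsol nr nc G b = Some x"
 shows "solves nr nc G b x" "j >= nc ==> x j = 0"
proof -
 obtain v where v: "raw_sol (mat nr nc (%(i, j). G i j), vec nr b) = Some v" "x = (%j. if j < nc then vec_index v j else 0)" using assms by (auto simp: lsol_def)
 have "v : carrier_vec nc" "mat nr nc (%(i, j). G i j) *\<^sub>v v = vec nr b" using raw_sol(1)[of "vec nr b" "mat nr nc (%(i, j). G i j)"] v by (auto simp: lsol_rel_def)
 thus "solves nr nc G b x" "j >= nc ==> x j = 0" using mat_solves[of v nc nr G b] v(2) by auto
qed

abbreviation encf :: "nat => (nat => 'k) => sexp" where "encf n x \<equiv> eL (%j. enc (x j)) [0..<n]"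

lemma pt_lsol:
 assumes "pt D f (%a. eN (nr a))" "pt D f (%a. eN (nc a))"
  "pt (Idx (Idx D nr) (%p. nc (fst p))) (ext (ext f)) (%p. enc (G (fst (fst p)) (snd (fst p)) (snd p)))"
  "pt (Idx D nr) (ext f) (%p. enc (b (fst p) (snd p)))"
 shows "pt D f (%a. enc_option (encf (nc a)) (lsol (nr a) (nc a) (G a) (b a)))"
proof -
 have "pt D f (%a. enc_pair (enc_mat enc) (enc_vec enc) (mat (nr a) (nc a) (%(i, j). G a i j), vec (nr a) (b a)))" unfolding enc_pair_def split enc_vec_vec by (intro pt_Dot pt_mat pt_map assms)
 hence "pt D f (%a. enc_option (enc_vec enc) (raw_sol (mat (nr a) (nc a) (%(i, j). G a i j), vec (nr a) (b a))))" by (rule pt_oracle[OF raw_sol(2)]) auto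
 thus ?thesis
 proof (rule pt_cg)
  fix a
  let ?A = "mat (nr a) (nc a) (%(i, j). G a i j)"
  show "enc_option (enc_vec enc) (raw_sol (?A, vec (nr a) (b a))) = enc_option (encf (nc a)) (lsol (nr a) (nc a) (G a) (b a))"
  proof (cases "raw_sol (?A, vec (nr a) (b a))")
   case (Some v)
   hence "v = vec (nc a) (%j. if j < nc a then v $ j else 0)" using raw_sol(1)[of "vec (nr a) (b a)" ?A] by (auto simp: lsol_rel_def)
   hence "enc_vec enc v = encf (nc a) (%j. if j < nc a then v $ j else 0)" using enc_vec_vec by metis
   thus ?thesis using Some by (simp add: lsol_def)
  qed (simp add: lsol_def)
 qed
qed

lemma enc_option_Null [simp]: "enc_option e x = Null \<longleftrightarrow> x = None" by (cases x) auto

lemma pt_the: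
 assumes "pt D f (%a. enc_option (e a) (x a))" "!!a. a : D ==> x a ~= None"
 shows "pt D f (%a. e a (the (x a)))"
 by (rule pt_cg[OF pt_hd[OF assms(1)]]) (use assms(2) in fastforce)

text \<open>The main device against growing codes: a vector given by a recursion is obtained by one
  call of the solver, as the only solution of a system of polynomial size.\<close>

lemma pt_unique:
 assumes "pt D f (%a. eN (nr a))" "pt D f (%a. eN (nc a))"
  "pt (Idx (Idx D nr) (%p. nc (fst p))) (ext (ext f)) (%p. enc (G (fst (fst p)) (snd (fst p)) (snd p)))"
  "pt (Idx D nr) (ext f) (%p. enc (b (fst p) (snd p)))"
  "!!a. a : D ==> solves (nr a) (nc a) (G a) (b a) (x a)"
  "!!a y j. a : D ==> solves (nr a) (nc a) (G a) (b a) y ==> j < nc a ==> y j = x a j"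
 shows "pt D f (%a. encf (nc a) (x a))"
proof -
 let ?l = "%a. lsol (nr a) (nc a) (G a) (b a)"
 have some: "?l a ~= None" if "a : D" for a using lsol_None assms(5)[OF that] by blast
 have "pt D f (%a. encf (nc a) (the (?l a)))" by (rule pt_the[OF pt_lsol[OF assms(1-4)] some])
 thus ?thesis by (rule pt_cg) (use some lsol_Some(1) assms(6) in \<open>fastforce intro!: enc_list_cong\<close>)
qed

lemma pt_mem:
 assumes x: "pt D f (%a. enc (x a))" and ys: "pt D f (%a. eL enc (ys a))"
 shows "pt D f (%a. enc_bool (x a : set (ys a)))"
proof -
 let ?n = "%a. length (ys a)"
 define s where "s a k = enc_bool (x a : set (take k (ys a)))" for a k
 have n: "pt D f (%a. eN (?n a))" by (rule pt_len[OF ys])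
 have "pt D f (%a. s a (?n a))"
 proof (rule pt_fold[OF n])
  show "pt D f (%a. s a 0)" unfolding s_def by (simp add: enc_bool_def pt_null)
  let ?e = "%p. Dot (f (fst p)) (Dot (eN (snd p)) (s (fst p) (snd p)))"
  have ext: "pt (Idx D ?n) ?e (ext f)" by (rule pt_cg[OF pt_Dot[OF pt_hd[OF pt_id] pt_hd[OF pt_tl[OF pt_id]]]]) simp
  have "pt (Idx D ?n) (ext f) (%p. enc (ys (fst p) ! snd p))" by (rule pt_nth[OF pt_Idx[OF ys] pt_snd]) auto
  hence c: "pt (Idx D ?n) (ext f) (%p. enc_bool (x (fst p) = ys (fst p) ! snd p))" by (intro pt_eq_field pt_Idx[OF x])
  have "pt (Idx D ?n) ?e (%p. if x (fst p) = ys (fst p) ! snd p then enc_bool True else s (fst p) (snd p))" by (intro pt_if pt_trans[OF ext c] pt_c pt_trans[OF pt_snd pt_snd])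
  thus "pt (Idx D ?n) ?e (%p. s (fst p) (Suc (snd p)))" by (rule pt_cg) (auto simp: s_def take_Suc_conv_app_nth)
  show "pb (SIGMA a:D. {..?n a}) (%p. f (fst p)) (%p. size (s (fst p) (snd p)))" by (rule pb_mono[OF pb_const[of _ _ 1]]) (auto simp: s_def enc_bool_def)
 qed
 thus ?thesis by (simp add: s_def)
qed

lemma pt_m: "pt D f (%a. enc_sconsts enc (m a, s a)) ==> pt D f (%a. eN (m a))"
 using pt_len[of D f "%a i. eL (%j. eL (%l. enc (s a i j l)) [0..<m a]) [0..<m a]" "%a. [0..<m a]"]
 by (simp add: enc_sconsts_def)

lemma pt_s:
 assumes "pt D f (%a. enc_sconsts enc (m a, s a))" "pt D f (%a. eN (i a))" "pt D f (%a. eN (j a))" "pt D f (%a. eN (l a))"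
  "!!a. a : D ==> i a < m a" "!!a. a : D ==> j a < m a" "!!a. a : D ==> l a < m a"
 shows "pt D f (%a. enc (s a (i a) (j a) (l a)))"
proof -
 have "pt D f (%a. eL (%j. eL (%l. enc (s a (i a) j l)) [0..<m a]) [0..<m a])" using pt_entry[OF assms(1)[unfolded enc_sconsts_def split] assms(2,5)] .
 from pt_entry[OF pt_entry[OF this assms(3,6)] assms(4,7)] show ?thesis .
qed

definition mulA :: "nat => 'k sconsts => (nat => 'k) => (nat => 'k) => nat => 'k" where
 "mulA m s x y l = (SUM i<m. SUM j<m. x i * y j * s i j l)"

lemma pt_mulA:
 assumes s: "pt D f (%a. enc_sconsts enc (m a, s a))"
  and x: "pt D f (%a. encf (m a) (x a))" and y: "pt D f (%a. encf (m a) (y a))"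
 shows "pt D f (%a. encf (m a) (mulA (m a) (s a) (x a) (y a)))"
 unfolding mulA_def
proof (rule pt_map[OF pt_m[OF s]])
 note S1 = pt_Idx[OF s, of m]
 note S2 = pt_Idx[OF S1, of "%p. m (fst p)"]
 note S3 = pt_Idx[OF S2, of "%p. m (fst (fst p))"]
 note l = pt_snd[of "Idx D m" "%p. f (fst p)" "%p. eN (snd p)"]
 let ?D3 = "Idx (Idx (Idx D m) (%p. m (fst p))) (%p. m (fst (fst p)))"
 have j: "pt ?D3 (ext (ext (ext f))) (%p. eN (snd p))" by (rule pt_snd)
 have i: "pt ?D3 (ext (ext (ext f))) (%p. eN (snd (fst p)))" by (rule pt_Idx, rule pt_snd)
 have l: "pt ?D3 (ext (ext (ext f))) (%p. eN (snd (fst (fst p))))" by (rule pt_Idx, rule pt_Idx, rule pt_snd)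
 show "pt (Idx D m) (ext f) (%p. enc (SUM i<m (fst p). SUM j<m (fst p). x (fst p) i * y (fst p) j * s (fst p) i j (snd p)))"
 proof (rule pt_sum[OF pt_m[OF S1]], rule pt_sum[OF pt_m[OF S2]], intro pt_mul)
  show "pt ?D3 (ext (ext (ext f))) (%p. enc (x (fst (fst (fst p))) (snd (fst p))))" by (rule pt_entry[OF pt_Idx[OF pt_Idx[OF pt_Idx[OF x]]] i]) auto
  show "pt ?D3 (ext (ext (ext f))) (%p. enc (y (fst (fst (fst p))) (snd p)))" by (rule pt_entry[OF pt_Idx[OF pt_Idx[OF pt_Idx[OF y]]] j]) auto
  show "pt ?D3 (ext (ext (ext f))) (%p. enc (s (fst (fst (fst p))) (snd (fst p)) (snd p) (snd (fst (fst p)))))" by (rule pt_s[OF S3 i j l]) auto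
 qed
qed

end

subsection \<open>Enumerating a large set or a finite subfield\<close>

text \<open>Words are Horner-like programs over the scalars \<open>cs\<close>. They certify that a
  scalar has a short description, from which the size of its code is bounded.\<close>

definition val :: "'a::field list => nat list => 'a" where
 "val cs js = foldl (%z j. if j < length cs then cs ! j * z else z+1) 0 js"

lemma val_simps: "val cs [] = 0" "val cs (js @ [j]) = (if j < length cs then cs ! j * val cs js else val cs js+1)"
 by (simp_all add: val_def)

definition wle :: "'a list => nat => nat list set" where
 "wle cs k = {js. length js <= k & set js <= {..length cs}}"

definition grow :: "nat => 'a list => 'a => 'a list" where
 "grow M xs c = (if length xs < M & c ~: set xs then xs @ [c] else xs)"

text \<open>Sums and products of arbitrary pairs are not formed: each candidate extends the word of
  \<open>x\<close> by one letter, so entries remain values of short words.\<close>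

definition cands :: "'a::field list => 'a => 'a list" where
 "cands cs x = map (%c. c * x) cs @ [x+1]"

definition stage :: "nat => 'a::field list => 'a list => nat => 'a list" where
 "stage M cs xs i = (if i < length xs then foldl (grow M) xs (cands cs (xs ! i)) else xs)"

text \<open>A breadth-first search from 0, stopped at \<open>M\<close> elements. Stage
  \<open>k\<close> treats entry \<open>k\<close>, so the list is its own queue.\<close>

definition clo_list :: "nat => 'a::field list => nat => 'a list" where
 "clo_list M cs k = foldl (stage M cs) [0] [0..<k]"

lemma clo_list_simps: "clo_list M cs 0 = [0]" "clo_list M cs (Suc k) = stage M cs (clo_list M cs k) k"
 by (simp_all add: clo_list_def)

text \<open>The \<open>k\<close>-th entry of the enumeration is the value of a word of length at most \<open>k\<close>.\<close>

definition einv :: "nat => 'a::field list => 'a list => bool" where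
 "einv M cs xs \<longleftrightarrow> distinct xs & length xs <= M & (ALL k<length xs. xs ! k : val cs ` wle cs k)"

lemma wle_mono: "k <= k' ==> wle cs k <= wle cs k'" by (auto simp: wle_def)

lemma cands_words:
 assumes "x : val cs ` wle cs k" "c : set (cands cs x)"
 shows "c : val cs ` wle cs (Suc k)"
proof -
 obtain js where js: "js : wle cs k" "x = val cs js" using assms(1) by blast
 have "EX j<=length cs. c = val cs (js @ [j])"
 proof (cases "c = x+1")
  case True
  thus ?thesis using js(2) by (intro exI[of _ "length cs"]) (simp add: val_simps)
 next
  case False
  then obtain y where "y : set cs" "c = y * x" using assms(2) by (auto simp: cands_def)
  then obtain j where "j < length cs" "c = cs ! j * x" by (metis in_set_conv_nth)
  thus ?thesis using js(2) by (intro exI[of _ j]) (simp add: val_simps)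
 qed
 then obtain j where "j <= length cs" "c = val cs (js @ [j])" by blast
 moreover from this(1) js(1) have "js @ [j] : wle cs (Suc k)" by (auto simp: wle_def)
 ultimately show ?thesis by blast
qed

lemma foldl_grow:
 assumes "einv M cs xs" "ALL c:set ys. c : val cs ` wle cs (length xs)"
 shows "einv M cs (foldl (grow M) xs ys)" "EX zs. foldl (grow M) xs ys = xs @ zs"
  "length (foldl (grow M) xs ys) < M ==> set ys <= set (foldl (grow M) xs ys)"
proof -
 have "einv M cs (foldl (grow M) xs ys) & (EX zs. foldl (grow M) xs ys = xs @ zs) &
  (length (foldl (grow M) xs ys) < M --> set ys <= set (foldl (grow M) xs ys))"
  using assms(2)
 proof (induct ys rule: rev_induct)
  case (snoc c ys)
  define zs where "zs = foldl (grow M) xs ys"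
  have IH: "einv M cs zs" "EX ws. zs = xs @ ws" "length zs < M ==> set ys <= set zs" using snoc by (auto simp: zs_def)
  have "wle cs (length xs) <= wle cs (length zs)" using IH(2) by (intro wle_mono) auto
  hence c: "c : val cs ` wle cs (length zs)" using snoc(2) by auto
  have "einv M cs (grow M zs c)" using IH(1) c by (auto simp: grow_def einv_def nth_append less_Suc_eq)
  moreover have "EX ws. grow M zs c = xs @ ws" using IH(2) by (auto simp: grow_def)
  moreover have "length (grow M zs c) < M --> set (ys @ [c]) <= set (grow M zs c)" using IH(3) by (auto simp: grow_def split: if_splits)
  ultimately show ?case by (simp add: zs_def)
 qed (use assms(1) in auto)
 thus "einv M cs (foldl (grow M) xs ys)" "EX zs. foldl (grow M) xs ys = xs @ zs"
  "length (foldl (grow M) xs ys) < M ==> set ys <= set (foldl (grow M) xs ys)" by blast+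
qed

lemma cands_inv:
 assumes "einv M cs xs" "i < length xs"
 shows "ALL c:set (cands cs (xs ! i)). c : val cs ` wle cs (length xs)"
proof
 fix c assume c: "c : set (cands cs (xs ! i))"
 have "xs ! i : val cs ` wle cs i" using assms by (simp add: einv_def)
 from cands_words[OF this c] show "c : val cs ` wle cs (length xs)" using wle_mono[of "Suc i" "length xs" cs] assms(2) by auto
qed

lemma stage_inv:
 assumes "einv M cs xs"
 shows "einv M cs (stage M cs xs i)" "EX zs. stage M cs xs i = xs @ zs"
  "i < length xs ==> length (stage M cs xs i) < M ==> set (cands cs (xs ! i)) <= set (stage M cs xs i)"
 using foldl_grow[OF assms cands_inv[OF assms, of i]] assms by (auto simp: stage_def)

lemma clo_list_inv: "M >= 1 ==> einv M cs (clo_list M cs k)"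
proof (induct k)
 case 0
 thus ?case by (auto simp: clo_list_simps einv_def wle_def val_simps intro: image_eqI[of _ _ "[]"])
qed (simp add: clo_list_simps stage_inv)

lemma clo_list_prefix:
 assumes "M >= 1" "k <= k'"
 shows "EX zs. clo_list M cs k' = clo_list M cs k @ zs"
 using assms(2)
proof (induct k' rule: dec_induct)
 case (step k')
 thus ?case using stage_inv(2)[OF clo_list_inv[OF assms(1)], of cs k' k'] by (auto simp: clo_list_simps)
qed simp

text \<open>With fewer than \<open>M\<close> elements every entry has had its stage, and its
  candidates were accepted because the limit was not reached.\<close>

lemma clo_list_closed:
 assumes M: "M >= 1" and less: "length (clo_list M cs M) < M" and x: "x : set (clo_list M cs M)"
 shows "set (cands cs x) <= set (clo_list M cs M)"
proof -
 let ?X = "clo_list M cs"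
 obtain i where i: "i < length (?X M)" "x = ?X M ! i" using x by (auto simp: in_set_conv_nth)
 have iM: "Suc i <= M" using i less by simp
 \<comment> \<open>Entry \<open>i\<close> is present when its stage comes: a stage with an empty
   queue changes nothing, and neither would all later ones.\<close>
 have "i < length (?X i)"
 proof (rule ccontr)
  assume *: "~i < length (?X i)"
  have "?X k = ?X i" if "i <= k" for k using that
  proof (induct k rule: dec_induct)
   case (step k) thus ?case using * by (simp add: clo_list_simps stage_def)
  qed simp
  from this[of M] show False using i(1) iM * by simp
 qed
 moreover obtain zs ws where zs: "?X M = ?X (Suc i) @ zs" "?X M = ?X i @ ws"
 proof -
  have "i <= M" using iM by simp
  with clo_list_prefix[OF M iM, of cs] clo_list_prefix[OF M this, of cs] show thesis by (elim exE) (rule that)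
 qed
 ultimately have "set (cands cs (?X i ! i)) <= set (?X (Suc i))" using stage_inv(3)[OF clo_list_inv[OF M], of i cs i] less by (auto simp: clo_list_simps)
 moreover have "x = ?X i ! i" using i zs(2) `i < length (?X i)` by (simp add: nth_append)
 ultimately show ?thesis using zs(1) by auto
qed

text \<open>
 A finite set closed under adding one and under multiplication by the \<open>cs\<close> is stable under adding the
 values of words, because multiplication by a nonzero \<open>c\<close> permutes it; hence it is a ring.
\<close>

lemma closed_set_ring:
 fixes S :: "'a::field set"
 assumes fin: "finite S" and S0: "0 : S" and S1': "ALL x:S. x+1 : S"
  and Sc': "ALL c:set cs. ALL x:S. c * x : S" and vals: "S <= range (val cs)"
 shows "1 : S" "c : set cs ==> c : S" "x : S ==> y : S ==> x+y : S" "x : S ==> y : S ==> x * y : S"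
proof -
 have S1: "x : S ==> x+1 : S" and Sc: "c : set cs ==> x : S ==> c * x : S" for c x using S1' Sc' by auto
 show one: "1 : S" using S1[OF S0] by simp
 show "c : set cs ==> c : S" using Sc[OF _ one, of c] by simp
 have scale: "EX y:S. x = c * y" if "c : set cs" "c ~= 0" "x : S" for c x
 proof -
  have "(%y. c * y) ` S = S" by (rule endo_inj_surj[OF fin]) (use that Sc in \<open>auto simp: inj_on_def\<close>)
  thus ?thesis using that(3) by blast
 qed
 have "ALL x:S. x+val cs js : S" for js
 proof (induct js rule: rev_induct)
  case (snoc j js)
  show ?case
  proof
   fix x assume x: "x : S"
   show "x+val cs (js @ [j]) : S"
   proof (cases "j < length cs & cs ! j ~= 0")
    case True
    then obtain y where y: "y : S" "x = cs ! j * y" using scale[of "cs ! j" x] x by auto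
    thus ?thesis using True snoc Sc[of "cs ! j" "y+val cs js"] by (simp add: val_simps distrib_left)
   next
    case False
    thus ?thesis using x snoc S1[of "x+val cs js"] by (auto simp: val_simps add.assoc)
   qed
  qed
 qed (simp add: val_simps)
 thus add: "x : S ==> y : S ==> x+y : S" for x y using vals by blast
 have "ALL x:S. val cs js * x : S" for js
 proof (induct js rule: rev_induct)
  case (snoc j js)
  thus ?case using Sc add by (auto simp: val_simps mult.assoc distrib_right)
 qed (simp add: val_simps S0)
 thus "x : S ==> y : S ==> x * y : S" using vals by blast
qed

context ela begin

text \<open>The unknowns are the values of all prefixes of the word. The system is bidiagonal and
  hence uniquely solvable; its right-hand side is 1 at the letters that add one.\<close>

lemma pt_val:
 assumes cs: "pt D f (%a. eL enc (cs a))"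
  and V: "!!a js. (a, js) : V ==> a : D & set js <= {..length (cs a)}"
 shows "pt V (%p. Dot (f (fst p)) (eL eN (snd p))) (%p. enc (val (cs (fst p)) (snd p)))"
proof -
 let ?h = "%p. Dot (f (fst p)) (eL eN (snd p))"
 let ?n = "%p :: 'a \<times> nat list. Suc (length (snd p))"
 let ?G = "%p i k. (if i = k then 1 else 0)-(if i = Suc k then (if snd p ! k < length (cs (fst p)) then cs (fst p) ! (snd p ! k) else 1) else 0)"
 let ?b = "%p i. if i = 0 then 0 else (if snd p ! (i-1) < length (cs (fst p)) then 0 else 1)"
 let ?x = "%p i. val (cs (fst p)) (take i (snd p))"
 have js: "pt V ?h (%p. eL eN (snd p))" by (rule pt_snd)
 have cs1: "pt V ?h (%p. eL enc (cs (fst p)))" by (rule pt_ext[OF cs]) (use V in auto)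
 have n: "pt V ?h (%p. eN (?n p))" by (rule pt_Suc, rule pt_len[OF js])
 let ?D2 = "Idx (Idx V ?n) (%p. ?n (fst p))"
 have i2: "pt E (ext (ext ?h)) (%p. eN (snd (fst p)))" for E :: "((('a \<times> nat list) \<times> nat) \<times> nat) set" by (rule pt_ext[OF pt_snd[of UNIV]]) simp
 have k2: "pt E (ext (ext ?h)) (%p. eN (snd p))" for E :: "((('a \<times> nat list) \<times> nat) \<times> nat) set" by (rule pt_snd)
 have len2: "pt ?D2 (ext (ext ?h)) (%p. eN (length (cs (fst (fst (fst p))))))" by (rule pt_Idx, rule pt_Idx, rule pt_len[OF cs1])
 have cs2: "pt ?D2 (ext (ext ?h)) (%p. eL enc (cs (fst (fst (fst p)))))" by (rule pt_Idx, rule pt_Idx, rule cs1)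
 have js2: "pt ?D2 (ext (ext ?h)) (%p. eL eN (snd (fst (fst p))))" by (rule pt_Idx, rule pt_Idx, rule js)
 have jk: "pt {p : ?D2. snd (fst p) = Suc (snd p)} (ext (ext ?h)) (%p. eN (snd (fst (fst p)) ! snd p))" by (rule pt_nth[OF pt_sub[OF js2] k2]) auto
 have G: "pt ?D2 (ext (ext ?h)) (%p. enc (?G (fst (fst p)) (snd (fst p)) (snd p)))"
 proof (intro pt_diff pt_if_field pt_eq pt_Suc i2 k2 pt_c pt_less jk pt_sub[OF len2])
  show "pt {a : {p : ?D2. snd (fst p) = Suc (snd p)}. snd (fst (fst a)) ! snd a < length (cs (fst (fst (fst a))))} (ext (ext ?h))
   (%p. enc (cs (fst (fst (fst p))) ! (snd (fst (fst p)) ! snd p)))"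
   by (rule pt_nth[OF pt_sub[OF cs2] pt_sub[OF jk]]) auto
 qed auto
 have b: "pt (Idx V ?n) (ext ?h) (%p. enc (?b (fst p) (snd p)))"
 proof (intro pt_if_field pt_eq pt_c pt_snd pt_less)
  show "pt {a : Idx V ?n. snd a ~= 0} (ext ?h) (%p. eN (snd (fst p) ! (snd p-1)))" by (rule pt_nth[OF pt_sub[OF pt_Idx[OF js]]]) (auto intro!: pt_minus pt_snd pt_c)
  show "pt {a : Idx V ?n. snd a ~= 0} (ext ?h) (%p. eN (length (cs (fst (fst p)))))" by (rule pt_sub[OF pt_Idx[OF pt_len[OF cs1]]]) auto
 qed
 have row: "(SUM k<?n p. ?G p i k * x k) = x i-(case i of 0 => 0 | Suc k => (if snd p ! k < length (cs (fst p)) then cs (fst p) ! (snd p ! k) else 1) * x k)"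
  if "i < ?n p" for p i x
 proof (cases i)
  case 0
  have "(SUM k<?n p. ?G p i k * x k) = (SUM k<?n p. if k = 0 then x 0 else 0)" using 0 by (intro sum.cong) auto
  thus ?thesis using 0 by simp
 next
  case (Suc j)
  let ?c = "if snd p ! j < length (cs (fst p)) then cs (fst p) ! (snd p ! j) else 1"
  have "(SUM k<?n p. ?G p i k * x k) = (SUM k<?n p. (if k = i then x i else 0)-(if k = j then ?c * x j else 0))" using Suc by (intro sum.cong) auto
  also have "... = x i-?c * x j" using Suc that by (simp add: sum_subtractf)
  finally show ?thesis using Suc by simp
 qed
 have "pt V ?h (%p. encf (?n p) (?x p))"
 proof (rule pt_unique[OF n n G b])
  fix p assume p: "p : V"
  show "solves (?n p) (?n p) (?G p) (?b p) (?x p)" unfolding solves_def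
  proof (intro allI impI)
   fix i assume i: "i < ?n p"
   show "(SUM k<?n p. ?G p i k*?x p k) = ?b p i" unfolding row[OF i] using i by (cases i) (auto simp: val_simps take_Suc_conv_app_nth)
  qed
  fix y j assume y: "solves (?n p) (?n p) (?G p) (?b p) y" and "j < ?n p"
  thus "y j = ?x p j"
  proof (induct j)
   case 0
   thus ?case using y row[of 0 p y] by (auto simp: solves_def val_simps)
  next
   case (Suc j)
   have "y (Suc j)-(if snd p ! j < length (cs (fst p)) then cs (fst p) ! (snd p ! j) else 1) * y j = ?b p (Suc j)" using Suc(2)[unfolded solves_def, rule_format, OF Suc(3)] unfolding row[OF Suc(3)] nat.case .
   thus ?case using Suc by (auto simp: take_Suc_conv_app_nth val_simps algebra_simps split: if_splits)
  qed
 qed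
 from pt_entry[OF this pt_len[OF js]] show ?thesis by simp
qed

text \<open>The algorithm itself never evaluates words. Computability of \<open>val\<close> is used
  only to bound the codes of all values of words of length at most \<open>M a\<close>.\<close>

lemma val_size:
 assumes cs: "pt D f (%a. eL enc (cs a))" and M: "pt D f (%a. eN (M a))"
 shows "EX Q. ALL a:D. ALL js:wle (cs a) (M a). size (enc (val (cs a) js)) <= poly Q (size (f a))"
proof -
 let ?V = "SIGMA a:D. wle (cs a) (M a)"
 have 1: "pb ?V (%p. Dot (f (fst p)) (eL eN (snd p))) (%p. size (enc (val (cs (fst p)) (snd p))))" by (rule pt_size[OF pt_val[OF cs]]) (auto simp: wle_def)
 have "pb ?V (%p. f (fst p)) (%p. size (f (fst p))+M (fst p)*(length (cs (fst p))+1)+1)" by (intro pb_add pb_mult pb_size pb_const pb_fst[OF pb_nat[OF M]] pb_fst[OF pb_nat[OF pt_len[OF cs]]]) auto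
 hence "pb ?V (%p. f (fst p)) (%p. size (Dot (f (fst p)) (eL eN (snd p))))"
 proof (rule pb_mono, clarsimp)
  fix a js assume js: "js : wle (cs a) (M a)"
  have "size (eL eN js) <= length js*(length (cs a)+1)" unfolding size_enc_list by (rule sum_list_le) (use js in \<open>auto simp: wle_def\<close>)
  also have "... <= M a*(length (cs a)+1)" using js by (intro mult_le_mono1) (simp add: wle_def)
  finally show "size (eL eN js) <= M a+M a * length (cs a)" by simp
 qed
 from pb_trans[OF this 1] show ?thesis unfolding pb_def by fastforce
qed

text \<open>Here field operations are iterated. This is safe because every entry is the value of a
  short word, so \<open>val_size\<close> bounds its code however it was reached.\<close>

lemma pt_closure_list:
 assumes cs: "pt D f (%a. eL enc (cs a))" and M: "pt D f (%a. eN (M a))" and M1: "!!a. a : D ==> M a >= 1"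
 shows "pt D f (%a. eL enc (clo_list (M a) (cs a) (M a)))"
proof -
 obtain Q where Q: "!!a js. a : D ==> js : wle (cs a) (M a) ==> size (enc (val (cs a) js)) <= poly Q (size (f a))" using val_size[OF cs M] by blast
 have sz: "size (eL enc xs) <= M a*(poly Q (size (f a))+1)" if a: "a : D" and xs: "einv (M a) (cs a) xs" for a xs
 proof -
  have "size (enc x)+1 <= poly Q (size (f a))+1" if x: "x : set xs" for x
  proof -
   obtain k where "k < length xs" "x = xs ! k" using x by (auto simp: in_set_conv_nth)
   then obtain js where "js : wle (cs a) k" "x = val (cs a) js" "k <= M a" using xs by (auto simp: einv_def)
   thus ?thesis using Q[OF a, of js] wle_mono[of k "M a" "cs a"] by auto
  qed
  hence "size (eL enc xs) <= length xs*(poly Q (size (f a))+1)" unfolding size_enc_list by (rule sum_list_le)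
  also have "... <= M a*(poly Q (size (f a))+1)" using xs by (intro mult_le_mono1) (simp add: einv_def)
  finally show ?thesis .
 qed
 have Qpb: "pb E (%p. f (h p)) (%p. M (h p)*(poly Q (size (f (h p)))+1))" if "h ` E <= D" for E :: "'x set" and h by (intro pb_mult pb_add pb_const pb_pull[OF pb_nat[OF M] that]) (auto simp: pb_def)
 let ?X = "%a. clo_list (M a) (cs a)"
 show ?thesis
 proof (rule pt_fold[where s = "%a k. eL enc (?X a k)", OF M])
  show "pt D f (%a. eL enc (?X a 0))" by (simp add: clo_list_simps) (rule pt_c)
  let ?e = "%p. Dot (f (fst p)) (Dot (eN (snd p)) (eL enc (?X (fst p) (snd p))))"
  let ?D1 = "Idx D M"
  have X: "pt ?D1 ?e (%p. eL enc (?X (fst p) (snd p)))" by (rule pt_trans[OF pt_snd pt_snd])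
  have i: "pt ?D1 ?e (%p. eN (snd p))" by (rule pt_cg[OF pt_hd[OF pt_tl[OF pt_id]]]) simp
  have csM: "pt ?D1 ?e (%p. eL enc (cs (fst p)))" "pt ?D1 ?e (%p. eN (M (fst p)))" by (rule pt_ext, rule cs M, force)+
  let ?D2 = "{p : ?D1. snd p < length (?X (fst p) (snd p))}"
  let ?c = "%p. cands (cs (fst p)) (?X (fst p) (snd p) ! snd p)"
  let ?Y = "%p k. foldl (grow (M (fst p))) (?X (fst p) (snd p)) (take k (?c p))"
  have sub: "?D2 <= ?D1" by auto
  note X2 = pt_sub[OF X sub] and i2 = pt_sub[OF i sub] and cs2 = pt_sub[OF csM(1) sub] and M2 = pt_sub[OF csM(2) sub]
  have x: "pt ?D2 ?e (%p. enc (?X (fst p) (snd p) ! snd p))" by (rule pt_nth[OF X2 i2]) auto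
  have c: "pt ?D2 ?e (%p. eL enc (?c p))" unfolding cands_def
  proof (rule pt_append)
   let ?g = "%p j. enc (cs (fst p) ! j*(?X (fst p) (snd p) ! snd p))"
   have "pt ?D2 ?e (%p. eL (?g p) [0..<length (cs (fst p))])"
   proof (rule pt_map[OF pt_len[OF cs2]], rule pt_mul[OF _ pt_Idx[OF x]])
    show "pt (Idx ?D2 (%p. length (cs (fst p)))) (ext ?e) (%p. enc (cs (fst (fst p)) ! snd p))" by (rule pt_nth[OF pt_Idx[OF cs2] pt_snd]) auto
   qed
   thus "pt ?D2 ?e (%p. eL enc (map (%c. c*(?X (fst p) (snd p) ! snd p)) (cs (fst p))))" by (rule pt_cg) (simp add: enc_list_map, subst (2) enc_list_nth, simp)
   show "pt ?D2 ?e (%p. eL enc [?X (fst p) (snd p) ! snd p+1])" unfolding enc_list.simps by (intro pt_Dot pt_add x pt_c)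
  qed
  have inv1: "einv (M a) (cs a) (?X a k)" if "a : D" for a k by (rule clo_list_inv[OF M1[OF that]])
  have inv2: "einv (M (fst p)) (cs (fst p)) (?Y p k)" if p: "p : ?D2" for p k
  proof (rule foldl_grow(1))
   show "einv (M (fst p)) (cs (fst p)) (?X (fst p) (snd p))" using p by (intro inv1) auto
   from cands_inv[OF this, of "snd p"] p
   show "ALL c:set (take k (?c p)). c : val (cs (fst p)) ` wle (cs (fst p)) (length (?X (fst p) (snd p)))" by (auto dest: in_set_takeD)
  qed
  have "pt ?D2 ?e (%p. eL enc (?Y p (length (?c p))))"
  proof (rule pt_fold[OF pt_len[OF c]])
   show "pt ?D2 ?e (%p. eL enc (?Y p 0))" using X2 by simp
   let ?e2 = "%p. Dot (?e (fst p)) (Dot (eN (snd p)) (eL enc (?Y (fst p) (snd p))))"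
   let ?D3 = "Idx ?D2 (%p. length (?c p))"
   have Y: "pt ?D3 ?e2 (%p. eL enc (?Y (fst p) (snd p)))" by (rule pt_trans[OF pt_snd pt_snd])
   have k: "pt ?D3 ?e2 (%p. eN (snd p))" by (rule pt_cg[OF pt_hd[OF pt_tl[OF pt_id]]]) simp
   have c3: "pt ?D3 ?e2 (%p. eL enc (?c (fst p)))" by (rule pt_ext[OF c]) auto
   have M3: "pt ?D3 ?e2 (%p. eN (M (fst (fst p))))" by (rule pt_ext[OF M2]) auto
   have ck: "pt ?D3 ?e2 (%p. enc (?c (fst p) ! snd p))" by (rule pt_nth[OF c3 k]) auto
   have "pt ?D3 ?e2 (%p. if length (?Y (fst p) (snd p)) < M (fst (fst p)) & ?c (fst p) ! snd p ~: set (?Y (fst p) (snd p))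
    then eL enc (?Y (fst p) (snd p) @ [?c (fst p) ! snd p]) else eL enc (?Y (fst p) (snd p)))"
    by (intro pt_if pt_conj pt_less pt_len[OF Y] M3 pt_not pt_sub[OF pt_mem[OF ck Y]] pt_append pt_sub[OF Y])
     (auto intro!: pt_Dot pt_c pt_sub[OF ck])
   thus "pt ?D3 ?e2 (%p. eL enc (?Y (fst p) (Suc (snd p))))" by (rule pt_cg) (auto simp: take_Suc_conv_app_nth grow_def)
   have "pb (SIGMA p:?D2. {..length (?c p)}) (%p. ?e (fst p)) (%p. size (f (fst (fst p))))" by (rule pb_mono[OF pb_size]) auto
   moreover have "pb (SIGMA p:?D2. {..length (?c p)}) (%p. f (fst (fst p))) (%p. size (eL enc (?Y (fst p) (snd p))))" by (rule pb_mono[OF Qpb[of "%p. fst (fst p)"]]) (use inv2 sz in auto)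
   ultimately show "pb (SIGMA p:?D2. {..length (?c p)}) (%p. ?e (fst p)) (%p. size (eL enc (?Y (fst p) (snd p))))" by (rule pb_trans)
  qed
  hence Y: "pt ?D2 ?e (%p. eL enc (foldl (grow (M (fst p))) (?X (fst p) (snd p)) (?c p)))" by simp
  have "pt ?D1 ?e (%p. if snd p < length (?X (fst p) (snd p)) then eL enc (foldl (grow (M (fst p))) (?X (fst p) (snd p)) (?c p))
    else eL enc (?X (fst p) (snd p)))"
   by (intro pt_if pt_less i pt_len[OF X] Y pt_sub[OF X]) auto
  thus "pt ?D1 ?e (%p. eL enc (?X (fst p) (Suc (snd p))))" by (rule pt_cg) (auto simp: clo_list_simps stage_def)
  show "pb (SIGMA a:D. {..M a}) (%p. f (fst p)) (%p. size (eL enc (?X (fst p) (snd p))))" by (rule pb_mono[OF Qpb[of fst]]) (use inv1 sz in auto)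
 qed
qed

end

subsection \<open>Sampling\<close>

definition bval :: "bool list => nat" where "bval bs = foldl (%r b. 2 * r + of_bool b) 0 bs"

text \<open>The remainder is reduced after each bit, since in unary the value of the whole chunk
  would be exponentially large.\<close>

definition bmod :: "nat => bool list => nat" where "bmod L bs = foldl (%r b. (2 * r + of_bool b) mod L) 0 bs"

definition chunk :: "nat => bool list => nat => bool list" where
 "chunk A w i = map (%t. w ! (i * A+t)) [0..<A]"

definition sample :: "nat => nat => 'a::zero list => bool list => nat => 'a" where
 "sample m A T w i = (if i < m then T ! bmod (length T) (chunk A w i) else 0)"

lemma bval_snoc: "bval (bs @ [b]) = 2 * bval bs + of_bool b" by (simp add: bval_def)

lemma bmod_snoc: "bmod L (bs @ [b]) = (2 * bmod L bs + of_bool b) mod L" by (simp add: bmod_def)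

lemma bmod_eq: "bmod L bs = bval bs mod L"
proof (induct bs rule: rev_induct)
 case (snoc b bs)
 thus ?case unfolding bmod_snoc bval_snoc by (metis mod_add_left_eq mod_mult_right_eq)
qed (simp add: bmod_def bval_def)

lemma bmod_less: "L > 0 ==> bmod L bs < L" by (simp add: bmod_eq)

lemma bval_less: "bval bs < 2^length bs"
 by (induct bs rule: rev_induct) (auto simp: bval_snoc bval_def of_bool_def)

lemma bval_inj: "length bs = length bs' ==> bval bs = bval bs' ==> bs = bs'"
proof (induct bs arbitrary: bs' rule: rev_induct)
 case (snoc b bs)
 then obtain cs c where c: "bs' = cs @ [c]" by (metis append_is_Nil_conv length_0_conv list.distinct(1) rev_exhaust)
 have e: "2 * bval bs + of_bool b = 2 * bval cs + of_bool c" using snoc(3) by (simp add: c bval_snoc)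
 hence "b = c" by (cases b; cases c; simp; presburger)
 hence "bval bs = bval cs" using e by simp
 thus ?case using snoc(1)[of cs] snoc(2) `b = c` by (simp add: c)
qed simp

lemma finite_bitlists: "finite {bs :: bool list. length bs = N}" "card {bs :: bool list. length bs = N} = 2^N"
 using finite_lists_length_eq[of "UNIV :: bool set" N] card_lists_length_eq[of "UNIV :: bool set" N] by simp_all

text \<open>Bit strings with the same remainder are told apart by the quotient, which is at most
  \<open>2^A div L\<close>.\<close>

lemma card_bits_mod:
 assumes L: "L > 0"
 shows "card {bs. length bs = A & bmod L bs = r} <= 2^A div L+1"
proof -
 have "card {bs. length bs = A & bmod L bs = r} <= card {..2^A div L}"
 proof (rule card_inj_on_le[where f = "%bs. bval bs div L"])
  show "inj_on (%bs. bval bs div L) {bs. length bs = A & bmod L bs = r}"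
  proof (rule inj_onI, clarify)
   fix x y assume "bval x div L = bval y div L" "length y = length x" "bmod L y = bmod L x" "A = length x" "r = bmod L x"
   hence "bval x = bval y" unfolding bmod_eq by (metis div_mult_mod_eq)
   thus "x = y" using `length y = length x` by (intro bval_inj) auto
  qed
  show "(%bs. bval bs div L) ` {bs. length bs = A & bmod L bs = r} <= {..2^A div L}"
  proof -
   have "bval bs div L <= 2^length bs div L" for bs using bval_less[of bs] by (simp add: div_le_mono)
   thus ?thesis by auto
  qed
 qed simp
 thus ?thesis by simp
qed

lemma card_chunks:
 assumes L: "L > 0"
 shows "m * A <= N ==> card {w. length w = N & (ALL i<m. bmod L (chunk A w i) = t i)} <= (2^A div L+1)^m*2^(N-m * A)"
proof (induct m arbitrary: t N)
 case 0
 thus ?case by (simp add: finite_bitlists)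
next
 case (Suc m)
 let ?X = "{bs. length bs = A & bmod L bs = t 0}"
 let ?Y = "{w. length w = N-A & (ALL i<m. bmod L (chunk A w i) = t (Suc i))}"
 have fin: "finite ?X" "finite ?Y" using finite_bitlists(1) by (auto intro: finite_subset)
 have "{w. length w = N & (ALL i<Suc m. bmod L (chunk A w i) = t i)} <= (%(x, y). x @ y) ` (?X \<times> ?Y)"
 proof
  fix w assume w: "w : {w. length w = N & (ALL i<Suc m. bmod L (chunk A w i) = t i)}"
  have AN: "A <= N" using Suc(2) by simp
  have c0: "chunk A w 0 = take A w" using w AN by (auto simp: chunk_def intro: nth_equalityI)
  have cS: "chunk A (drop A w) i = chunk A w (Suc i)" for i using w AN by (auto simp: chunk_def nth_drop add_ac)
  have "take A w : ?X" using w AN c0 by force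
  moreover have "drop A w : ?Y" using w AN by (auto simp: cS)
  ultimately have "(take A w, drop A w) : ?X \<times> ?Y" by (rule SigmaI)
  thus "w : (%(x, y). x @ y) ` (?X \<times> ?Y)" by (intro image_eqI[of _ _ "(take A w, drop A w)"]) simp_all
 qed
 hence "card {w. length w = N & (ALL i<Suc m. bmod L (chunk A w i) = t i)} <= card (?X \<times> ?Y)" using fin by (intro surj_card_le) auto
 also have "... = card ?X * card ?Y" by (rule card_cartesian_product)
 also have "... <= (2^A div L+1)*((2^A div L+1)^m*2^(N-A-m * A))" using Suc(2) by (intro mult_le_mono card_bits_mod[OF L] Suc(1)) simp
 finally show ?case by (simp add: algebra_simps)
qed

text \<open>\<open>L * (2^A div L + 1)\<close> exceeds \<open>2^A\<close> by a factor of at most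
  \<open>1 + 1/(8 m)\<close>, whose \<open>m\<close>-th power is at most \<open>exp (1/8)\<close>;
  this is at most 8/7 because \<open>exp (-1/8) >= 7/8\<close>.\<close>

lemma sampling_distortion:
 fixes L m A :: nat
 assumes m: "m > 0" and L: "L > 0" and A: "8 * m * L <= 2^A"
 shows "7*(L*(2^A div L+1))^m <= 8*(2^A)^m"
proof -
 let ?x = "1 / (8 * real m)"
 have "real (L*(2^A div L+1)) <= 2^A + real L"
 proof -
  have "L*(2^A div L+1) <= 2^A+L" by simp
  hence "real (L*(2^A div L+1)) <= real (2^A+L)" by (simp only: of_nat_le_iff)
  thus ?thesis by simp
 qed
 also have "... <= 2^A*(1+?x)"
 proof -
  have "real (8 * m * L) <= real (2^A)" using A by (simp only: of_nat_le_iff)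
  thus ?thesis using m by (simp add: field_simps)
 qed
 finally have "real (L*(2^A div L+1))^m <= (2^A*(1+?x))^m" by (intro power_mono) auto
 also have "... = (2^A)^m*(1+?x)^m" by (rule power_mult_distrib)
 also have "(1+?x)^m <= exp ?x^m" using exp_ge_add_one_self[of ?x] by (intro power_mono) auto
 also have "exp ?x^m = exp (1 / 8)" using m by (simp add: exp_of_nat_mult[symmetric])
 also have "exp (1 / 8 :: real) <= 8 / 7"
 proof -
  have "exp (1 / 8)*(7 / 8) <= exp (1 / 8) * exp (- (1 / 8) :: real)" using exp_ge_add_one_self[of "- (1 / 8) :: real"] by simp
  thus ?thesis by (simp add: exp_minus)
 qed
 finally have "real (L*(2^A div L+1))^m <= (2^A)^m*(8 / 7)" by simp
 hence "real (7*(L*(2^A div L+1))^m) <= real (8*(2^A)^m)" by simp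
 thus ?thesis by (simp only: of_nat_le_iff)
qed

text \<open>Each grid point is hit by at most 8/7 of its fair share of bit strings, so 7/16 of bad
  points become a probability of at most 1/2.\<close>

lemma sample_bound:
 fixes T :: "'a::zero list"
 assumes m: "m > 0" and T: "T ~= []" and A: "8 * m * length T <= 2^A" and N: "m * A <= N"
  and B: "finite B" "!!x i. x : B ==> i < m ==> x i : set T" "16 * card B <= 7 * length T^m" and dist: "distinct T"
 shows "2 * card {w. length w = N & sample m A T w : B} <= 2^N"
proof -
 let ?L = "length T" and ?c = "2^A div length T+1"
 have L: "?L > 0" using T by simp
 define t where "t x i = (SOME k. k < ?L & T ! k = x i)" for x :: "nat => 'a" and i
 have t: "t x i < ?L" "T ! t x i = x i" if "x : B" "i < m" for x i using someI_ex[of "%k. k < ?L & T ! k = x i"] B(2)[OF that] unfolding t_def by (auto simp: in_set_conv_nth)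
 have fin: "finite {w :: bool list. length w = N & P w}" for P by (rule finite_subset[OF _ finite_bitlists(1)[of N]]) auto
 have "{w. length w = N & sample m A T w : B} <= (UN x:B. {w. length w = N & (ALL i<m. bmod ?L (chunk A w i) = t x i)})"
 proof
  fix w assume w: "w : {w. length w = N & sample m A T w : B}"
  have "bmod ?L (chunk A w i) = t (sample m A T w) i" if i: "i < m" for i
  proof -
   show ?thesis using t(2)[of "sample m A T w" i] w i using t(1)[of "sample m A T w" i] w i bmod_less[OF L] nth_eq_iff_index_eq[OF dist] by (simp add: sample_def)
  qed
  thus "w : (UN x:B. {w. length w = N & (ALL i<m. bmod ?L (chunk A w i) = t x i)})" using w by blast
 qed
 hence "card {w. length w = N & sample m A T w : B} <= card (UN x:B. {w. length w = N & (ALL i<m. bmod ?L (chunk A w i) = t x i)})" by (intro card_mono finite_UN_I B fin)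
 also have "... <= (SUM x:B. card {w. length w = N & (ALL i<m. bmod ?L (chunk A w i) = t x i)})" by (rule card_UN_le[OF B(1)])
 also have "... <= (SUM x:B. ?c^m*2^(N-m * A))" by (intro sum_mono card_chunks[OF L N])
 also have "... = card B*(?c^m*2^(N-m * A))" by simp
 finally have "16 * card {w. length w = N & sample m A T w : B} <= (16 * card B)*(?c^m*2^(N-m * A))" by simp
 also have "... <= (7*?L^m)*(?c^m*2^(N-m * A))" using B(3) by (rule mult_le_mono1)
 also have "... = (7*(?L*?c)^m)*2^(N-m * A)" by (simp only: power_mult_distrib mult.assoc)
 also have "... <= (8*(2^A)^m)*2^(N-m * A)" by (rule mult_le_mono1[OF sampling_distortion[OF m L A]])
 also have "... = 8*2^(A * m+(N-m * A))" by (simp only: power_add power_mult mult.assoc)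
 also have "A * m+(N-m * A) = N" using N by (simp add: mult.commute)
 finally show ?thesis by linarith
qed

lemma pt_bits_mod:
 assumes w: "pt D f (%a. eL enc_bool (w a))" and A: "pt D f (%a. eN (A a))" and i: "pt D f (%a. eN (i a))"
  and L: "pt D f (%a. eN (L a))" and L0: "!!a. a : D ==> L a > 0" and len: "!!a. a : D ==> Suc (i a) * A a <= length (w a)"
 shows "pt D f (%a. eN (bmod (L a) (chunk (A a) (w a) (i a))))"
proof -
 define s where "s a k = bmod (L a) (map (%t. w a ! (i a * A a+t)) [0..<k])" for a k
 have "pt D f (%a. eN (s a (A a)))"
 proof (rule pt_fold[OF A])
  show "pt D f (%a. eN (s a 0))" by (simp add: s_def bmod_def pt_null)
  let ?e = "%p. Dot (f (fst p)) (Dot (eN (snd p)) (eN (s (fst p) (snd p))))"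
  let ?D = "Idx D A"
  have k: "pt ?D ?e (%p. eN (snd p))" by (rule pt_cg[OF pt_hd[OF pt_tl[OF pt_id]]]) simp
  have S: "pt ?D ?e (%p. eN (s (fst p) (snd p)))" by (rule pt_trans[OF pt_snd pt_snd])
  have F: "pt ?D ?e (%p. eN (A (fst p)))" "pt ?D ?e (%p. eN (i (fst p)))" "pt ?D ?e (%p. eN (L (fst p)))"
   "pt ?D ?e (%p. eL enc_bool (w (fst p)))" by (rule pt_ext, rule A i L w, force)+
  have "pt ?D ?e (%p. enc_bool (w (fst p) ! (i (fst p) * A (fst p) + snd p)))" by (rule pt_nth[OF F(4)]) (use len in \<open>fastforce intro: pt_plus pt_times F k\<close>)+
  hence b: "pt ?D ?e (%p. eN (of_bool (w (fst p) ! (i (fst p) * A (fst p) + snd p))))" by (rule pt_cg[OF pt_if[of _ _ _ "%_. eN 1" "%_. eN 0"]]) (rule pt_c, rule pt_c, simp)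
  have "pt ?D ?e (%p. eN ((2 * s (fst p) (snd p) + of_bool (w (fst p) ! (i (fst p) * A (fst p) + snd p))) mod L (fst p)))" by (intro pt_mod pt_plus pt_times S b F pt_c) (use L0 in auto)
  thus "pt ?D ?e (%p. eN (s (fst p) (Suc (snd p))))" by (rule pt_cg) (simp add: s_def bmod_snoc)
  have "pb (SIGMA a:D. {..A a}) (%p. f (fst p)) (%p. L (fst p))" by (rule pb_fst[OF pb_nat[OF L]]) auto
  thus "pb (SIGMA a:D. {..A a}) (%p. f (fst p)) (%p. size (eN (s (fst p) (snd p))))" by (rule pb_mono) (use L0 in \<open>auto simp: s_def intro!: less_imp_le bmod_less\<close>)
 qed
 thus ?thesis by (simp add: s_def chunk_def)
qed

lemma (in ela) pt_sample:
 assumes w: "pt D f (%a. eL enc_bool (w a))" and A: "pt D f (%a. eN (A a))"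
  and T: "pt D f (%a. eL enc (T a))" "!!a. a : D ==> T a ~= []"
  and m: "pt D f (%a. eN (m a))" and len: "!!a. a : D ==> m a * A a <= length (w a)"
 shows "pt D f (%a. encf (m a) (sample (m a) (A a) (T a) (w a)))"
proof -
 have "pt (Idx D m) (ext f) (%p. enc (T (fst p) ! bmod (length (T (fst p))) (chunk (A (fst p)) (w (fst p)) (snd p))))"
 proof (rule pt_nth[OF pt_Idx[OF T(1)]], rule pt_bits_mod[OF pt_Idx[OF w] pt_Idx[OF A] pt_snd pt_Idx[OF pt_len[OF T(1)]]])
  fix p assume p: "p : Idx D m"
  thus "length (T (fst p)) > 0" using T(2) by auto
  thus "bmod (length (T (fst p))) (chunk (A (fst p)) (w (fst p)) (snd p)) < length (T (fst p))" by (rule bmod_less)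
  have "Suc (snd p) * A (fst p) <= m (fst p) * A (fst p)" using p by (intro mult_le_mono1) auto
  also have "... <= length (w (fst p))" using len p by auto
  finally show "Suc (snd p) * A (fst p) <= length (w (fst p))" .
 qed
 hence "pt (Idx D m) (ext f) (%p. enc (sample (m (fst p)) (A (fst p)) (T (fst p)) (w (fst p)) (snd p)))" by (rule pt_cg) (auto simp: sample_def)
 from pt_map[OF m this] show ?thesis .
qed

subsection \<open>The algorithm after sampling\<close>

text \<open>All quantities of the algorithm are functions on a set \<open>D\<close> of situations
  encoded by \<open>f\<close>; later a situation is an input together with its coins.\<close>

locale alg_run = ela enc for enc :: "'k::field => sexp" +
 fixes D :: "'a set" and f :: "'a => sexp" and m n :: "'a => nat" and s :: "'a => 'k sconsts"
  and e1 u :: "'a => nat => 'k"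
 assumes cs: "a : D ==> cs_alg (m a) (s a) (e1 a)" and nn: "a : D ==> n a * n a = m a" and uA: "a : D ==> u a : spt (m a)"
  and pS: "pt D f (%a. enc_sconsts enc (m a, s a))" and pu: "pt D f (%a. encf (m a) (u a))"
begin

lemma fd: "a : D ==> fd_alg (m a) (s a) (e1 a)" using cs by (simp add: cs_alg_def)

lemma mp: "a : D ==> m a > 0" using cs_alg.m_pos[OF cs] .

lemma np: "a : D ==> n a > 0" using mp[of a] nn[of a] by (cases "n a") auto

definition pw :: "'a => nat => nat => 'k" where "pw a i = fd_alg.mpow (m a) (s a) (e1 a) (u a) i"

definition mulS :: "'a => (nat => 'k) => (nat => 'k) => nat => 'k" where "mulS a = fd_alg.mul (m a) (s a)"

definition TS :: "'a => (nat => 'k) => nat => nat => nat => 'k" where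
 "TS a z i j = mulS a (mulS a (pw a i) z) (pw a j)"

text \<open>The square root by counting: \<open>min k n\<close> grows with \<open>k\<close> as long
  as the square of the next number stays within \<open>m\<close>.\<close>

lemma pt_n: "pt D f (%a. eN (n a))"
proof -
 have m: "pt D f (%a. eN (m a))" by (rule pt_m[OF pS])
 have "pt D f (%a. eN (min (m a) (n a)))"
 proof (rule pt_fold[where s = "%a k. eN (min k (n a))", OF m])
  show "pt D f (%a. eN (min 0 (n a)))" by (simp add: pt_null)
  let ?e = "%p. Dot (f (fst p)) (Dot (eN (snd p)) (eN (min (snd p) (n (fst p)))))"
  have k: "pt (Idx D m) ?e (%p. eN (snd p))" by (rule pt_cg[OF pt_hd[OF pt_tl[OF pt_id]]]) simp
  have S: "pt (Idx D m) ?e (%p. eN (min (snd p) (n (fst p))))" by (rule pt_trans[OF pt_snd pt_snd])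
  have M: "pt (Idx D m) ?e (%p. eN (m (fst p)))" by (rule pt_ext[OF m]) auto
  have "pt (Idx D m) ?e (%p. if Suc (snd p) * Suc (snd p) <= m (fst p) then eN (Suc (snd p)) else eN (min (snd p) (n (fst p))))" by (intro pt_if pt_le pt_times pt_Suc k M pt_sub[OF k] pt_sub[OF S]) auto
  thus "pt (Idx D m) ?e (%p. eN (min (Suc (snd p)) (n (fst p))))"
  proof (rule pt_cg)
   fix p assume "p : Idx D m"
   hence "Suc (snd p) * Suc (snd p) <= m (fst p) \<longleftrightarrow> Suc (snd p) <= n (fst p)" using nn using power_mono_iff[of "Suc (snd p)" "n (fst p)" 2] by (auto simp: power2_eq_square)
   thus "(if Suc (snd p) * Suc (snd p) <= m (fst p) then eN (Suc (snd p)) else eN (min (snd p) (n (fst p)))) =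
    eN (min (Suc (snd p)) (n (fst p)))" by (auto simp: min_def intro!: arg_cong[of _ _ eN])
  qed
  show "pb (SIGMA a:D. {..m a}) (%p. f (fst p)) (%p. size (eN (min (snd p) (n (fst p)))))" by (rule pb_mono[OF pb_fst[OF pb_nat[OF m]]]) auto
 qed
 moreover have "min (m a) (n a) = n a" if "a : D" for a using nn[OF that] np[OF that] by (metis min.absorb2 le_square)
 ultimately show ?thesis by (auto intro: pt_cg)
qed

lemma pt_e1: "pt D f (%a. encf (m a) (e1 a))"
proof (rule pt_unique[where nr = "%a. m a * m a" and nc = m and G = "%a k i. s a i (k div m a) (k mod m a)" and b = "%a k. if k div m a = k mod m a then 1 else 0"])
 have m: "pt D f (%a. eN (m a))" by (rule pt_m[OF pS])
 show "pt D f (%a. eN (m a * m a))" "pt D f (%a. eN (m a))" by (intro pt_times m)+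
 let ?N = "%a. m a * m a"
 have k: "pt (Idx (Idx D ?N) (%p. m (fst p))) (ext (ext f)) (%p. eN (snd (fst p)))" by (rule pt_Idx[OF pt_snd])
 show "pt (Idx (Idx D ?N) (%p. m (fst p))) (ext (ext f)) (%p. enc (s (fst (fst p)) (snd p) (snd (fst p) div m (fst (fst p))) (snd (fst p) mod m (fst (fst p)))))" by (rule pt_s[OF pt_Idx[OF pt_Idx[OF pS]] pt_snd pt_Least_div[OF k pt_Idx[OF pt_Idx[OF m]]] pt_mod[OF k pt_Idx[OF pt_Idx[OF m]]]])
   (use mp in \<open>auto simp: less_mult_imp_div_less\<close>)
 show "pt (Idx D ?N) (ext f) (%p. enc (if snd p div m (fst p) = snd p mod m (fst p) then 1 else 0))" by (intro pt_if_field pt_eq pt_c pt_Least_div pt_mod pt_snd pt_Idx[OF m]) (use mp in auto)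
 fix a assume a: "a : D"
 interpret cs_alg "m a" "s a" "e1 a" by (rule cs[OF a])
 show "solves (m a * m a) (m a) (%k i. s a i (k div m a) (k mod m a)) (%k. if k div m a = k mod m a then 1 else 0) (e1 a)" unfolding solves_def all_flat[OF m_pos] by (simp add: flat sc_unit_l mult.commute)
 fix y j assume "solves (m a * m a) (m a) (%k i. s a i (k div m a) (k mod m a)) (%k. if k div m a = k mod m a then 1 else 0) y" "j < m a"
 thus "y j = e1 a j" unfolding solves_def all_flat[OF m_pos] by (intro unit_unique) (simp_all add: flat)
qed

text \<open>The range up to \<open>3 * n\<close> comes from the traces: that of
  \<open>X^(b+i)\<close> with \<open>b, i < n\<close> reduces \<open>X^(b+i+l)\<close> with
  \<open>l < n\<close>.\<close>

definition tab :: "'a => sexp" where "tab a = encf (Suc (3 * n a) * m a) (%q. pw a (q div m a) (q mod m a))"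

lemma pt_tab: "pt D f tab"
 unfolding tab_def
proof (rule pt_unique[where nr = "%a. Suc (3 * n a) * m a" and nc = "%a. Suc (3 * n a) * m a"
  and G = "%a q k. (if q = k then 1 else 0)-(if q div m a = Suc (k div m a) then SUM i<m a. u a i * s a i (k mod m a) (q mod m a) else 0)"
  and b = "%a q. if q div m a = 0 then e1 a (q mod m a) else 0"])
 have m: "pt D f (%a. eN (m a))" by (rule pt_m[OF pS])
 let ?N = "%a. Suc (3 * n a) * m a"
 show N: "pt D f (%a. eN (?N a))" by (intro pt_times pt_Suc pt_c pt_n m)
 thus "pt D f (%a. eN (?N a))" .
 let ?D2 = "Idx (Idx D ?N) (%p. ?N (fst p))"
 have q: "pt ?D2 (ext (ext f)) (%p. eN (snd (fst p)))" by (rule pt_Idx[OF pt_snd])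
 have k: "pt ?D2 (ext (ext f)) (%p. eN (snd p))" by (rule pt_snd)
 have m2: "pt ?D2 (ext (ext f)) (%p. eN (m (fst (fst p))))" by (rule pt_Idx[OF pt_Idx[OF m]])
 have qk: "pt ?D2 (ext (ext f)) (%p. eN (snd (fst p) div m (fst (fst p))))" "pt ?D2 (ext (ext f)) (%p. eN (snd (fst p) mod m (fst (fst p))))"
  "pt ?D2 (ext (ext f)) (%p. eN (snd p div m (fst (fst p))))" "pt ?D2 (ext (ext f)) (%p. eN (snd p mod m (fst (fst p))))"
  by (intro pt_Least_div pt_mod q k m2; use mp in auto)+
 have S: "pt ?D2 (ext (ext f)) (%p. enc (SUM i<m (fst (fst p)). u (fst (fst p)) i * s (fst (fst p)) i (snd p mod m (fst (fst p))) (snd (fst p) mod m (fst (fst p)))))"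
 proof (rule pt_sum[OF m2], rule pt_mul)
  let ?D3 = "Idx ?D2 (%p. m (fst (fst p)))"
  show "pt ?D3 (ext (ext (ext f))) (%p. enc (u (fst (fst (fst p))) (snd p)))" by (rule pt_entry[OF pt_Idx[OF pt_Idx[OF pt_Idx[OF pu]]] pt_snd]) auto
  show "pt ?D3 (ext (ext (ext f))) (%p. enc (s (fst (fst (fst p))) (snd p) (snd (fst p) mod m (fst (fst (fst p)))) (snd (fst (fst p)) mod m (fst (fst (fst p))))))" by (rule pt_s[OF pt_Idx[OF pt_Idx[OF pt_Idx[OF pS]]] pt_snd pt_Idx[OF qk(4)] pt_Idx[OF qk(2)]]) (use mp in auto)
 qed
 show "pt ?D2 (ext (ext f)) (%p. enc ((if snd (fst p) = snd p then 1 else 0)-(if snd (fst p) div m (fst (fst p)) = Suc (snd p div m (fst (fst p)))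
   then SUM i<m (fst (fst p)). u (fst (fst p)) i * s (fst (fst p)) i (snd p mod m (fst (fst p))) (snd (fst p) mod m (fst (fst p))) else 0)))"
  by (intro pt_diff pt_if_field pt_eq pt_Suc q k qk pt_c pt_sub[OF S]) auto
 have q1: "pt (Idx D ?N) (ext f) (%p. eN (snd p mod m (fst p)))" by (intro pt_mod pt_snd pt_Idx[OF m]) (use mp in auto)
 have "pt (Idx D ?N) (ext f) (%p. enc (e1 (fst p) (snd p mod m (fst p))))" by (rule pt_entry[OF pt_Idx[OF pt_e1] q1]) (use mp in auto)
 thus "pt (Idx D ?N) (ext f) (%p. enc (if snd p div m (fst p) = 0 then e1 (fst p) (snd p mod m (fst p)) else 0))" by (intro pt_if_field pt_eq pt_Least_div pt_snd pt_Idx[OF m] pt_c) (use mp in \<open>auto intro: pt_sub\<close>)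
 fix a assume a: "a : D"
 interpret cs_alg "m a" "s a" "e1 a" by (rule cs[OF a])
 let ?G = "%q k. (if q = k then 1 else 0)-(if q div m a = Suc (k div m a) then SUM i<m a. u a i * s a i (k mod m a) (q mod m a) else 0)"
 let ?b = "%q. if q div m a = 0 then e1 a (q mod m a) else 0"
 have ifm: "(if c then x else 0) * y = (if c then x * y else 0)" for c and x y :: 'k by simp
 have row: "(SUM k<?N a. ?G (r * m a+l) k * y k) = y (r * m a+l)-(case r of 0 => 0 | Suc r' => SUM j<m a. (SUM i<m a. u a i * s a i j l) * y (r' * m a+j))"
  if r: "r < Suc (3 * n a)" and l: "l < m a" for r l y
 proof -
  have "(SUM k<?N a. ?G (r * m a+l) k * y k) =
   (SUM k<?N a. if r * m a+l = k then y k else 0)-(SUM k<?N a. if r = Suc (k div m a) then (SUM i<m a. u a i * s a i (k mod m a) l) * y k else 0)"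
   unfolding sum_subtractf[symmetric] flat(2,3)[OF l] left_diff_distrib ifm mult_1_left ..
  also have "(SUM k<?N a. if r * m a+l = k then y k else 0) = y (r * m a+l)" using flat(1)[OF l r] by simp
  also have "(SUM k<?N a. if r = Suc (k div m a) then (SUM i<m a. u a i * s a i (k mod m a) l) * y k else 0) =
   (SUM r'<Suc (3 * n a). if r = Suc r' then SUM j<m a. (SUM i<m a. u a i * s a i j l) * y (r' * m a+j) else 0)"
   unfolding sum_flat[OF m_pos] by (intro sum.cong refl) (simp add: flat)
  also have "... = (case r of 0 => 0 | Suc r' => SUM j<m a. (SUM i<m a. u a i * s a i j l) * y (r' * m a+j))" using r by (cases r) (simp_all del: sum.lessThan_Suc)
  finally show ?thesis .
 qed
 have sol: "solves (?N a) (?N a) ?G ?b y \<longleftrightarrow> (ALL r<Suc (3 * n a). ALL l<m a. y (r * m a+l) -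
   (case r of 0 => 0 | Suc r' => SUM j<m a. (SUM i<m a. u a i * s a i j l) * y (r' * m a+j)) = (if r = 0 then e1 a l else 0))" for y
  unfolding solves_def all_flat[OF m_pos] by (intro all_cong1 imp_cong refl, subst row, assumption, assumption, simp only: flat)
 show "solves (?N a) (?N a) ?G ?b (%q. pw a (q div m a) (q mod m a))" unfolding sol pw_def
 proof (intro allI impI)
  fix r l assume "r < Suc (3 * n a)" and l: "l < m a"
  show "mpow (e1 a) (u a) ((r * m a+l) div m a) ((r * m a+l) mod m a)-(case r of 0 => 0 | Suc r' => SUM j<m a. (SUM i<m a. u a i * s a i j l) *
    mpow (e1 a) (u a) ((r' * m a+j) div m a) ((r' * m a+j) mod m a)) = (if r = 0 then e1 a l else 0)"
   using power_system[OF l, of "u a"] l by (cases r) (simp_all add: flat del: mult_Suc mpow.simps(2))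
 qed
 fix y q assume y: "solves (?N a) (?N a) ?G ?b y" and q: "q < ?N a"
 note y' = y[unfolded sol, rule_format]
 have "y (q div m a * m a+q mod m a) = mpow (e1 a) (u a) (q div m a) (q mod m a)"
 proof (rule power_system_unique[where N = "Suc (3 * n a)"])
  show "y (0 * m a+l) = e1 a l" if "l < m a" for l using y'[of 0 l] that by simp
  show "y (Suc r * m a+l) = (SUM j<m a. (SUM i<m a. u a i * s a i j l) * y (r * m a+j))" if "Suc r < Suc (3 * n a)" "l < m a" for r l using y'[of "Suc r" l] that by simp
 qed (use q m_pos in \<open>auto simp: less_mult_imp_div_less simp del: mult_Suc\<close>)
 thus "y q = pw a (q div m a) (q mod m a)" by (simp add: pw_def)
qed

text \<open>What every later computation needs, packed into one tree so that it stays available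
  inside nested index families.\<close>

definition base :: "'a => sexp" where
 "base a = Dot (enc_sconsts enc (m a, s a)) (Dot (eN (n a)) (Dot (encf (m a) (e1 a)) (tab a)))"

lemma pt_base: "pt D f base" unfolding base_def by (intro pt_Dot pS pt_n pt_e1 pt_tab)

definition bs :: "'b set => ('b => sexp) => ('b => 'a) => bool" where
 "bs E g sg \<longleftrightarrow> sg ` E <= D & pt E g (%b. base (sg b))"

lemma bs_D: "bs E g sg ==> b : E ==> sg b : D" by (auto simp: bs_def)

lemma bs_Idx: "bs E g sg ==> bs (Idx E N) (ext g) (%p. sg (fst p))"
 unfolding bs_def by (auto intro: pt_Idx)

lemma bs_self: "E <= D ==> bs E f (%a. a)" unfolding bs_def using pt_sub[OF pt_base] by auto

lemma bsp:
 assumes "bs E g sg"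
 shows "pt E g (%b. enc_sconsts enc (m (sg b), s (sg b)))" "pt E g (%b. eN (n (sg b)))" "pt E g (%b. encf (m (sg b)) (e1 (sg b)))"
  "pt E g (%b. tab (sg b))" "pt E g (%b. eN (m (sg b)))"
proof -
 have B: "pt E g (%b. base (sg b))" using assms by (simp add: bs_def)
 show S: "pt E g (%b. enc_sconsts enc (m (sg b), s (sg b)))" using pt_hd[OF B] by (simp add: base_def)
 show "pt E g (%b. eN (n (sg b)))" using pt_hd[OF pt_tl[OF B]] by (simp add: base_def)
 show "pt E g (%b. encf (m (sg b)) (e1 (sg b)))" using pt_hd[OF pt_tl[OF pt_tl[OF B]]] by (simp add: base_def)
 show "pt E g (%b. tab (sg b))" using pt_tl[OF pt_tl[OF pt_tl[OF B]]] by (simp add: base_def)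
 show "pt E g (%b. eN (m (sg b)))" by (rule pt_m[OF S])
qed

lemma pt_mulS:
 assumes B: "bs E g sg" and x: "pt E g (%b. encf (m (sg b)) (x b))" and y: "pt E g (%b. encf (m (sg b)) (y b))"
 shows "pt E g (%b. encf (m (sg b)) (mulS (sg b) (x b) (y b)))"
 by (rule pt_cg[OF pt_mulA[OF bsp(1)[OF B] x y]])
  (auto simp: mulA_def mulS_def fd_alg.mul_def[OF fd[OF bs_D[OF B]]] intro!: enc_list_cong)

lemma pt_pw:
 assumes B: "bs E g sg" and i: "pt E g (%b. eN (i b))" and l: "pt E g (%b. eN (l b))"
  and lt: "!!b. b : E ==> i b <= 3 * n (sg b)" "!!b. b : E ==> l b < m (sg b)"
 shows "pt E g (%b. enc (pw (sg b) (i b) (l b)))"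
proof -
 have idx: "pt E g (%b. eN (i b * m (sg b)+l b))" by (intro pt_plus pt_times i l bsp(5)[OF B])
 have "pt E g (%b. enc (pw (sg b) ((i b * m (sg b)+l b) div m (sg b)) ((i b * m (sg b)+l b) mod m (sg b))))" by (rule pt_entry[OF bsp(4)[OF B, unfolded tab_def] idx]) (use lt in \<open>auto intro!: flat(1) simp: less_Suc_eq_le simp del: mult_Suc\<close>)
 thus ?thesis by (rule pt_cg) (use lt(2) in \<open>simp add: flat\<close>)
qed

lemma pt_pwv:
 assumes B: "bs E g sg" and i: "pt E g (%b. eN (i b))" and lt: "!!b. b : E ==> i b <= 3 * n (sg b)"
 shows "pt E g (%b. encf (m (sg b)) (pw (sg b) (i b)))"
 by (rule pt_map[OF bsp(5)[OF B]], rule pt_pw[OF bs_Idx[OF B] pt_Idx[OF i] pt_snd]) (use lt in auto)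

lemma pt_TSv:
 assumes B: "bs E g sg" and z: "pt E g (%b. encf (m (sg b)) (z b))" and i: "pt E g (%b. eN (i b))" and j: "pt E g (%b. eN (j b))"
  and lt: "!!b. b : E ==> i b < n (sg b)" "!!b. b : E ==> j b < n (sg b)"
 shows "pt E g (%b. encf (m (sg b)) (TS (sg b) (z b) (i b) (j b)))"
 unfolding TS_def by (intro pt_mulS[OF B] z pt_pwv[OF B] i j) (use lt in fastforce)+

lemma pt_bv:
 assumes B: "bs E g sg" and j: "pt E g (%b. eN (j b))"
 shows "pt E g (%b. encf (m (sg b)) (bv (j b)))"
proof (rule pt_map[OF bsp(5)[OF B]])
 show "pt (Idx E (%b. m (sg b))) (ext g) (%p. enc (bv (j (fst p)) (snd p)))"
 proof (rule pt_cg)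
  show "pt (Idx E (%b. m (sg b))) (ext g) (%p. enc (if snd p = j (fst p) then 1 else 0))" by (intro pt_if_field pt_eq pt_snd pt_Idx[OF j] pt_c)
 qed (auto simp: bv_apply)
qed

end

section \<open>The tests on a sampled element\<close>

context alg_run begin

definition psol :: "'a => (nat => 'k) option" where "psol a = lsol (m a) (n a) (%l i. pw a i l) (%l. pw a (n a) l)"

definition tsol :: "'a => (nat => 'k) option" where
 "tsol a = lsol (m a) (n a-1) (%l i. pw a i l) (%l. pw a (n a-1) l)"

text \<open>The derivative at \<open>u\<close> in coordinates. Integer factors are sums of ones in
  the field; for \<open>i = 0\<close> the sum is empty, so the truncated exponent
  \<open>i - 1\<close> does no harm.\<close>

definition dP :: "'a => nat => 'k" where
 "dP a l = (SUM j<n a. 1) * pw a (n a-1) l-(SUM i<n a. (SUM j<i. 1) * the (psol a) i * pw a (i-1) l)"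

definition ssol :: "'a => (nat => 'k) option" where
 "ssol a = lsol (m a) (m a) (%l j. SUM i<m a. dP a i * s a i j l) (%l. e1 a l)"

definition good :: "'a => bool" where "good a \<longleftrightarrow> psol a ~= None & tsol a = None & ssol a ~= None"

lemma fun_eq_A: "x : spt k ==> y : spt k ==> (!!l. l < k ==> x l = y l) ==> x = (y :: nat => 'k)"
 by (rule ext) (metis (mono_tags) mem_Collect_eq not_less spt_def)

lemma pwA: "a : D ==> pw a i : spt (m a)"
proof -
 assume a: "a : D"
 interpret cs_alg "m a" "s a" "e1 a" by (rule cs[OF a])
 show ?thesis unfolding pw_def by (cases i) auto
qed

lemma rel_solves:
 assumes a: "a : D"
 shows "solves (m a) k (%l i. pw a i l) (%l. pw a r l) y \<longleftrightarrow> pw a r = (SUM i<k. y i *c pw a i)"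
proof -
 have SA: "(SUM i<k. y i *c pw a i) : spt (m a)" by (intro spt_sum spt_closed pwA a)
 have e: "(SUM j<k. pw a j l * y j) = (SUM i<k. y i *c pw a i) l" for l by (simp add: fapp mult.commute)
 show ?thesis unfolding solves_def e
 proof
  assume "ALL l<m a. (SUM i<k. y i *c pw a i) l = pw a r l"
  thus "pw a r = (SUM i<k. y i *c pw a i)" by (intro fun_eq_A[OF pwA[OF a] SA]) simp
 qed simp
qed

lemma dP_eq:
 assumes a: "a : D"
 shows "fd_alg.peval (m a) (s a) (e1 a) (pderiv (mn 1 (n a)-(SUM i<n a. mn (the (psol a) i) i))) (u a) = dP a"
proof -
 interpret cs_alg "m a" "s a" "e1 a" by (rule cs[OF a])
 show ?thesis unfolding dP_def pw_def by (rule ext) (simp add: pderiv_diff pderiv_sum pderiv_monom peval_diff peval_sum peval_monom fapp mult.assoc)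
qed

lemma sep_solves:
 assumes a: "a : D" and y: "y : spt (m a)"
 shows "solves (m a) (m a) (%l j. SUM i<m a. dP a i * s a i j l) (%l. e1 a l) y \<longleftrightarrow> mulS a (dP a) y = e1 a"
proof -
 interpret cs_alg "m a" "s a" "e1 a" by (rule cs[OF a])
 have "(SUM j<m a. (SUM i<m a. dP a i * s a i j l) * y j) = mul (dP a) y l" if "l < m a" for l using that by (simp add: mul_def sum_distrib_right) (subst sum.swap, simp add: mult_ac)
 note row = this
 show ?thesis unfolding solves_def mulS_def
 proof
  assume "ALL l<m a. (SUM j<m a. (SUM i<m a. dP a i * s a i j l) * y j) = e1 a l"
  thus "mul (dP a) y = e1 a" by (intro fun_eq_A[OF mul_supp[of "dP a" y] e1_supp]) (simp add: row)
 qed (simp add: row)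
qed

lemma good_gen:
 assumes a: "a : D" and g: "good a"
 shows "gen_elt (m a) (s a) (e1 a) (n a) (u a) (the (psol a)) (the (ssol a))"
proof -
 interpret cs_alg "m a" "s a" "e1 a" by (rule cs[OF a])
 obtain p d where p: "psol a = Some p" and d: "ssol a = Some d" using g by (auto simp: good_def)
 have dA: "d : A" using lsol_Some(2)[OF d[unfolded ssol_def]] by (simp add: spt_def)
 show ?thesis
 proof unfold_locales
  show "mpow (e1 a) (u a) (n a) = (SUM i<n a. the (psol a) i *c mpow (e1 a) (u a) i)" using lsol_Some(1)[OF p[unfolded psol_def]] unfolding rel_solves[OF a] by (simp add: pw_def p)
  show "\<nexists>c. mpow (e1 a) (u a) (n a-1) = (SUM i<n a-1. c i *c mpow (e1 a) (u a) i)" using g lsol_None[of "m a" "n a-1" "%l i. pw a i l" "%l. pw a (n a-1) l"] unfolding good_def tsol_def rel_solves[OF a] by (auto simp: pw_def)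
  show "the (ssol a) : A" using dA d by simp
  show "mul (peval (e1 a) (pderiv (mn 1 (n a)-(SUM i<n a. mn (the (psol a) i) i))) (u a)) (the (ssol a)) = e1 a" using lsol_Some(1)[OF d[unfolded ssol_def]] unfolding dP_eq[OF a] sep_solves[OF a dA] by (simp add: mulS_def d)
 qed (use nn uA a in auto)
qed

text \<open>This confines failure to the bad grid points. It needs the third part of
  \<open>good_elt_tests\<close> for whichever solution \<open>psol\<close> happens to be.\<close>

lemma good_complete:
 assumes a: "a : D" and g: "cs_alg.good_elt (m a) (s a) (e1 a) (n a) (u a)"
 shows "good a"
proof -
 interpret cs_alg "m a" "s a" "e1 a" by (rule cs[OF a])
 note T = good_elt_tests[OF nn[OF a] uA[OF a] g]
 obtain p0 where "mpow (e1 a) (u a) (n a) = (SUM i<n a. p0 i *c mpow (e1 a) (u a) i)" using T(1) by blast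
 hence "solves (m a) (n a) (%l i. pw a i l) (%l. pw a (n a) l) p0" unfolding rel_solves[OF a] by (simp add: pw_def)
 then obtain p where p: "psol a = Some p" using lsol_None unfolding psol_def by blast
 have "mpow (e1 a) (u a) (n a) = (SUM i<n a. p i *c mpow (e1 a) (u a) i)" using lsol_Some(1)[OF p[unfolded psol_def]] unfolding rel_solves[OF a] by (simp add: pw_def)
 from T(3)[OF this] obtain d where d: "d : A" "mul (dP a) d = e1 a" using dP_eq[OF a] p by auto
 hence "ssol a ~= None" using sep_solves[OF a d(1)] lsol_None unfolding ssol_def mulS_def by blast
 moreover have "tsol a = None"
 proof (rule ccontr)
  assume "tsol a ~= None"
  then obtain c where "tsol a = Some c" by blast
  from lsol_Some(1)[OF this[unfolded tsol_def]] show False using T(2) unfolding rel_solves[OF a] by (auto simp: pw_def)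
 qed
 ultimately show ?thesis using p by (simp add: good_def)
qed

lemma pt_rel:
 assumes B: "bs E g sg" and k: "pt E g (%b. eN (k b))" and r: "pt E g (%b. eN (r b))"
  and lt: "!!b. b : E ==> k b <= 3 * n (sg b)" "!!b. b : E ==> r b <= 3 * n (sg b)"
 shows "pt E g (%b. enc_option (encf (k b)) (lsol (m (sg b)) (k b) (%l i. pw (sg b) i l) (%l. pw (sg b) (r b) l)))"
proof (rule pt_lsol[OF bsp(5)[OF B] k])
 show "pt (Idx (Idx E (%b. m (sg b))) (%p. k (fst p))) (ext (ext g)) (%p. enc (pw (sg (fst (fst p))) (snd p) (snd (fst p))))" by (rule pt_pw[OF bs_Idx[OF bs_Idx[OF B]] pt_snd pt_Idx[OF pt_snd]]) (use lt in fastforce)+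
 show "pt (Idx E (%b. m (sg b))) (ext g) (%p. enc (pw (sg (fst p)) (r (fst p)) (snd p)))" by (rule pt_pw[OF bs_Idx[OF B] pt_Idx[OF r] pt_snd]) (use lt in auto)
qed

lemma pt_psol: "pt D f (%a. enc_option (encf (n a)) (psol a))"
 unfolding psol_def by (rule pt_rel[OF bs_self pt_n pt_n]) auto

lemma pt_tsol: "pt D f (%a. enc_option (encf (n a-1)) (tsol a))"
 unfolding tsol_def by (rule pt_rel[OF bs_self]) (auto intro: pt_minus pt_n pt_c)

lemma pt_ssol: "pt {a:D. psol a ~= None} f (%a. enc_option (encf (m a)) (ssol a))"
proof -
 let ?D = "{a:D. psol a ~= None}"
 have B: "bs ?D f (%a. a)" by (rule bs_self) auto
 have p: "pt ?D f (%a. encf (n a) (the (psol a)))" by (rule pt_the[OF pt_sub[OF pt_psol]]) auto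
 note B1 = bs_Idx[OF B, of m]
 note B2 = bs_Idx[OF B1, of "%p. n (fst p)"]
 have d: "pt ?D f (%a. encf (m a) (dP a))" unfolding dP_def
 proof (rule pt_map[OF bsp(5)[OF B]], intro pt_diff pt_mul)
  have one: "pt E g (%b. enc (SUM j<k b. 1))" if "pt E g (%b. eN (k b))" for E :: "'x set" and g k by (rule pt_sum[OF that]) (rule pt_c)
  show "pt (Idx ?D m) (ext f) (%p. enc (SUM j<n (fst p). 1))" by (rule one[OF bsp(2)[OF B1]])
  show "pt (Idx ?D m) (ext f) (%p. enc (pw (fst p) (n (fst p)-1) (snd p)))" by (rule pt_pw[OF B1 pt_minus[OF bsp(2)[OF B1] pt_c[of _ _ "eN 1"]] pt_snd]) auto
  show "pt (Idx ?D m) (ext f) (%p. enc (SUM i<n (fst p). (SUM j<i. 1) * the (psol (fst p)) i * pw (fst p) (i-1) (snd p)))"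
  proof (rule pt_sum[OF bsp(2)[OF B1]], intro pt_mul)
   let ?E = "Idx (Idx ?D m) (%p. n (fst p))"
   show "pt ?E (ext (ext f)) (%p. enc (SUM j<snd p. 1))" by (rule one[OF pt_snd])
   show "pt ?E (ext (ext f)) (%p. enc (the (psol (fst (fst p))) (snd p)))" by (rule pt_entry[OF pt_Idx[OF pt_Idx[OF p]] pt_snd]) auto
   have "pt ?E (ext (ext f)) (%p. eN (snd p-1))" by (intro pt_minus pt_c pt_snd)
   thus "pt ?E (ext (ext f)) (%p. enc (pw (fst (fst p)) (snd p-1) (snd (fst p))))" by (rule pt_pw[OF B2 _ pt_Idx[OF pt_snd]]) auto
  qed
 qed
 show ?thesis unfolding ssol_def
 proof (rule pt_lsol[OF bsp(5)[OF B] bsp(5)[OF B]])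
  let ?E = "Idx (Idx ?D m) (%p. m (fst p))"
  note C = bs_Idx[OF B1, of "%p. m (fst p)"]
  show "pt ?E (ext (ext f)) (%p. enc (SUM i<m (fst (fst p)). dP (fst (fst p)) i * s (fst (fst p)) i (snd p) (snd (fst p))))"
  proof (rule pt_sum[OF bsp(5)[OF C]], rule pt_mul)
   let ?F = "Idx ?E (%p. m (fst (fst p)))"
   show "pt ?F (ext (ext (ext f))) (%p. enc (dP (fst (fst (fst p))) (snd p)))" by (rule pt_entry[OF pt_Idx[OF pt_Idx[OF pt_Idx[OF d]]] pt_snd]) auto
   show "pt ?F (ext (ext (ext f))) (%p. enc (s (fst (fst (fst p))) (snd p) (snd (fst p)) (snd (fst (fst p)))))" by (rule pt_s[OF bsp(1)[OF bs_Idx[OF C]] pt_snd pt_Idx[OF pt_snd] pt_Idx[OF pt_Idx[OF pt_snd]]]) auto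
  qed
  show "pt (Idx ?D m) (ext f) (%p. enc (e1 (fst p) (snd p)))" by (rule pt_entry[OF bsp(3)[OF B1] pt_snd]) auto
 qed
qed

lemma pt_good: "pt D f (%a. enc_bool (good a))"
proof -
 have p: "pt D f (%a. enc_bool (psol a ~= None))" using pt_nonnull[OF pt_psol] by simp
 have t: "pt D f (%a. enc_bool (~tsol a ~= None))" using pt_not[OF pt_nonnull[OF pt_tsol]] by simp
 have q: "pt {a:D. psol a ~= None} f (%a. enc_bool (ssol a ~= None))" using pt_nonnull[OF pt_ssol] by simp
 have "pt D f (%a. enc_bool (psol a ~= None & ~tsol a ~= None & ssol a ~= None))" by (intro pt_conj p pt_sub[OF t] pt_sub[OF q]) auto
 thus ?thesis by (simp add: good_def)
qed

abbreviation DG where "DG \<equiv> {a : D. good a}"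

lemma good_split: "a : DG ==> EX mu. gen_elt_split (m a) (s a) (e1 a) (n a) (u a) (the (psol a)) (the (ssol a)) mu"
proof -
 assume a: "a : DG"
 then interpret gen_elt "m a" "s a" "e1 a" "n a" "u a" "the (psol a)" "the (ssol a)" using good_gen by auto
 from exists_roots obtain mu where "split_poly (map_poly to_ac P) (n a) mu" "reg_elt (m a) (base_change_sc (s a)) (acv (e1 a)) (n a) mu (acv (u a))" by blast
 hence "gen_elt_split (m a) (s a) (e1 a) (n a) (u a) (the (psol a)) (the (ssol a)) mu" by (intro gen_elt_split.intro gen_elt_axioms gen_elt_split_axioms.intro)
 thus ?thesis by blast
qed

definition PP :: "'a => 'k poly" where
 "PP a = mn 1 (n a)-(SUM i<n a. mn (the (psol a) i) i)"

definition rsol :: "'a => nat => (nat => 'k) option" where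
 "rsol a r = lsol (m a) (n a) (%l i. pw a i l) (%l. pw a r l)"

definition tr :: "'a => nat => 'k" where "tr a j = (SUM l<n a. the (rsol a (j+l)) l)"

lemma rsol_good:
 assumes a: "a : DG"
 shows "rsol a r ~= None" "i < n a ==> the (rsol a r) i = coeff (mn 1 r mod PP a) i"
proof -
 have aD: "a : D" using a by simp
 interpret gen_elt "m a" "s a" "e1 a" "n a" "u a" "the (psol a)" "the (ssol a)" using good_gen a by auto
 have P: "PP a = P" by (simp add: PP_def P_def)
 have "solves (m a) (n a) (%l i. pw a i l) (%l. pw a r l) (%l. coeff (mn 1 r mod P) l)" unfolding rel_solves[OF aD] using red_rel[of r] by (simp add: pw_def)
 thus n: "rsol a r ~= None" using lsol_None unfolding rsol_def by blast
 then obtain y where y: "rsol a r = Some y" by blast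
 assume "i < n a"
 hence "y i = coeff (mn 1 r mod P) i" using lsol_Some(1)[OF y[unfolded rsol_def]] unfolding solves_def pw_def by (intro red_unique) auto
 thus "the (rsol a r) i = coeff (mn 1 r mod PP a) i" using y P by simp
qed

lemma tr_good: "a : DG ==> tr a j = trace_field (PP a) (mn 1 j)"
proof -
 assume a: "a : DG"
 then interpret gen_elt "m a" "s a" "e1 a" "n a" "u a" "the (psol a)" "the (ssol a)" using good_gen by auto
 have P: "PP a = P" by (simp add: PP_def P_def)
 show ?thesis unfolding tr_def P trace_red using rsol_good[OF a] P by (intro sum.cong refl) simp
qed

lemma pt_tr:
 assumes B: "bs E g sg" and G: "sg ` E <= DG" and j: "pt E g (%b. eN (j b))" and lt: "!!b. b : E ==> j b < 2 * n (sg b)"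
 shows "pt E g (%b. enc (tr (sg b) (j b)))"
 unfolding tr_def
proof (rule pt_sum[OF bsp(2)[OF B]])
 let ?E = "Idx E (%b. n (sg b))"
 note B1 = bs_Idx[OF B, of "%b. n (sg b)"]
 have jl: "pt ?E (ext g) (%p. eN (j (fst p) + snd p))" by (intro pt_plus pt_Idx[OF j] pt_snd)
 have "pt ?E (ext g) (%p. enc_option (encf (n (sg (fst p)))) (rsol (sg (fst p)) (j (fst p) + snd p)))" unfolding rsol_def
 proof (rule pt_rel[OF B1 bsp(2)[OF B1] jl])
  fix p assume "p : ?E"
  hence "fst p : E" "snd p < n (sg (fst p))" by auto
  thus "n (sg (fst p)) <= 3 * n (sg (fst p))" "j (fst p) + snd p <= 3 * n (sg (fst p))" using lt[of "fst p"] by auto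
 qed
 hence "pt ?E (ext g) (%p. encf (n (sg (fst p))) (the (rsol (sg (fst p)) (j (fst p) + snd p))))" by (rule pt_the, intro rsol_good(1) subsetD[OF G] imageI) auto
 thus "pt ?E (ext g) (%p. enc (the (rsol (sg (fst p)) (j (fst p) + snd p)) (snd p)))" by (rule pt_entry[OF _ pt_snd]) auto
qed

end

section \<open>The generator, the cocycle and the output\<close>

context alg_run begin

text \<open>\<open>FG\<close>, \<open>fsol\<close>, \<open>vv\<close> and \<open>csol\<close>
  restate the earlier systems for all situations at once, without reference to the roots
  \<open>mu\<close>; \<open>good_facts\<close> identifies the two versions.\<close>

definition FG :: "'a => nat => nat => nat => 'k" where
 "FG a i k q = (if q div m a = i then TS a (bv (k div m a)) (q mod m a div n a) (q mod m a mod n a) (k mod m a)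
   else if k div m a = i then TS a (bv (q div m a)) (q mod m a div n a) (q mod m a mod n a) (k mod m a) else 0)"

definition fsol :: "'a => nat => (nat => 'k) option" where
 "fsol a i = lsol (Suc i * m a) (Suc i * m a) (%k q. FG a i k q) (%k. if k div m a = i & k mod m a = i then 1 else 0)"

definition vv :: "'a => nat => 'k" where
 "vv a l = (SUM i<m a. SUM q<m a. the (fsol a i) (i * m a+q) * TS a (bv i) (q div n a) (q mod n a) l)"

definition csol :: "'a => (nat => 'k) option" where
 "csol a = lsol (n a * m a) (n a * n a * n a)
   (%k q. tr a (q div n a mod n a+k div m a) * TS a (vv a) (q div n a div n a) (q mod n a) (k mod m a))
   (%k. mulS a (mulS a (vv a) (pw a (k div m a))) (vv a) (k mod m a))"

definition out :: "'a => 'k vec \<times> 'k poly \<times> 'k tensor \<times> (nat list => 'k vec)" where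
 "out a = (vec (m a) (u a), PP a,
   (%al. if al : set (expos (PP a) 3) then the (csol a) ((al ! 0 * n a+al ! 1) * n a+al ! 2) else 0),
   (%al. vec (m a) (TS a (vv a) (al ! 0) (al ! 1))))"

definition correct :: "'a => 'k vec \<times> 'k poly \<times> 'k tensor \<times> (nat list => 'k vec) => bool" where
 "correct a = (%(u, P, c, E). u : carrier (sc_alg (m a) (s a)) &
    max_comm_subalg (m a) (s a) (gen_subalg (m a) (s a) u) & etale_subalg (m a) (s a) (gen_subalg (m a) (s a) u) &
    is_min_poly (m a) (s a) u P & c : amitsur_cocycles P 2 &
    (ALL al:set (expos P 2). E al : carrier_vec (m a)) &
    lin_map (m a) P E : ring_iso (cocycle_alg P c) (sc_alg (m a) (s a)))"

lemma good_facts: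
 assumes a: "a : DG"
 shows "i < m a ==> fsol a i ~= None" "csol a ~= None" "correct a (out a)" "degree (PP a) = n a"
  "coeffs (PP a) = map (%i. if i < n a then-the (psol a) i else 1) [0..<Suc (n a)]"
proof -
 obtain mu where "gen_elt_split (m a) (s a) (e1 a) (n a) (u a) (the (psol a)) (the (ssol a)) mu" using good_split[OF a] by blast
 then interpret G: gen_elt_split "m a" "s a" "e1 a" "n a" "u a" "the (psol a)" "the (ssol a)" mu .
 have P: "PP a = G.P" by (simp add: PP_def G.P_def)
 show "degree (PP a) = n a" "coeffs (PP a) = map (%i. if i < n a then-the (psol a) i else 1) [0..<Suc (n a)]" using G.degree_P G.coeffs_P P by auto
 have T: "TS a = G.T" by (intro ext) (simp add: TS_def mulS_def pw_def G.T_def)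
 have FG: "FG a i = G.fbG i" for i by (intro ext) (simp add: FG_def G.fbG_def T)
 have fb: "(%k. if k div m a = i & k mod m a = i then 1 else 0) = G.fbb i" for i by (intro ext) (simp add: G.fbb_def)
 have fsol: "fsol a i = lsol (Suc i * m a) (Suc i * m a) (G.fbG i) (G.fbb i)" for i unfolding fsol_def fb FG ..
 have f: "fsol a i ~= None" if "i < m a" for i using G.fb_exists[OF that] lsol_None unfolding fsol solves_def by blast
 thus "i < m a ==> fsol a i ~= None" .
 have y: "ALL i<m a. ALL k<Suc i * m a. (SUM q<Suc i * m a. G.fbG i k q * the (fsol a i) q) = G.fbb i k"
 proof (rule allI, rule impI)
  fix i assume i: "i < m a"
  obtain z where z: "fsol a i = Some z" using f[OF i] by blast
  from lsol_Some(1)[OF this[unfolded fsol]]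
  show "ALL k<Suc i * m a. (SUM q<Suc i * m a. G.fbG i k q * the (fsol a i) q) = G.fbb i k" unfolding solves_def z by simp
 qed
 have vv: "vv a = (SUM i<m a. SUM j<n a. SUM k<n a. the (fsol a i) (i * m a+(j * n a+k)) *c G.T (bv i) j k)"
 proof
  fix l
  have "vv a l = (SUM i<m a. SUM j<n a. SUM k<n a. the (fsol a i) (i * m a+(j * n a+k)) * G.T (bv i) j k l)" unfolding vv_def T by (rule sum.cong[OF refl], subst G.sum_nn, intro sum.cong refl) (simp add: flat)
  thus "vv a l = (SUM i<m a. SUM j<n a. SUM k<n a. the (fsol a i) (i * m a+(j * n a+k)) *c G.T (bv i) j k) l" by (simp add: fapp)
 qed
 have vA: "vv a : spt (m a)" unfolding vv by (intro spt_sum spt_closed G.T_A)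
 have tr: "tr a j = trace_field G.P (mn 1 j)" for j using tr_good[OF a] P by simp
 note OC = G.output_correct[OF y vv]
 have cs: "solves (n a * m a) (n a * n a * n a)
   (%k q. tr a (q div n a mod n a+k div m a) * TS a (vv a) (q div n a div n a) (q mod n a) (k mod m a))
   (%k. mulS a (mulS a (vv a) (pw a (k div m a))) (vv a) (k mod m a)) z \<longleftrightarrow>
   (ALL i<n a. (SUM j<n a. SUM b<n a. SUM d<n a. (z ((j * n a+b) * n a+d) * trace_field G.P (mn 1 (b+i))) *c G.T (vv a) j d) =
    G.mul (G.mul (vv a) (G.mpow (e1 a) (u a) i)) (vv a))" for z
  unfolding solves_def T mulS_def pw_def tr by (rule G.c_solves[OF vA])
 show c: "csol a ~= None" using OC(1) lsol_None unfolding csol_def cs[symmetric] by blast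
 then obtain z where z: "csol a = Some z" by blast
 from OC(2)[OF lsol_Some(1)[OF z[unfolded csol_def], unfolded cs]]
 show "correct a (out a)" unfolding correct_def out_def split P T z option.sel by simp
qed

lemma pt_fsol:
 assumes B: "bs E g sg" and G: "sg ` E <= DG" and i: "pt E g (%b. eN (i b))" and lt: "!!b. b : E ==> i b < m (sg b)"
 shows "pt E g (%b. encf (Suc (i b) * m (sg b)) (the (fsol (sg b) (i b))))"
proof -
 let ?N = "%b. Suc (i b) * m (sg b)"
 have N: "pt E g (%b. eN (?N b))" by (intro pt_times pt_Suc i bsp(5)[OF B])
 note B1 = bs_Idx[OF B, of ?N]
 note B2 = bs_Idx[OF B1, of "%p. ?N (fst p)"]
 let ?E = "Idx (Idx E ?N) (%p. ?N (fst p))"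
 have mE: "m (sg (fst (fst p))) > 0" "n (sg (fst (fst p))) > 0" "n (sg (fst (fst p))) * n (sg (fst (fst p))) = m (sg (fst (fst p)))"
   if "p : ?E" for p
  using mp[OF bs_D[OF B2 that]] np[OF bs_D[OF B2 that]] nn[OF bs_D[OF B2 that]] by auto
 have k: "pt ?E (ext (ext g)) (%p. eN (snd (fst p)))" by (rule pt_Idx[OF pt_snd])
 have q: "pt ?E (ext (ext g)) (%p. eN (snd p))" by (rule pt_snd)
 have i2: "pt ?E (ext (ext g)) (%p. eN (i (fst (fst p))))" by (rule pt_Idx[OF pt_Idx[OF i]])
 note m2 = bsp(5)[OF B2] and n2 = bsp(2)[OF B2]
 have kd: "pt ?E (ext (ext g)) (%p. eN (snd (fst p) div m (sg (fst (fst p)))))" by (rule pt_Least_div[OF k m2 mE(1)])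
 have km: "pt ?E (ext (ext g)) (%p. eN (snd (fst p) mod m (sg (fst (fst p)))))" by (rule pt_mod[OF k m2 mE(1)])
 have qd: "pt ?E (ext (ext g)) (%p. eN (snd p div m (sg (fst (fst p)))))" by (rule pt_Least_div[OF q m2 mE(1)])
 have qm: "pt ?E (ext (ext g)) (%p. eN (snd p mod m (sg (fst (fst p)))))" by (rule pt_mod[OF q m2 mE(1)])
 have qmd: "pt ?E (ext (ext g)) (%p. eN (snd p mod m (sg (fst (fst p))) div n (sg (fst (fst p)))))" by (rule pt_Least_div[OF qm n2 mE(2)])
 have qmm: "pt ?E (ext (ext g)) (%p. eN (snd p mod m (sg (fst (fst p))) mod n (sg (fst (fst p)))))" by (rule pt_mod[OF qm n2 mE(2)])
 have lt1: "snd p mod m (sg (fst (fst p))) div n (sg (fst (fst p))) < n (sg (fst (fst p)))" if "p : ?E" for p using mE[OF that] by (intro less_mult_imp_div_less) simp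
 have lt2: "snd p mod m (sg (fst (fst p))) mod n (sg (fst (fst p))) < n (sg (fst (fst p)))" if "p : ?E" for p using mE[OF that] by simp
 have lt3: "snd (fst p) mod m (sg (fst (fst p))) < m (sg (fst (fst p)))" if "p : ?E" for p using mE[OF that] by simp
 have T1: "pt ?E (ext (ext g)) (%p. enc (TS (sg (fst (fst p))) (bv (snd (fst p) div m (sg (fst (fst p))))) (snd p mod m (sg (fst (fst p))) div n (sg (fst (fst p))))
   (snd p mod m (sg (fst (fst p))) mod n (sg (fst (fst p)))) (snd (fst p) mod m (sg (fst (fst p))))))"
  by (rule pt_entry[OF pt_TSv[OF B2 pt_bv[OF B2 kd] qmd qmm lt1 lt2] km lt3])
 have T2: "pt ?E (ext (ext g)) (%p. enc (TS (sg (fst (fst p))) (bv (snd p div m (sg (fst (fst p))))) (snd p mod m (sg (fst (fst p))) div n (sg (fst (fst p))))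
   (snd p mod m (sg (fst (fst p))) mod n (sg (fst (fst p)))) (snd (fst p) mod m (sg (fst (fst p))))))"
  by (rule pt_entry[OF pt_TSv[OF B2 pt_bv[OF B2 qd] qmd qmm lt1 lt2] km lt3])
 have FGp: "pt ?E (ext (ext g)) (%p. enc (FG (sg (fst (fst p))) (i (fst (fst p))) (snd (fst p)) (snd p)))" unfolding FG_def by (intro pt_if_field pt_eq qd i2 pt_c pt_sub[OF T1] pt_sub[OF T2] pt_sub[OF kd] pt_sub[OF i2]) auto
 have "pt E g (%b. enc_option (encf (?N b)) (fsol (sg b) (i b)))" unfolding fsol_def
 proof (rule pt_lsol[OF N N FGp])
  have mE1: "m (sg (fst p)) > 0" if "p : Idx E ?N" for p using mp[OF bs_D[OF B1 that]] .
  show "pt (Idx E ?N) (ext g) (%p. enc (if snd p div m (sg (fst p)) = i (fst p) & snd p mod m (sg (fst p)) = i (fst p) then 1 else 0))" by (intro pt_if_field pt_conj pt_eq pt_Least_div pt_mod pt_snd bsp(5)[OF B1] pt_Idx[OF i] pt_c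
     pt_sub[OF pt_mod[OF pt_snd bsp(5)[OF B1] mE1]] pt_sub[OF pt_Idx[OF i]] mE1) auto
 qed
 thus ?thesis by (rule pt_the) (use good_facts(1) G lt in blast)
qed

lemma pt_vv: "pt DG f (%a. encf (m a) (vv a))"
 unfolding vv_def
proof -
 have B: "bs DG f (%a. a)" by (rule bs_self) auto
 note B1 = bs_Idx[OF B, of m]
 note B2 = bs_Idx[OF B1, of "%p. m (fst p)"]
 note B3 = bs_Idx[OF B2, of "%p. m (fst (fst p))"]
 let ?E2 = "Idx (Idx DG m) (%p. m (fst p))"
 let ?E3 = "Idx ?E2 (%p. m (fst (fst p)))"
 have F2: "pt ?E2 (ext (ext f)) (%p. encf (Suc (snd p) * m (fst (fst p))) (the (fsol (fst (fst p)) (snd p))))" by (rule pt_fsol[OF B2 _ pt_snd]) auto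
 have nE: "n (fst (fst (fst p))) > 0" "n (fst (fst (fst p))) * n (fst (fst (fst p))) = m (fst (fst (fst p)))" if "p : ?E3" for p using np[OF bs_D[OF B3 that]] nn[OF bs_D[OF B3 that]] by auto
 have q: "pt ?E3 (ext (ext (ext f))) (%p. eN (snd p))" by (rule pt_snd)
 have i: "pt ?E3 (ext (ext (ext f))) (%p. eN (snd (fst p)))" by (rule pt_Idx[OF pt_snd])
 have l: "pt ?E3 (ext (ext (ext f))) (%p. eN (snd (fst (fst p))))" by (rule pt_Idx[OF pt_Idx[OF pt_snd]])
 have "pt ?E3 (ext (ext (ext f))) (%p. eN (snd (fst p) * m (fst (fst (fst p))) + snd p))" by (intro pt_plus pt_times i q bsp(5)[OF B3])
 hence A: "pt ?E3 (ext (ext (ext f))) (%p. enc (the (fsol (fst (fst (fst p))) (snd (fst p))) (snd (fst p) * m (fst (fst (fst p))) + snd p)))" by (rule pt_entry[OF pt_Idx[OF F2]]) auto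
 have lt1: "snd p div n (fst (fst (fst p))) < n (fst (fst (fst p)))" if "p : ?E3" for p using nE[OF that] that by (intro less_mult_imp_div_less) auto
 have lt2: "snd p mod n (fst (fst (fst p))) < n (fst (fst (fst p)))" if "p : ?E3" for p using nE[OF that] by simp
 have C: "pt ?E3 (ext (ext (ext f))) (%p. enc (TS (fst (fst (fst p))) (bv (snd (fst p))) (snd p div n (fst (fst (fst p)))) (snd p mod n (fst (fst (fst p)))) (snd (fst (fst p)))))" by (rule pt_entry[OF pt_TSv[OF B3 pt_bv[OF B3 i] pt_Least_div[OF q bsp(2)[OF B3] nE(1)] pt_mod[OF q bsp(2)[OF B3] nE(1)] lt1 lt2] l]) auto
 show "pt DG f (%a. encf (m a) (%l. SUM i<m a. SUM q<m a. the (fsol a i) (i * m a+q) * TS a (bv i) (q div n a) (q mod n a) l))" by (rule pt_map[OF bsp(5)[OF B]], rule pt_sum[OF bsp(5)[OF B1]], rule pt_sum[OF bsp(5)[OF B2]], rule pt_mul[OF A C])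
qed

lemma pt_csol: "pt DG f (%a. encf (n a * n a * n a) (the (csol a)))"
proof -
 have B: "bs DG f (%a. a)" by (rule bs_self) auto
 let ?R = "%a. n a * m a" and ?C = "%a. n a * n a * n a"
 note B1 = bs_Idx[OF B, of ?R]
 note B2 = bs_Idx[OF B1, of "%p. ?C (fst p)"]
 let ?E1 = "Idx DG ?R" and ?E = "Idx (Idx DG ?R) (%p. ?C (fst p))"
 have R: "pt DG f (%a. eN (?R a))" and C: "pt DG f (%a. eN (?C a))" by (intro pt_times bsp(2)[OF B] bsp(5)[OF B])+
 have k: "pt ?E (ext (ext f)) (%p. eN (snd (fst p)))" by (rule pt_Idx[OF pt_snd])
 have q: "pt ?E (ext (ext f)) (%p. eN (snd p))" by (rule pt_snd)
 have pos: "m (fst (fst p)) > 0" "n (fst (fst p)) > 0" if "p : ?E" for p using mp[OF bs_D[OF B2 that]] np[OF bs_D[OF B2 that]] by auto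
 have pos1: "m (fst p) > 0" if "p : ?E1" for p using mp[OF bs_D[OF B1 that]] .
 note m2 = bsp(5)[OF B2] and n2 = bsp(2)[OF B2]
 note qn = pt_Least_div[OF q n2 pos(2)]
 have b1: "snd (fst p) div m (fst (fst p)) < n (fst (fst p))" "snd p div n (fst (fst p)) div n (fst (fst p)) < n (fst (fst p))" if "p : ?E" for p using that by (auto intro!: less_mult_imp_div_less)
 have t: "pt ?E (ext (ext f)) (%p. enc (tr (fst (fst p)) (snd p div n (fst (fst p)) mod n (fst (fst p)) + snd (fst p) div m (fst (fst p)))))"
 proof (rule pt_tr[OF B2])
  show "pt ?E (ext (ext f)) (%p. eN (snd p div n (fst (fst p)) mod n (fst (fst p)) + snd (fst p) div m (fst (fst p))))" by (rule pt_plus[OF pt_mod[OF qn n2 pos(2)] pt_Least_div[OF k m2 pos(1)]])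
  fix p assume p: "p : ?E"
  have "snd p div n (fst (fst p)) mod n (fst (fst p)) < n (fst (fst p))" using pos[OF p] by simp
  thus "snd p div n (fst (fst p)) mod n (fst (fst p)) + snd (fst p) div m (fst (fst p)) < 2 * n (fst (fst p))" using b1(1)[OF p] by linarith
 qed auto
 have lt2: "snd p mod n (fst (fst p)) < n (fst (fst p))" "snd (fst p) mod m (fst (fst p)) < m (fst (fst p))" if "p : ?E" for p using pos[OF that] by auto
 have S: "pt ?E (ext (ext f)) (%p. enc (TS (fst (fst p)) (vv (fst (fst p))) (snd p div n (fst (fst p)) div n (fst (fst p))) (snd p mod n (fst (fst p))) (snd (fst p) mod m (fst (fst p)))))" by (rule pt_entry[OF pt_TSv[OF B2 pt_Idx[OF pt_Idx[OF pt_vv]] pt_Least_div[OF qn n2 pos(2)] pt_mod[OF q n2 pos(2)] b1(2) lt2(1)] pt_mod[OF k m2 pos(1)] lt2(2)])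
 have lt3: "snd p div m (fst p) <= 3 * n (fst p)" "snd p mod m (fst p) < m (fst p)" if "p : ?E1" for p
 proof -
  have "snd p div m (fst p) < n (fst p)" using that by (auto intro!: less_mult_imp_div_less)
  thus "snd p div m (fst p) <= 3 * n (fst p)" by linarith
 qed (use pos1[OF that] in simp)
 note v1 = pt_Idx[OF pt_vv, of ?R]
 have b: "pt ?E1 (ext f) (%p. enc (mulS (fst p) (mulS (fst p) (vv (fst p)) (pw (fst p) (snd p div m (fst p)))) (vv (fst p)) (snd p mod m (fst p))))" by (rule pt_entry[OF pt_mulS[OF B1 pt_mulS[OF B1 v1 pt_pwv[OF B1 pt_Least_div[OF pt_snd bsp(5)[OF B1] pos1] lt3(1)]] v1]
    pt_mod[OF pt_snd bsp(5)[OF B1] pos1] lt3(2)])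
 have "pt DG f (%a. enc_option (encf (?C a)) (csol a))" unfolding csol_def by (rule pt_lsol[OF R C pt_mul[OF t S] b])
 thus ?thesis by (rule pt_the) (use good_facts(2) in auto)
qed

text \<open>In \<open>List.n_lists\<close> the first entry varies fastest, so the output is produced
  with the loop over the first entry innermost.\<close>

lemma n_lists_2: "List.n_lists 2 xs = concat (map (%y. map (%x. [x, y]) xs) xs)"
proof -
 show ?thesis unfolding numeral_2_eq_2 One_nat_def by (simp add: comp_def)
qed

lemma concat_map_concat: "concat (map h (concat L)) = concat (map (%l. concat (map h l)) L)"
 by (induct L) auto

lemma n_lists_3: "List.n_lists 3 xs = concat (map (%z. concat (map (%y. map (%x. [x, y, z]) xs) xs)) xs)"
by (simp add: numeral_3_eq_3 numeral_2_eq_2 n_lists_2 concat_map_concat comp_def)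

lemma pt_out: "pt DG f (%a. enc_output enc (out a))"
proof -
 have B: "bs DG f (%a. a)" by (rule bs_self) auto
 have sub: "DG <= D" by auto
 note n0 = bsp(2)[OF B]
 have e1: "pt DG f (%a. enc_vec enc (vec (m a) (u a)))" unfolding enc_vec_vec by (rule pt_sub[OF pu sub])
 have p: "pt DG f (%a. encf (n a) (the (psol a)))" by (rule pt_the[OF pt_sub[OF pt_psol sub]]) (auto simp: good_def)
 have "pt DG f (%a. eL (%i. enc (if i < n a then-the (psol a) i else 1)) [0..<Suc (n a)])"
 proof (rule pt_map[OF pt_Suc[OF n0]], intro pt_if_field pt_less pt_snd pt_Idx[OF n0] pt_uminus pt_c)
  show "pt {p : Idx DG (%a. Suc (n a)). snd p < n (fst p)} (ext f) (%p. enc (the (psol (fst p)) (snd p)))" by (rule pt_entry[OF pt_ext[OF p] pt_snd]) auto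
 qed
 hence e2: "pt DG f (%a. eL enc (coeffs (PP a)))" by (rule pt_cg) (simp only: good_facts(5) enc_list_map)
 have e4: "pt DG f (%a. eL (%al. enc_vec enc (vec (m a) (TS a (vv a) (al ! 0) (al ! 1)))) (concat (map (%y. map (%x. [x, y]) [0..<n a]) [0..<n a])))"
 proof (rule pt_concat[OF n0], unfold enc_list_map, rule pt_map[OF pt_Idx[OF n0]])
  let ?E = "Idx (Idx DG n) (%p. n (fst p))"
  note B2 = bs_Idx[OF bs_Idx[OF B, of n], of "%p. n (fst p)"]
  have "pt ?E (ext (ext f)) (%p. encf (m (fst (fst p))) (TS (fst (fst p)) (vv (fst (fst p))) (snd p) (snd (fst p))))" by (rule pt_TSv[OF B2 pt_Idx[OF pt_Idx[OF pt_vv]] pt_snd pt_Idx[OF pt_snd]]) auto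
  thus "pt ?E (ext (ext f)) (%p. enc_vec enc (vec (m (fst (fst p))) (TS (fst (fst p)) (vv (fst (fst p))) ([snd p, snd (fst p)] ! 0) ([snd p, snd (fst p)] ! 1))))" by (simp add: enc_vec_vec)
 qed
 let ?z = "%a al. the (csol a) ((al ! 0 * n a+al ! 1) * n a+al ! 2)"
 have e3: "pt DG f (%a. eL (%al. enc (?z a al)) (concat (map (%z. concat (map (%y. map (%x. [x, y, z]) [0..<n a]) [0..<n a])) [0..<n a])))"
 proof (rule pt_concat[OF n0], rule pt_concat[OF pt_Idx[OF n0]], unfold enc_list_map, rule pt_map[OF pt_Idx[OF pt_Idx[OF n0]]])
  let ?E = "Idx (Idx (Idx DG n) (%p. n (fst p))) (%p. n (fst (fst p)))"
  note n3 = pt_Idx[OF pt_Idx[OF pt_Idx[OF n0]], of n "%p. n (fst p)" "%p. n (fst (fst p))"]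
  have "pt ?E (ext (ext (ext f))) (%p. eN ((snd p * n (fst (fst (fst p))) + snd (fst p)) * n (fst (fst (fst p))) + snd (fst (fst p))))" by (intro pt_plus pt_times n3 pt_snd pt_Idx[OF pt_snd] pt_Idx[OF pt_Idx[OF pt_snd]])
  hence "pt ?E (ext (ext (ext f))) (%p. enc (the (csol (fst (fst (fst p)))) ((snd p * n (fst (fst (fst p))) + snd (fst p)) * n (fst (fst (fst p))) + snd (fst (fst p)))))" by (rule pt_entry[OF pt_Idx[OF pt_Idx[OF pt_Idx[OF pt_csol]]]]) (auto intro!: flat(1))
  thus "pt ?E (ext (ext (ext f))) (%p. enc (?z (fst (fst (fst p))) [snd p, snd (fst p), snd (fst (fst p))]))" by simp
 qed
 have "pt DG f (%a. Dot (enc_vec enc (vec (m a) (u a))) (Dot (eL enc (coeffs (PP a)))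
   (Dot (eL (%al. enc (?z a al)) (List.n_lists 3 [0..<n a])) (eL (%al. enc_vec enc (vec (m a) (TS a (vv a) (al ! 0) (al ! 1)))) (List.n_lists 2 [0..<n a])))))"
  unfolding n_lists_3 n_lists_2 by (intro pt_Dot e1 e2 e3 e4)
 thus ?thesis
 proof (rule pt_cg)
  fix a assume a: "a : DG"
  have x: "expos (PP a) N = List.n_lists N [0..<n a]" for N by (simp only: expos_def good_facts(4)[OF a])
  have "eL (%al. enc (?z a al)) (expos (PP a) 3) = eL (%al. enc (if al : set (expos (PP a) 3) then ?z a al else 0)) (expos (PP a) 3)" by (rule enc_list_cong) simp
  thus "Dot (enc_vec enc (vec (m a) (u a))) (Dot (eL enc (coeffs (PP a)))
   (Dot (eL (%al. enc (?z a al)) (List.n_lists 3 [0..<n a])) (eL (%al. enc_vec enc (vec (m a) (TS a (vv a) (al ! 0) (al ! 1)))) (List.n_lists 2 [0..<n a])))) =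
   enc_output enc (out a)" unfolding enc_output_def out_def split x by simp
 qed
qed

definition result :: "'a => ('k vec \<times> 'k poly \<times> 'k tensor \<times> (nat list => 'k vec)) option" where
 "result a = (if good a then Some (out a) else None)"

theorem pt_result: "pt D f (%a. enc_option (enc_output enc) (result a))"
proof -
 have "pt D f (%a. if good a then Dot (enc_output enc (out a)) Null else Null)" by (intro pt_if pt_good pt_Dot pt_out pt_null)
 thus ?thesis by (rule pt_cg) (simp add: result_def)
qed

theorem result_correct: "a : D ==> result a = Some y ==> correct a y"
 using good_facts(3) by (auto simp: result_def split: if_splits)

theorem result_complete: "a : D ==> result a = None ==> ~cs_alg.good_elt (m a) (s a) (e1 a) (n a) (u a)"
 using good_complete by (auto simp: result_def split: if_splits)

end

section \<open>The sampling grid and the assembly of the algorithm\<close>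

lemma exists_scalar_list: "EX \<Gamma> :: 'k::field list. ALL m>=4. infinite (UNIV :: 'k set) \<or> card (UNIV :: 'k set) > m --> card (set \<Gamma>) >= 5"
proof (cases "finite (UNIV :: 'k set)")
 case True
 then obtain \<Gamma> :: "'k list" where "set \<Gamma> = UNIV" using finite_list by blast
 thus ?thesis using True by (intro exI[of _ \<Gamma>]) auto
next
 case False
 then obtain S :: "'k set" where S: "card S = 5" "finite S" by (metis infinite_arbitrarily_large)
 then obtain \<Gamma> where "set \<Gamma> = S" using finite_list by blast
 thus ?thesis using S by (intro exI[of _ \<Gamma>]) auto
qed

text \<open>The scalars \<open>\<Gamma>\<close> depend on the field only and are part of the
  program. They guarantee five elements in a grid that closes up early, which structure constants 0
  and 1 in characteristic 2 would not.\<close>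

definition sc_list :: "'k list => nat => 'k sconsts => 'k list" where
 "sc_list \<Gamma> m s = concat (map (%i. concat (map (%j. map (%l. s i j l) [0..<m]) [0..<m])) [0..<m]) @ \<Gamma>"

lemma set_sc_list: "i < m ==> j < m ==> l < m ==> s i j l : set (sc_list \<Gamma> m s)" "set \<Gamma> <= set (sc_list \<Gamma> m s)"
 by (auto simp: sc_list_def) force

context ela begin

lemma pt_sc_list:
 assumes S: "pt D f (%a. enc_sconsts enc (m a, s a))"
 shows "pt D f (%a. eL enc (sc_list \<Gamma> (m a) (s a)))"
 unfolding sc_list_def
proof (rule pt_append[OF pt_concat[OF pt_m[OF S] pt_concat[OF pt_m[OF pt_Idx[OF S]]]] pt_c], unfold enc_list_map,
  rule pt_map[OF pt_m[OF pt_Idx[OF pt_Idx[OF S]]]])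
 show "pt (Idx (Idx (Idx D m) (%p. m (fst p))) (%p. m (fst (fst p)))) (ext (ext (ext f)))
   (%p. enc (s (fst (fst (fst p))) (snd (fst (fst p))) (snd (fst p)) (snd p)))"
  by (rule pt_s[OF pt_Idx[OF pt_Idx[OF pt_Idx[OF S]]] pt_Idx[OF pt_Idx[OF pt_snd]] pt_Idx[OF pt_snd] pt_snd]) auto
qed

end

definition seed_list :: "'k::field list => nat => 'k sconsts => 'k list" where
 "seed_list \<Gamma> m s = clo_list (5 * m * m) (sc_list \<Gamma> m s) (5 * m * m)"

text \<open>Either the list reaches \<open>5 * m * m\<close> elements and
  \<open>bad_grid_large\<close> applies, or it is closed, hence a finite ring containing the
  structure constants and \<open>\<Gamma>\<close>, and \<open>bad_grid_closed\<close>
  applies.\<close>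

lemma seed_list_props:
 fixes \<Gamma> :: "'k::field list"
 assumes cs: "cs_alg m s e1" and nn: "n * n = m" and big: "m >= 4 ==> card (set \<Gamma>) >= 5"
 shows "seed_list \<Gamma> m s ~= []" "distinct (seed_list \<Gamma> m s)" "length (seed_list \<Gamma> m s) <= 5 * m * m"
  "16 * card {x. (ALL i<m. x i : set (seed_list \<Gamma> m s)) & (ALL i>=m. x i = 0) & ~cs_alg.good_elt m s e1 n x} <= 7 * length (seed_list \<Gamma> m s)^m"
proof -
 interpret cs_alg m s e1 by (rule cs)
 let ?cs = "sc_list \<Gamma> m s" and ?M = "5 * m * m" and ?T = "seed_list \<Gamma> m s"
 have M: "?M >= 1" using m_pos by simp
 have inv: "einv ?M ?cs ?T" unfolding seed_list_def by (rule clo_list_inv[OF M])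
 obtain zs where zs: "?T = [0] @ zs" using clo_list_prefix[OF M, of 0 ?M ?cs] by (auto simp: seed_list_def clo_list_simps)
 thus "?T ~= []" by simp
 show d: "distinct ?T" and len: "length ?T <= ?M" using inv by (simp_all add: einv_def)
 have cT: "card (set ?T) = length ?T" using d by (rule distinct_card)
 show "16 * card {x. (ALL i<m. x i : set ?T) & (ALL i>=m. x i = 0) & ~good_elt n x} <= 7 * length ?T^m"
 proof (cases "length ?T = ?M")
  case True
  hence "5 * m^2 <= card (set ?T)" using cT by (simp add: power2_eq_square)
  from bad_grid_large[OF nn _ this] show ?thesis using cT by simp
 next
  case False
  hence "length ?T < ?M" using len by simp
  hence cl: "set (cands ?cs x) <= set ?T" if "x : set ?T" for x using clo_list_closed[OF M, of ?cs x] that unfolding seed_list_def by blast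
  have T0: "0 : set ?T" using zs by simp
  have T1: "ALL x:set ?T. x+1 : set ?T" using cl by (auto simp: cands_def)
  have Tc: "ALL c:set ?cs. ALL x:set ?T. c * x : set ?T" using cl by (auto simp: cands_def)
  have vals: "set ?T <= range (val ?cs)" 
  using inv by (force simp: in_set_conv_nth einv_def)
  note R = closed_set_ring[OF finite_set T0 T1 Tc vals]
  have sT: "s i j l : set ?T" if "i < m" "j < m" "l < m" for i j l using R(2)[OF set_sc_list(1)[of i m j l s \<Gamma>]] that by blast
  \<comment> \<open>\<open>m\<close> is a positive square, hence 1 or at least 4; in the second case
    \<open>\<Gamma>\<close> provides five elements.\<close>
  have "m = 1 \<or> card (set ?T) >= 5"
  proof (cases "m >= 4")
   case True
   have "set \<Gamma> <= set ?T" using R(2) set_sc_list(2)[of \<Gamma> m s] by blast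
   hence "card (set \<Gamma>) <= card (set ?T)" by (intro card_mono) auto
   thus ?thesis using big[OF True] by simp
  next
   case False
   have "n < 2"
   proof (rule ccontr)
    assume "~n < 2"
    hence "2*2 <= n * n" by (intro mult_le_mono) auto
    thus False using nn False by simp
   qed
   thus ?thesis using nn m_pos by auto
  qed
  from bad_grid_closed[OF nn finite_set T0 R(1) R(3) R(4) sT this] show ?thesis using cT by simp
 qed
qed

lemma size_ge_m: "m <= size (enc_sconsts enc (m, s))"
proof -
 have "length xs <= size (eL g xs)" for g and xs :: "nat list" by (induct xs) auto
 from this[of "[0..<m]"] show ?thesis by (simp add: enc_sconsts_def)
qed

text \<open>With \<open>L <= 5 * m * m\<close> the left side is at most \<open>40 * m^3\<close>, and
  this is at most \<open>64 * 8^m\<close>; hence \<open>3 * m + 6\<close> bits per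
  coordinate.\<close>

lemma bits_enough: "8 * m * L <= 2^(3 * m+6)" if "L <= 5 * m * m" for m L :: nat
proof -
 have m: "m <= 2^m" by (simp add: less_imp_le)
 have "8 * m * L <= 8 * m*(5 * m * m)" using that by (rule mult_le_mono2)
 also have "... = 40*(m * m * m)" by (simp add: mult.assoc)
 also have "... <= 64*(2^m*2^m*2^m)" by (intro mult_le_mono m) simp
 also have "... = 2^(3 * m+6)" by (simp add: power_add power_mult power3_eq_cube[symmetric] power_mult_distrib flip: power_mult)
 finally show ?thesis .
qed

theorem theorem3p10:
  fixes enc :: "'k::field \<Rightarrow> sexp"
  assumes "efficient_linear_algebra enc"
  shows "las_vegas_polytime_solvable (enc_sconsts enc) (enc_output enc)
    {(m, s). central_simple m s \<and> (infinite (UNIV :: 'k set) \<or> card (UNIV :: 'k set) > m)}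
    (\<lambda>(m, s) (u, P, c, E).
       u \<in> carrier (sc_alg m s) \<and>
       max_comm_subalg m s (gen_subalg m s u) \<and> etale_subalg m s (gen_subalg m s u) \<and>
       is_min_poly m s u P \<and>
       c \<in> amitsur_cocycles P 2 \<and>
       (\<forall>\<alpha>\<in>set (expos P 2). E \<alpha> \<in> carrier_vec m) \<and>
       lin_map m P E \<in> ring_iso (cocycle_alg P c) (sc_alg m s))"
proof -
 interpret ela enc by unfold_locales (rule assms)
 obtain \<Gamma> :: "'k list" where \<Gamma>: "!!m. m >= 4 ==> infinite (UNIV :: 'k set) \<or> card (UNIV :: 'k set) > m ==> card (set \<Gamma>) >= 5" using exists_scalar_list by blast
 let ?dom = "{(m, s :: 'k sconsts). central_simple m s & (infinite (UNIV :: 'k set) \<or> card (UNIV :: 'k set) > m)}"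
 \<comment> \<open>The number of coins: \<open>m\<close> coordinates take \<open>3 * m + 6\<close>
   bits each, and \<open>m\<close> is at most the size of the encoded input.\<close>
 define r :: "nat poly" where "r = [:0, 6, 3:]"
 have r: "poly r x = x*(3 * x+6)" for x by (simp add: r_def algebra_simps)
 define ei where "ei = enc_sconsts enc"
 \<comment> \<open>The coins are part of the situation, so the randomised algorithm becomes a
   deterministic computation on pairs.\<close>
 define D where "D = {(a, w :: bool list). a : ?dom & length w = poly r (size (ei a))}"
 define f where "f p = Dot (ei (fst p)) (eL enc_bool (snd p))" for p :: "(nat \<times> 'k sconsts) \<times> bool list"
 define m where "m p = fst (fst p)" for p :: "(nat \<times> 'k sconsts) \<times> bool list"
 define s where "s p = snd (fst p)" for p :: "(nat \<times> 'k sconsts) \<times> bool list"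
 define e1 where "e1 p = fvec (m p) (one (sc_alg (m p) (s p)))" for p
 define n where "n p = (SOME n. n * n = m p)" for p
 define A where "A p = 3 * m p+6" for p
 define T where "T p = seed_list \<Gamma> (m p) (s p)" for p
 define u where "u p = sample (m p) (A p) (T p) (snd p)" for p
 have cs: "cs_alg (m p) (s p) (e1 p)" if "p : D" for p using that central_simple_cs_alg by (auto simp: D_def m_def s_def e1_def)
 have nn: "n p * n p = m p" if "p : D" for p unfolding n_def by (rule someI_ex[OF cs_alg.exists_square[OF cs[OF that]]])
 have props: "T p ~= []" "distinct (T p)" "length (T p) <= 5 * m p * m p"
  "16 * card {x. (ALL i<m p. x i : set (T p)) & (ALL i>=m p. x i = 0) & ~cs_alg.good_elt (m p) (s p) (e1 p) (n p) x} <= 7 * length (T p)^m p"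
  if p: "p : D" for p
 proof -
  have "m p >= 4 ==> card (set \<Gamma>) >= 5" using p \<Gamma>[of "m p"] by (auto simp: D_def m_def)
  from seed_list_props[OF cs[OF p] nn[OF p] this]
  show "T p ~= []" "distinct (T p)" "length (T p) <= 5 * m p * m p"
   "16 * card {x. (ALL i<m p. x i : set (T p)) & (ALL i>=m p. x i = 0) & ~cs_alg.good_elt (m p) (s p) (e1 p) (n p) x} <= 7 * length (T p)^m p"
   unfolding T_def by blast+
 qed
 have enough: "m p * A p <= length (snd p)" if "p : D" for p
 proof -
  have "m p <= size (ei (fst p))" using size_ge_m[of "m p" enc "s p"] by (simp add: ei_def m_def s_def)
  hence "m p * A p <= poly r (size (ei (fst p)))" unfolding r A_def by (intro mult_le_mono) auto
  thus ?thesis using that by (auto simp: D_def)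
 qed
 have pS: "pt D f (%p. enc_sconsts enc (m p, s p))" by (rule pt_cg[OF pt_hd[OF pt_id]]) (simp add: f_def ei_def m_def s_def)
 have pw: "pt D f (%p. eL enc_bool (snd p))" by (rule pt_cg[OF pt_tl[OF pt_id]]) (simp add: f_def)
 have num: "pt D f (%p. eN (k :: nat))" for k by (rule pt_c)
 have pT: "pt D f (%p. eL enc (T p))" unfolding T_def seed_list_def
 proof (rule pt_closure_list[OF pt_sc_list[OF pS]])
  show "pt D f (%p. eN (5 * m p * m p))" by (intro pt_times num pt_m[OF pS])
  show "1 <= 5 * m p * m p" if "p : D" for p using cs_alg.m_pos[OF cs[OF that]] by simp
 qed
 have pu: "pt D f (%p. encf (m p) (u p))" unfolding u_def by (rule pt_sample[OF pw _ pT props(1) pt_m[OF pS] enough]) (unfold A_def, intro pt_plus pt_times num pt_m[OF pS])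
 interpret R: alg_run enc D f m n s e1 u
 proof (intro alg_run.intro alg_run_axioms.intro ela_axioms)
  show "u p : spt (m p)" if "p : D" for p by (simp add: u_def sample_def spt_def)
 qed (fact cs nn pS pu)+
 obtain p U where p: "pb D f U" "!!a. a : D ==> EX t<=U a. runs p (f a) (enc_option (enc_output enc) (R.result a)) t" using R.pt_result unfolding pt_def by blast
 obtain Q where Q: "!!a. a : D ==> U a <= poly Q (size (f a))" using p(1) unfolding pb_def by blast
 \<comment> \<open>For an input of size \<open>x\<close> the program starts on a tree of size at
   most \<open>1 + x + 2 * r(x)\<close>, as each coin takes at most two nodes.\<close>
 define q where "q = Q \<circ>\<^sub>p ([:1, 1:] + r + r)"
 have size_w: "size (eL enc_bool w) <= length w+length w" for w by (induct w) (auto simp: enc_bool_def)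
 have halt: "EX t<=poly q (size (ei a)). runs p (Dot (ei a) (eL enc_bool w)) (enc_option (enc_output enc) (R.result (a, w))) t"
  if aw: "(a, w) : D" for a w
 proof -
  obtain t where t: "t <= U (a, w)" "runs p (f (a, w)) (enc_option (enc_output enc) (R.result (a, w))) t" using p(2)[OF aw] by blast
  have "size (f (a, w)) <= poly ([:1, 1:] + r + r) (size (ei a))" using size_w[of w] aw by (simp add: f_def D_def)
  from poly_nat_mono[OF this, of Q] have "t <= poly q (size (ei a))" using t(1) Q[OF aw] by (simp add: q_def poly_pcompose)
  thus ?thesis using t(2) by (auto simp: f_def)
 qed
 show ?thesis unfolding las_vegas_polytime_solvable_def Let_def ei_def[symmetric]
 proof (rule exI[of _ p], rule exI[of _ q], rule exI[of _ r], intro ballI conjI)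
  fix a w assume a: "a : ?dom" and w: "w : {w :: bool list. length w = poly r (size (ei a))}"
  have aw: "(a, w) : D" using a w by (simp add: D_def)
  obtain t where t: "t <= poly q (size (ei a))" "runs p (Dot (ei a) (eL enc_bool w)) (enc_option (enc_output enc) (R.result (a, w))) t" using halt[OF aw] by blast
  show "EX b t. runs p (Dot (ei a) (eL enc_bool w)) (enc_option (enc_output enc) b) t & t <= poly q (size (ei a)) &
   (case b of None => True | Some y => (case a of (m, s) => %(u, P, c, E).
    u : carrier (sc_alg m s) &
    max_comm_subalg m s (gen_subalg m s u) & etale_subalg m s (gen_subalg m s u) &
    is_min_poly m s u P &
    c : amitsur_cocycles P 2 &
    (ALL al:set (expos P 2). E al : carrier_vec m) &
    lin_map m P E : ring_iso (cocycle_alg P c) (sc_alg m s)) y)"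
  proof (rule exI[of _ "R.result (a, w)"], rule exI[of _ t], intro conjI t)
   show "case R.result (a, w) of None => True | Some y => (case a of (m, s) => %(u, P, c, E).
    u : carrier (sc_alg m s) &
    max_comm_subalg m s (gen_subalg m s u) & etale_subalg m s (gen_subalg m s u) &
    is_min_poly m s u P &
    c : amitsur_cocycles P 2 &
    (ALL al:set (expos P 2). E al : carrier_vec m) &
    lin_map m P E : ring_iso (cocycle_alg P c) (sc_alg m s)) y"
   proof (cases "R.result (a, w)")
    case (Some y)
    from R.result_correct[OF aw this] show ?thesis unfolding Some R.correct_def m_def s_def by (cases a) simp
   qed simp
  qed
 next
  fix a assume a: "a : ?dom"
  let ?N = "poly r (size (ei a))"
  let ?coins = "{w :: bool list. length w = ?N}"
  let ?fail = "{w. EX t. runs p (Dot (ei a) (eL enc_bool w)) (enc_option (enc_output enc) None) t}"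
  \<comment> \<open>All quantities except the sample depend on the input alone; \<open>w0\<close> is
    an arbitrary choice of coins at which to name them.\<close>
  define w0 where "w0 = replicate ?N False"
  have aw: "(a, w) : D" if "length w = ?N" for w using a that by (simp add: D_def)
  have d0: "(a, w0) : D" by (rule aw) (simp add: w0_def)
  have same: "m (a, w) = m (a, w0)" "s (a, w) = s (a, w0)" "e1 (a, w) = e1 (a, w0)" "n (a, w) = n (a, w0)" "A (a, w) = A (a, w0)" "T (a, w) = T (a, w0)" for w by (simp_all add: m_def s_def e1_def n_def A_def T_def)
  let ?B = "{x. (ALL i<m (a, w0). x i : set (T (a, w0))) & (ALL i>=m (a, w0). x i = 0) & ~cs_alg.good_elt (m (a, w0)) (s (a, w0)) (e1 (a, w0)) (n (a, w0)) x}"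
  have fin: "finite ?B" by (rule finite_subset[OF _ cs_alg.card_grid(1)[OF cs[OF d0] nn[OF d0], of "set (T (a, w0))"]]) auto
  have "?coins \<inter> ?fail <= {w. length w = ?N & sample (m (a, w0)) (A (a, w0)) (T (a, w0)) w : ?B}"
  proof
   fix w assume w: "w : ?coins \<inter> ?fail"
   hence wD: "(a, w) : D" using aw by blast
   obtain t where t: "runs p (Dot (ei a) (eL enc_bool w)) (enc_option (enc_output enc) None) t" using w by blast
   \<comment> \<open>By determinism the run that prints the failure symbol is the run of the
     algorithm.\<close>
   have "enc_option (enc_output enc) (R.result (a, w)) = enc_option (enc_output enc) None" using halt[OF wD] runs_det[OF t] by metis
   hence "R.result (a, w) = None" by (cases "R.result (a, w)") auto
   from R.result_complete[OF wD this]
   have "~cs_alg.good_elt (m (a, w0)) (s (a, w0)) (e1 (a, w0)) (n (a, w0)) (u (a, w))" unfolding same[of w] .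
   moreover have "u (a, w) = sample (m (a, w0)) (A (a, w0)) (T (a, w0)) w" unfolding u_def same[of w] by simp
   moreover have "sample (m (a, w0)) (A (a, w0)) (T (a, w0)) w i : set (T (a, w0))" if "i < m (a, w0)" for i using that bmod_less[of "length (T (a, w0))"] props(1)[OF d0] by (simp add: sample_def)
   moreover have "sample (m (a, w0)) (A (a, w0)) (T (a, w0)) w i = 0" if "i >= m (a, w0)" for i using that by (simp add: sample_def)
   ultimately show "w : {w. length w = ?N & sample (m (a, w0)) (A (a, w0)) (T (a, w0)) w : ?B}" using w by simp
  qed
  hence "card (?coins \<inter> ?fail) <= card {w. length w = ?N & sample (m (a, w0)) (A (a, w0)) (T (a, w0)) w : ?B}" by (rule card_mono[rotated]) (rule finite_subset[OF _ finite_bitlists(1)[of ?N]], auto)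
  moreover have "2 * card {w. length w = ?N & sample (m (a, w0)) (A (a, w0)) (T (a, w0)) w : ?B} <= 2^?N"
  proof (rule sample_bound)
   show "m (a, w0) > 0" by (rule cs_alg.m_pos[OF cs[OF d0]])
   show "8 * m (a, w0) * length (T (a, w0)) <= 2^A (a, w0)" unfolding A_def by (rule bits_enough[OF props(3)[OF d0]])
   show "m (a, w0) * A (a, w0) <= ?N" using enough[OF d0] by (simp add: w0_def)
  qed (use props[OF d0] fin in auto)
  ultimately have "2 * card (?coins \<inter> ?fail) <= 2^?N" by linarith
  hence "real (2 * card (?coins \<inter> ?fail)) <= real (2^?N)" by (simp only: of_nat_le_iff)
  moreover have "?coins ~= {}" using aw by (auto intro: exI[of _ w0] simp: w0_def)
  hence "measure_pmf.prob (pmf_of_set ?coins) ?fail = real (card (?coins \<inter> ?fail)) / real (card ?coins)" by (rule measure_pmf_of_set) (rule finite_bitlists(1))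
  moreover have "real (card ?coins) = 2^?N" by (simp add: finite_bitlists)
  moreover have "x = c / d ==> d = z ==> 2 * c <= z ==> z > 0 ==> x <= 1 / 2" for x c d z :: real by (auto simp: divide_le_eq)
  ultimately show "measure_pmf.prob (pmf_of_set ?coins) ?fail <= 1 / 2" by simp
 qed
qed

end
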